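(* Let $V=\bigoplus_{k=1}^r V_{d_k}$ with $d_1\le\cdots\le d_r$ be an $\operatorname{SL}_2$-representation with $V^{\operatorname{SL}_2}=\{0\}$ (i.e. all $d_k\ge 1$). For $m\ge 0$ let $\gamma_m$ be the coefficient of $(1-t)^{m+3-D}$ in the Laurent expansion of $\operatorname{Hilb}_V(t)$ at $t=1$ in powers of $1-t$. (i) Assume $V$ is not isomorphic to $2V_1$, nor to $V_d$ for $d\le 4$. Then $$\gamma_0=\sigma_V\,\frac{s_\rho(\boldsymbol a)}{s_\delta(\boldsymbol a)},\qquad \rho=(C-3,C-3,C-3,C-4,\ldots,1,0),\quad \delta=(C-1,C-2,\ldots,1,0),$$ and $\gamma_1=\tfrac{3}{2}\gamma_0$. Hence the $a$-invariant $-(D-3)-2\gamma_1/\gamma_0$ of $\mathbb{C}[V]^{\operatorname{SL}_2}$ is equal to $-D$. (ii) Assume $V$ is not isomorphic to any of: $V_d$ for $d=1,2,3,4,5,6,8$; $2V_1$, $V_1+V_2$, $V_1+V_3$, $V_1+V_4$, $2V_2$, $V_2+V_3$, $V_2+V_4$, $2V_3$, $2V_4$. Let $\rho'=(C-3,C-4,C-4,C-4,C-5,\ldots,1,0)$. If all $d_k$ are even, or at least two $d_k$ are odd, or at least one odd $d_k$ is $>1$, then $$\gamma_2=\sigma_V\,\frac{42\,s_\rho(\boldsymbol a)+s_{\rho'}(\boldsymbol a)\big(P_2(\boldsymbol a_\Theta)-8\big)}{24\,s_\delta(\boldsymbol a)}.$$ If $d_1=1$ and all other $d_k$ are even, then $$\gamma_2=\frac{42\,s_\rho(\boldsymbol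 a)+s_{\rho'}(\boldsymbol a)\big(P_2(\boldsymbol a_\Theta)-8\big)}{24\,s_\delta(\boldsymbol a)}+\frac{s_{(C-4,C-4,C-4,C-5,\ldots,1,0)}(\boldsymbol a_1)}{4\,s_{(C-2,C-3,C-4,\ldots,1,0)}(\boldsymbol a_1)},$$ where $\boldsymbol a_1$ denotes $\boldsymbol a$ with the entry $a_{1,1}$ removed. (iii) Assume $V$ is not isomorphic to $2V_1$, nor to $V_d$ for $d\le 4$. Then $$\gamma_3=\frac{5(\gamma_2-\gamma_0)}{2}.$$
   Context: $\operatorname{SL}_2=\operatorname{SL}_2(\mathbb{C})$, and $V_d$ is its $(d+1)$-dimensional irreducible representation on binary forms of degree $d$; $2V_d$ means $V_d\oplus V_d$ and $V_c+V_d$ means $V_c\oplus V_d$. The $d_k$ need not be distinct. $D=\dim V=r+\sum_k d_k$. $\mathbb{C}[V]^{\operatorname{SL}_2}$ is the algebra of invariant polynomials, graded by degree, and $\operatorname{Hilb}_V(t)=\sum_{n\ge0}\dim\big(\mathbb{C}[V]^{\operatorname{SL}_2}_n\big)t^n$, a rational function. The $a$-invariant of $\mathbb{C}[V]^{\operatorname{SL}_2}$ is the degree of this rational function (degree of numerator minus degree of denominator). Weights: $a_{k,i}=2i-d_k$ for $1\le k\le r$, $0\le i\le d_k$. $\Theta=\{(k,i)\in\mathbb{Z}^2:1\le k\le r,\ 0\le i\le d_k\}$ and $\Lambda=\{(k,i)\in\mathbb{Z}^2:1\le k\le r,\ \lfloor d_k/2\rfloor+1\le i\le d_k\}$ (the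 pairs with $a_{k,i}>0$); $C=|\Lambda|$. $\boldsymbol a=(a_{k,i}:(k,i)\in\Lambda)$ and $\boldsymbol a_\Theta=(a_{k,i}:(k,i)\in\Theta)$. $P_2(\boldsymbol a_\Theta)=\sum_{(k,i)\in\Theta}a_{k,i}^2$. $\sigma_V=2$ if every $d_k$ is even and $\sigma_V=1$ otherwise. Schur polynomials: for $\rho=(\rho_1,\ldots,\rho_n)\in\mathbb{Z}^n$ and variables $\boldsymbol x=(x_1,\ldots,x_n)$, $s_\rho(\boldsymbol x)=\det\big(x_i^{\rho_j+n-j}\big)_{i,j}/\det\big(x_i^{n-j}\big)_{i,j}$, which is a symmetric polynomial (a symmetric Laurent polynomial if negative exponents occur); it is evaluated at $\boldsymbol a$ as a (Laurent) polynomial, so repeated entries are allowed. The displayed tuples are to be read as having length equal to the number of variables, including for small $C$ where negative entries may appear: $\rho\in\mathbb{Z}^C$ has $\rho_1=\rho_2=C-3$ and $\rho_j=C-j$ for $j\ge3$; $\rho'\in\mathbb{Z}^C$ has $\rho'_1=C-3$, $\rho'_2=\rho'_3=C-4$, $\rho'_j=C-j$ for $j\ge4$; the tuple $(C-4,C-4,C-4,C-5,\ldots,1,0)\in\mathbb{Z}^{C-1}$ has first two entries $C-4$ and $j$-th entry $C-1-j$ for $j\ge3$. For example, if $C=2$ then $\rho=(-1,-1)$. *)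

theory Defs
  imports
    "HOL-Library.Function_Algebras"
    "HOL-Library.Poly_Mapping"
    "HOL-Computational_Algebra.Computational_Algebra"
    "HOL-Computational_Algebra.Field_as_Ring"
    "Jordan_Normal_Form.Determinant"
begin

(* A representation V_{d_1} + ... + V_{d_r} of SL_2(C) is given by the list ds = [d_1, ..., d_r].
   The summands are counted from k = 0, so d_k is ds ! k with k < length ds. *)

section \<open>Representations of the special linear group\<close>

definition SL2 :: "complex mat set" where
  "SL2 = {g \<in> carrier_mat 2 2. det g = 1}"

definition Theta :: "nat list \<Rightarrow> (nat \<times> nat) set" where
  "Theta ds = {(k, i). k < length ds \<and> i \<le> ds ! k}"

(* A vector v is a tuple of binary forms: its k-th component is the form
   \<Sum>i\<le>ds ! k. v (k, i) x^i y^(ds ! k - i). *)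
definition rep_space :: "nat list \<Rightarrow> (nat \<times> nat \<Rightarrow> complex) set" where
  "rep_space ds = {v. \<forall>p. p \<notin> Theta ds \<longrightarrow> v p = 0}"

definition bin_form :: "nat \<Rightarrow> (nat \<Rightarrow> complex) \<Rightarrow> complex \<Rightarrow> complex \<Rightarrow> complex" where
  "bin_form d c x y = (\<Sum>i\<le>d. c i * x ^ i * y ^ (d - i))"

(* The coefficients of the form obtained by substituting
   x := g11 x + g21 y  and  y := g12 x + g22 y, computed after setting y = 1
   (see bin_form_subst below). This is the d-th symmetric power of the standard representation. *)
definition subst_form :: "nat \<Rightarrow> complex mat \<Rightarrow> (nat \<Rightarrow> complex) \<Rightarrow> nat \<Rightarrow> complex" where
  "subst_form d g c =
     coeff (\<Sum>i\<le>d. Polynomial.smult (c i) ([:g $$ (1, 0), g $$ (0, 0):] ^ i * [:g $$ (1, 1), g $$ (0, 1):] ^ (d - i)))"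

definition act :: "nat list \<Rightarrow> complex mat \<Rightarrow> (nat \<times> nat \<Rightarrow> complex) \<Rightarrow> nat \<times> nat \<Rightarrow> complex" where
  "act ds g v = (\<lambda>(k, i). if (k, i) \<in> Theta ds then subst_form (ds ! k) g (\<lambda>j. v (k, j)) i else 0)"

lemma bin_form_mult_linear:
  assumes "degree p \<le> d"
  shows "bin_form (Suc d) (coeff (p * [:b, a:])) x y = bin_form d (coeff p) x y * (a * x + b * y)"
proof -
  have c: "coeff (p * [:b, a:]) i = b * coeff p i + (if i = 0 then 0 else a * coeff p (i - 1))" for i
    by (cases i) (simp_all add: mult.commute)
  have 1: "(\<Sum>i\<le>Suc d. b * coeff p i * x ^ i * y ^ (Suc d - i)) = bin_form d (coeff p) x y * (b * y)"
    using assms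
    by (simp add: bin_form_def coeff_eq_0 sum_distrib_left sum_distrib_right Suc_diff_le mult_ac)
  have 2: "(\<Sum>i\<le>Suc d. (if i = 0 then 0 else a * coeff p (i - 1)) * x ^ i * y ^ (Suc d - i))
      = bin_form d (coeff p) x y * (a * x)"
    by (subst sum.atMost_Suc_shift) (simp add: bin_form_def sum_distrib_left sum_distrib_right mult_ac)
  show ?thesis
    unfolding bin_form_def[of "Suc d"] c distrib_right sum.distrib 1 2
    by (simp add: algebra_simps)
qed

lemma degree_linear_power_le: "degree ([:b, a:] ^ n) \<le> n" for a b :: complex
  by (rule order_trans[OF degree_power_le]) simp

lemma bin_form_linear_powers:
  "bin_form (i + j) (coeff ([:b, a:] ^ i * [:b', a':] ^ j)) x y
     = (a * x + b * y) ^ i * (a' * x + b' * y) ^ j"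
proof -
  have *: "bin_form i (coeff ([:b, a:] ^ i)) x y = (a * x + b * y) ^ i"
  proof (induction i)
    case (Suc i)
    then show ?case
      unfolding power_Suc2 bin_form_mult_linear[OF degree_linear_power_le] by simp
  qed (simp add: bin_form_def)
  show ?thesis
  proof (induction j)
    case (Suc j)
    have "degree ([:b, a:] ^ i * [:b', a':] ^ j) \<le> i + j"
      by (rule order_trans[OF degree_mult_le]) (intro add_mono degree_linear_power_le)
    note step = bin_form_mult_linear[OF this]
    show ?case
      unfolding power_Suc2 add_Suc_right mult.assoc[symmetric] step Suc ..
  qed (simp add: *)
qed

lemma bin_form_subst:
  "bin_form d (subst_form d g c) x y
     = bin_form d c (g $$ (0, 0) * x + g $$ (1, 0) * y) (g $$ (0, 1) * x + g $$ (1, 1) * y)"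
proof -
  have "bin_form d (subst_form d g c) x y = (\<Sum>i\<le>d. c i *
      bin_form d (coeff ([:g $$ (1, 0), g $$ (0, 0):] ^ i * [:g $$ (1, 1), g $$ (0, 1):] ^ (d - i))) x y)"
    unfolding bin_form_def subst_form_def coeff_sum coeff_smult sum_distrib_right sum_distrib_left
    by (subst sum.swap) (simp add: mult_ac)
  also have "\<dots> = (\<Sum>i\<le>d. c i * ((g $$ (0, 0) * x + g $$ (1, 0) * y) ^ i
      * (g $$ (0, 1) * x + g $$ (1, 1) * y) ^ (d - i)))"
  proof (rule sum.cong[OF refl])
    fix i assume "i \<in> {..d}"
    then have "i + (d - i) = d" by simp
    then show "c i * bin_form d (coeff ([:g $$ (1, 0), g $$ (0, 0):] ^ i *
          [:g $$ (1, 1), g $$ (0, 1):] ^ (d - i))) x y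
        = c i * ((g $$ (0, 0) * x + g $$ (1, 0) * y) ^ i * (g $$ (0, 1) * x + g $$ (1, 1) * y) ^ (d - i))"
      using bin_form_linear_powers[of i "d - i"] by metis
  qed
  finally show ?thesis
    by (simp add: bin_form_def mult_ac)
qed

definition fixed_vectors :: "nat list \<Rightarrow> (nat \<times> nat \<Rightarrow> complex) set" where
  "fixed_vectors ds = {v \<in> rep_space ds. \<forall>g\<in>SL2. act ds g v = v}"

definition fscale :: "complex \<Rightarrow> ('a \<Rightarrow> complex) \<Rightarrow> 'a \<Rightarrow> complex" where
  "fscale c F = (\<lambda>x. c * F x)"

global_interpretation fun_vs: vector_space fscale
  by unfold_locales (auto simp: fscale_def fun_eq_iff algebra_simps)

definition rep_iso :: "nat list \<Rightarrow> nat list \<Rightarrow> bool" where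
  "rep_iso ds es \<longleftrightarrow> (\<exists>f. bij_betw f (rep_space ds) (rep_space es)
     \<and> (\<forall>v\<in>rep_space ds. \<forall>w\<in>rep_space ds. f (v + w) = f v + f w)
     \<and> (\<forall>c. \<forall>v\<in>rep_space ds. f (fscale c v) = fscale c (f v))
     \<and> (\<forall>g\<in>SL2. \<forall>v\<in>rep_space ds. f (act ds g v) = act es g (f v)))"

section \<open>Invariants and the Hilbert series\<close>

(* Homogeneous polynomials of degree n on V, as polynomial functions of the coordinates in Theta. *)
definition homog_polys :: "nat list \<Rightarrow> nat \<Rightarrow> ((nat \<times> nat \<Rightarrow> complex) \<Rightarrow> complex) set" where
  "homog_polys ds n = fun_vs.span
     {\<lambda>v. \<Prod>p\<in>Theta ds. v p ^ m p | m :: nat \<times> nat \<Rightarrow> nat. (\<Sum>p\<in>Theta ds. m p) = n}"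

definition invariants :: "nat list \<Rightarrow> nat \<Rightarrow> ((nat \<times> nat \<Rightarrow> complex) \<Rightarrow> complex) set" where
  "invariants ds n =
     {F \<in> homog_polys ds n. \<forall>g\<in>SL2. \<forall>v\<in>rep_space ds. F (act ds g v) = F v}"

definition hilb_series :: "nat list \<Rightarrow> complex fps" where
  "hilb_series ds = Abs_fps (\<lambda>n. of_nat (fun_vs.dim (invariants ds n)))"

(* The rational function whose power series at t = 0 is H. *)
definition rational_of_fps :: "complex fps \<Rightarrow> complex poly fract" where
  "rational_of_fps H =
     (THE h. \<exists>p q. q \<noteq> 0 \<and> h = Fract p q \<and> H * fps_of_poly q = fps_of_poly p)"

definition rational_degree :: "complex poly fract \<Rightarrow> int" where
  "rational_degree h =
     int (degree (fst (quot_of_fract h))) - int (degree (snd (quot_of_fract h)))"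

(* Laurent expansion at t = 1 in the variable u = 1 - t, i.e. after substituting t := 1 - u. *)
definition laurent_at_1 :: "complex poly fract \<Rightarrow> complex fls" where
  "laurent_at_1 h =
     fps_to_fls (fps_of_poly (pcompose (fst (quot_of_fract h)) [:1, -1:])) /
     fps_to_fls (fps_of_poly (pcompose (snd (quot_of_fract h)) [:1, -1:]))"

definition dimV :: "nat list \<Rightarrow> nat" where
  "dimV ds = length ds + sum_list ds"

definition gam :: "nat list \<Rightarrow> nat \<Rightarrow> complex" where
  "gam ds m = fls_nth (laurent_at_1 (rational_of_fps (hilb_series ds))) (int m + 3 - int (dimV ds))"

definition a_invariant :: "nat list \<Rightarrow> int" where
  "a_invariant ds = rational_degree (rational_of_fps (hilb_series ds))"

section \<open>Weights\<close>

definition weight :: "nat list \<Rightarrow> nat \<times> nat \<Rightarrow> int" where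
  "weight ds = (\<lambda>(k, i). 2 * int i - int (ds ! k))"

(* The set Lambda of pairs of positive weight, enumerated lexicographically. *)
definition Lambda :: "nat list \<Rightarrow> (nat \<times> nat) list" where
  "Lambda ds = [(k, i). k \<leftarrow> [0..<length ds], i \<leftarrow> [ds ! k div 2 + 1..<ds ! k + 1]]"

definition pos_weights :: "nat list \<Rightarrow> int list" where
  "pos_weights ds = map (weight ds) (Lambda ds)"

(* The entry removed is the weight of x in the first summand, (k, i) = (0, 1). *)
definition pos_weights1 :: "nat list \<Rightarrow> int list" where
  "pos_weights1 ds = map (weight ds) (removeAll (0, 1) (Lambda ds))"

definition P2 :: "nat list \<Rightarrow> int" where
  "P2 ds = (\<Sum>p\<in>Theta ds. (weight ds p)\<^sup>2)"

definition sigma :: "nat list \<Rightarrow> nat" where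
  "sigma ds = (if \<forall>d\<in>set ds. even d then 2 else 1)"

section \<open>Schur polynomials\<close>

(* Laurent polynomials in x_0, x_1, ...: finitely supported coefficients on exponent vectors. *)
type_synonym laurent_poly = "(nat \<Rightarrow>\<^sub>0 int) \<Rightarrow>\<^sub>0 complex"

definition var_pow :: "nat \<Rightarrow> int \<Rightarrow> laurent_poly" where
  "var_pow i e = Poly_Mapping.single (Poly_Mapping.single i e) 1"

definition laurent_eval :: "int list \<Rightarrow> laurent_poly \<Rightarrow> complex" where
  "laurent_eval xs S = (\<Sum>m\<in>Poly_Mapping.keys S.
     Poly_Mapping.lookup S m * (\<Prod>i<length xs. of_int (xs ! i) powi Poly_Mapping.lookup m i))"

definition alternant :: "int list \<Rightarrow> laurent_poly" where
  "alternant es = det (mat (length es) (length es) (\<lambda>(i, j). var_pow i (es ! j)))"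

definition schur :: "int list \<Rightarrow> laurent_poly" where
  "schur rho = (let n = length rho in
     THE S. S * alternant (map (\<lambda>j. int n - 1 - int j) [0..<n])
              = alternant (map (\<lambda>j. rho ! j + int n - 1 - int j) [0..<n]))"

(* s_rho(xs), for length xs = length rho *)
definition schur_at :: "int list \<Rightarrow> int list \<Rightarrow> complex" where
  "schur_at rho xs = laurent_eval xs (schur rho)"

definition delta_tuple :: "int \<Rightarrow> int list" where
  "delta_tuple C = map (\<lambda>j. C - j) [1..C]"

definition rho_tuple :: "int \<Rightarrow> int list" where
  "rho_tuple C = map (\<lambda>j. if j \<le> 2 then C - 3 else C - j) [1..C]"

definition rho'_tuple :: "int \<Rightarrow> int list" where
  "rho'_tuple C = map (\<lambda>j. if j = 1 then C - 3 else if j \<le> 3 then C - 4 else C - j) [1..C]"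

end

theory Submission
  imports
    Defs
    "HOL-Complex_Analysis.Complex_Analysis"
    "HOL-Real_Asymp.Real_Asymp"
begin

hide_const (open) Determinants.det Finite_Cartesian_Product.mat Sigma_Algebra.sigma

text \<open>By Cayley and Sylvester, the invariants of degree \<open>n\<close> have as dimension the number of monomials of
  degree \<open>n\<close> and weight 0 minus the number of those of weight 2. So for \<open>\<bar>t\<bar> < 1\<close> the Hilbert series is the mean of
  \<open>(1 - z\<^sup>-\<^sup>2) / \<Prod>(1 - t z\<^sup>a)\<close> over the unit circle, where \<open>a\<close> runs through all weights. For
  \<open>\<bar>t\<bar> > 1\<close> this mean is given by the same rational function up to sign. The symmetry of the integrand
  under \<open>t \<mapsto> 1 / t\<close> becomes a functional equation of the Hilbert series, which determines its
  degree and yields the relations for \<open>\<gamma>\<^sub>1\<close> and \<open>\<gamma>\<^sub>3\<close>.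

  For real \<open>t\<close> and \<open>w = (1 - t)\<^sup>2 / t\<close> the mean is, up to powers of \<open>t\<close> and \<open>1 - t\<close>, the integral of
  \<open>4 sin\<^sup>2\<theta> / \<Prod>(w + 4 sin\<^sup>2(a\<theta>/2))\<close> over \<open>(0, \<pi>)\<close>, where \<open>a\<close> runs through the positive weights. As
  \<open>w \<rightarrow> 0\<close> its mass concentrates at \<open>\<theta> = 0\<close>, at \<open>\<theta> = \<pi>\<close> (to leading order if all \<open>a\<close> are even, to second order if
  exactly one is odd), and elsewhere it is negligible because
  sufficiently many of the factors \<open>sin(a\<theta>/2)\<close> do not vanish. Substituting \<open>\<theta> = x \<surd>w\<close> gives an expansion
  in terms of the integrals of \<open>4 x\<^sup>2 / \<Prod>(1 + a\<^sup>2 x\<^sup>2)\<close> and \<open>4 x\<^sup>4 / \<Prod>(1 + a\<^sup>2 x\<^sup>2)\<close> over \<open>(0, \<infinity>)\<close>, and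
  partial fractions evaluate these as quotients of Schur polynomials.\<close>

section \<open>The Cayley--Sylvester formula\<close>

text \<open>The exceptional representations come from the middle of the interval. Where
  \<open>m\<close> sine factors stay away from 0 the integrand is smaller than the peak by a factor
  w^(m - 3/2). So m = 2 at every angle in (0, \<pi>) is enough for the leading coefficient and m = 3
  for the next one, and the listed exceptions other than 2V_1 in the shorter list are those where
  some angle leaves fewer. 2V_1 passes the first count, but its positive weights add up to 2, too
  little for the numerator of the integrand to be a polynomial once negative powers of z are
  cleared. Schur quotients appear because all exponents rho_j + C - j but one are even: the
  alternant is a Vandermonde matrix in the squares a^2 with one column replaced by an odd power of
  a, hence a divided difference. Partial fractions of the peak integrals produce the same divided
  differences. Both computations require distinct weights; repeated ones are reached by a
  perturbation and continuity. The constants 3/2 and 15/8 come from (1 - u)^(-3/2) with u = 1 - t,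
  and the -8 beside P_2 from the quartic Taylor term of 4 sin^2 \<theta>.\<close>

lemma finite_Theta: "finite (Theta ds)"
proof -
  have "Theta ds = (SIGMA k:{..<length ds}. {..ds ! k})" by (auto simp: Theta_def)
  then show ?thesis by simp
qed

section \<open>Polynomial functions of fixed degree and weight, and derivations on them\<close>

type_synonym tup = "nat \<times> nat \<Rightarrow> complex"

text \<open>Polynomial functions homogeneous of degree \<open>n\<close> and of torus weight
  \<open>l\<close>. Generating them by one coordinate factor at a time gives the induction along
  which identities between derivations are checked; \<open>whom_iff_span\<close> matches them with
  spans of monomials, where dimensions are counted. The function 0 has every degree and
  weight.\<close>

inductive whom :: "nat list \<Rightarrow> nat \<Rightarrow> int \<Rightarrow> (tup \<Rightarrow> complex) \<Rightarrow> bool" for ds where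
  one: "whom ds 0 0 (\<lambda>_. 1)"
| coord: "p \<in> Theta ds \<Longrightarrow> whom ds n l f \<Longrightarrow> whom ds (Suc n) (l + weight ds p) (\<lambda>v. v p * f v)"
| zero: "whom ds n l (\<lambda>_. 0)"
| add: "whom ds n l f \<Longrightarrow> whom ds n l g \<Longrightarrow> whom ds n l (\<lambda>v. f v + g v)"
| scale: "whom ds n l f \<Longrightarrow> whom ds n l (\<lambda>v. c * f v)"

text \<open>The differential \<open>D\<close> depends on \<open>f\<close> alone and not on the
  curve, so a derivation may be computed along any convenient curve with the right velocity.\<close>

lemma whom_derivative_exists:
  assumes "whom ds n l f"
  shows "\<exists>D. \<forall>c u s0. (\<forall>p\<in>Theta ds. ((\<lambda>s. c s p) has_field_derivative u p) (at s0)) \<longrightarrow>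
    ((\<lambda>s. f (c s)) has_field_derivative D (c s0) u) (at s0)"
  using assms
proof induction
  case one
  then show ?case by (intro exI[of _ "\<lambda>_ _. 0"]) auto
next
  case (coord p n l f)
  then obtain D where D: "\<And>c u s0. (\<forall>p\<in>Theta ds. ((\<lambda>s. c s p) has_field_derivative u p) (at s0)) \<Longrightarrow>
    ((\<lambda>s. f (c s)) has_field_derivative D (c s0) u) (at s0)" by blast
  show ?case
    by (intro exI[of _ "\<lambda>v u. u p * f v + D v u * v p"] allI impI DERIV_mult D) (use coord in auto)
next
  case zero
  then show ?case by (intro exI[of _ "\<lambda>_ _. 0"]) auto
next
  case (add n l f g)
  then obtain D D' where D: "\<And>c u s0. (\<forall>p\<in>Theta ds. ((\<lambda>s. c s p) has_field_derivative u p) (at s0)) \<Longrightarrow>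
    ((\<lambda>s. f (c s)) has_field_derivative D (c s0) u) (at s0)"
    "\<And>c u s0. (\<forall>p\<in>Theta ds. ((\<lambda>s. c s p) has_field_derivative u p) (at s0)) \<Longrightarrow>
    ((\<lambda>s. g (c s)) has_field_derivative D' (c s0) u) (at s0)" by blast
  show ?case
    by (intro exI[of _ "\<lambda>v u. D v u + D' v u"] allI impI DERIV_add D) auto
next
  case (scale n l f c)
  then obtain D where D: "\<And>c u s0. (\<forall>p\<in>Theta ds. ((\<lambda>s. c s p) has_field_derivative u p) (at s0)) \<Longrightarrow>
    ((\<lambda>s. f (c s)) has_field_derivative D (c s0) u) (at s0)" by blast
  show ?case
    by (intro exI[of _ "\<lambda>v u. c * D v u"] allI impI DERIV_cmult D) auto
qed

text \<open>The derivative of \<open>f\<close> along the vector field \<open>A\<close>. Since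
  \<open>deriv\<close> is meaningful only where the limit exists, the chain, product and sum rules
  below assume membership in \<open>whom\<close>.\<close>

definition lie :: "(tup \<Rightarrow> tup) \<Rightarrow> (tup \<Rightarrow> complex) \<Rightarrow> tup \<Rightarrow> complex" where
  "lie A f v = deriv (\<lambda>s. f (\<lambda>p. v p + s * A v p)) 0"

lemma lie_chain:
  assumes "whom ds n l f" and "\<And>p. p \<in> Theta ds \<Longrightarrow> ((\<lambda>s. c s p) has_field_derivative A (c s0) p) (at s0)"
  shows "((\<lambda>s. f (c s)) has_field_derivative lie A f (c s0)) (at s0)"
proof -
  obtain D where D: "\<And>c u s0. (\<forall>p\<in>Theta ds. ((\<lambda>s. c s p) has_field_derivative u p) (at s0)) \<Longrightarrow>
    ((\<lambda>s. f (c s)) has_field_derivative D (c s0) u) (at s0)"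
    using whom_derivative_exists[OF assms(1)] by blast
  have "lie A f v = D v (A v)" for v
    unfolding lie_def
    by (rule DERIV_imp_deriv, rule DERIV_cong[OF D[where u = "A v"]]) (auto intro!: derivative_eq_intros)
  then show ?thesis using D[of c "A (c s0)" s0] assms(2) by simp
qed

lemma lie_at_zero:
  assumes "whom ds n l f"
  shows "((\<lambda>s. f (\<lambda>p. v p + s * A v p)) has_field_derivative lie A f v) (at 0)"
proof -
  have "((\<lambda>s. f (\<lambda>p. v p + s * A v p)) has_field_derivative lie (\<lambda>_. A v) f (\<lambda>p. v p + 0 * A v p)) (at 0)"
    by (rule lie_chain[OF assms, where c = "\<lambda>s p. v p + s * A v p" and A = "\<lambda>_. A v"]) (auto intro!: derivative_eq_intros)
  then show ?thesis by (simp add: lie_def)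
qed

lemma lie_const: "lie A (\<lambda>_. c) = (\<lambda>_. 0)"
  by (simp add: lie_def fun_eq_iff)

lemma lie_coord:
  assumes "whom ds n l f"
  shows "lie A (\<lambda>v. v p * f v) = (\<lambda>v. A v p * f v + v p * lie A f v)"
proof
  fix v
  show "lie A (\<lambda>v. v p * f v) v = A v p * f v + v p * lie A f v"
    unfolding lie_def[of A "\<lambda>v. v p * f v"]
    by (rule DERIV_imp_deriv) (auto intro!: derivative_eq_intros lie_at_zero[OF assms])
qed

lemma lie_add:
  assumes "whom ds n l f" "whom ds n' l' g"
  shows "lie A (\<lambda>v. f v + g v) = (\<lambda>v. lie A f v + lie A g v)"
proof
  fix v
  show "lie A (\<lambda>v. f v + g v) v = lie A f v + lie A g v"
    unfolding lie_def[of A "\<lambda>v. f v + g v"]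
    by (rule DERIV_imp_deriv) (auto intro!: derivative_eq_intros lie_at_zero[OF assms(1)] lie_at_zero[OF assms(2)])
qed

lemma lie_scale:
  assumes "whom ds n l f"
  shows "lie A (\<lambda>v. c * f v) = (\<lambda>v. c * lie A f v)"
proof
  fix v
  show "lie A (\<lambda>v. c * f v) v = c * lie A f v"
    unfolding lie_def[of A "\<lambda>v. c * f v"]
    by (rule DERIV_imp_deriv) (auto intro!: derivative_eq_intros lie_at_zero[OF assms(1)])
qed

section \<open>The sl_2-triple acting on polynomial functions\<close>

definition up_field :: "nat list \<Rightarrow> tup \<Rightarrow> tup" where
  "up_field ds v = (\<lambda>(k, i). (if i < ds ! k then of_nat (i + 1) else 0) * v (k, i + 1))"

text \<open>\<open>dn_field\<close> and \<open>up_field\<close> are the velocity fields of the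
  one-parameter groups \<open>tri s 0\<close> and \<open>tri 0 s\<close>, as
  \<open>act_tri_upper_deriv\<close> and \<open>act_tri_lower_deriv\<close> show. The conditionals
  make the component at the end of a form 0, where the neighbouring coordinate would leave
  \<open>Theta\<close>.\<close>

definition dn_field :: "nat list \<Rightarrow> tup \<Rightarrow> tup" where
  "dn_field ds v = (\<lambda>(k, i). (if i = 0 then 0 else of_nat (ds ! k + 1 - i)) * v (k, i - 1))"

abbreviation "raise ds \<equiv> lie (up_field ds)"
abbreviation "lower ds \<equiv> lie (dn_field ds)"

text \<open>By the product rule it is enough that each component of the field is a multiple of one
  coordinate whose weight is larger by \<open>e\<close>. The alternative \<open>c = 0\<close> covers
  the ends of a form.\<close>

lemma whom_lie_shift:
  assumes "whom ds n l f"
    and "\<And>p. p \<in> Theta ds \<Longrightarrow> \<exists>c q. (\<forall>v. A v p = c * v q) \<and> (c = 0 \<or> q \<in> Theta ds \<and> weight ds q = weight ds p + e)"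
  shows "whom ds n (l + e) (lie A f)"
  using assms(1)
proof induction
  case one
  then show ?case by (simp add: lie_const whom.zero)
next
  case (coord p n l f)
  from assms(2)[OF coord(1)] obtain c q where cq: "\<And>v. A v p = c * v q"
    "c = 0 \<or> q \<in> Theta ds \<and> weight ds q = weight ds p + e" by blast
  have 1: "whom ds (Suc n) (l + weight ds p + e) (\<lambda>v. v p * lie A f v)"
    using whom.coord[OF coord(1) coord(3)] by (simp add: algebra_simps)
  have 2: "whom ds (Suc n) (l + weight ds p + e) (\<lambda>v. A v p * f v)"
  proof (cases "c = 0")
    case True
    then show ?thesis using cq(1) by (simp add: whom.zero)
  next
    case False
    then have q: "q \<in> Theta ds" "weight ds q = weight ds p + e" using cq(2) by auto
    from whom.scale[OF whom.coord[OF q(1) coord(2)], of c] q(2) show ?thesis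
      by (simp add: cq(1) algebra_simps)
  qed
  show ?case unfolding lie_coord[OF coord(2)] by (rule whom.add[OF 2 1])
next
  case (zero n l)
  then show ?case by (simp add: lie_const whom.zero)
next
  case (add n l f g)
  then show ?case by (simp add: lie_add whom.add)
next
  case (scale n l f c)
  then show ?case by (simp add: lie_scale whom.scale)
qed

lemma whom_raise: "whom ds n l f \<Longrightarrow> whom ds n (l + 2) (raise ds f)"
proof (erule whom_lie_shift)
  fix p assume "p \<in> Theta ds"
  then show "\<exists>c q. (\<forall>v. up_field ds v p = c * v q) \<and> (c = 0 \<or> q \<in> Theta ds \<and> weight ds q = weight ds p + 2)"
    by (cases p, intro exI[of _ "if snd p < ds ! fst p then of_nat (snd p + 1) else 0"] exI[of _ "(fst p, snd p + 1)"])
      (auto simp: up_field_def Theta_def weight_def)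
qed

lemma whom_lower: "whom ds n l f \<Longrightarrow> whom ds n (l + -2) (lower ds f)"
proof (erule whom_lie_shift)
  fix p assume "p \<in> Theta ds"
  then show "\<exists>c q. (\<forall>v. dn_field ds v p = c * v q) \<and> (c = 0 \<or> q \<in> Theta ds \<and> weight ds q = weight ds p + -2)"
    by (cases p, intro exI[of _ "if snd p = 0 then 0 else of_nat (ds ! fst p + 1 - snd p)"] exI[of _ "(fst p, snd p - 1)"])
      (auto simp: dn_field_def Theta_def weight_def)
qed

text \<open>The relation [E, F] = H, with H acting on weight \<open>l\<close> as the scalar
  \<open>l\<close>. A commutator of derivations is a derivation, and so is multiplication by the
  weight; this leaves the coordinates to be checked, which is the fact \<open>cc\<close>.\<close>

lemma raise_lower_comm:
  assumes "whom ds n l f"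
  shows "raise ds (lower ds f) = (\<lambda>v. lower ds (raise ds f) v + of_int l * f v)"
  using assms
proof induction
  case one
  then show ?case by (simp add: lie_const)
next
  case (coord p n l f)
  obtain k i where p: "p = (k, i)" by (cases p)
  then have i: "k < length ds" "i \<le> ds ! k" using coord(1) by (auto simp: Theta_def)
  define x where "x = (if i < ds ! k then of_nat (i + 1) else 0 :: complex)"
  define y where "y = (if i = 0 then 0 else of_nat (ds ! k + 1 - i) :: complex)"
  have X: "up_field ds v p = x * v (k, i + 1)" for v by (simp add: up_field_def p x_def)
  have Y: "dn_field ds v p = y * v (k, i - 1)" for v by (simp add: dn_field_def p y_def)
  note f = coord(2)
  note Rf = whom_raise[OF f] and Lf = whom_lower[OF f]
  \<comment> \<open>At the end of a form \<open>(k, i + 1)\<close> lies outside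
    \<open>Theta\<close>, but then \<open>x = 0\<close>. So the product is kept together with its
    coefficient.\<close>
  have hx: "\<exists>n l. whom ds n l (\<lambda>v. x * (v (k, i + 1) * f v))"
  proof (cases "i < ds ! k")
    case True
    then have "(k, i + 1) \<in> Theta ds" using i by (auto simp: Theta_def)
    from whom.scale[OF whom.coord[OF this f]] show ?thesis by blast
  next
    case False
    then show ?thesis unfolding x_def by (auto intro: whom.zero)
  qed
  have hy: "\<exists>n l. whom ds n l (\<lambda>v. y * (v (k, i - 1) * f v))"
  proof -
    have "(k, i - 1) \<in> Theta ds" using i by (auto simp: Theta_def)
    from whom.scale[OF whom.coord[OF this f]] show ?thesis by blast
  qed
  have cx: "lie A (\<lambda>v. x * (v (k, i + 1) * f v)) = (\<lambda>v. x * (A v (k, i + 1) * f v + v (k, i + 1) * lie A f v))" for A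
  proof (cases "i < ds ! k")
    case True
    then have "(k, i + 1) \<in> Theta ds" using i by (auto simp: Theta_def)
    from lie_scale[OF whom.coord[OF this f]] show ?thesis unfolding lie_coord[OF f] by simp
  next
    case False
    then show ?thesis unfolding x_def by (simp add: lie_const)
  qed
  have cy: "lie A (\<lambda>v. y * (v (k, i - 1) * f v)) = (\<lambda>v. y * (A v (k, i - 1) * f v + v (k, i - 1) * lie A f v))" for A
  proof -
    have "(k, i - 1) \<in> Theta ds" using i by (auto simp: Theta_def)
    from lie_scale[OF whom.coord[OF this f]] show ?thesis unfolding lie_coord[OF f] by simp
  qed
  obtain n1 l1 n2 l2 where hx': "whom ds n1 l1 (\<lambda>v. x * (v (k, i + 1) * f v))"
    and hy': "whom ds n2 l2 (\<lambda>v. y * (v (k, i - 1) * f v))" using hx hy by blast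
  have L1: "lower ds (\<lambda>v. v p * f v) = (\<lambda>v. y * (v (k, i - 1) * f v) + v p * lower ds f v)"
    unfolding lie_coord[OF f] Y by (simp add: mult.assoc)
  have R1: "raise ds (\<lambda>v. v p * f v) = (\<lambda>v. x * (v (k, i + 1) * f v) + v p * raise ds f v)"
    unfolding lie_coord[OF f] X by (simp add: mult.assoc)
  have cc: "y * up_field ds v (k, i - 1) - x * dn_field ds v (k, i + 1) = of_int (weight ds p) * v p" for v
    unfolding p x_def y_def up_field_def dn_field_def weight_def using i
    by (cases "i = 0"; cases "i < ds ! k") (auto simp: algebra_simps of_nat_diff)
  have "raise ds (lower ds (\<lambda>v. v p * f v)) v = lower ds (raise ds (\<lambda>v. v p * f v)) v + of_int (l + weight ds p) * (v p * f v)" for v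
    unfolding L1 R1 lie_add[OF hx' whom.coord[OF coord(1) Rf]] lie_add[OF hy' whom.coord[OF coord(1) Lf]]
      cx cy lie_coord[OF Rf] lie_coord[OF Lf] coord(3) X Y
    using cc[of v] by (simp add: algebra_simps) (metis (no_types, lifting) distrib_left mult.left_commute)
  then show ?case by blast
next
  case (zero n l)
  then show ?case by (simp add: lie_const)
next
  case (add n l f g)
  show ?case
    unfolding lie_add[OF add(1,2)] lie_add[OF whom_raise[OF add(1)] whom_raise[OF add(2)]]
      lie_add[OF whom_lower[OF add(1)] whom_lower[OF add(2)]] add(3,4) by (simp add: algebra_simps)
next
  case (scale n l f c)
  show ?case
    unfolding lie_scale[OF scale(1)] lie_scale[OF whom_raise[OF scale(1)]]
      lie_scale[OF whom_lower[OF scale(1)]] scale(2) by (simp add: algebra_simps)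
qed

lemma whom_lower_pow: "whom ds n l f \<Longrightarrow> whom ds n (l - 2 * int k) ((lower ds ^^ k) f)"
proof (induction k)
  case (Suc k)
  from whom_lower[OF Suc.IH[OF Suc.prems]] show ?case by (simp add: algebra_simps)
qed simp

lemma whom_raise_pow: "whom ds n l f \<Longrightarrow> whom ds n (l + 2 * int k) ((raise ds ^^ k) f)"
proof (induction k)
  case (Suc k)
  from whom_raise[OF Suc.IH[OF Suc.prems]] show ?case by (simp add: algebra_simps)
qed simp

text \<open>Moving E past k + 1 factors F picks up the weights l, l - 2, ..., l - 2k, whose sum is
  (k + 1)(l - k).\<close>

lemma raise_lower_pow:
  assumes f: "whom ds n l f"
  shows "raise ds ((lower ds ^^ Suc k) f) =
    (\<lambda>v. (lower ds ^^ Suc k) (raise ds f) v + of_int ((int k + 1) * (l - int k)) * (lower ds ^^ k) f v)"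
proof (induction k)
  case 0
  then show ?case using raise_lower_comm[OF f] by simp
next
  case (Suc k)
  have "raise ds ((lower ds ^^ Suc (Suc k)) f) = raise ds (lower ds ((lower ds ^^ Suc k) f))" by simp
  also have "\<dots> = (\<lambda>v. lower ds (raise ds ((lower ds ^^ Suc k) f)) v + of_int (l - 2 * int (Suc k)) * ((lower ds ^^ Suc k) f) v)"
    by (rule raise_lower_comm[OF whom_lower_pow[OF f]])
  also have "raise ds ((lower ds ^^ Suc k) f) =
    (\<lambda>v. (lower ds ^^ Suc k) (raise ds f) v + of_int ((int k + 1) * (l - int k)) * (lower ds ^^ k) f v)" by (rule Suc.IH)
  also have "lower ds (\<lambda>v. (lower ds ^^ Suc k) (raise ds f) v + of_int ((int k + 1) * (l - int k)) * (lower ds ^^ k) f v)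
    = (\<lambda>v. (lower ds ^^ Suc (Suc k)) (raise ds f) v + of_int ((int k + 1) * (l - int k)) * (lower ds ^^ Suc k) f v)"
    unfolding lie_add[OF whom_lower_pow[OF whom_raise[OF f]] whom.scale[OF whom_lower_pow[OF f]]]
      lie_scale[OF whom_lower_pow[OF f]] by simp
  also have "(\<lambda>v. (lower ds ^^ Suc (Suc k)) (raise ds f) v + of_int ((int k + 1) * (l - int k)) * (lower ds ^^ Suc k) f v
     + of_int (l - 2 * int (Suc k)) * ((lower ds ^^ Suc k) f) v) =
     (\<lambda>v. (lower ds ^^ Suc (Suc k)) (raise ds f) v + of_int ((int (Suc k) + 1) * (l - int (Suc k))) * (lower ds ^^ Suc k) f v)"
    by (rule ext) (simp add: algebra_simps)
  finally show ?case .
qed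

lemma weight_bound:
  assumes "p \<in> Theta ds"
  shows "\<bar>weight ds p\<bar> \<le> int (sum_list ds)"
proof -
  obtain k i where p: "p = (k, i)" by (cases p)
  with assms have "k < length ds" "i \<le> ds ! k" by (auto simp: Theta_def)
  moreover from this have "ds ! k \<le> sum_list ds" by (simp add: elem_le_sum_list)
  ultimately show ?thesis by (auto simp: p weight_def)
qed

text \<open>Each coordinate factor contributes at most \<open>sum_list ds\<close> to the absolute
  value of the weight. Hence high powers of \<open>raise\<close> and \<open>lower\<close> annihilate
  a given function, which starts the descending inductions below.\<close>

lemma whom_vanish: "whom ds n l f \<Longrightarrow> int n * int (sum_list ds) < \<bar>l\<bar> \<Longrightarrow> f = (\<lambda>_. 0)"
proof (induction rule: whom.induct)
  case (coord p n l f)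
  have "int n * int (sum_list ds) < \<bar>l\<bar>"
    using coord.prems weight_bound[OF coord.hyps(1)] by (simp add: algebra_simps)
  with coord.IH show ?case by simp
qed auto

lemma lower_pow_zero: "(lower ds ^^ k) (\<lambda>_. 0) = (\<lambda>_. 0)"
  by (induction k) (auto simp: lie_const)

text \<open>Descending induction on \<open>k\<close>: F^k E^k g lies in the image of E. For large
  \<open>k\<close> it is 0. For the step, E^k g has weight 2k + 2, so E(F^(k+1) E^k g) is F^(k+1)
  E^(k+1) g plus (k + 1)(k + 2) times F^k E^k g, and the first summand is in the image already. At k
  = 0 this is the claim.\<close>

lemma raise_surj:
  assumes g: "whom ds n 2 g"
  shows "\<exists>f. whom ds n 0 f \<and> raise ds f = g"
proof -
  define N where "N = n * sum_list ds"
  have *: "k \<le> N \<Longrightarrow> \<exists>f. whom ds n 0 f \<and> raise ds f = (lower ds ^^ k) ((raise ds ^^ k) g)" for k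
  proof (induction k rule: inc_induct)
    case base
    have "(raise ds ^^ N) g = (\<lambda>_. 0)"
      by (rule whom_vanish[OF whom_raise_pow[OF g]]) (simp add: N_def add_nonneg_pos)
    then show ?case by (intro exI[of _ "\<lambda>_. 0"]) (simp add: lower_pow_zero whom.zero lie_const)
  next
    case (step k)
    then obtain f where f: "whom ds n 0 f" "raise ds f = (lower ds ^^ Suc k) ((raise ds ^^ Suc k) g)" by blast
    define c :: complex where "c = of_int ((int k + 1) * (int k + 2))"
    have "int k + 1 \<noteq> 0" "int k + 2 \<noteq> 0" by auto
    then have c0: "c \<noteq> 0" unfolding c_def of_int_eq_0_iff mult_eq_0_iff by blast
    define h where "h = (lower ds ^^ Suc k) ((raise ds ^^ k) g)"
    have wh: "whom ds n 0 h" using whom_lower_pow[OF whom_raise_pow[OF g], of k "Suc k"] by (simp add: h_def)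
    have "raise ds h = (\<lambda>v. (lower ds ^^ Suc k) ((raise ds ^^ Suc k) g) v + c * (lower ds ^^ k) ((raise ds ^^ k) g) v)"
      unfolding h_def raise_lower_pow[OF whom_raise_pow[OF g]] by (simp add: c_def algebra_simps)
    then have "raise ds (\<lambda>v. (1 / c) * (h v + (- 1) * f v)) = (lower ds ^^ k) ((raise ds ^^ k) g)"
      unfolding lie_scale[OF whom.add[OF wh whom.scale[OF f(1)]]] lie_add[OF wh whom.scale[OF f(1)]]
        lie_scale[OF f(1)] f(2) using c0 by (auto simp: fun_eq_iff field_simps)
    moreover have "whom ds n 0 (\<lambda>v. (1 / c) * (h v + (- 1) * f v))"
      by (intro whom.scale whom.add wh f(1))
    ultimately show ?case by blast
  qed
  from *[of 0] show ?thesis by simp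
qed

text \<open>A highest weight vector of weight 0 spans a trivial representation. From E F^(k+1) f =
  -k(k + 1) F^k f the vanishing of F^k f descends from large \<open>k\<close> as long as the factor
  is not 0, that is down to k = 1.\<close>

lemma raise_zero_imp_lower_zero:
  assumes f: "whom ds n 0 f" and "raise ds f = (\<lambda>_. 0)"
  shows "lower ds f = (\<lambda>_. 0)"
proof -
  define N where "N = Suc (n * sum_list ds)"
  have "k \<le> N \<Longrightarrow> 1 \<le> k \<Longrightarrow> (lower ds ^^ k) f = (\<lambda>_. 0)" for k
  proof (induction k rule: inc_induct)
    case base
    show ?case by (rule whom_vanish[OF whom_lower_pow[OF f]]) (simp add: N_def)
  next
    case (step k)
    have "(\<lambda>v. of_int ((int k + 1) * (0 - int k)) * (lower ds ^^ k) f v) = (\<lambda>_. 0)"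
      using raise_lower_pow[OF f, of k] step by (simp only: assms(2) lower_pow_zero lie_const) simp
    moreover have "of_int ((int k + 1) * (0 - int k)) \<noteq> (0::complex)"
      unfolding of_int_eq_0_iff mult_eq_0_iff using step by auto
    ultimately show ?case unfolding fun_eq_iff mult_eq_0_iff by metis
  qed
  from this[of 1] show ?thesis by (simp add: N_def)
qed

section \<open>Monomials as bases of the weight spaces\<close>

definition Mon :: "nat list \<Rightarrow> nat \<Rightarrow> int \<Rightarrow> (nat \<times> nat \<Rightarrow> nat) set" where
  "Mon ds n l = {m. (\<forall>p. p \<notin> Theta ds \<longrightarrow> m p = 0) \<and> sum m (Theta ds) = n
     \<and> (\<Sum>p\<in>Theta ds. int (m p) * weight ds p) = l}"

definition monom_fun :: "nat list \<Rightarrow> (nat \<times> nat \<Rightarrow> nat) \<Rightarrow> tup \<Rightarrow> complex" where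
  "monom_fun ds m = (\<lambda>v. \<Prod>p\<in>Theta ds. v p ^ m p)"

lemma finite_MonU: "finite {m. (\<forall>p. p \<notin> Theta ds \<longrightarrow> m p = 0) \<and> sum m (Theta ds) = (n::nat)}"
proof (rule finite_subset)
  show "{m. (\<forall>p. p \<notin> Theta ds \<longrightarrow> m p = 0) \<and> sum m (Theta ds) = n} \<subseteq>
    {m. \<forall>p. (p \<in> Theta ds \<longrightarrow> m p \<in> {..n}) \<and> (p \<notin> Theta ds \<longrightarrow> m p = 0)}"
    using member_le_sum[of _ "Theta ds"] finite_Theta by fastforce
qed (intro finite_set_of_finite_funs finite_Theta finite_atMost)

lemma finite_Mon: "finite (Mon ds n l)"
  by (rule finite_subset[OF _ finite_MonU[of ds n]]) (auto simp: Mon_def)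

text \<open>Induction on the variables. With the other variables fixed, the sum is a polynomial in
  the variable \<open>q\<close> that vanishes everywhere, so each of its coefficients vanishes. A
  coefficient collects the exponents with the same value at \<open>q\<close>, and
  \<open>m(q := 0)\<close> turns these into exponents in the remaining variables.\<close>

lemma monomials_independent:
  fixes c :: "('a \<Rightarrow> nat) \<Rightarrow> complex"
  assumes "finite A" "finite M" "\<forall>m\<in>M. \<forall>p. p \<notin> A \<longrightarrow> m p = 0"
    and "\<forall>v. (\<Sum>m\<in>M. c m * (\<Prod>p\<in>A. v p ^ m p)) = 0"
  shows "\<forall>m\<in>M. c m = 0"
  using assms
proof (induction A arbitrary: M c rule: finite_induct)
  case empty
  then have "M \<subseteq> {\<lambda>_. 0}" by auto
  then have "M = {} \<or> M = {\<lambda>_. 0}" by auto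
  with empty.prems(3) show ?case by auto
next
  case (insert q A)
  show ?case
  proof
    fix m0 assume m0: "m0 \<in> M"
    define k where "k = m0 q"
    define M' where "M' = {m \<in> M. m q = k}"
    define M'' where "M'' = (\<lambda>m. m(q := 0)) ` M'"
    define c' where "c' = (\<lambda>m. c (m(q := k)))"
    have inj: "inj_on (\<lambda>m. m(q := 0)) M'"
    proof (rule inj_onI)
      fix m m' assume "m \<in> M'" "m' \<in> M'" and e: "m(q := 0) = m'(q := 0)"
      then have "m q = m' q" by (simp add: M'_def)
      with e show "m = m'" by (metis fun_upd_triv fun_upd_upd)
    qed
    have z: "(\<Sum>m\<in>M''. c' m * (\<Prod>p\<in>A. v p ^ m p)) = 0" for v
    proof -
      define P where "P = (\<Sum>m\<in>M. monom (c m * (\<Prod>p\<in>A. v p ^ m p)) (m q))"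
      have "poly P x = 0" for x
      proof -
        have "(\<Prod>p\<in>A. (v(q := x)) p ^ m p) = (\<Prod>p\<in>A. v p ^ m p)" for m
          by (rule prod.cong) (use insert in auto)
        then have "poly P x = (\<Sum>m\<in>M. c m * (\<Prod>p\<in>insert q A. (v(q := x)) p ^ m p))"
          using insert by (simp add: P_def poly_sum poly_monom mult_ac)
        then show ?thesis using insert.prems(3) by metis
      qed
      then have "P = 0" using poly_all_0_iff_0 by blast
      then have "coeff P k = 0" by simp
      also have "coeff P k = (\<Sum>m\<in>M. if m q = k then c m * (\<Prod>p\<in>A. v p ^ m p) else 0)"
        by (simp add: P_def coeff_sum)
      also have "\<dots> = (\<Sum>m\<in>M'. c m * (\<Prod>p\<in>A. v p ^ m p))"
        unfolding M'_def by (rule sum.inter_filter[symmetric]) (rule insert.prems(1))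
      also have "\<dots> = (\<Sum>m\<in>M''. c' m * (\<Prod>p\<in>A. v p ^ m p))"
        unfolding M''_def sum.reindex[OF inj] o_def
      proof (rule sum.cong)
        fix m assume "m \<in> M'"
        then have "m(q := k) = m" by (auto simp: M'_def)
        then show "c m * (\<Prod>p\<in>A. v p ^ m p) = c' (m(q := 0)) * (\<Prod>p\<in>A. v p ^ (m(q := 0)) p)"
          unfolding c'_def using insert.hyps(2) by (auto intro!: prod.cong)
      qed simp
      finally show ?thesis by simp
    qed
    have "\<forall>m\<in>M''. c' m = 0"
      by (rule insert.IH) (use insert.prems z in \<open>auto simp: M''_def M'_def\<close>)
    moreover have "m0(q := 0) \<in> M''" using m0 by (auto simp: M''_def M'_def k_def)
    ultimately have "c' (m0(q := 0)) = 0" by blast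
    then show "c m0 = 0" by (simp add: c'_def k_def)
  qed
qed

lemma mono_coeff_zero:
  assumes "finite M" "\<And>m p. m \<in> M \<Longrightarrow> p \<notin> Theta ds \<Longrightarrow> m p = 0"
    and "\<And>v. (\<Sum>m\<in>M. c m * monom_fun ds m v) = 0" "m \<in> M"
  shows "c m = 0"
  using monomials_independent[OF finite_Theta[of ds] assms(1), of c] assms(2-4) unfolding monom_fun_def by blast

lemma mono_inj:
  assumes "\<And>m p. m \<in> M \<Longrightarrow> p \<notin> Theta ds \<Longrightarrow> m p = 0"
  shows "inj_on (monom_fun ds) M"
proof (rule inj_onI, rule ccontr)
  fix m m' assume m: "m \<in> M" "m' \<in> M" "monom_fun ds m = monom_fun ds m'" "m \<noteq> m'"
  have "(if m = m then 1 else - 1) = (0::complex)"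
    by (rule mono_coeff_zero[of "{m, m'}" ds "\<lambda>x. if x = m then 1 else -1"]) (use m assms in auto)
  then show False by simp
qed

lemma sum_fun_apply: "(\<Sum>x\<in>A. F x) v = (\<Sum>x\<in>A. F x v)" for F :: "'a \<Rightarrow> 'b \<Rightarrow> 'c :: comm_monoid_add"
  by (induction A rule: infinite_finite_induct) auto

lemma mono_independent:
  assumes "finite M" and supp: "\<And>m p. m \<in> M \<Longrightarrow> p \<notin> Theta ds \<Longrightarrow> m p = 0"
  shows "\<not> fun_vs.dependent (monom_fun ds ` M)"
proof
  assume "fun_vs.dependent (monom_fun ds ` M)"
  then obtain u where u: "\<exists>f\<in>monom_fun ds ` M. u f \<noteq> 0" "(\<Sum>f\<in>monom_fun ds ` M. fscale (u f) f) = 0"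
    using fun_vs.dependent_finite[of "monom_fun ds ` M"] assms(1) by auto
  have inj: "inj_on (monom_fun ds) M" by (rule mono_inj) (rule supp)
  have "(\<Sum>m\<in>M. u (monom_fun ds m) * monom_fun ds m v) = 0" for v
  proof -
    have "(\<Sum>m\<in>M. fscale (u (monom_fun ds m)) (monom_fun ds m)) = 0"
      using u(2) by (subst (asm) sum.reindex[OF inj]) auto
    then have "(\<Sum>m\<in>M. fscale (u (monom_fun ds m)) (monom_fun ds m)) v = 0" by simp
    then show ?thesis by (simp add: fscale_def sum_fun_apply)
  qed
  then have "\<And>m. m \<in> M \<Longrightarrow> u (monom_fun ds m) = 0"
    using mono_coeff_zero[OF assms(1), where c = "\<lambda>m. u (monom_fun ds m)" and ds = ds] supp by blast
  with u(1) show False by auto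
qed

lemma mono_span_expand:
  assumes "finite M" and supp: "\<And>m p. m \<in> M \<Longrightarrow> p \<notin> Theta ds \<Longrightarrow> m p = 0"
    and "F \<in> fun_vs.span (monom_fun ds ` M)"
  obtains c where "F = (\<lambda>v. \<Sum>m\<in>M. c m * monom_fun ds m v)"
proof -
  from assms(3) obtain u where "F = (\<Sum>f\<in>monom_fun ds ` M. fscale (u f) f)"
    using fun_vs.span_finite[of "monom_fun ds ` M"] assms(1) by auto
  moreover have "inj_on (monom_fun ds) M" by (rule mono_inj) (rule supp)
  ultimately have "F = (\<Sum>m\<in>M. fscale (u (monom_fun ds m)) (monom_fun ds m))"
    by (simp add: sum.reindex)
  then have "F = (\<lambda>v. \<Sum>m\<in>M. u (monom_fun ds m) * monom_fun ds m v)"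
    by (simp add: fun_eq_iff sum_fun_apply fscale_def)
  then show ?thesis by (rule that)
qed

lemma sum_upd_Suc:
  fixes g :: "'a \<Rightarrow> 'b :: comm_semiring_1"
  assumes "finite A" "p \<in> A"
  shows "(\<Sum>q\<in>A. of_nat ((m(p := Suc (m p))) q) * g q) = (\<Sum>q\<in>A. of_nat (m q) * g q) + g p"
proof -
  have "(\<Sum>q\<in>A - {p}. of_nat ((m(p := Suc (m p))) q) * g q) = (\<Sum>q\<in>A - {p}. of_nat (m q) * g q)"
    by (rule sum.cong) auto
  then show ?thesis using assms by (simp add: sum.remove[of A p] algebra_simps)
qed

lemma mono_Suc:
  assumes "p \<in> Theta ds"
  shows "monom_fun ds (m(p := Suc (m p))) = (\<lambda>v. v p * monom_fun ds m v)"
proof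
  fix v :: tup
  have "(\<Prod>q\<in>Theta ds - {p}. v q ^ (m(p := Suc (m p))) q) = (\<Prod>q\<in>Theta ds - {p}. v q ^ m q)"
    by (rule prod.cong) auto
  then show "monom_fun ds (m(p := Suc (m p))) v = v p * monom_fun ds m v"
    unfolding monom_fun_def using assms finite_Theta by (simp add: prod.remove[of _ p] algebra_simps)
qed

lemma Mon_Suc:
  assumes "m \<in> Mon ds n l" "p \<in> Theta ds"
  shows "m(p := Suc (m p)) \<in> Mon ds (Suc n) (l + weight ds p)"
  using sum_upd_Suc[OF finite_Theta assms(2), of m "\<lambda>_. 1 :: nat"] sum_upd_Suc[OF finite_Theta assms(2), of m "weight ds"]
    assms by (auto simp: Mon_def simp del: fun_upd_apply) auto

lemma whom_mono: "m \<in> Mon ds n l \<Longrightarrow> whom ds n l (monom_fun ds m)"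
proof (induction n arbitrary: m l)
  case 0
  then have "m p = 0" for p using finite_Theta by (cases p, cases "p \<in> Theta ds") (auto simp: Mon_def)
  then have "m = (\<lambda>_. 0)" by blast
  moreover from this 0 have "l = 0" by (simp add: Mon_def)
  ultimately show ?case using whom.one by (simp add: monom_fun_def)
next
  case (Suc n)
  have "sum m (Theta ds) \<noteq> 0" using Suc.prems by (simp add: Mon_def)
  then obtain p where p: "p \<in> Theta ds" "m p \<noteq> 0" by (meson sum.neutral)
  define m' where "m' = m(p := m p - 1)"
  have m: "m = m'(p := Suc (m' p))" using p by (auto simp: m'_def)
  have "m' \<in> Mon ds n (l - weight ds p)"
    using sum_upd_Suc[OF finite_Theta p(1), of m' "\<lambda>_. 1 :: nat"] sum_upd_Suc[OF finite_Theta p(1), of m' "weight ds"]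
      Suc.prems p(1) unfolding m[symmetric] by (auto simp: Mon_def m'_def)
  from whom.coord[OF p(1) Suc.IH[OF this]] show ?case
    by (subst m, subst mono_Suc[OF p(1)]) simp
qed

lemma whom_iff_span: "whom ds n l f \<longleftrightarrow> f \<in> fun_vs.span (monom_fun ds ` Mon ds n l)"
proof
  assume "whom ds n l f"
  then show "f \<in> fun_vs.span (monom_fun ds ` Mon ds n l)"
  proof induction
    case one
    have "(\<lambda>_. 0) \<in> Mon ds 0 0" by (simp add: Mon_def)
    moreover have "monom_fun ds (\<lambda>_. 0) = (\<lambda>_. 1)" by (simp add: monom_fun_def)
    ultimately show ?case by (metis fun_vs.span_base imageI)
  next
    case (coord p n l f)
    from coord(3) show ?case
    proof (induction rule: fun_vs.span_induct_alt)
      case base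
      then show ?case by (simp add: zero_fun_def fun_vs.span_zero[unfolded zero_fun_def])
    next
      case (step c x y)
      from step(1) obtain m where m: "m \<in> Mon ds n l" "x = monom_fun ds m" by auto
      have "(\<lambda>v. v p * (fscale c x + y) v) = fscale c (monom_fun ds (m(p := Suc (m p)))) + (\<lambda>v. v p * y v)"
        unfolding mono_Suc[OF coord(1)] m(2) by (auto simp: fscale_def algebra_simps)
      also have "\<dots> \<in> fun_vs.span (monom_fun ds ` Mon ds (Suc n) (l + weight ds p))"
        by (intro fun_vs.span_add fun_vs.span_scale step fun_vs.span_base imageI Mon_Suc m coord)
      finally show ?case .
    qed
  next
    case (zero n l)
    then show ?case using fun_vs.span_zero by (simp add: zero_fun_def)
  next
    case (add n l f g)
    then show ?case using fun_vs.span_add[OF add(3,4)] by (simp add: plus_fun_def)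
  next
    case (scale n l f c)
    have "(\<lambda>v. c * f v) = fscale c f" by (simp add: fscale_def)
    then show ?case using fun_vs.span_scale[OF scale(2), of c] by simp
  qed
next
  assume "f \<in> fun_vs.span (monom_fun ds ` Mon ds n l)"
  then show "whom ds n l f"
  proof (induction rule: fun_vs.span_induct_alt)
    case base
    then show ?case using whom.zero by (simp add: zero_fun_def)
  next
    case (step c x y)
    then show ?case using whom.add[OF whom.scale[OF whom_mono]] by (auto simp: plus_fun_def fscale_def)
  qed
qed

lemma homog_polys_eq:
  "homog_polys ds n = fun_vs.span (monom_fun ds ` {m. (\<forall>p. p \<notin> Theta ds \<longrightarrow> m p = 0) \<and> sum m (Theta ds) = n})"
proof -
  have "{\<lambda>v. \<Prod>p\<in>Theta ds. v p ^ m p | m :: nat \<times> nat \<Rightarrow> nat. (\<Sum>p\<in>Theta ds. m p) = n}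
      = monom_fun ds ` {m. (\<forall>p. p \<notin> Theta ds \<longrightarrow> m p = 0) \<and> sum m (Theta ds) = n}" (is "?L = ?R")
  proof
    show "?L \<subseteq> ?R"
    proof
      fix f assume "f \<in> ?L"
      then obtain m where m: "f = monom_fun ds m" "sum m (Theta ds) = n" by (auto simp: monom_fun_def)
      \<comment> \<open>The exponents in \<open>homog_polys\<close> are arbitrary outside
        \<open>Theta\<close>; setting them to 0 there changes neither the monomial nor its
        degree.\<close>
      let ?m = "\<lambda>p. if p \<in> Theta ds then m p else 0"
      have "f = monom_fun ds ?m" unfolding m monom_fun_def by (intro ext prod.cong) auto
      moreover have "sum ?m (Theta ds) = n" unfolding m(2)[symmetric] by (rule sum.cong) auto
      ultimately show "f \<in> ?R" by (intro image_eqI[of _ _ ?m]) auto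
    qed
  qed (auto simp: monom_fun_def)
  then show ?thesis by (simp add: homog_polys_def)
qed

lemma whom_cong_Theta:
  "whom ds n l f \<Longrightarrow> (\<And>p. p \<in> Theta ds \<Longrightarrow> v p = v' p) \<Longrightarrow> f v = f v'"
  by (induction rule: whom.induct) auto

lemma whom_in_homog:
  assumes "whom ds n l f" shows "f \<in> homog_polys ds n"
proof -
  have "Mon ds n l \<subseteq> {m. (\<forall>p. p \<notin> Theta ds \<longrightarrow> m p = 0) \<and> sum m (Theta ds) = n}"
    by (auto simp: Mon_def)
  from fun_vs.span_mono[OF image_mono[OF this]] assms show ?thesis
    unfolding whom_iff_span homog_polys_eq by blast
qed

section \<open>Unipotent and diagonal matrices acting on binary forms\<close>

definition tri :: "complex \<Rightarrow> complex \<Rightarrow> complex Matrix.mat" where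
  "tri a b = Matrix.mat 2 2 (\<lambda>(i, j). if i = j then 1 else if i = 0 then a else b)"

lemma det_2x2: "A \<in> carrier_mat 2 2 \<Longrightarrow> Determinant.det A = A $$ (0,0) * A $$ (1,1) - A $$ (0,1) * A $$ (1,0)"
  for A :: "complex mat"
  by (subst laplace_expansion_column[of A 2 0])
    (auto simp: numeral_2_eq_2 cofactor_def mat_delete_def det_single)

lemma mult_2x2:
  assumes "A \<in> carrier_mat 2 2" "B \<in> carrier_mat 2 2" "i < 2" "j < 2"
  shows "(A * B) $$ (i, j) = A $$ (i, 0) * B $$ (0, j) + A $$ (i, 1) * (B $$ (1, j) :: complex)"
  using assms by (simp add: scalar_prod_def numeral_2_eq_2)

lemma bin_form_cong: "(\<And>i. i \<le> d \<Longrightarrow> c i = c' i) \<Longrightarrow> bin_form d c x y = bin_form d c' x y"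
  unfolding bin_form_def by (rule sum.cong) auto

lemma bin_form_inj:
  assumes "\<And>x y. bin_form d c x y = bin_form d c' x y" "i \<le> d"
  shows "c i = c' i"
proof -
  define P where "P = (\<Sum>i\<le>d. monom (c i - c' i) i)"
  have "poly P x = bin_form d c x 1 - bin_form d c' x 1" for x
    by (simp add: P_def poly_sum poly_monom bin_form_def algebra_simps sum_subtractf)
  then have "P = 0" using assms(1) poly_all_0_iff_0[of P] by simp
  then have "coeff P i = 0" by simp
  then show ?thesis using assms(2) by (simp add: P_def coeff_sum)
qed

text \<open>A form is determined by its values, and on values \<open>bin_form_subst\<close>
  describes the action as a substitution. Two substitutions compose to the one given by
  \<open>g * h\<close>.\<close>

lemma act_mult:
  assumes "g \<in> carrier_mat 2 2" "h \<in> carrier_mat 2 2"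
  shows "act ds g (act ds h v) = act ds (g * h) v"
proof
  fix p :: "nat \<times> nat"
  obtain k i where p: "p = (k, i)" by (cases p)
  show "act ds g (act ds h v) p = act ds (g * h) v p"
  proof (cases "p \<in> Theta ds")
    case True
    then have k: "k < length ds" "i \<le> ds ! k" by (auto simp: p Theta_def)
    define d where "d = ds ! k"
    have "subst_form d g (\<lambda>j. act ds h v (k, j)) i = subst_form d (g * h) (\<lambda>j. v (k, j)) i"
    proof (rule bin_form_inj)
      fix x y
      have "bin_form d (\<lambda>j. act ds h v (k, j)) x' y' = bin_form d (subst_form d h (\<lambda>j. v (k, j))) x' y'" for x' y'
        by (rule bin_form_cong) (use k in \<open>auto simp: act_def Theta_def d_def\<close>)
      then show "bin_form d (subst_form d g (\<lambda>j. act ds h v (k, j))) x y = bin_form d (subst_form d (g * h) (\<lambda>j. v (k, j))) x y"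
        unfolding bin_form_subst by (simp add: mult_2x2[OF assms] algebra_simps)
    qed (use k in \<open>simp add: d_def\<close>)
    then show ?thesis using True by (simp add: p act_def d_def)
  qed (simp add: p act_def)
qed

lemma tri_carrier: "tri a b \<in> carrier_mat 2 2" by (simp add: tri_def)

lemma tri_index: "tri a b $$ (0,0) = 1" "tri a b $$ (0,1) = a" "tri a b $$ (1,0) = b" "tri a b $$ (1,1) = 1"
  by (simp_all add: tri_def)

lemma tri_SL2: "tri a 0 \<in> SL2" "tri 0 b \<in> SL2"
  unfolding SL2_def using tri_carrier by (auto simp: det_2x2[OF tri_carrier] tri_index[unfolded One_nat_def])

text \<open>Gauss decomposition into upper, lower and upper unipotent factors. The middle factor
  carries the lower left entry of \<open>g\<close>; the outer ones are found by solving for the two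
  diagonal entries, and determinant 1 takes care of the last entry.\<close>

lemma SL2_decompose_lower:
  assumes "g \<in> SL2" "g $$ (1,0) \<noteq> 0"
  shows "g = tri ((g $$ (0,0) - 1) / g $$ (1,0)) 0 * (tri 0 (g $$ (1,0)) * tri ((g $$ (1,1) - 1) / g $$ (1,0)) 0)"
    (is "g = ?A * (?B * ?C)")
proof -
  have g: "g \<in> carrier_mat 2 2" and dg: "g $$ (0,0) * g $$ (1,1) - g $$ (0,1) * g $$ (1,0) = 1"
    using assms(1) det_2x2[of g] by (auto simp: SL2_def)
  have BC: "?B * ?C \<in> carrier_mat 2 2" by (intro mult_carrier_mat[OF tri_carrier tri_carrier])
  show ?thesis
  proof (rule eq_matI)
    fix i j assume "i < dim_row (?A * (?B * ?C))" "j < dim_col (?A * (?B * ?C))"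
    then have ij: "i < 2" "j < 2" by (simp_all add: tri_def)
    then have "i = 0 \<or> i = 1" "j = 0 \<or> j = 1" by auto
    then show "g $$ (i, j) = (?A * (?B * ?C)) $$ (i, j)"
      unfolding mult_2x2[OF tri_carrier BC ij]
      using dg assms(2) ij by (elim disjE) (simp_all add: mult_2x2[OF tri_carrier tri_carrier] tri_index[unfolded One_nat_def] field_simps)
  qed (use g tri_carrier in auto)
qed

text \<open>The two unipotent groups generate SL_2: the Gauss decomposition covers a nonzero lower
  left entry, and the other matrices are moved into that case by one unipotent factor.\<close>

lemma invariant_of_unipotent:
  assumes U: "\<And>s v. f (act ds (tri s 0) v) = f v" and L: "\<And>s v. f (act ds (tri 0 s) v) = f v"
    and "g \<in> SL2"
  shows "f (act ds g v) = f v"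
proof -
  have *: "f (act ds g v) = f v" if g: "g \<in> SL2" "g $$ (1,0) \<noteq> 0" for g v
    by (subst SL2_decompose_lower[OF g]) (simp add: act_mult[symmetric] tri_carrier mult_carrier_mat[OF tri_carrier tri_carrier] U L)
  show ?thesis
  proof (cases "g $$ (1,0) = 0")
    case True
    have g: "g \<in> carrier_mat 2 2" and dg: "g $$ (0,0) * g $$ (1,1) - g $$ (0,1) * g $$ (1,0) = 1"
      using assms(3) det_2x2[of g] by (auto simp: SL2_def)
    \<comment> \<open>If the lower left entry is 0, the diagonal entries are nonzero, and adding the
      first row to the second brings one of them to the lower left.\<close>
    have "tri 0 1 * g \<in> SL2"
      using det_mult[OF tri_carrier g, of 0 1] assms(3) tri_SL2 mult_carrier_mat[OF tri_carrier g] by (auto simp: SL2_def)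
    moreover have "(tri 0 1 * g) $$ (1,0) \<noteq> 0"
      using dg True by (auto simp: mult_2x2[OF tri_carrier g] tri_index[unfolded One_nat_def])
    ultimately have "f (act ds (tri 0 1 * g) v) = f v" by (rule *)
    then show ?thesis by (simp add: act_mult[symmetric] tri_carrier g L)
  qed (use * assms(3) in blast)
qed


lemma subst_form_diag:
  assumes "z \<noteq> 0" "i \<le> d"
  shows "subst_form d (Matrix.mat 2 2 (\<lambda>(i, j). if i = j then if i = 0 then z else 1 / z else 0)) c i
    = z powi (2 * int i - int d) * c i"
proof -
  have c1: "coeff ([:0, z:] ^ j * [:1 / z, 0:] ^ (d - j)) i = (if i = j then z ^ j * (1 / z) ^ (d - j) else 0)" for j
  proof -
    have "[:0, z:] = monom z 1" "[:1 / z, 0:] = [:1 / z:]" by (simp_all add: monom_altdef)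
    then have "[:0, z:] ^ j * [:1 / z, 0:] ^ (d - j) = monom (z ^ j * (1 / z) ^ (d - j)) j"
      by (simp add: monom_power poly_const_pow mult.commute smult_monom)
    then show ?thesis by simp
  qed
  have "subst_form d (Matrix.mat 2 2 (\<lambda>(i, j). if i = j then if i = 0 then z else 1 / z else 0)) c i
    = (\<Sum>j\<le>d. c j * (if i = j then z ^ j * (1 / z) ^ (d - j) else 0))"
    unfolding subst_form_def coeff_sum coeff_smult using c1 by simp
  also have "\<dots> = c i * (z ^ i * (1 / z) ^ (d - i))"
    using assms(2) by (simp add: if_distrib[of "\<lambda>x. _ * x"] cong: if_cong)
  also have "z ^ i * (1 / z) ^ (d - i) = z powi (2 * int i - int d)"
  proof -
    have "2 * int i - int d = int i - int (d - i)" using assms(2) by simp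
    then have "z powi (2 * int i - int d) = z powi int i / z powi int (d - i)"
      using assms(1) by (metis power_int_diff)
    then show ?thesis by (simp add: power_divide)
  qed
  finally show ?thesis by (simp add: mult.commute)
qed

lemma powi_sum:
  fixes z :: "'a :: field"
  assumes "finite A" "z \<noteq> 0"
  shows "(\<Prod>p\<in>A. z powi f p) = z powi (\<Sum>p\<in>A. f p)"
  using assms by (induction A rule: finite_induct) (auto simp: power_int_add)

lemma monom_fun_diag:
  assumes "z \<noteq> 0" "m \<in> Mon ds n l"
  shows "monom_fun ds m (act ds (Matrix.mat 2 2 (\<lambda>(i, j). if i = j then if i = 0 then z else 1 / z else 0)) v)
     = z powi l * monom_fun ds m v"
proof -
  have "monom_fun ds m (act ds (Matrix.mat 2 2 (\<lambda>(i, j). if i = j then if i = 0 then z else 1 / z else 0)) v)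
    = (\<Prod>p\<in>Theta ds. z powi (int (m p) * weight ds p) * v p ^ m p)"
    unfolding monom_fun_def
  proof (rule prod.cong[OF refl])
    fix p assume p: "p \<in> Theta ds"
    obtain k i where ki: "p = (k, i)" by (cases p)
    with p have "i \<le> ds ! k" by (simp add: Theta_def)
    then have "act ds (Matrix.mat 2 2 (\<lambda>(i, j). if i = j then if i = 0 then z else 1 / z else 0)) v p = z powi weight ds p * v p"
      using p by (simp add: act_def ki subst_form_diag[OF assms(1)] weight_def)
    then show "act ds (Matrix.mat 2 2 (\<lambda>(i, j). if i = j then if i = 0 then z else 1 / z else 0)) v p ^ m p
      = z powi (int (m p) * weight ds p) * v p ^ m p"
      by (simp add: power_mult_distrib power_int_power' mult.commute)
  qed
  also have "\<dots> = (\<Prod>p\<in>Theta ds. z powi (int (m p) * weight ds p)) * monom_fun ds m v"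
    by (simp add: prod.distrib monom_fun_def)
  also have "(\<Prod>p\<in>Theta ds. z powi (int (m p) * weight ds p)) = z powi (\<Sum>p\<in>Theta ds. int (m p) * weight ds p)"
    by (rule powi_sum[OF finite_Theta assms(1)])
  finally show ?thesis using assms(2) by (simp add: Mon_def)
qed

section \<open>One-parameter groups and the infinitesimal description of invariants\<close>

lemma act_tri_upper:
  assumes "(k, i) \<in> Theta ds"
  shows "act ds (tri s 0) v (k, i) = (\<Sum>j\<le>ds ! k. v (k, j) * (if i < j then 0 else of_nat ((ds ! k - j) choose (i - j)) * s ^ (i - j)))"
proof -
  have "coeff ([:0, 1:] ^ j * [:1, s:] ^ n) i = (if i < j then 0 else of_nat (n choose (i - j)) * s ^ (i - j))" for j n
  proof -
    have "[:0, 1:] ^ j = (monom 1 j :: complex poly)" by (simp add: monom_altdef)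
    then show ?thesis
      by (cases "i - j \<le> n") (auto simp: coeff_monom_mult coeff_linear_poly_power coeff_eq_0[OF le_less_trans[OF degree_linear_power_le]] binomial_eq_0)
  qed
  then show ?thesis using assms by (simp add: act_def subst_form_def coeff_sum tri_index[unfolded One_nat_def])
qed

lemma act_tri_lower:
  assumes "(k, i) \<in> Theta ds"
  shows "act ds (tri 0 s) v (k, i) = (\<Sum>j\<le>ds ! k. v (k, j) * (if j < i then 0 else of_nat (j choose i) * s ^ (j - i)))"
proof -
  have "coeff ([:s, 1:] ^ j * [:1, 0:] ^ n) i = (if j < i then 0 else of_nat (j choose i) * s ^ (j - i))" for j n
  proof -
    have "[:1, 0:] ^ n = (1 :: complex poly)" by (simp flip: one_pCons)
    then show ?thesis
      by (cases "i \<le> j") (auto simp: coeff_linear_poly_power coeff_eq_0[OF le_less_trans[OF degree_linear_power_le]])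
  qed
  then show ?thesis using assms by (simp add: act_def subst_form_def coeff_sum tri_index[unfolded One_nat_def])
qed

text \<open>The curve is an integral curve of the field at every \<open>s\<close>, not only at 0.
  Differentiating the power of \<open>s\<close> in the binomial expansion reproduces component i - 1
  by (a + 1) C(N, a + 1) = (N - a) C(N, a), with N = d - j and a = i - 1 - j.\<close>

lemma act_tri_upper_deriv:
  assumes "p \<in> Theta ds"
  shows "((\<lambda>s. act ds (tri s 0) v p) has_field_derivative dn_field ds (act ds (tri s 0) v) p) (at s)"
proof -
  obtain k i where p: "p = (k, i)" by (cases p)
  define d where "d = ds ! k"
  have ki: "k < length ds" "i \<le> d" using assms by (auto simp: p Theta_def d_def)
  have *: "((\<lambda>s. v (k, j) * (if i < j then 0 else of_nat ((d - j) choose (i - j)) * s ^ (i - j))) has_field_derivative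
      (if i = 0 then 0 else of_nat (d + 1 - i)) * (v (k, j) * (if i - 1 < j then 0 else of_nat ((d - j) choose (i - 1 - j)) * s ^ (i - 1 - j)))) (at s)" for j
  proof (cases "i \<le> j")
    case True
    then have "(\<lambda>s. v (k, j) * (if i < j then 0 else of_nat ((d - j) choose (i - j)) * s ^ (i - j))) = (\<lambda>s. if i < j then 0 else v (k, j))"
      by auto
    moreover have "(if i = 0 then 0 else of_nat (d + 1 - i)) * (v (k, j) * (if i - 1 < j then 0 else of_nat ((d - j) choose (i - 1 - j)) * s ^ (i - 1 - j))) = 0"
      using True by auto
    ultimately show ?thesis by (metis DERIV_const)
  next
    case False
    define a where "a = i - 1 - j"
    have i: "i - j = Suc a" "i - 1 - j = a" "d + 1 - i = (d - j) - a" "\<not> i < j" "\<not> i - 1 < j" "i \<noteq> 0"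
      using False ki by (auto simp: a_def)
    have "Suc a * ((d - j) choose Suc a) = ((d - j) - a) * ((d - j) choose a)"
      by (simp only: binomial_absorb_comp binomial_absorption)
    then have "of_nat (Suc a) * of_nat ((d - j) choose Suc a) = (of_nat ((d - j) - a) * of_nat ((d - j) choose a) :: complex)"
      by (metis of_nat_mult)
    then have e: "v (k, j) * (of_nat ((d - j) choose Suc a) * (of_nat (Suc a) * s ^ a)) = of_nat ((d - j) - a) * (v (k, j) * (of_nat ((d - j) choose a) * s ^ a))"
      by (simp add: mult_ac del: of_nat_Suc)
    have "((\<lambda>s. v (k, j) * (of_nat ((d - j) choose Suc a) * s ^ Suc a)) has_field_derivative
       v (k, j) * (of_nat ((d - j) choose Suc a) * (of_nat (Suc a) * s ^ a))) (at s)"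
      by (auto intro!: derivative_eq_intros simp del: power_Suc of_nat_Suc)
    then show ?thesis unfolding i e by (simp add: i del: One_nat_def)
  qed
  have "((\<lambda>s. \<Sum>j\<le>d. v (k, j) * (if i < j then 0 else of_nat ((d - j) choose (i - j)) * s ^ (i - j))) has_field_derivative
      (\<Sum>j\<le>d. (if i = 0 then 0 else of_nat (d + 1 - i)) * (v (k, j) * (if i - 1 < j then 0 else of_nat ((d - j) choose (i - 1 - j)) * s ^ (i - 1 - j))))) (at s)"
    by (rule DERIV_sum) (rule *)
  moreover have "(k, i - 1) \<in> Theta ds" using ki by (auto simp: Theta_def d_def)
  ultimately show ?thesis using assms
    by (simp add: p act_tri_upper dn_field_def sum_distrib_left d_def cong: if_cong)
qed

lemma act_tri_lower_deriv:
  assumes "p \<in> Theta ds"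
  shows "((\<lambda>s. act ds (tri 0 s) v p) has_field_derivative up_field ds (act ds (tri 0 s) v) p) (at s)"
proof -
  obtain k i where p: "p = (k, i)" by (cases p)
  define d where "d = ds ! k"
  have ki: "k < length ds" "i \<le> d" using assms by (auto simp: p Theta_def d_def)
  have *: "((\<lambda>s. v (k, j) * (if j < i then 0 else of_nat (j choose i) * s ^ (j - i))) has_field_derivative
      (if i < d then of_nat (i + 1) else 0) * (v (k, j) * (if j < Suc i then 0 else of_nat (j choose Suc i) * s ^ (j - Suc i)))) (at s)"
      if j: "j \<le> d" for j
  proof (cases "j \<le> i")
    case True
    then have "(\<lambda>s. v (k, j) * (if j < i then 0 else of_nat (j choose i) * s ^ (j - i))) = (\<lambda>s. if j < i then 0 else v (k, j))"
      by auto
    moreover have "(if i < d then of_nat (i + 1) else 0) * (v (k, j) * (if j < Suc i then 0 else of_nat (j choose Suc i) * s ^ (j - Suc i))) = 0"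
      using True by auto
    ultimately show ?thesis by (metis DERIV_const)
  next
    case False
    define a where "a = j - Suc i"
    have i: "j - i = Suc a" "j - Suc i = a" "\<not> j < i" "\<not> j < Suc i" "i < d"
      using False ki j by (auto simp: a_def)
    have "Suc i * (j choose Suc i) = (j - i) * (j choose i)"
      by (simp only: binomial_absorb_comp binomial_absorption)
    then have "of_nat (Suc i) * of_nat (j choose Suc i) = (of_nat (Suc a) * of_nat (j choose i) :: complex)"
      unfolding i(1)[symmetric] by (metis of_nat_mult)
    then have e: "v (k, j) * (of_nat (j choose i) * (of_nat (Suc a) * s ^ a)) = of_nat (Suc i) * (v (k, j) * (of_nat (j choose Suc i) * s ^ a))"
      by (simp add: mult_ac del: of_nat_Suc)
    have "((\<lambda>s. v (k, j) * (of_nat (j choose i) * s ^ Suc a)) has_field_derivative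
       v (k, j) * (of_nat (j choose i) * (of_nat (Suc a) * s ^ a))) (at s)"
      by (auto intro!: derivative_eq_intros simp del: power_Suc of_nat_Suc)
    then show ?thesis unfolding e using i by simp
  qed
  have "((\<lambda>s. \<Sum>j\<le>d. v (k, j) * (if j < i then 0 else of_nat (j choose i) * s ^ (j - i))) has_field_derivative
      (\<Sum>j\<le>d. (if i < d then of_nat (i + 1) else 0) * (v (k, j) * (if j < Suc i then 0 else of_nat (j choose Suc i) * s ^ (j - Suc i))))) (at s)"
    by (rule DERIV_sum) (rule *, simp)
  moreover have "(k, i + 1) \<in> Theta ds" if "i < d" using ki that by (auto simp: Theta_def d_def)
  ultimately show ?thesis using assms
    by (cases "i < d") (simp_all add: p act_tri_lower up_field_def sum_distrib_left d_def)
qed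

lemma act_tri_zero: "p \<in> Theta ds \<Longrightarrow> act ds (tri 0 0) v p = v p"
proof -
  assume p: "p \<in> Theta ds"
  obtain k i where ki: "p = (k, i)" by (cases p)
  have "(\<Sum>j\<le>ds ! k. v (k, j) * (if i < j then 0 else of_nat ((ds ! k - j) choose (i - j)) * 0 ^ (i - j))) = (\<Sum>j\<le>ds ! k. if j = i then v (k, j) else 0)"
    by (rule sum.cong) auto
  then show ?thesis using p act_tri_upper[of k i ds 0 v] by (simp add: ki Theta_def)
qed

text \<open>An invariant is fixed by one torus element, which forces weight 0, and by the matrices
  \<open>tri 0 s\<close>, whose derivative at s = 0 is \<open>raise\<close>. Conversely,
  \<open>raise F = 0\<close> in weight 0 gives \<open>lower F = 0\<close>; the orbits of both
  unipotent groups are integral curves of the two fields, so F is constant along them, and these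
  groups generate SL_2.\<close>

lemma invariants_iff:
  "F \<in> invariants ds n \<longleftrightarrow> whom ds n 0 F \<and> raise ds F = (\<lambda>_. 0)"
proof
  assume F: "F \<in> invariants ds n"
  \<comment> \<open>The single element diag(2, 1/2) detects weight 0: it multiplies a monomial of
    weight w by 2^w, which is 1 only for w = 0.\<close>
  define T where "T = Matrix.mat 2 2 (\<lambda>(i, j). if i = j then if i = (0::nat) then 2 else 1 / 2 else (0::complex))"
  have T: "T \<in> SL2" unfolding SL2_def using det_2x2[of T] by (simp add: T_def)
  define M where "M = {m. (\<forall>p. p \<notin> Theta ds \<longrightarrow> m p = 0) \<and> sum m (Theta ds) = n}"
  have fM: "finite M" unfolding M_def by (rule finite_MonU)
  define wt where "wt = (\<lambda>m :: nat \<times> nat \<Rightarrow> nat. \<Sum>p\<in>Theta ds. int (m p) * weight ds p)"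
  have mM: "m \<in> Mon ds n (wt m)" if "m \<in> M" for m using that by (simp add: M_def Mon_def wt_def)
  have supp: "m p = 0" if "m \<in> M" "p \<notin> Theta ds" for m p using that unfolding M_def by blast
  have "F \<in> fun_vs.span (monom_fun ds ` M)" using F by (simp add: invariants_def homog_polys_eq M_def)
  then obtain c where c: "F = (\<lambda>v. \<Sum>m\<in>M. c m * monom_fun ds m v)"
    by (rule mono_span_expand[OF fM, of ds F, rotated]) (use supp in blast)+
  have Fcong: "F v = F v'" if "\<And>p. p \<in> Theta ds \<Longrightarrow> v p = v' p" for v v'
    unfolding c monom_fun_def using that by simp
  \<comment> \<open>\<open>invariants\<close> tests vectors of \<open>rep_space\<close> only. Both F
    and \<open>act\<close> depend only on the coordinates in \<open>Theta\<close>, so invariance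
    extends to all functions \<open>v\<close>.\<close>
  have Finv: "F (act ds g v) = F v" if "g \<in> SL2" for g v
  proof -
    define v' where "v' = (\<lambda>p. if p \<in> Theta ds then v p else 0)"
    have "act ds g v = act ds g v'"
      by (auto simp: act_def subst_form_def v'_def Theta_def intro!: ext arg_cong2[of _ _ _ _ coeff] sum.cong)
    moreover have "v' \<in> rep_space ds" by (simp add: rep_space_def v'_def)
    ultimately have "F (act ds g v) = F v'" using F that by (simp add: invariants_def)
    also have "\<dots> = F v" by (rule Fcong) (simp add: v'_def)
    finally show ?thesis .
  qed
  have c0: "c m = 0" if "m \<in> M" "wt m \<noteq> 0" for m
  proof -
    have "c m * (2 powi wt m - 1) = 0"
    proof (rule mono_coeff_zero[OF fM, where c = "\<lambda>m. c m * (2 powi wt m - 1)" and ds = ds])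
      fix v
      have "(\<Sum>m\<in>M. c m * (2 powi wt m * monom_fun ds m v)) = F (act ds T v)"
        unfolding c T_def by (intro sum.cong refl) (simp add: monom_fun_diag[OF _ mM])
      also have "\<dots> = F v" by (rule Finv[OF T])
      finally show "(\<Sum>m\<in>M. c m * (2 powi wt m - 1) * monom_fun ds m v) = 0"
        unfolding c by (simp add: algebra_simps sum_subtractf)
    qed (use that supp in blast)+
    moreover have "(2::complex) powi wt m \<noteq> 1"
    proof
      assume "(2::complex) powi wt m = 1"
      then have "norm ((2::complex) powi wt m) = 1" by simp
      then have "(2::real) powi wt m = 1" by (simp add: norm_power_int)
      moreover have "(2::real) ^ k \<noteq> 1" if "k \<noteq> 0" for k
      proof
        assume "(2::real) ^ k = 1"
        moreover have "1 < (2::real) ^ k" by (rule one_less_power) (use that in auto)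
        ultimately show False by linarith
      qed
      ultimately show False using that(2) by (cases "wt m > 0") (auto simp: power_int_def power_one_over)
    qed
    ultimately show ?thesis by simp
  qed
  have wF: "whom ds n 0 F"
  proof -
    have "whom ds n 0 (\<lambda>v. \<Sum>m\<in>M'. c m * monom_fun ds m v)" if "finite M'" "M' \<subseteq> M" for M'
      using that
    proof (induction rule: finite_induct)
      case (insert m M')
      have "whom ds n 0 (\<lambda>v. c m * monom_fun ds m v)"
        using c0[of m] whom.scale[OF whom_mono[OF mM, of m]] insert.prems whom.zero by (cases "wt m = 0") auto
      from whom.add[OF this insert.IH] insert show ?case by simp
    qed (simp add: whom.zero)
    then show ?thesis unfolding c using fM by blast
  qed
  moreover have "raise ds F v = 0" for v
  proof -
    have "((\<lambda>s. F (act ds (tri 0 s) v)) has_field_derivative raise ds F (act ds (tri 0 0) v)) (at 0)"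
      by (rule lie_chain[OF wF, where c = "\<lambda>s. act ds (tri 0 s) v"]) (rule act_tri_lower_deriv)
    then have "((\<lambda>_. F v) has_field_derivative raise ds F (act ds (tri 0 0) v)) (at 0)"
      by (simp add: Finv tri_SL2)
    then have "raise ds F (act ds (tri 0 0) v) = 0" by (rule DERIV_unique) (rule DERIV_const)
    moreover have "raise ds F (act ds (tri 0 0) v) = raise ds F v"
      by (rule whom_cong_Theta[OF whom_raise[OF wF] act_tri_zero])
    ultimately show ?thesis by simp
  qed
  ultimately show "whom ds n 0 F \<and> raise ds F = (\<lambda>_. 0)" by blast
next
  assume F: "whom ds n 0 F \<and> raise ds F = (\<lambda>_. 0)"
  then have wF: "whom ds n 0 F" and R: "raise ds F = (\<lambda>_. 0)" by auto
  have L: "lower ds F = (\<lambda>_. 0)" by (rule raise_zero_imp_lower_zero[OF wF R])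
  have at0: "F (act ds (tri 0 0) v) = F v" for v
    by (rule whom_cong_Theta[OF wF act_tri_zero])
  have U: "F (act ds (tri s 0) v) = F v" for s v
  proof -
    have "((\<lambda>s. F (act ds (tri s 0) v)) has_field_derivative lower ds F (act ds (tri s 0) v)) (at s)" for s
      by (rule lie_chain[OF wF, where c = "\<lambda>s. act ds (tri s 0) v"]) (rule act_tri_upper_deriv)
    then have "((\<lambda>s. F (act ds (tri s 0) v)) has_field_derivative 0) (at s)" for s by (simp add: L)
    then obtain c where "\<And>s. F (act ds (tri s 0) v) = c"
      using has_field_derivative_zero_constant[of UNIV "\<lambda>s. F (act ds (tri s 0) v)"] by auto
    then have "F (act ds (tri s 0) v) = F (act ds (tri 0 0) v)" by simp
    then show ?thesis by (simp add: at0)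
  qed
  have L: "F (act ds (tri 0 s) v) = F v" for s v
  proof -
    have "((\<lambda>s. F (act ds (tri 0 s) v)) has_field_derivative raise ds F (act ds (tri 0 s) v)) (at s)" for s
      by (rule lie_chain[OF wF, where c = "\<lambda>s. act ds (tri 0 s) v"]) (rule act_tri_lower_deriv)
    then have "((\<lambda>s. F (act ds (tri 0 s) v)) has_field_derivative 0) (at s)" for s by (simp add: R)
    then obtain c where "\<And>s. F (act ds (tri 0 s) v) = c"
      using has_field_derivative_zero_constant[of UNIV "\<lambda>s. F (act ds (tri 0 s) v)"] by auto
    then have "F (act ds (tri 0 s) v) = F (act ds (tri 0 0) v)" by simp
    then show ?thesis by (simp add: at0)
  qed
  show "F \<in> invariants ds n"
    unfolding invariants_def using whom_in_homog[OF wF] invariant_of_unipotent[of F ds, OF U L] by auto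
qed

text \<open>Rank and nullity for a map that is linear on \<open>V\<close> only, as
  \<open>raise\<close> is additive only where the derivatives exist. A basis of the kernel is
  extended by one preimage for each element of \<open>G\<close>.\<close>

lemma rank_nullity_step:
  assumes V: "fun_vs.subspace V" and fin: "V \<subseteq> fun_vs.span S" "finite S"
    and add: "\<And>x y. x \<in> V \<Longrightarrow> y \<in> V \<Longrightarrow> T (x + y) = T x + T y"
    and scale: "\<And>c x. x \<in> V \<Longrightarrow> T (fscale c x) = fscale c (T x)"
    and "finite G" "\<not> fun_vs.dependent G" "G \<subseteq> T ` V"
  shows "\<exists>B. finite B \<and> \<not> fun_vs.dependent B \<and> fun_vs.span B = {v \<in> V. T v \<in> fun_vs.span G}
     \<and> card B = fun_vs.dim {v \<in> V. T v = 0} + card G"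
  using assms(6-8)
proof (induction G rule: finite_induct)
  case empty
  let ?K = "{v \<in> V. T v = 0}"
  have T0: "T 0 = 0" using scale[of 0 0] fun_vs.subspace_0[OF V] by (simp add: fscale_def zero_fun_def)
  have K: "fun_vs.subspace ?K"
    unfolding fun_vs.subspace_def using V add scale T0
    by (auto simp: fun_vs.subspace_0 fun_vs.subspace_add fun_vs.subspace_scale)
  obtain B where B: "B \<subseteq> ?K" "\<not> fun_vs.dependent B" "?K \<subseteq> fun_vs.span B" "card B = fun_vs.dim ?K"
    using fun_vs.basis_exists by blast
  have "B \<subseteq> fun_vs.span S" using B(1) fin(1) by auto
  then have "finite B" using fun_vs.independent_span_bound[OF fin(2) B(2)] by blast
  moreover have "fun_vs.span B = ?K" using B(1,3) K fun_vs.span_minimal by blast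
  ultimately show ?case using B by (intro exI[of _ B]) (simp add: zero_fun_def)
next
  case (insert g G)
  have "\<not> fun_vs.dependent G" using insert.prems(1) fun_vs.dependent_mono by blast
  then obtain B where B: "finite B" "\<not> fun_vs.dependent B" "fun_vs.span B = {v \<in> V. T v \<in> fun_vs.span G}"
      "card B = fun_vs.dim {v \<in> V. T v = 0} + card G"
    using insert.IH insert.prems by blast
  obtain s where s: "s \<in> V" "T s = g" using insert.prems(2) by blast
  have gG: "g \<notin> fun_vs.span G" using insert.prems(1) insert.hyps(2) by (simp add: fun_vs.independent_insert)
  then have sB: "s \<notin> fun_vs.span B" using s B(3) by auto
  then have ind: "\<not> fun_vs.dependent (insert s B)" using B(2) by (simp add: fun_vs.independent_insertI)
  have diff: "T (v - fscale k s) = T v - fscale k g" "v - fscale k s \<in> V \<longleftrightarrow> v \<in> V" if "v \<in> V" for v k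
  proof -
    have m: "v - fscale k s = v + fscale (- k) s" by (auto simp: fscale_def fun_eq_iff)
    have "T (v - fscale k s) = T v + fscale (- k) (T s)"
      unfolding m by (simp only: add[OF that fun_vs.subspace_scale[OF V s(1)]] scale[OF s(1)])
    then show "T (v - fscale k s) = T v - fscale k g" using s by (auto simp: fscale_def fun_eq_iff)
    show "v - fscale k s \<in> V \<longleftrightarrow> v \<in> V" unfolding m using s(1) that V fun_vs.subspace_add fun_vs.subspace_scale by metis
  qed
  have "fun_vs.span (insert s B) = {v \<in> V. T v \<in> fun_vs.span (insert g G)}"
  proof (rule Set.set_eqI)
    fix v
    have vV: "v \<in> V" if "v - fscale k s \<in> V" for k
    proof -
      have "v = (v - fscale k s) + fscale k s" by simp
      then show ?thesis using that s(1) fun_vs.subspace_add[OF V] fun_vs.subspace_scale[OF V] by metis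
    qed
    then show "v \<in> fun_vs.span (insert s B) \<longleftrightarrow> v \<in> {v \<in> V. T v \<in> fun_vs.span (insert g G)}"
      unfolding fun_vs.span_insert B(3) mem_Collect_eq using diff vV by metis
  qed
  moreover have "s \<notin> B" using sB fun_vs.span_base by blast
  ultimately show ?case
    using ind B insert.hyps by (intro exI[of _ "insert s B"]) (simp add: zero_fun_def)
qed

text \<open>\<open>raise\<close> maps the functions of weight 0 onto those of weight 2, and its
  kernel there consists of the invariants.\<close>

lemma dim_invariants:
  "fun_vs.dim (invariants ds n) + card (Mon ds n 2) = card (Mon ds n 0)"
proof -
  have inj: "inj_on (monom_fun ds) (Mon ds n l)" for l by (rule mono_inj) (unfold Mon_def, blast)
  have ind: "\<not> fun_vs.dependent (monom_fun ds ` Mon ds n l)" for l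
    by (rule mono_independent[OF finite_Mon]) (unfold Mon_def, blast)
  let ?V = "{f. whom ds n 0 f}"
  have V: "?V = fun_vs.span (monom_fun ds ` Mon ds n 0)" using whom_iff_span by blast
  have "\<exists>B. finite B \<and> \<not> fun_vs.dependent B \<and> fun_vs.span B = {v \<in> ?V. raise ds v \<in> fun_vs.span (monom_fun ds ` Mon ds n 2)}
     \<and> card B = fun_vs.dim {v \<in> ?V. raise ds v = 0} + card (monom_fun ds ` Mon ds n 2)"
  proof (rule rank_nullity_step)
    show "fun_vs.subspace ?V" unfolding V by (rule fun_vs.subspace_span)
    show "?V \<subseteq> fun_vs.span (monom_fun ds ` Mon ds n 0)" using V by simp
    show "finite (monom_fun ds ` Mon ds n 0)" by (simp add: finite_Mon)
    show "finite (monom_fun ds ` Mon ds n 2)" by (simp add: finite_Mon)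
    show "raise ds (x + y) = raise ds x + raise ds y" if "x \<in> ?V" "y \<in> ?V" for x y
      using that lie_add by (auto simp: plus_fun_def)
    show "raise ds (fscale c x) = fscale c (raise ds x)" if "x \<in> ?V" for c x
      using that lie_scale by (auto simp: fscale_def)
    show "monom_fun ds ` Mon ds n 2 \<subseteq> raise ds ` ?V"
    proof
      fix g assume "g \<in> monom_fun ds ` Mon ds n 2"
      then have "whom ds n 2 g" using whom_mono by auto
      from raise_surj[OF this] show "g \<in> raise ds ` ?V" by auto
    qed
  qed (rule ind)
  then obtain B where B: "\<not> fun_vs.dependent B" "fun_vs.span B = {v \<in> ?V. raise ds v \<in> fun_vs.span (monom_fun ds ` Mon ds n 2)}"
     "card B = fun_vs.dim {v \<in> ?V. raise ds v = 0} + card (monom_fun ds ` Mon ds n 2)" by blast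
  have "{v \<in> ?V. raise ds v \<in> fun_vs.span (monom_fun ds ` Mon ds n 2)} = ?V"
    using whom_raise[of ds n 0] whom_iff_span by auto
  then have "fun_vs.dim (fun_vs.span B) = fun_vs.dim (fun_vs.span (monom_fun ds ` Mon ds n 0))" using B(2) V by simp
  then have "card B = card (Mon ds n 0)"
    by (simp only: fun_vs.dim_span_eq_card_independent[OF B(1)] fun_vs.dim_span_eq_card_independent[OF ind] card_image[OF inj])
  moreover have "{v \<in> ?V. raise ds v = 0} = invariants ds n"
    using invariants_iff by (auto simp: zero_fun_def)
  ultimately show ?thesis using B(3) by (simp add: card_image[OF inj])
qed

section \<open>Schur polynomials\<close>

lemma det_mat_cong:
  "(\<And>i j. i < n \<Longrightarrow> j < n \<Longrightarrow> f i j = g i j) \<Longrightarrow> det (Matrix.mat n n (\<lambda>(i, j). f i j)) = det (Matrix.mat n n (\<lambda>(i, j). g i j))"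
  by (intro arg_cong[of _ _ det] eq_matI) auto

lemma det_mat_perm: "det (Matrix.mat n n f) = (\<Sum>p | p permutes {0..<n}. signof p * (\<Prod>i=0..<n. f (i, p i)))"
proof -
  have "p i < n" if "p permutes {0..<n}" "i < n" for p i
    using permutes_in_image[OF that(1), of i] that(2) by simp
  then show ?thesis by (subst det_def'[of _ n]) (auto intro!: sum.cong prod.cong)
qed

lemma det_mult_rows: 
  fixes c :: "nat \<Rightarrow> 'a :: comm_ring_1"
  shows "det (Matrix.mat n n (\<lambda>(i, j). c i * f i j)) = (\<Prod>i<n. c i) * det (Matrix.mat n n (\<lambda>(i, j). f i j))"
  unfolding det_mat_perm by (simp add: prod.distrib sum_distrib_left mult_ac atLeast0LessThan)

text \<open>The divided difference of the monomial of degree \<open>e\<close> at the nodes \<open>x 0, \<dots>, x k\<close>.\<close>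

primrec divdiff :: "(nat \<Rightarrow> 'a :: comm_ring_1) \<Rightarrow> nat \<Rightarrow> nat \<Rightarrow> 'a" where
  "divdiff x 0 k = (if k = 0 then 1 else 0)"
| "divdiff x (Suc e) k = x k * divdiff x e k + (if k = 0 then 0 else divdiff x e (k - 1))"

text \<open>For the Newton basis q_k, the product of x_i - x_l over l < k, one has x_i q_k = x_k q_k
  + q_(k+1), which is the recursion of \<open>divdiff\<close>. The term q_n vanishes at the first n
  nodes, so stopping at \<open>n\<close> loses nothing.\<close>

lemma divdiff_newton:
  assumes "i < n"
  shows "x i ^ e = (\<Sum>k<n. divdiff x e k * (\<Prod>l<k. x i - x l))"
proof (induction e)
  case 0
  have "(\<Sum>k<n. divdiff x 0 k * (\<Prod>l<k. x i - x l)) = (\<Sum>k<n. if k = 0 then 1 else 0)"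
    by (rule sum.cong) auto
  then show ?case using assms by simp
next
  case (Suc e)
  obtain n' where n: "n = Suc n'" using assms by (cases n) auto
  define q where "q = (\<lambda>k. \<Prod>l<k. x i - x l)"
  have q: "x i * q k = x k * q k + q (Suc k)" for k by (simp add: q_def algebra_simps)
  have q0: "q n = 0" unfolding q_def using assms by (intro prod_zero) auto
  have "x i ^ Suc e = (\<Sum>k<n. divdiff x e k * (x i * q k))"
    by (simp add: Suc q_def sum_distrib_left mult_ac)
  also have "\<dots> = (\<Sum>k<n. x k * divdiff x e k * q k) + (\<Sum>k<n. divdiff x e k * q (Suc k))"
    unfolding q by (simp add: algebra_simps sum.distrib)
  also have "(\<Sum>k<n. divdiff x e k * q (Suc k)) = (\<Sum>k<n. (if k = 0 then 0 else divdiff x e (k - 1)) * q k)"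
    using q0 unfolding n sum.lessThan_Suc_shift[of "\<lambda>k. (if k = 0 then 0 else divdiff x e (k - 1)) * q k"] by simp
  finally show ?case by (simp add: q_def algebra_simps sum.distrib)
qed

text \<open>The last case repeats the left side, so that one equation yields both the diagonal
  entries and the vanishing ones of the matrices below.\<close>

lemma divdiff_triangular: "divdiff x e k = (if k = e then 1 else if k > e then 0 else divdiff x e k)"
proof (induction e arbitrary: k)
  case (Suc e)
  have a: "divdiff x e k = 0" if "k > e" for k using Suc[of k] that by simp
  have b: "divdiff x e e = 1" using Suc[of e] by simp
  show ?case using a[of k] a[of "k - 1"] b by auto
qed auto

lemma det_one_diag_lower:
  assumes "A \<in> carrier_mat n n" "\<And>i. i < n \<Longrightarrow> A $$ (i, i) = 1" "\<And>i j. i < j \<Longrightarrow> j < n \<Longrightarrow> A $$ (i, j) = 0"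
  shows "det A = (1 :: 'a :: comm_ring_1)"
  using assms by (subst det_lower_triangular[of n A]) (auto simp: prod_list_diag_prod)

lemma sum_rev: "(\<Sum>k<n. f (n - 1 - k)) = (\<Sum>k<n. f k)" for f :: "nat \<Rightarrow> 'a :: comm_monoid_add"
  by (rule sum.reindex_bij_witness[of _ "\<lambda>k. n - 1 - k" "\<lambda>k. n - 1 - k"]) auto

text \<open>Both alternants have the Newton matrix \<open>T\<close> as left factor, and for the
  staircase exponents the right factor is unitriangular. No division occurs, so the identity holds
  in the ring of Laurent polynomials and exhibits the quotient of the alternants as a
  determinant.\<close>

lemma alternant_factor:
  fixes x :: "nat \<Rightarrow> 'a :: comm_ring_1"
  shows "det (Matrix.mat n n (\<lambda>(i, j). x i ^ f j)) =
    det (Matrix.mat n n (\<lambda>(i, j). x i ^ (n - 1 - j))) * det (Matrix.mat n n (\<lambda>(k, j). divdiff x (f j) (n - 1 - k)))"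
proof -
  define T where "T = Matrix.mat n n (\<lambda>(i, k). \<Prod>l<n - 1 - k. x i - x l)"
  define W where "W = (\<lambda>f. Matrix.mat n n (\<lambda>(k, j). divdiff x (f j) (n - 1 - k)))"
  have TW: "Matrix.mat n n (\<lambda>(i, j). x i ^ f j) = T * W f" for f
    by (rule eq_matI) (auto simp: T_def W_def scalar_prod_def divdiff_newton[of _ n x] atLeast0LessThan
        sum_rev[of "\<lambda>k. divdiff x _ k * (\<Prod>l<k. x _ - x l)", symmetric] mult.commute)
  have c: "T \<in> carrier_mat n n" "W f \<in> carrier_mat n n" for f by (auto simp: T_def W_def)
  define g where "g = (\<lambda>j. n - 1 - j)"
  have dW: "det (W g) = 1"
    by (rule det_one_diag_lower[OF c(2)]) (auto simp: W_def divdiff_triangular g_def)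
  have "det (Matrix.mat n n (\<lambda>(i, j). x i ^ g j)) = det T"
    unfolding TW det_mult[OF c(1) c(2)] dW by simp
  then have "det (Matrix.mat n n (\<lambda>(i, j). x i ^ (n - 1 - j))) = det T" unfolding g_def .
  then show ?thesis unfolding TW[of f] det_mult[OF c(1) c(2)] by (simp add: W_def)
qed

text \<open>The determinant of the order reversal, a sign, stays unevaluated: what counts is that it
  is nonzero and the same for the nodes x and their squares.\<close>

lemma vandermonde_det:
  fixes x :: "nat \<Rightarrow> 'a :: comm_ring_1"
  shows "det (Matrix.mat n n (\<lambda>(i, j). x i ^ (n - 1 - j))) =
    (\<Prod>i<n. \<Prod>l<i. x i - x l) * det (Matrix.mat n n (\<lambda>(i, j). if i = n - 1 - j then 1 else 0))"
proof -
  define T where "T = Matrix.mat n n (\<lambda>(i, k). \<Prod>l<k. x i - x l)"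
  define W where "W = Matrix.mat n n (\<lambda>(k, j). divdiff x (n - 1 - j) k)"
  define R where "R = Matrix.mat n n (\<lambda>(i, j). if i = n - 1 - j then 1 else 0 :: 'a)"
  define W' where "W' = Matrix.mat n n (\<lambda>(k, j). divdiff x j k)"
  have c: "T \<in> carrier_mat n n" "W \<in> carrier_mat n n" "R \<in> carrier_mat n n" "W' \<in> carrier_mat n n"
    by (auto simp: T_def W_def R_def W'_def)
  have TW: "Matrix.mat n n (\<lambda>(i, j). x i ^ (n - 1 - j)) = T * W"
    by (rule eq_matI) (auto simp: T_def W_def scalar_prod_def divdiff_newton[of _ n x] atLeast0LessThan mult.commute)
  have WR: "W = W' * R"
    by (rule eq_matI) (auto simp: W'_def W_def R_def scalar_prod_def if_distrib[of "\<lambda>t. _ * t"] cong: if_cong)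
  have "det W' = 1"
    by (subst det_upper_triangular[OF _ c(4)]) (auto simp: prod_list_diag_prod W'_def divdiff_triangular)
  moreover have "det T = (\<Prod>i<n. \<Prod>l<i. x i - x l)"
  proof -
    have "T $$ (i, j) = 0" if "i < j" "j < n" for i j
      unfolding T_def using that by (auto intro!: prod_zero)
    then have "det T = (\<Prod>i = 0..<n. T $$ (i, i))"
      using det_lower_triangular[OF _ c(1)] c(1) by (simp add: prod_list_diag_prod)
    then show ?thesis by (simp add: T_def atLeast0LessThan)
  qed
  moreover have "det (T * W) = det T * (det W' * det R)"
    by (simp only: det_mult[OF c(1,2)]) (simp only: WR det_mult[OF c(4,3)])
  ultimately show ?thesis unfolding TW by (simp add: R_def)
qed

lemma det_reversal_nonzero:
  "det (Matrix.mat n n (\<lambda>(i, j). if i = n - 1 - j then 1 else 0)) \<noteq> (0 :: 'a :: field)"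
proof -
  define R where "R = Matrix.mat n n (\<lambda>(i, j). if i = n - 1 - j then 1 else 0 :: 'a)"
  have c: "R \<in> carrier_mat n n" by (simp add: R_def)
  have "R * R = 1\<^sub>m n"
    by (rule eq_matI) (auto simp: R_def scalar_prod_def if_distrib[of "\<lambda>t. _ * t"] if_distrib[of "\<lambda>t. t * _"] sum.delta cong: if_cong)
  then have "det R * det R = 1" using det_mult[OF c c] by simp
  then show ?thesis unfolding R_def[symmetric] by auto
qed

section \<open>Evaluation of Laurent polynomials\<close>

definition leval :: "nat \<Rightarrow> (nat \<Rightarrow> complex) \<Rightarrow> laurent_poly \<Rightarrow> complex" where
  "leval n X S = (\<Sum>m\<in>Poly_Mapping.keys S. Poly_Mapping.lookup S m * (\<Prod>i<n. X i powi Poly_Mapping.lookup m i))"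

text \<open>Passing from integer to complex points makes room for perturbing repeated
  weights.\<close>

lemma laurent_eval_eq: "laurent_eval xs S = leval (length xs) (\<lambda>i. of_int (xs ! i)) S"
  by (simp add: laurent_eval_def leval_def)

lemma leval_superset:
  assumes "finite K" "Poly_Mapping.keys S \<subseteq> K"
  shows "leval n X S = (\<Sum>m\<in>K. Poly_Mapping.lookup S m * (\<Prod>i<n. X i powi Poly_Mapping.lookup m i))"
  unfolding leval_def using assms by (intro sum.mono_neutral_left) (auto simp: in_keys_iff)

lemma leval_add: "leval n X (S + T) = leval n X S + leval n X T"
proof -
  let ?K = "Poly_Mapping.keys S \<union> Poly_Mapping.keys T"
  have "finite ?K" "Poly_Mapping.keys (S + T) \<subseteq> ?K" "Poly_Mapping.keys S \<subseteq> ?K" "Poly_Mapping.keys T \<subseteq> ?K"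
    using Poly_Mapping.keys_add[of S T] by auto
  then show ?thesis by (simp add: leval_superset[of ?K] lookup_add sum.distrib algebra_simps)
qed

lemma leval_zero: "leval n X 0 = 0" by (simp add: leval_def)

lemma leval_single: "leval n X (Poly_Mapping.single m c) = c * (\<Prod>i<n. X i powi Poly_Mapping.lookup m i)"
  by (subst leval_superset[of "{m}"]) (auto simp: lookup_single)

lemma leval_sum: "leval n X (\<Sum>a\<in>A. F a) = (\<Sum>a\<in>A. leval n X (F a))"
  by (induction A rule: infinite_finite_induct) (auto simp: leval_add leval_zero)

lemma sum_single_keys: "S = (\<Sum>m\<in>Poly_Mapping.keys S. Poly_Mapping.single m (Poly_Mapping.lookup S m))"
proof (rule poly_mapping_eqI)
  fix k
  show "Poly_Mapping.lookup S k = Poly_Mapping.lookup (\<Sum>m\<in>Poly_Mapping.keys S. Poly_Mapping.single m (Poly_Mapping.lookup S m)) k"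
    by (simp add: Poly_Mapping.lookup_sum lookup_single when_def in_keys_iff)
qed

text \<open>The coordinates have to be nonzero because \<open>0 powi e\<close> is not multiplicative
  over sums of exponents.\<close>

lemma leval_mult:
  assumes "\<And>i. i < n \<Longrightarrow> X i \<noteq> 0"
  shows "leval n X (S * T) = leval n X S * leval n X T"
proof -
  have 1: "leval n X (Poly_Mapping.single m c * Poly_Mapping.single m' c') =
      leval n X (Poly_Mapping.single m c) * leval n X (Poly_Mapping.single m' c')" for m c m' c'
    unfolding mult_single leval_single using assms
    by (simp add: lookup_add power_int_add prod.distrib mult_ac)
  have "S * T = (\<Sum>m\<in>Poly_Mapping.keys S. \<Sum>m'\<in>Poly_Mapping.keys T.
      Poly_Mapping.single m (Poly_Mapping.lookup S m) * Poly_Mapping.single m' (Poly_Mapping.lookup T m'))"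
    by (subst sum_single_keys[of S], subst sum_single_keys[of T]) (simp only: sum_product)
  also have "leval n X \<dots> = leval n X (\<Sum>m\<in>Poly_Mapping.keys S. Poly_Mapping.single m (Poly_Mapping.lookup S m))
     * leval n X (\<Sum>m\<in>Poly_Mapping.keys T. Poly_Mapping.single m (Poly_Mapping.lookup T m))"
    by (simp only: leval_sum 1 sum_product)
  finally show ?thesis by (simp flip: sum_single_keys)
qed

lemma leval_one: "leval n X 1 = 1"
  unfolding single_one[symmetric] leval_single by simp

lemma leval_hom: "(\<And>i. i < n \<Longrightarrow> X i \<noteq> 0) \<Longrightarrow> comm_ring_hom (leval n X)"
  by unfold_locales (auto simp: leval_mult leval_add leval_one leval_zero)

lemma leval_var_pow: "i < n \<Longrightarrow> leval n X (var_pow i e) = X i powi e"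
proof -
  assume i: "i < n"
  have "(\<Prod>j<n. X j powi Poly_Mapping.lookup (Poly_Mapping.single i e) j) = (\<Prod>j<n. if j = i then X i powi e else 1)"
    by (rule prod.cong) (auto simp: lookup_single when_def)
  then show ?thesis using i by (simp add: var_pow_def leval_single)
qed

lemma leval_alternant:
  assumes "\<And>i. i < length es \<Longrightarrow> X i \<noteq> 0"
  shows "leval (length es) X (alternant es) = det (Matrix.mat (length es) (length es) (\<lambda>(i, j). X i powi (es ! j)))"
proof -
  interpret comm_ring_hom "leval (length es) X" by (rule leval_hom) (rule assms)
  show ?thesis unfolding alternant_def hom_det[symmetric]
    by (intro arg_cong[of _ _ det] eq_matI) (auto simp: leval_var_pow)
qed

lemma leval_alternant_map:
  assumes "\<And>i. i < n \<Longrightarrow> X i \<noteq> 0"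
  shows "leval n X (alternant (map e [0..<n])) = det (Matrix.mat n n (\<lambda>(i, j). X i powi (e j)))"
proof -
  have "leval n X (alternant (map e [0..<n])) = det (Matrix.mat n n (\<lambda>(i, j). X i powi (map e [0..<n] ! j)))"
    using leval_alternant[of "map e [0..<n]" X] assms by simp
  also have "\<dots> = det (Matrix.mat n n (\<lambda>(i, j). X i powi (e j)))" by (rule det_mat_cong) simp
  finally show ?thesis .
qed

lemma var_pow_add: "var_pow i (d + e) = var_pow i d * var_pow i e"
  by (simp add: var_pow_def mult_single single_add)

lemma var_pow_0: "var_pow i 0 = 1"
  by (simp add: var_pow_def)

lemma var_pow_nat: "var_pow i (int e) = var_pow i 1 ^ e"
  by (induction e) (simp_all add: var_pow_0 var_pow_add add.commute)

text \<open>Multiplication by the N-th power of every variable makes all exponents nonnegative, so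
  that \<open>alternant_factor\<close> applies. This factor is a unit with inverse
  \<open>P'\<close>.\<close>

lemma schur_exists:
  "\<exists>S. S * alternant (map (\<lambda>j. int n - 1 - int j) [0..<n]) = alternant (map (\<lambda>j. e j) [0..<n])"
proof -
  define N where "N = (\<Sum>j<n. nat \<bar>e j\<bar>)"
  have N: "0 \<le> e j + int N" if "j < n" for j
  proof -
    have "nat \<bar>e j\<bar> \<le> N" unfolding N_def using that by (intro member_le_sum) auto
    then show ?thesis by linarith
  qed
  define f where "f = (\<lambda>j. nat (e j + int N))"
  define P where "P = (\<Prod>i<n. var_pow i (int N))"
  define P' where "P' = (\<Prod>i<n. var_pow i (- int N))"
  have PP: "P' * P = 1"
    unfolding P_def P'_def prod.distrib[symmetric] var_pow_add[symmetric] by (simp add: var_pow_0)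
  define S where "S = det (Matrix.mat n n (\<lambda>(k, j). divdiff (\<lambda>i. var_pow i 1) (f j) (n - 1 - k)))"
  have 1: "alternant (map (\<lambda>j. int n - 1 - int j) [0..<n]) = det (Matrix.mat n n (\<lambda>(i, j). var_pow i 1 ^ (n - 1 - j)))"
  proof -
    have "var_pow i (map (\<lambda>j. int n - 1 - int j) [0..<n] ! j) = var_pow i 1 ^ (n - 1 - j)" if "j < n" for i j
    proof -
      have "map (\<lambda>j. int n - 1 - int j) [0..<n] ! j = int (n - 1 - j)" using that by simp
      then show ?thesis by (simp only: var_pow_nat)
    qed
    then show ?thesis unfolding alternant_def length_map length_upt diff_zero by (intro det_mat_cong)
  qed
  have "P * alternant (map (\<lambda>j. e j) [0..<n]) = det (Matrix.mat n n (\<lambda>(i, j). var_pow i (int N) * var_pow i (e j)))"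
  proof -
    have "alternant (map (\<lambda>j. e j) [0..<n]) = det (Matrix.mat n n (\<lambda>(i, j). var_pow i (e j)))"
      unfolding alternant_def length_map length_upt diff_zero by (rule det_mat_cong) simp
    then show ?thesis by (simp only: P_def det_mult_rows)
  qed
  also have "\<dots> = det (Matrix.mat n n (\<lambda>(i, j). var_pow i 1 ^ f j))"
  proof (rule det_mat_cong)
    fix i j assume "j < n"
    then have f: "int N + e j = int (f j)" using N[of j] by (simp add: f_def)
    have "var_pow i (int N) * var_pow i (e j) = var_pow i (int (f j))"
      unfolding f[symmetric] by (rule var_pow_add[symmetric])
    then show "var_pow i (int N) * var_pow i (e j) = var_pow i 1 ^ f j" unfolding var_pow_nat[of i "f j"] .
  qed
  also have "\<dots> = alternant (map (\<lambda>j. int n - 1 - int j) [0..<n]) * S"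
    unfolding alternant_factor[of n "\<lambda>i. var_pow i 1" f] 1 S_def ..
  finally have "P * alternant (map (\<lambda>j. e j) [0..<n]) = alternant (map (\<lambda>j. int n - 1 - int j) [0..<n]) * S" .
  then have "P' * (P * alternant (map (\<lambda>j. e j) [0..<n])) = P' * S * alternant (map (\<lambda>j. int n - 1 - int j) [0..<n])"
    by (simp add: mult_ac)
  then have "P' * S * alternant (map (\<lambda>j. int n - 1 - int j) [0..<n]) = alternant (map (\<lambda>j. e j) [0..<n])"
    by (simp add: mult.assoc[symmetric] PP)
  then show ?thesis by blast
qed

lemma vandermonde_nonzero:
  fixes X :: "nat \<Rightarrow> complex"
  assumes "\<And>i j. i < n \<Longrightarrow> j < i \<Longrightarrow> X i \<noteq> X j"
  shows "det (Matrix.mat n n (\<lambda>(i, j). X i ^ (n - 1 - j))) \<noteq> 0"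
  unfolding vandermonde_det using det_reversal_nonzero[of n, where 'a = complex] assms by (auto simp: prod_zero_iff)

lemma det_powi_vandermonde:
  "det (Matrix.mat n n (\<lambda>(i, j). X i powi (int n - 1 - int j))) = det (Matrix.mat n n (\<lambda>(i, j). X i ^ (n - 1 - j)))"
  for X :: "nat \<Rightarrow> complex"
proof (rule det_mat_cong)
  fix i j assume "j < n"
  then have "int n - 1 - int j = int (n - 1 - j)" by simp
  then show "X i powi (int n - 1 - int j) = X i ^ (n - 1 - j)" by (simp only: power_int_of_nat)
qed

lemma alternant_delta_nonzero: "alternant (map (\<lambda>j. int n - 1 - int j) [0..<n]) \<noteq> 0"
proof
  assume 0: "alternant (map (\<lambda>j. int n - 1 - int j) [0..<n]) = 0"
  define X where "X = (\<lambda>i. of_nat (Suc i) :: complex)"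
  have "X i \<noteq> 0" for i unfolding X_def by (rule of_nat_neq_0)
  then have "leval n X (alternant (map (\<lambda>j. int n - 1 - int j) [0..<n])) = det (Matrix.mat n n (\<lambda>(i, j). X i powi (int n - 1 - int j)))"
    by (rule leval_alternant_map)
  moreover have "det (Matrix.mat n n (\<lambda>(i, j). X i ^ (n - 1 - j))) \<noteq> 0"
    by (rule vandermonde_nonzero) (auto simp: X_def)
  ultimately show False unfolding det_powi_vandermonde 0 by (simp add: leval_zero)
qed

text \<open>Justifies the definite description in \<open>schur\<close>: existence was just shown,
  and uniqueness is cancellation of the nonzero staircase alternant.\<close>

lemma schur_alternant:
  "schur rho * alternant (map (\<lambda>j. int (length rho) - 1 - int j) [0..<length rho]) =
    alternant (map (\<lambda>j. rho ! j + int (length rho) - 1 - int j) [0..<length rho])"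
proof -
  define n where "n = length rho"
  obtain S where S: "S * alternant (map (\<lambda>j. int n - 1 - int j) [0..<n]) = alternant (map (\<lambda>j. rho ! j + int n - 1 - int j) [0..<n])"
    using schur_exists by blast
  have "schur rho = S"
    unfolding schur_def Let_def n_def[symmetric]
  proof (rule the_equality)
    fix S' assume "S' * alternant (map (\<lambda>j. int n - 1 - int j) [0..<n]) = alternant (map (\<lambda>j. rho ! j + int n - 1 - int j) [0..<n])"
    then have "S' * alternant (map (\<lambda>j. int n - 1 - int j) [0..<n]) = S * alternant (map (\<lambda>j. int n - 1 - int j) [0..<n])"
      using S by (rule trans[OF _ sym])
    then show "S' = S" using alternant_delta_nonzero[of n] by (rule mult_right_cancel[THEN iffD1, rotated])
  qed (rule S)
  then show ?thesis using S by (simp add: n_def)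
qed

lemma leval_schur:
  assumes "length rho = n" "\<And>i. i < n \<Longrightarrow> X i \<noteq> 0"
  shows "leval n X (schur rho) * det (Matrix.mat n n (\<lambda>(i, j). X i ^ (n - 1 - j))) =
    det (Matrix.mat n n (\<lambda>(i, j). X i powi (rho ! j + int n - 1 - int j)))"
proof -
  have 1: "leval n X (alternant (map e [0..<n])) = det (Matrix.mat n n (\<lambda>(i, j). X i powi (e j)))" for e
    by (rule leval_alternant_map) (rule assms(2))
  have "leval n X (schur rho) * leval n X (alternant (map (\<lambda>j. int n - 1 - int j) [0..<n])) =
     leval n X (alternant (map (\<lambda>j. rho ! j + int n - 1 - int j) [0..<n]))"
    using schur_alternant[of rho] unfolding assms(1) by (subst leval_mult[symmetric]) (use assms(2) in auto)
  then show ?thesis unfolding 1 det_powi_vandermonde .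
qed

section \<open>Lagrange interpolation and alternants with one replaced column\<close>

definition lagr :: "nat \<Rightarrow> (nat \<Rightarrow> 'a :: field) \<Rightarrow> nat \<Rightarrow> 'a" where
  "lagr n y i = 1 / (\<Prod>j\<in>{..<n} - {i}. y i - y j)"

lemma lagrange_basis_props:
  fixes y :: "nat \<Rightarrow> 'a :: field"
  assumes "i < n"
  shows "degree (\<Prod>j\<in>{..<n} - {i}. [:- y j, 1:]) = n - 1" "coeff (\<Prod>j\<in>{..<n} - {i}. [:- y j, 1:]) (n - 1) = 1"
proof -
  show d: "degree (\<Prod>j\<in>{..<n} - {i}. [:- y j, 1:]) = n - 1"
    using assms by (subst degree_prod_eq_sum_degree) auto
  have "lead_coeff (\<Prod>j\<in>{..<n} - {i}. [:- y j, 1:]) = (\<Prod>j\<in>{..<n} - {i}. lead_coeff [:- y j, 1:])"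
    by (rule Polynomial.lead_coeff_prod)
  then have "lead_coeff (\<Prod>j\<in>{..<n} - {i}. [:- y j, 1:]) = 1" by simp
  then show "coeff (\<Prod>j\<in>{..<n} - {i}. [:- y j, 1:]) (n - 1) = 1" by (simp add: d)
qed

lemma lagrange_interpolation:
  fixes y :: "nat \<Rightarrow> 'a :: field"
  assumes inj: "inj_on y {..<n}" and deg: "degree p < n"
  shows "p = (\<Sum>i<n. Polynomial.smult (poly p (y i) * lagr n y i) (\<Prod>j\<in>{..<n} - {i}. [:- y j, 1:]))" (is "p = ?q")
proof (rule poly_eqI_degree[of "y ` {..<n}"])
  have card: "card (y ` {..<n}) = n" using inj by (simp add: card_image)
  show "card (y ` {..<n}) > degree p" using card deg by simp
  have "degree ?q \<le> n - 1"
    by (intro degree_sum_le) (auto intro: order_trans[OF degree_smult_le] simp: lagrange_basis_props)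
  then show "card (y ` {..<n}) > degree ?q" using card deg by simp
  fix x assume "x \<in> y ` {..<n}"
  then obtain k where k: "k < n" "x = y k" by auto
  have "poly ?q x = (\<Sum>i<n. if i = k then poly p (y k) else 0)"
    unfolding poly_sum
  proof (rule sum.cong)
    fix i assume i: "i \<in> {..<n}"
    show "poly (Polynomial.smult (poly p (y i) * lagr n y i) (\<Prod>j\<in>{..<n} - {i}. [:- y j, 1:])) x = (if i = k then poly p (y k) else 0)"
    proof (cases "i = k")
      case True
      have "(\<Prod>j\<in>{..<n} - {k}. y k - y j) \<noteq> 0" using inj k by (auto simp: prod_zero_iff inj_on_def)
      then show ?thesis using True k by (simp add: poly_prod lagr_def)
    next
      case False
      then have "(\<Prod>j\<in>{..<n} - {i}. x - y j) = 0" using k by (intro prod_zero) auto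
      then show ?thesis using False by (simp add: poly_prod)
    qed
  qed simp
  then show "poly p x = poly ?q x" using k by simp
qed

text \<open>The sum of \<open>\<phi> i * lagr n y i\<close> is the divided difference of \<phi> at
  all \<open>n\<close> nodes; for a polynomial it is found by comparing top coefficients in the
  interpolation formula.\<close>

lemma lagrange_top_coeff:
  fixes y :: "nat \<Rightarrow> 'a :: field"
  assumes "inj_on y {..<n}" "degree p < n"
  shows "(\<Sum>i<n. poly p (y i) * lagr n y i) = coeff p (n - 1)"
proof -
  have "coeff p (n - 1) = coeff (\<Sum>i<n. Polynomial.smult (poly p (y i) * lagr n y i) (\<Prod>j\<in>{..<n} - {i}. [:- y j, 1:])) (n - 1)"
    using lagrange_interpolation[OF assms] by simp
  also have "\<dots> = (\<Sum>i<n. poly p (y i) * lagr n y i)"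
    by (simp add: coeff_sum lagrange_basis_props[unfolded One_nat_def])
  finally show ?thesis by simp
qed

lemma lagr_power_sum:
  fixes y :: "nat \<Rightarrow> 'a :: field"
  assumes "inj_on y {..<n}" "k < n"
  shows "(\<Sum>i<n. y i ^ k * lagr n y i) = (if k = n - 1 then 1 else 0)"
  using lagrange_top_coeff[OF assms(1), of "monom 1 k"] assms(2)
  by (simp add: degree_monom_eq poly_monom)

text \<open>Interpolation of the monomial of degree n - 1 is exact; it is evaluated at the point
  -1/t, where each factor -1/t - y_j equals (-1/t)(1 + y_j t) and the powers of -1/t cancel.\<close>

lemma partial_fractions:
  fixes y :: "nat \<Rightarrow> real"
  assumes inj: "inj_on y {..<n}" and n: "0 < n" and t: "t \<noteq> 0" and nz: "\<And>i. i < n \<Longrightarrow> 1 + y i * t \<noteq> 0"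
  shows "1 / (\<Prod>i<n. 1 + y i * t) = (\<Sum>i<n. y i ^ (n - 1) * lagr n y i / (1 + y i * t))"
proof -
  have P0: "(\<Prod>i<n. 1 + y i * t) \<noteq> 0" using nz by (simp add: prod_zero_iff)
  have e: "- c - 1 / t = (- 1 / t) * (1 + c * t)" for c using t by (simp add: distrib_left)
  have "poly (monom 1 (n - 1)) (- 1 / t) = poly (\<Sum>i<n. Polynomial.smult (y i ^ (n - 1) * lagr n y i) (\<Prod>j\<in>{..<n} - {i}. [:- y j, 1:])) (- 1 / t)"
    using lagrange_interpolation[OF inj, of "monom 1 (n - 1)"] n by (simp add: degree_monom_eq poly_monom)
  then have "(- 1 / t) ^ (n - 1) = (\<Sum>i<n. y i ^ (n - 1) * lagr n y i * (\<Prod>j\<in>{..<n} - {i}. - y j - 1 / t))"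
    by (simp add: poly_monom poly_sum poly_prod)
  also have "\<dots> = (\<Sum>i<n. (- 1 / t) ^ (n - 1) * (y i ^ (n - 1) * lagr n y i * (\<Prod>j\<in>{..<n} - {i}. 1 + y j * t)))"
  proof (rule sum.cong[OF refl])
    fix i assume "i \<in> {..<n}"
    have "(\<Prod>j\<in>{..<n} - {i}. - y j - 1 / t) = (\<Prod>j\<in>{..<n} - {i}. (- 1 / t) * (1 + y j * t))"
      by (simp only: e)
    also have "\<dots> = (- 1 / t) ^ (n - 1) * (\<Prod>j\<in>{..<n} - {i}. 1 + y j * t)"
      unfolding prod.distrib using \<open>i \<in> {..<n}\<close> by simp
    finally show "y i ^ (n - 1) * lagr n y i * (\<Prod>j\<in>{..<n} - {i}. - y j - 1 / t) =
       (- 1 / t) ^ (n - 1) * (y i ^ (n - 1) * lagr n y i * (\<Prod>j\<in>{..<n} - {i}. 1 + y j * t))" by simp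
  qed
  finally have 1: "1 = (\<Sum>i<n. y i ^ (n - 1) * lagr n y i * (\<Prod>j\<in>{..<n} - {i}. 1 + y j * t))"
    unfolding sum_distrib_left[symmetric] using t by simp
  have "1 / (\<Prod>i<n. 1 + y i * t) = (\<Sum>i<n. y i ^ (n - 1) * lagr n y i * (\<Prod>j\<in>{..<n} - {i}. 1 + y j * t)) / (\<Prod>i<n. 1 + y i * t)"
    using 1 by simp
  also have "\<dots> = (\<Sum>i<n. y i ^ (n - 1) * lagr n y i / (1 + y i * t))"
    unfolding sum_divide_distrib
  proof (rule sum.cong[OF refl])
    fix i assume i: "i \<in> {..<n}"
    have "(\<Prod>i<n. 1 + y i * t) = (1 + y i * t) * (\<Prod>j\<in>{..<n} - {i}. 1 + y j * t)"
      using i by (simp add: prod.remove)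
    then show "y i ^ (n - 1) * lagr n y i * (\<Prod>j\<in>{..<n} - {i}. 1 + y j * t) / (\<Prod>i<n. 1 + y i * t) = y i ^ (n - 1) * lagr n y i / (1 + y i * t)"
      using P0 by simp
  qed
  finally show ?thesis .
qed

text \<open>As a function of the column \<phi> the determinant is a linear functional that vanishes
  on the powers k < n - 1, since these columns are present already. Such functionals are multiples
  of the divided difference, and the power n - 1 determines the multiple.\<close>

lemma det_column_lagrange:
  fixes y :: "nat \<Rightarrow> 'a :: field"
  assumes inj: "inj_on y {..<n}" and c: "c < n" and g: "\<And>k. k < n - 1 \<Longrightarrow> \<exists>j<n. j \<noteq> c \<and> g j = k"
  shows "det (Matrix.mat n n (\<lambda>(i, j). if j = c then \<phi> i else y i ^ g j)) =
    (\<Sum>i<n. \<phi> i * lagr n y i) * det (Matrix.mat n n (\<lambda>(i, j). if j = c then y i ^ (n - 1) else y i ^ g j))"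
proof -
  define A where "A = (\<lambda>\<phi>. Matrix.mat n n (\<lambda>(i, j). if j = c then \<phi> i else y i ^ g j))"
  define K where "K = (\<lambda>i. cofactor (A (\<lambda>_. 0)) i c)"
  have cof: "cofactor (A \<phi>) i c = K i" if "i < n" for \<phi> i
  proof -
    have "mat_delete (A \<phi>) i c = mat_delete (A (\<lambda>_. 0)) i c"
      using c that by (intro eq_matI) (auto simp: A_def mat_delete_def)
    then show ?thesis by (simp add: cofactor_def K_def)
  qed
  have det: "det (A \<phi>) = (\<Sum>i<n. \<phi> i * K i)" for \<phi>
    by (subst laplace_expansion_column[of _ n c]) (use c cof in \<open>auto simp: A_def intro!: sum.cong\<close>)
  have z: "(\<Sum>i<n. y i ^ k * K i) = 0" if "k < n - 1" for k
  proof -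
    from g[OF that] obtain j where j: "j < n" "j \<noteq> c" "g j = k" by blast
    have "det (A (\<lambda>i. y i ^ k)) = 0"
      by (rule Determinant.det_identical_columns[of _ n c j]) (use c j in \<open>auto simp: A_def intro!: eq_vecI\<close>)
    then show ?thesis by (simp add: det)
  qed
  have psi: "(\<Sum>i<n. poly p (y i) * K i) = coeff p (n - 1) * det (A (\<lambda>i. y i ^ (n - 1)))" if "degree p \<le> n - 1" for p
  proof -
    have "(\<Sum>i<n. poly p (y i) * K i) = (\<Sum>i<n. \<Sum>k\<le>n - 1. coeff p k * (y i ^ k * K i))"
    proof (rule sum.cong[OF refl])
      fix i
      have "poly p (y i) = (\<Sum>k\<le>n - 1. coeff p k * y i ^ k)"
        unfolding poly_altdef by (rule sum.mono_neutral_left) (use that in \<open>auto intro: coeff_eq_0\<close>)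
      then show "poly p (y i) * K i = (\<Sum>k\<le>n - 1. coeff p k * (y i ^ k * K i))"
        by (simp only: sum_distrib_right mult.assoc)
    qed
    also have "\<dots> = (\<Sum>k\<le>n - 1. coeff p k * (\<Sum>i<n. y i ^ k * K i))"
      by (subst sum.swap) (simp add: sum_distrib_left)
    also have "\<dots> = (\<Sum>k\<in>{n - 1}. coeff p k * (\<Sum>i<n. y i ^ k * K i))"
      by (rule sum.mono_neutral_right) (use z in auto)
    finally show ?thesis by (simp add: det)
  qed
  have "K i = lagr n y i * det (A (\<lambda>i. y i ^ (n - 1)))" if i: "i < n" for i
  proof -
    \<comment> \<open>This polynomial vanishes at all nodes but \<open>y i\<close> and is monic of
      degree n - 1, so \<open>psi\<close> isolates the cofactor \<open>K i\<close>.\<close>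
    let ?p = "\<Prod>j\<in>{..<n} - {i}. [:- y j, 1:]"
    have "poly ?p (y k) = 0" if "k < n" "k \<noteq> i" for k
      unfolding poly_prod by (rule prod_zero) (use that in auto)
    then have "(\<Sum>k<n. poly ?p (y k) * K k) = (\<Sum>k<n. if k = i then poly ?p (y i) * K i else 0)"
      by (intro sum.cong) auto
    then have "poly ?p (y i) * K i = det (A (\<lambda>i. y i ^ (n - 1)))"
      using psi[of ?p] i lagrange_basis_props[of i n y] by simp
    moreover have "(\<Prod>j\<in>{..<n} - {i}. y i - y j) \<noteq> 0" using inj i by (auto simp: prod_zero_iff inj_on_def)
    ultimately show ?thesis by (simp add: lagr_def poly_prod field_simps)
  qed
  then have "det (A \<phi>) = (\<Sum>i<n. \<phi> i * lagr n y i) * det (A (\<lambda>i. y i ^ (n - 1)))"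
    unfolding det[of \<phi>] sum_distrib_right by (intro sum.cong) auto
  then show ?thesis unfolding A_def .
qed

lemma nth_upto1: "j < n \<Longrightarrow> [1..int n] ! j = 1 + int j"
  by (rule nth_upto) simp

text \<open>For rho the exponents rho_j + n - j are 2n - 4, 2n - 5, 2n - 6, 2n - 8, ..., 0: a
  Vandermonde matrix in X^2 whose column of degree n - 1 is missing and which has the odd power 2n -
  5 in second place. Exchanging the first two columns gives the minus sign. For rho' the odd power
  is 2n - 7 in third place, and two exchanges give a plus sign. For delta the exponents are 2n - 2,
  ..., 2, 0, the Vandermonde determinant of the squares, and division by that of the X_i leaves the
  sums X_i + X_l.\<close>

lemma leval_schur_rho_distinct:
  fixes X :: "nat \<Rightarrow> complex"
  assumes n: "n \<ge> 2" and X0: "\<And>i. i < n \<Longrightarrow> X i \<noteq> 0" and inj: "inj_on (\<lambda>i. X i ^ 2) {..<n}"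
  shows "leval n X (schur (rho_tuple (int n))) =
    - (\<Sum>i<n. X i powi (2 * int n - 5) * lagr n (\<lambda>i. X i ^ 2) i) * leval n X (schur (delta_tuple (int n)))"
    (is "?R = - ?S * ?D")
  and "n \<ge> 3 \<Longrightarrow> leval n X (schur (rho'_tuple (int n))) =
    (\<Sum>i<n. X i powi (2 * int n - 7) * lagr n (\<lambda>i. X i ^ 2) i) * leval n X (schur (delta_tuple (int n)))"
  and "leval n X (schur (delta_tuple (int n))) = (\<Prod>i<n. \<Prod>l<i. X i + X l)"
proof -
  define y where "y = (\<lambda>i. X i ^ 2)"
  have injX: "X i \<noteq> X j" if "i < n" "j < i" for i j
    using inj that unfolding inj_on_def by (metis lessThan_iff less_trans less_irrefl)
  have V0: "det (Matrix.mat n n (\<lambda>(i, j). X i ^ (n - 1 - j))) \<noteq> 0"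
    by (rule vandermonde_nonzero) (use injX in auto)
  define Vy where "Vy = det (Matrix.mat n n (\<lambda>(i, j). y i ^ (n - 1 - j)))"
  have pw: "X i powi (2 * int k) = y i ^ k" for i k
    by (simp add: y_def power_int_def nat_mult_distrib flip: power_mult)
  have "?D * det (Matrix.mat n n (\<lambda>(i, j). X i ^ (n - 1 - j))) = det (Matrix.mat n n (\<lambda>(i, j). X i powi (delta_tuple (int n) ! j + int n - 1 - int j)))"
    by (rule leval_schur) (use X0 in \<open>auto simp: delta_tuple_def\<close>)
  also have "\<dots> = Vy"
    unfolding Vy_def
  proof (rule det_mat_cong)
    fix i j assume ij: "i < n" "j < n"
    have "delta_tuple (int n) ! j + int n - 1 - int j = 2 * int (n - 1 - j)" using ij by (simp add: delta_tuple_def nth_upto1 of_nat_diff)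
    then show "X i powi (delta_tuple (int n) ! j + int n - 1 - int j) = y i ^ (n - 1 - j)" by (simp only: pw)
  qed
  finally have D: "?D * det (Matrix.mat n n (\<lambda>(i, j). X i ^ (n - 1 - j))) = Vy" .
  have "Vy = (\<Prod>i<n. \<Prod>l<i. X i + X l) * det (Matrix.mat n n (\<lambda>(i, j). X i ^ (n - 1 - j)))"
    unfolding Vy_def vandermonde_det y_def by (simp add: power2_eq_square square_diff_square_factored prod.distrib)
  then show "?D = (\<Prod>i<n. \<Prod>l<i. X i + X l)" using D V0 by simp
  have "?R * det (Matrix.mat n n (\<lambda>(i, j). X i ^ (n - 1 - j))) = det (Matrix.mat n n (\<lambda>(i, j). X i powi (rho_tuple (int n) ! j + int n - 1 - int j)))"
    by (rule leval_schur) (use X0 in \<open>auto simp: rho_tuple_def\<close>)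
  also have "\<dots> = det (Matrix.mat n n (\<lambda>(i, j). if j = 1 then X i powi (2 * int n - 5) else y i ^ (if j = 0 then n - 2 else n - 1 - j)))"
  proof (rule det_mat_cong)
    fix i j assume ij: "i < n" "j < n"
    have "rho_tuple (int n) ! j + int n - 1 - int j = (if j = 1 then 2 * int n - 5 else 2 * int (if j = 0 then n - 2 else n - 1 - j))"
      using ij n by (auto simp: rho_tuple_def nth_upto1 of_nat_diff)
    then show "X i powi (rho_tuple (int n) ! j + int n - 1 - int j) = (if j = 1 then X i powi (2 * int n - 5) else y i ^ (if j = 0 then n - 2 else n - 1 - j))"
      by (cases "j = 1") (simp_all only: if_True if_False pw simp_thms)
  qed
  also have "\<dots> = ?S * det (Matrix.mat n n (\<lambda>(i, j). if j = 1 then y i ^ (n - 1) else y i ^ (if j = 0 then n - 2 else n - 1 - j)))"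
    unfolding y_def
  proof (rule det_column_lagrange[OF inj])
    fix k assume k: "k < n - 1"
    show "\<exists>j<n. j \<noteq> 1 \<and> (if j = 0 then n - 2 else n - 1 - j) = k"
      using k by (intro exI[of _ "if k = n - 2 then 0 else n - 1 - k"]) auto
  qed (use n in simp)
  also have sw: "det (Matrix.mat n n (\<lambda>(i, j). if j = 1 then y i ^ (n - 1) else y i ^ (if j = 0 then n - 2 else n - 1 - j))) = - Vy"
  proof -
    have "swapcols 0 1 (Matrix.mat n n (\<lambda>(i, j). y i ^ (n - 1 - j))) = Matrix.mat n n (\<lambda>(i, j). if j = 1 then y i ^ (n - 1) else y i ^ (if j = 0 then n - 2 else n - 1 - j))"
      using n by (intro eq_matI) (auto simp: numeral_2_eq_2)
    then show ?thesis unfolding Vy_def using det_swapcols[of 0 n 1 "Matrix.mat n n (\<lambda>(i, j). y i ^ (n - 1 - j))"] n by simp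
  qed
  finally have "?R * det (Matrix.mat n n (\<lambda>(i, j). X i ^ (n - 1 - j))) = (- ?S * ?D) * det (Matrix.mat n n (\<lambda>(i, j). X i ^ (n - 1 - j)))"
    unfolding mult.assoc D by (simp only: mult_minus_left mult_minus_right)
  then show "?R = - ?S * ?D" unfolding mult_right_cancel[OF V0] .
  assume n3: "n \<ge> 3"
  let ?R' = "leval n X (schur (rho'_tuple (int n)))" and ?S' = "\<Sum>i<n. X i powi (2 * int n - 7) * lagr n (\<lambda>i. X i ^ 2) i"
  let ?g = "\<lambda>j. if j = 0 then n - 2 else if j = 1 then n - 3 else n - 1 - j"
  have "?R' * det (Matrix.mat n n (\<lambda>(i, j). X i ^ (n - 1 - j))) = det (Matrix.mat n n (\<lambda>(i, j). X i powi (rho'_tuple (int n) ! j + int n - 1 - int j)))"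
    by (rule leval_schur) (use X0 in \<open>auto simp: rho'_tuple_def\<close>)
  also have "\<dots> = det (Matrix.mat n n (\<lambda>(i, j). if j = 2 then X i powi (2 * int n - 7) else y i ^ ?g j))"
  proof (rule det_mat_cong)
    fix i j assume ij: "i < n" "j < n"
    have "rho'_tuple (int n) ! j + int n - 1 - int j = (if j = 2 then 2 * int n - 7 else 2 * int (?g j))"
      using ij n3 by (auto simp: rho'_tuple_def nth_upto1 of_nat_diff)
    then show "X i powi (rho'_tuple (int n) ! j + int n - 1 - int j) = (if j = 2 then X i powi (2 * int n - 7) else y i ^ ?g j)"
      by (cases "j = 2") (simp_all only: if_True if_False pw simp_thms)
  qed
  also have "\<dots> = ?S' * det (Matrix.mat n n (\<lambda>(i, j). if j = 2 then y i ^ (n - 1) else y i ^ ?g j))"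
    unfolding y_def
  proof (rule det_column_lagrange[OF inj])
    fix k assume k: "k < n - 1"
    show "\<exists>j<n. j \<noteq> 2 \<and> ?g j = k"
      using k n3 by (intro exI[of _ "if k = n - 2 then 0 else if k = n - 3 then 1 else n - 1 - k"]) auto
  qed (use n3 in simp)
  also have "det (Matrix.mat n n (\<lambda>(i, j). if j = 2 then y i ^ (n - 1) else y i ^ ?g j)) = Vy"
  proof -
    have "swapcols 1 2 (Matrix.mat n n (\<lambda>(i, j). if j = 1 then y i ^ (n - 1) else y i ^ (if j = 0 then n - 2 else n - 1 - j)))
       = Matrix.mat n n (\<lambda>(i, j). if j = 2 then y i ^ (n - 1) else y i ^ ?g j)"
      using n3 by (intro eq_matI) (auto simp: numeral_2_eq_2 numeral_3_eq_3)
    then show ?thesis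
      using det_swapcols[of 1 n 2 "Matrix.mat n n (\<lambda>(i, j). if j = 1 then y i ^ (n - 1) else y i ^ (if j = 0 then n - 2 else n - 1 - j))"] n3 sw by simp
  qed
  finally have "?R' * det (Matrix.mat n n (\<lambda>(i, j). X i ^ (n - 1 - j))) = (?S' * ?D) * det (Matrix.mat n n (\<lambda>(i, j). X i ^ (n - 1 - j)))"
    unfolding mult.assoc D .
  then show "?R' = ?S' * ?D" unfolding mult_right_cancel[OF V0] .
qed

section \<open>Schur quotients as integrals\<close>

lemma atan_integral:
  assumes "c > 0"
  shows "set_integrable lborel {0<..} (\<lambda>x::real. 1 / (1 + c\<^sup>2 * x\<^sup>2))"
    and "(LINT x:{0<..}|lborel. 1 / (1 + c\<^sup>2 * x\<^sup>2)) = pi / (2 * c)"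
proof -
  define F where "F = (\<lambda>x. arctan (c * x) / c)"
  have D: "DERIV F x :> 1 / (1 + c\<^sup>2 * x\<^sup>2)" for x
  proof -
    have "DERIV (\<lambda>x. arctan (c * x) / c) x :> (inverse (1 + (c * x)\<^sup>2) * c) / c" by (auto intro!: derivative_eq_intros)
    then show ?thesis using assms by (simp add: F_def power_mult_distrib inverse_eq_divide)
  qed
  have p: "1 + c\<^sup>2 * x\<^sup>2 > 0" for x :: real by (intro add_pos_nonneg) auto
  have cont: "isCont (\<lambda>x. 1 / (1 + c\<^sup>2 * x\<^sup>2)) x" for x :: real
    using p[of x] by (intro continuous_intros) auto
  have A: "(F \<longlongrightarrow> 0) (at_right 0)"
  proof -
    have "isCont F 0" using D by (rule DERIV_isCont)
    then have "(F \<longlongrightarrow> F 0) (at_right 0)" by (simp add: isCont_def filterlim_at_split)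
    then show ?thesis by (simp add: F_def)
  qed
  have "LIM x at_top. c * x :> at_top" by (rule filterlim_tendsto_pos_mult_at_top[OF tendsto_const assms filterlim_ident])
  then have "((\<lambda>x. arctan (c * x)) \<longlongrightarrow> pi / 2) at_top" by (rule filterlim_compose[OF tendsto_arctan_at_top])
  then have B: "(F \<longlongrightarrow> (pi / 2) / c) at_top" unfolding F_def by (rule tendsto_divide[OF _ tendsto_const]) (use assms in simp)
  note F = interval_integral_FTC_nonneg[of 0 \<infinity> F "\<lambda>x. 1 / (1 + c\<^sup>2 * x\<^sup>2)" 0 "(pi / 2) / c"]
  have 0: "(0::ereal) < \<infinity>" by simp
  have nn: "AE x in lborel. 0 < ereal x \<longrightarrow> ereal x < \<infinity> \<longrightarrow> 0 \<le> 1 / (1 + c\<^sup>2 * x\<^sup>2)"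
    using p by (intro AE_I2) (auto intro!: divide_nonneg_pos)
  have A': "((F \<circ> real_of_ereal) \<longlongrightarrow> 0) (at_right (0::ereal))" using A ereal_tendsto_simps1(2)[of F 0 0] by (simp add: zero_ereal_def)
  have B': "((F \<circ> real_of_ereal) \<longlongrightarrow> (pi / 2) / c) (at_left (\<infinity>::ereal))" using B ereal_tendsto_simps1(3)[of F] by simp
  show "set_integrable lborel {0<..} (\<lambda>x::real. 1 / (1 + c\<^sup>2 * x\<^sup>2))"
    using F(1)[OF 0 D cont nn A' B'] by (simp add: zero_ereal_def)
  show "(LINT x:{0<..}|lborel. 1 / (1 + c\<^sup>2 * x\<^sup>2)) = pi / (2 * c)"
    using F(2)[OF 0 D cont nn A' B'] unfolding zero_ereal_def interval_integral_to_infinity_eq by simp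
qed

lemma set_integrable_halfline:
  fixes f :: "real \<Rightarrow> real"
  assumes [measurable]: "f \<in> borel_measurable borel" and "\<And>x. x > 0 \<Longrightarrow> \<bar>f x\<bar> \<le> B / (1 + x\<^sup>2)"
  shows "set_integrable lborel {0<..} f"
proof (rule set_integrable_bound)
  show "set_integrable lborel {0<..} (\<lambda>x. B * (1 / (1 + x\<^sup>2)))"
    using atan_integral(1)[of 1] by (intro set_integrable_mult_right) auto
  show "set_borel_measurable lborel {0<..} f" unfolding set_borel_measurable_def by measurable
  show "AE x in lborel. x \<in> {0<..} \<longrightarrow> norm (f x) \<le> norm (B * (1 / (1 + x\<^sup>2)))"
  proof (intro AE_I2 impI)
    fix x :: real assume "x \<in> {0<..}"
    then have "\<bar>f x\<bar> \<le> B / (1 + x\<^sup>2)" using assms(2) by simp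
    also have "\<dots> = B * (1 / (1 + x\<^sup>2))" by simp
    also have "\<dots> \<le> \<bar>B * (1 / (1 + x\<^sup>2))\<bar>" by (rule abs_ge_self)
    finally show "norm (f x) \<le> norm (B * (1 / (1 + x\<^sup>2)))" unfolding real_norm_def .
  qed
qed

text \<open>Dominated convergence for a real parameter tending to 0 from the right, reduced to
  sequences. All rescaled integrands below admit a majorant of the shape B / (1 + x^2).\<close>

lemma dominated_halfline:
  fixes f :: "real \<Rightarrow> real" and s :: "real \<Rightarrow> real \<Rightarrow> real"
  assumes [measurable]: "f \<in> borel_measurable borel" "\<And>w. s w \<in> borel_measurable borel" and "0 < \<delta>"
    and bound: "\<And>w x. 0 < w \<Longrightarrow> w < \<delta> \<Longrightarrow> x > 0 \<Longrightarrow> \<bar>s w x\<bar> \<le> B / (1 + x\<^sup>2)"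
    and lim: "\<And>x. x > 0 \<Longrightarrow> ((\<lambda>w. s w x) \<longlongrightarrow> f x) (at_right 0)"
  shows "((\<lambda>w. LINT x:{0<..}|lborel. s w x) \<longlongrightarrow> (LINT x:{0<..}|lborel. f x)) (at_right 0)"
proof (rule tendsto_at_right_sequentially[OF \<open>0 < \<delta>\<close>])
  fix S :: "nat \<Rightarrow> real" assume S: "\<And>n. 0 < S n" "\<And>n. S n < \<delta>" "decseq S" "S \<longlonglongrightarrow> 0"
  have S': "filterlim S (at_right 0) sequentially"
    using S by (simp add: filterlim_at_withinI)
  have B0: "B / (1 + x\<^sup>2) \<ge> 0" if "x > 0" for x :: real using bound[of "S 0" x] S that by (meson abs_ge_zero order_trans)
  show "(\<lambda>n. LINT x:{0<..}|lborel. s (S n) x) \<longlonglongrightarrow> (LINT x:{0<..}|lborel. f x)"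
    unfolding set_lebesgue_integral_def
  proof (rule integral_dominated_convergence)
    show "integrable lborel (\<lambda>x. indicator {0<..} x *\<^sub>R (B * (1 / (1 + x\<^sup>2))) :: real)"
      using set_integrable_mult_right[OF atan_integral(1)[of 1], of B] by (simp add: set_integrable_def)
    show "AE x in lborel. (\<lambda>n. indicat_real {0<..} x *\<^sub>R s (S n) x) \<longlonglongrightarrow> indicat_real {0<..} x *\<^sub>R f x"
      using filterlim_compose[OF lim S'] by (intro AE_I2) (auto split: split_indicator)
    show "AE x in lborel. norm (indicat_real {0<..} x *\<^sub>R s (S n) x) \<le> indicat_real {0<..} x *\<^sub>R (B * (1 / (1 + x\<^sup>2)))" for n
      using bound S by (intro AE_I2) (auto split: split_indicator)
  qed measurable
qed

text \<open>The limit of w^(-n) times the product of the factors w + 4 sin^2(X_i \<theta> / 2) at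
  \<theta> = x sqrt w.\<close>

definition PK :: "nat \<Rightarrow> (nat \<Rightarrow> real) \<Rightarrow> real \<Rightarrow> real" where
  "PK n X x = (\<Prod>i<n. 1 + (X i)\<^sup>2 * x\<^sup>2)"

definition K0 :: "nat \<Rightarrow> (nat \<Rightarrow> real) \<Rightarrow> real" where
  "K0 n X = (LINT x:{0<..}|lborel. 4 * x ^ 2 / PK n X x)"

definition K2 :: "nat \<Rightarrow> (nat \<Rightarrow> real) \<Rightarrow> real" where
  "K2 n X = (LINT x:{0<..}|lborel. 4 * x ^ 4 / PK n X x)"

lemma PK_measurable [measurable]: "PK n X \<in> borel_measurable borel"
  unfolding PK_def[abs_def] by measurable

lemma PK_pos: "PK n X x > 0"
  unfolding PK_def by (intro prod_pos add_pos_nonneg) auto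

lemma PK_ge:
  assumes "\<And>i. i < n \<Longrightarrow> X i \<ge> 1" "m \<le> n"
  shows "(1 + x\<^sup>2) ^ m \<le> PK n X x"
proof -
  have "(1 + x\<^sup>2) ^ m \<le> (1 + x\<^sup>2) ^ n" using assms(2) by (intro power_increasing) auto
  also have "(1 + x\<^sup>2) ^ n = (\<Prod>i<n. 1 + x\<^sup>2)" by simp
  also have "\<dots> \<le> PK n X x" unfolding PK_def
  proof (rule prod_mono, intro conjI)
    fix i assume "i \<in> {..<n}"
    then have "1 \<le> (X i)\<^sup>2" using assms(1)[of i] by (simp add: one_le_power)
    then show "1 + x\<^sup>2 \<le> 1 + (X i)\<^sup>2 * x\<^sup>2" using mult_right_mono[of 1 "(X i)\<^sup>2" "x\<^sup>2"] by simp
  qed auto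
  finally show ?thesis .
qed

lemma pow_over_one_plus:
  fixes x :: real
  shows "x ^ (2 * m) / (1 + x\<^sup>2) ^ Suc m \<le> 1 / (1 + x\<^sup>2)"
proof -
  have p: "1 + x\<^sup>2 > 0" by (intro add_pos_nonneg) auto
  have "x ^ (2 * m) = (x\<^sup>2) ^ m" by (simp add: power_mult)
  also have "\<dots> \<le> (1 + x\<^sup>2) ^ m" by (intro power_mono) auto
  finally have "x ^ (2 * m) / (1 + x\<^sup>2) ^ Suc m \<le> (1 + x\<^sup>2) ^ m / (1 + x\<^sup>2) ^ Suc m"
    using p by (intro divide_right_mono) auto
  also have "\<dots> = 1 / (1 + x\<^sup>2)" unfolding power_Suc by (rule nonzero_divide_mult_cancel_right) (use p in simp)
  finally show ?thesis .
qed

lemma K_integrand_bound: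
  assumes "\<And>i. i < n \<Longrightarrow> X i \<ge> 1" "Suc m \<le> n"
  shows "\<bar>4 * x ^ (2 * m) / PK n X x\<bar> \<le> 4 / (1 + x\<^sup>2)"
proof -
  have p: "1 + x\<^sup>2 > 0" by (intro add_pos_nonneg) auto
  have "\<bar>4 * x ^ (2 * m) / PK n X x\<bar> = 4 * (x ^ (2 * m) / PK n X x)" using PK_pos[of n X x] by simp
  also have "\<dots> \<le> 4 * (x ^ (2 * m) / (1 + x\<^sup>2) ^ Suc m)"
    using PK_ge[OF assms] p by (intro mult_left_mono divide_left_mono mult_pos_pos PK_pos zero_less_power) auto
  also have "\<dots> \<le> 4 * (1 / (1 + x\<^sup>2))" by (intro mult_left_mono pow_over_one_plus) auto
  finally show ?thesis by simp
qed

lemma K_integrable: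
  assumes "\<And>i. i < n \<Longrightarrow> X i \<ge> 1" "Suc m \<le> n"
  shows "set_integrable lborel {0<..} (\<lambda>x. 4 * x ^ (2 * m) / PK n X x)"
  by (rule set_integrable_halfline[where B = 4]) (use K_integrand_bound[OF assms] in auto)

text \<open>The shifts i e make the weights distinct for small e > 0 and keep them at least 1, which
  yields a majorant independent of e.\<close>

lemma K_tendsto:
  assumes "\<And>i. i < n \<Longrightarrow> X i \<ge> 1" "Suc m \<le> n"
  shows "((\<lambda>e. LINT x:{0<..}|lborel. 4 * x ^ (2 * m) / PK n (\<lambda>i. X i + real i * e) x) \<longlongrightarrow>
     (LINT x:{0<..}|lborel. 4 * x ^ (2 * m) / PK n X x)) (at_right 0)"
proof (rule dominated_halfline[where B = 4 and \<delta> = 1])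
  fix e x :: real assume e: "0 < e"
  show "\<bar>4 * x ^ (2 * m) / PK n (\<lambda>i. X i + real i * e) x\<bar> \<le> 4 / (1 + x\<^sup>2)"
    using assms(1) e by (intro K_integrand_bound assms(2) add_increasing2) auto
next
  fix x :: real
  have "((\<lambda>e. 4 * x ^ (2 * m) / PK n (\<lambda>i. X i + real i * e) x) \<longlongrightarrow> 4 * x ^ (2 * m) / PK n (\<lambda>i. X i + real i * 0) x) (at_right 0)"
    using less_imp_neq[OF PK_pos[of n "\<lambda>i. X i + real i * 0" x], THEN not_sym] unfolding PK_def by (intro tendsto_intros)
  then show "((\<lambda>e. 4 * x ^ (2 * m) / PK n (\<lambda>i. X i + real i * e) x) \<longlongrightarrow> 4 * x ^ (2 * m) / PK n X x) (at_right 0)" by simp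
qed auto

text \<open>Division by 1 + b t with remainder. The quotient 4 c w (b t - 1) is the part that
  cancels when summed over the nodes.\<close>

lemma quartic_partial_fraction:
  fixes b t c w :: real
  assumes "1 + b * t \<noteq> 0"
  shows "4 * t ^ 2 * (b * (b * c) * w / (1 + b * t)) = 4 * t * (b * c * w) + - 4 * (c * w) + 4 * (c * w) * (1 / (1 + b * t))"
proof -
  define d where "d = 1 + b * t"
  have d: "d \<noteq> 0" using assms by (simp add: d_def)
  have "(4 * t * (b * c * w) + - 4 * (c * w) + 4 * (c * w) * (1 / d)) * d = 4 * t * (b * c * w) * d - 4 * (c * w) * d + 4 * (c * w)"
    using d by (simp add: distrib_right left_diff_distrib)
  also have "\<dots> = 4 * t ^ 2 * (b * (b * c) * w)"
    unfolding d_def by (simp add: algebra_simps power2_eq_square)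
  also have "\<dots> = (4 * t ^ 2 * (b * (b * c) * w / d)) * d" using d by simp
  finally show ?thesis unfolding d_def[symmetric] mult_right_cancel[OF d] by (rule sym)
qed

text \<open>Partial fractions in x^2. The polynomial parts, which are not integrable, cancel because
  a divided difference kills low powers (\<open>s2\<close>, \<open>s3\<close>). Each remaining term
  integrates to a multiple of pi / (2 X_i), and this division by X_i is where the odd powers of X_i
  come from.\<close>

lemma K_distinct:
  assumes n: "n \<ge> 2" and X: "\<And>i. i < n \<Longrightarrow> X i > 0" and inj: "inj_on (\<lambda>i. (X i)\<^sup>2) {..<n}"
  shows "K0 n X = - 2 * pi * (\<Sum>i<n. X i powi (2 * int n - 5) * lagr n (\<lambda>i. (X i)\<^sup>2) i)"
    and "n \<ge> 3 \<Longrightarrow> K2 n X = 2 * pi * (\<Sum>i<n. X i powi (2 * int n - 7) * lagr n (\<lambda>i. (X i)\<^sup>2) i)"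
proof -
  define y where "y = (\<lambda>i. (X i)\<^sup>2)"
  define w where "w = lagr n y"
  have y0: "y i > 0" if "i < n" for i using X[OF that] by (simp add: y_def)
  have injy: "inj_on y {..<n}" using inj by (simp add: y_def)
  have p: "1 + y i * x\<^sup>2 > 0" if "i < n" for i and x :: real using y0[OF that] by (intro add_pos_nonneg) auto
  have pf: "1 / PK n X x = (\<Sum>i<n. y i ^ (n - 1) * w i / (1 + y i * x\<^sup>2))" if "x > 0" for x
  proof -
    have "PK n X x = (\<Prod>i<n. 1 + y i * x\<^sup>2)" by (simp add: PK_def y_def)
    moreover have "1 + y i * x\<^sup>2 \<noteq> 0" if "i < n" for i using p[OF that, of x] by simp
    ultimately show ?thesis using partial_fractions[OF injy, of "x\<^sup>2"] n that by (simp add: w_def)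
  qed
  have pw: "X i powi (2 * int k - 1) = y i ^ k / X i" if "i < n" for i k
  proof -
    have "X i powi (2 * int k - 1) = X i powi (int (2 * k)) / X i" using X[OF that] by (simp add: power_int_diff)
    then show ?thesis by (simp add: y_def power_mult power_int_of_nat del: of_nat_mult)
  qed
  have int: "set_integrable lborel {0<..} (\<lambda>x. c * (1 / (1 + y i * x\<^sup>2)))" "(LINT x:{0<..}|lborel. c * (1 / (1 + y i * x\<^sup>2))) = c * (pi / (2 * X i))"
    if "i < n" for i c
    using set_integrable_mult_right[OF atan_integral(1)[OF X[OF that]], of c] atan_integral(2)[OF X[OF that]]
    unfolding y_def set_integral_mult_right by simp_all
  have total: "(LINT x:{0<..}|lborel. \<Sum>i<n. c i * (1 / (1 + y i * x\<^sup>2))) = (\<Sum>i<n. c i * (pi / (2 * X i)))" for c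
  proof -
    have "(LINT x:{0<..}|lborel. \<Sum>i<n. c i * (1 / (1 + y i * x\<^sup>2))) = (\<Sum>i<n. LINT x:{0<..}|lborel. c i * (1 / (1 + y i * x\<^sup>2)))"
      unfolding set_lebesgue_integral_def scaleR_sum_right
      by (rule Bochner_Integration.integral_sum) (use int(1) in \<open>auto simp: set_integrable_def\<close>)
    also have "\<dots> = (\<Sum>i<n. c i * (pi / (2 * X i)))" by (rule sum.cong) (use int(2) in auto)
    finally show ?thesis .
  qed
  have s2: "(\<Sum>i<n. y i ^ (n - 2) * w i) = 0" unfolding w_def using lagr_power_sum[OF injy, of "n - 2"] n by simp
  have e0: "4 * x ^ 2 / PK n X x = (\<Sum>i<n. (- 4 * (y i ^ (n - 2) * w i)) * (1 / (1 + y i * x\<^sup>2)))" if "x > 0" for x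
  proof -
    have "4 * x ^ 2 / PK n X x = 4 * x ^ 2 * (1 / PK n X x)" by simp
    also have "\<dots> = (\<Sum>i<n. 4 * (y i ^ (n - 2) * w i) + (- 4 * (y i ^ (n - 2) * w i)) * (1 / (1 + y i * x\<^sup>2)))"
      unfolding pf[OF that] sum_distrib_left
    proof (rule sum.cong[OF refl])
      fix i assume "i \<in> {..<n}"
      then have i: "1 + y i * x\<^sup>2 \<noteq> 0" using p[of i x] by simp
      have "n - 1 = Suc (n - 2)" using n by simp
      then have "y i ^ (n - 1) = y i * y i ^ (n - 2)" by simp
      then show "4 * x\<^sup>2 * (y i ^ (n - 1) * w i / (1 + y i * x\<^sup>2)) = 4 * (y i ^ (n - 2) * w i) + - 4 * (y i ^ (n - 2) * w i) * (1 / (1 + y i * x\<^sup>2))"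
        using i by (simp add: divide_simps) (simp add: algebra_simps)
    qed
    also have "\<dots> = (\<Sum>i<n. (- 4 * (y i ^ (n - 2) * w i)) * (1 / (1 + y i * x\<^sup>2)))"
      unfolding sum.distrib sum_distrib_left[symmetric] s2 by simp
    finally show ?thesis .
  qed
  have "K0 n X = (LINT x:{0<..}|lborel. \<Sum>i<n. (- 4 * (y i ^ (n - 2) * w i)) * (1 / (1 + y i * x\<^sup>2)))"
    unfolding K0_def by (rule set_lebesgue_integral_cong) (use e0 in auto)
  also have "\<dots> = (\<Sum>i<n. (- 4 * (y i ^ (n - 2) * w i)) * (pi / (2 * X i)))" by (rule total)
  also have "\<dots> = - 2 * pi * (\<Sum>i<n. X i powi (2 * int n - 5) * w i)"
    unfolding sum_distrib_left
  proof (rule sum.cong[OF refl])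
    fix i assume i: "i \<in> {..<n}"
    have "2 * int n - 5 = 2 * int (n - 2) - 1" using n by simp
    then have "X i powi (2 * int n - 5) = y i ^ (n - 2) / X i" by (simp only: pw i[unfolded lessThan_iff])
    then show "- 4 * (y i ^ (n - 2) * w i) * (pi / (2 * X i)) = - 2 * pi * (X i powi (2 * int n - 5) * w i)" by simp
  qed
  finally show "K0 n X = - 2 * pi * (\<Sum>i<n. X i powi (2 * int n - 5) * lagr n (\<lambda>i. (X i)\<^sup>2) i)" by (simp add: w_def y_def)
  assume n3: "n \<ge> 3"
  have s3: "(\<Sum>i<n. y i ^ (n - 3) * w i) = 0" unfolding w_def using lagr_power_sum[OF injy, of "n - 3"] n3 by simp
  have e2: "4 * x ^ 4 / PK n X x = (\<Sum>i<n. (4 * (y i ^ (n - 3) * w i)) * (1 / (1 + y i * x\<^sup>2)))" if "x > 0" for x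
  proof -
    have "4 * x ^ 4 / PK n X x = 4 * x ^ 4 * (1 / PK n X x)" by simp
    also have "\<dots> = (\<Sum>i<n. 4 * x\<^sup>2 * (y i ^ (n - 2) * w i) + - 4 * (y i ^ (n - 3) * w i) + (4 * (y i ^ (n - 3) * w i)) * (1 / (1 + y i * x\<^sup>2)))"
      unfolding pf[OF that] sum_distrib_left
    proof (rule sum.cong[OF refl])
      fix i assume "i \<in> {..<n}"
      then have i: "1 + y i * x\<^sup>2 \<noteq> 0" using p[of i x] by simp
      have e: "n - 1 = Suc (Suc (n - 3))" "n - 2 = Suc (n - 3)" using n3 by auto
      show "4 * x ^ 4 * (y i ^ (n - 1) * w i / (1 + y i * x\<^sup>2)) = 4 * x\<^sup>2 * (y i ^ (n - 2) * w i) + - 4 * (y i ^ (n - 3) * w i) + 4 * (y i ^ (n - 3) * w i) * (1 / (1 + y i * x\<^sup>2))"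
        using quartic_partial_fraction[OF i, of "y i ^ (n - 3)" "w i"] unfolding e power_Suc by simp
    qed
    also have "\<dots> = (\<Sum>i<n. (4 * (y i ^ (n - 3) * w i)) * (1 / (1 + y i * x\<^sup>2)))"
      unfolding sum.distrib sum_distrib_left[symmetric] s2 s3 by simp
    finally show ?thesis .
  qed
  have "K2 n X = (LINT x:{0<..}|lborel. \<Sum>i<n. (4 * (y i ^ (n - 3) * w i)) * (1 / (1 + y i * x\<^sup>2)))"
    unfolding K2_def by (rule set_lebesgue_integral_cong) (use e2 in auto)
  also have "\<dots> = (\<Sum>i<n. (4 * (y i ^ (n - 3) * w i)) * (pi / (2 * X i)))" by (rule total)
  also have "\<dots> = 2 * pi * (\<Sum>i<n. X i powi (2 * int n - 7) * w i)"
    unfolding sum_distrib_left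
  proof (rule sum.cong[OF refl])
    fix i assume i: "i \<in> {..<n}"
    have "2 * int n - 7 = 2 * int (n - 3) - 1" using n3 by simp
    then have "X i powi (2 * int n - 7) = y i ^ (n - 3) / X i" by (simp only: pw i[unfolded lessThan_iff])
    then show "4 * (y i ^ (n - 3) * w i) * (pi / (2 * X i)) = 2 * pi * (X i powi (2 * int n - 7) * w i)" by simp
  qed
  finally show "K2 n X = 2 * pi * (\<Sum>i<n. X i powi (2 * int n - 7) * lagr n (\<lambda>i. (X i)\<^sup>2) i)" by (simp add: w_def y_def)
qed

lemma leval_tendsto:
  assumes "\<And>i. i < n \<Longrightarrow> X i \<ge> 1"
  shows "((\<lambda>e. leval n (\<lambda>i. complex_of_real (X i + real i * e)) S) \<longlongrightarrow> leval n (\<lambda>i. complex_of_real (X i)) S) (at_right 0)"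
proof -
  have "((\<lambda>e. leval n (\<lambda>i. complex_of_real (X i + real i * e)) S) \<longlongrightarrow> leval n (\<lambda>i. complex_of_real (X i + real i * 0)) S) (at_right 0)"
    unfolding leval_def
  proof (intro tendsto_intros)
    fix i assume "i \<in> {..<n}"
    then have "X i > 0" using assms[of i] by simp
    then show "complex_of_real (X i + real i * 0) \<noteq> 0" by simp
  qed
  then show ?thesis by simp
qed

text \<open>For distinct squares both sides are the same divided difference. Repeated values are
  reached through X_i + i e with e \<rightarrow> 0, since the evaluations and the integrals are
  continuous in the nodes. The denominator is nonzero in the limit, being a product of sums of
  positive numbers.\<close>

lemma leval_schur_integral:
  assumes n: "n \<ge> 2" and X: "\<And>i. i < n \<Longrightarrow> X i \<ge> 1"
  shows "leval n (\<lambda>i. complex_of_real (X i)) (schur (rho_tuple (int n))) =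
      of_real (K0 n X / (2 * pi)) * leval n (\<lambda>i. complex_of_real (X i)) (schur (delta_tuple (int n)))"
    and "n \<ge> 3 \<Longrightarrow> leval n (\<lambda>i. complex_of_real (X i)) (schur (rho'_tuple (int n))) =
      of_real (K2 n X / (2 * pi)) * leval n (\<lambda>i. complex_of_real (X i)) (schur (delta_tuple (int n)))"
    and "leval n (\<lambda>i. complex_of_real (X i)) (schur (delta_tuple (int n))) \<noteq> 0"
proof -
  define Y where "Y = (\<lambda>e i. X i + real i * e)"
  have ev: "\<forall>\<^sub>F e in at_right 0. e > 0 \<and> inj_on (\<lambda>i. (Y e i)\<^sup>2) {..<n}"
  proof -
    have "\<forall>\<^sub>F e in at_right 0. \<forall>i\<in>{..<n}. \<forall>j\<in>{..<n}. i \<noteq> j \<longrightarrow> Y e i \<noteq> Y e j"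
    proof (intro eventually_ball_finite ballI finite_lessThan)
      fix i j assume "i \<in> {..<n}" "j \<in> {..<n}"
      show "\<forall>\<^sub>F e in at_right 0. i \<noteq> j \<longrightarrow> Y e i \<noteq> Y e j"
      proof (cases "i = j")
        case False
        \<comment> \<open>Two of the perturbed values coincide for at most one
          \<open>e\<close>.\<close>
        have "\<forall>\<^sub>F e in at_right (0::real). e \<noteq> (X i - X j) / (real j - real i)" by (rule eventually_neq_at_within)
        then show ?thesis by eventually_elim (use False in \<open>auto simp: Y_def field_simps\<close>)
      qed simp
    qed
    moreover have "\<forall>\<^sub>F e in at_right (0::real). e > 0" by (simp add: eventually_at_right_less)
    ultimately show ?thesis
    proof eventually_elim
      case (elim e)
      have pos: "Y e i > 0" if "i < n" for i using X[OF that] elim(2) by (simp add: Y_def add_pos_nonneg)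
      show ?case
      proof (intro conjI inj_onI elim(2))
        fix i j assume ij: "i \<in> {..<n}" "j \<in> {..<n}" "(Y e i)\<^sup>2 = (Y e j)\<^sup>2"
        then have "Y e i = Y e j" using pos[of i] pos[of j] by (simp add: power2_eq_iff_nonneg less_imp_le)
        then show "i = j" using elim(1) ij by blast
      qed
    qed
  qed
  have cinj: "inj_on (\<lambda>i. (complex_of_real (Y e i))\<^sup>2) {..<n}" if "inj_on (\<lambda>i. (Y e i)\<^sup>2) {..<n}" for e
    using that unfolding inj_on_def of_real_power[symmetric] of_real_eq_iff .
  have pos: "Y e i > 0" if "i < n" "e > 0" for i e using X[OF that(1)] that(2) by (simp add: Y_def add_pos_nonneg)
  have lagr_real: "lagr n (\<lambda>i. (complex_of_real (Y e i))\<^sup>2) i = of_real (lagr n (\<lambda>i. (Y e i)\<^sup>2) i)" for e i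
    by (simp add: lagr_def)
  have r: "\<forall>\<^sub>F e in at_right 0. leval n (\<lambda>i. complex_of_real (Y e i)) (schur (rho_tuple (int n))) =
      of_real (K0 n (Y e) / (2 * pi)) * leval n (\<lambda>i. complex_of_real (Y e i)) (schur (delta_tuple (int n)))"
    using ev
  proof eventually_elim
    case (elim e)
    show ?case
      using leval_schur_rho_distinct(1)[OF n _ cinj, of e] K_distinct(1)[OF n, of "Y e"] elim pos[of _ e]
      by (simp add: lagr_real less_imp_neq[THEN not_sym])
  qed
  have t: "((\<lambda>e. leval n (\<lambda>i. complex_of_real (Y e i)) S) \<longlongrightarrow> leval n (\<lambda>i. complex_of_real (X i)) S) (at_right 0)" for S
    unfolding Y_def by (rule leval_tendsto[OF X])
  have k0: "((\<lambda>e. K0 n (Y e)) \<longlongrightarrow> K0 n X) (at_right 0)"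
    using K_tendsto[of n X 1, OF X] n unfolding K0_def Y_def by simp
  show "leval n (\<lambda>i. complex_of_real (X i)) (schur (rho_tuple (int n))) =
      of_real (K0 n X / (2 * pi)) * leval n (\<lambda>i. complex_of_real (X i)) (schur (delta_tuple (int n)))"
  proof (rule tendsto_unique[OF _ t])
    have "((\<lambda>e. of_real (K0 n (Y e) / (2 * pi)) * leval n (\<lambda>i. complex_of_real (Y e i)) (schur (delta_tuple (int n)))) \<longlongrightarrow>
        of_real (K0 n X / (2 * pi)) * leval n (\<lambda>i. complex_of_real (X i)) (schur (delta_tuple (int n)))) (at_right 0)"
      by (intro tendsto_intros k0 t) auto
    then show "((\<lambda>e. leval n (\<lambda>i. complex_of_real (Y e i)) (schur (rho_tuple (int n)))) \<longlongrightarrow>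
        of_real (K0 n X / (2 * pi)) * leval n (\<lambda>i. complex_of_real (X i)) (schur (delta_tuple (int n)))) (at_right 0)"
      by (rule Lim_transform_eventually) (use r in eventually_elim, simp)
  qed simp
  show "leval n (\<lambda>i. complex_of_real (X i)) (schur (delta_tuple (int n))) \<noteq> 0"
  proof -
    have "\<forall>\<^sub>F e in at_right 0. (\<Prod>i<n. \<Prod>l<i. complex_of_real (Y e i) + complex_of_real (Y e l)) = leval n (\<lambda>i. complex_of_real (Y e i)) (schur (delta_tuple (int n)))"
      using ev
    proof eventually_elim
      case (elim e)
      show ?case
        using leval_schur_rho_distinct(3)[OF n _ cinj, of e] elim pos[of _ e] by (simp add: less_imp_neq[THEN not_sym])
    qed
    moreover have "((\<lambda>e. \<Prod>i<n. \<Prod>l<i. complex_of_real (Y e i) + complex_of_real (Y e l)) \<longlongrightarrow> (\<Prod>i<n. \<Prod>l<i. complex_of_real (Y 0 i) + complex_of_real (Y 0 l))) (at_right 0)"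
      unfolding Y_def by (intro tendsto_intros)
    ultimately have "((\<lambda>e. leval n (\<lambda>i. complex_of_real (Y e i)) (schur (delta_tuple (int n)))) \<longlongrightarrow> (\<Prod>i<n. \<Prod>l<i. complex_of_real (Y 0 i) + complex_of_real (Y 0 l))) (at_right 0)"
      by (rule Lim_transform_eventually[rotated])
    then have "leval n (\<lambda>i. complex_of_real (X i)) (schur (delta_tuple (int n))) = (\<Prod>i<n. \<Prod>l<i. complex_of_real (Y 0 i) + complex_of_real (Y 0 l))"
      by (rule tendsto_unique[OF trivial_limit_at_right_real t])
    moreover have "complex_of_real (Y 0 i) + complex_of_real (Y 0 l) \<noteq> 0" if "i < n" "l < i" for i l
    proof -
      have "Y 0 i + Y 0 l > 0" using X[of i] X[of l] that by (simp add: Y_def)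
      then show ?thesis by (metis of_real_add of_real_eq_0_iff less_irrefl)
    qed
    ultimately show ?thesis by (auto simp: prod_zero_iff)
  qed
  assume n3: "n \<ge> 3"
  have r: "\<forall>\<^sub>F e in at_right 0. leval n (\<lambda>i. complex_of_real (Y e i)) (schur (rho'_tuple (int n))) =
      of_real (K2 n (Y e) / (2 * pi)) * leval n (\<lambda>i. complex_of_real (Y e i)) (schur (delta_tuple (int n)))"
    using ev
  proof eventually_elim
    case (elim e)
    show ?case
      using leval_schur_rho_distinct(2)[OF n _ cinj n3, of e] K_distinct(2)[OF n _ _ n3, of "Y e"] elim pos[of _ e]
      by (simp add: lagr_real less_imp_neq[THEN not_sym])
  qed
  have k2: "((\<lambda>e. K2 n (Y e)) \<longlongrightarrow> K2 n X) (at_right 0)"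
    using K_tendsto[of n X 2, OF X] n3 unfolding K2_def Y_def by simp
  show "leval n (\<lambda>i. complex_of_real (X i)) (schur (rho'_tuple (int n))) =
      of_real (K2 n X / (2 * pi)) * leval n (\<lambda>i. complex_of_real (X i)) (schur (delta_tuple (int n)))"
  proof (rule tendsto_unique[OF _ t])
    have "((\<lambda>e. of_real (K2 n (Y e) / (2 * pi)) * leval n (\<lambda>i. complex_of_real (Y e i)) (schur (delta_tuple (int n)))) \<longlongrightarrow>
        of_real (K2 n X / (2 * pi)) * leval n (\<lambda>i. complex_of_real (X i)) (schur (delta_tuple (int n)))) (at_right 0)"
      by (intro tendsto_intros k2 t) auto
    then show "((\<lambda>e. leval n (\<lambda>i. complex_of_real (Y e i)) (schur (rho'_tuple (int n)))) \<longlongrightarrow>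
        of_real (K2 n X / (2 * pi)) * leval n (\<lambda>i. complex_of_real (X i)) (schur (delta_tuple (int n)))) (at_right 0)"
      by (rule Lim_transform_eventually) (use r in eventually_elim, simp)
  qed simp
qed

section \<open>Asymptotics of the circle integral\<close>

lemma sin_cubic_bound: "\<bar>sin x - x\<bar> \<le> \<bar>x\<bar> ^ 3 / 6" for x :: real
proof -
  have "(\<Sum>m<3. sin_coeff m * x ^ m) = x"
    by (simp add: eval_nat_numeral sin_coeff_def)
  moreover have "fact 3 = (6::real)" by (simp add: eval_nat_numeral)
  ultimately show ?thesis using Maclaurin_sin_bound[of x 3] by (simp add: field_simps)
qed

lemma sin_ge_half: "0 \<le> x \<Longrightarrow> x \<le> 1 \<Longrightarrow> x / 2 \<le> sin x" for x :: real
proof -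
  assume x: "0 \<le> x" "x \<le> 1"
  have "x ^ 3 \<le> x * 1" unfolding power3_eq_cube mult.assoc using x by (intro mult_left_mono) (auto simp: mult_le_one)
  moreover have "\<bar>sin x - x\<bar> \<le> x ^ 3 / 6" using sin_cubic_bound[of x] x by simp
  ultimately show ?thesis using x by linarith
qed

text \<open>This is the squared absolute value of 1 - exp(i c \<theta>), that is 2 - 2 cos(c
  \<theta>).\<close>

definition sn :: "real \<Rightarrow> real \<Rightarrow> real" where
  "sn c \<theta> = 4 * (sin (c * \<theta> / 2))\<^sup>2"

lemma sn_nonneg: "0 \<le> sn c \<theta>" by (simp add: sn_def)

lemma sn_le4: "sn c \<theta> \<le> 4" by (simp add: sn_def sin_squared_eq)

lemma sn_measurable [measurable]: "sn c \<in> borel_measurable borel"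
  unfolding sn_def[abs_def] by (intro borel_measurable_continuous_onI) (auto intro!: continuous_intros)

lemma sn_continuous [continuous_intros]: "continuous_on A f \<Longrightarrow> continuous_on A (\<lambda>x. sn c (f x))" for f :: "real \<Rightarrow> real"
  unfolding sn_def by (auto intro!: continuous_intros)

lemma sn_upper: "sn c \<theta> \<le> (c * \<theta>)\<^sup>2"
proof -
  have "\<bar>sin (c * \<theta> / 2)\<bar> \<le> \<bar>c * \<theta> / 2\<bar>" by (rule abs_sin_x_le_abs_x)
  then have "(sin (c * \<theta> / 2))\<^sup>2 \<le> (c * \<theta> / 2)\<^sup>2" by (simp only: abs_le_square_iff)
  then show ?thesis by (simp add: sn_def power_divide)
qed

lemma sn_lower:
  assumes "0 \<le> \<theta>" "0 \<le> c" "c * \<theta> \<le> 2"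
  shows "(c * \<theta>)\<^sup>2 / 4 \<le> sn c \<theta>"
proof -
  have "c * \<theta> / 2 / 2 \<le> sin (c * \<theta> / 2)" using assms by (intro sin_ge_half) auto
  then have "(c * \<theta> / 2 / 2)\<^sup>2 \<le> (sin (c * \<theta> / 2))\<^sup>2" using assms by (intro power_mono) auto
  then show ?thesis by (simp add: sn_def power_divide)
qed

lemma cos_taylor_bound: "\<bar>cos x - (\<Sum>m<n. cos_coeff m * x ^ m)\<bar> \<le> \<bar>x\<bar> ^ n / fact n"
proof -
  obtain t where t: "cos x = (\<Sum>m<n. cos_coeff m * x ^ m) + cos (t + 1 / 2 * real n * pi) / fact n * x ^ n"
    using Maclaurin_cos_expansion[of x n] by blast
  have "\<bar>cos x - (\<Sum>m<n. cos_coeff m * x ^ m)\<bar> = \<bar>cos (t + 1 / 2 * real n * pi)\<bar> * (\<bar>x\<bar> ^ n / fact n)"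
    by (subst t) (simp add: abs_mult power_abs)
  also have "\<dots> \<le> 1 * (\<bar>x\<bar> ^ n / fact n)" by (intro mult_right_mono) auto
  finally show ?thesis by simp
qed

lemma sn_cos: "sn c \<theta> = 2 - 2 * cos (c * \<theta>)"
  using cos_double_sin[of "c * \<theta> / 2"] by (simp add: sn_def)

lemma sn_quartic: "\<bar>sn c \<theta> - (c * \<theta>)\<^sup>2\<bar> \<le> (c * \<theta>) ^ 4 / 12"
proof -
  have s: "(\<Sum>m<4. cos_coeff m * y ^ m) = 1 - y\<^sup>2 / 2" and f: "fact 4 = (24::real)" for y :: real
  proof -
    have "(\<Sum>m<4. g m) = g 0 + g 1 + g 2 + g 3" for g :: "nat \<Rightarrow> real" by (simp add: eval_nat_numeral)
    then show "(\<Sum>m<4. cos_coeff m * y ^ m) = 1 - y\<^sup>2 / 2" by (simp add: cos_coeff_def)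
  qed (simp add: fact_numeral)
  define y where "y = c * \<theta>"
  have "2 - 2 * cos y - y\<^sup>2 = (- 2) * (cos y - (1 - y\<^sup>2 / 2))" by simp
  then have "\<bar>2 - 2 * cos y - y\<^sup>2\<bar> = 2 * \<bar>cos y - (1 - y\<^sup>2 / 2)\<bar>" by (simp only: abs_mult)
  moreover have "\<bar>cos y - (1 - y\<^sup>2 / 2)\<bar> \<le> y ^ 4 / 24" using cos_taylor_bound[of y 4] unfolding s f by simp
  ultimately show ?thesis unfolding sn_cos y_def[symmetric] by linarith
qed

lemma sn_sextic: "\<bar>sn c \<theta> - (c * \<theta>)\<^sup>2 + (c * \<theta>) ^ 4 / 12\<bar> \<le> (c * \<theta>) ^ 6 / 360"
proof -
  have s: "(\<Sum>m<6. cos_coeff m * y ^ m) = 1 - y\<^sup>2 / 2 + y ^ 4 / 24" and f: "fact 6 = (720::real)" for y :: real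
  proof -
    have "(\<Sum>m<6. g m) = g 0 + g 1 + g 2 + g 3 + g 4 + g 5" for g :: "nat \<Rightarrow> real" by (simp add: eval_nat_numeral)
    then show "(\<Sum>m<6. cos_coeff m * y ^ m) = 1 - y\<^sup>2 / 2 + y ^ 4 / 24" by (simp add: cos_coeff_def fact_numeral)
  qed (simp add: fact_numeral)
  define y where "y = c * \<theta>"
  have "2 - 2 * cos y - y\<^sup>2 + y ^ 4 / 12 = (- 2) * (cos y - (1 - y\<^sup>2 / 2 + y ^ 4 / 24))" by simp
  then have "\<bar>2 - 2 * cos y - y\<^sup>2 + y ^ 4 / 12\<bar> = 2 * \<bar>cos y - (1 - y\<^sup>2 / 2 + y ^ 4 / 24)\<bar>" by (simp only: abs_mult)
  moreover have "\<bar>cos y - (1 - y\<^sup>2 / 2 + y ^ 4 / 24)\<bar> \<le> y ^ 6 / 720" using cos_taylor_bound[of y 6] unfolding s f by simp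
  ultimately show ?thesis unfolding sn_cos y_def[symmetric] by linarith
qed

text \<open>At \<theta> = x sqrt w the sextic remainder is of order w^3, so after two divisions by
  \<open>w\<close> an error of order \<open>w\<close> is left.\<close>

lemma sn_expansion:
  assumes "c > 0" "x > 0"
  shows "((\<lambda>w. (sn c (sqrt w * x) / w - c\<^sup>2 * x\<^sup>2) / w) \<longlongrightarrow> - (c ^ 4 * x ^ 4 / 12)) (at_right 0)"
proof (rule Lim_transform)
  show "((\<lambda>w::real. - (c ^ 4 * x ^ 4 / 12)) \<longlongrightarrow> - (c ^ 4 * x ^ 4 / 12)) (at_right 0)" by simp
  show "((\<lambda>w. (sn c (sqrt w * x) / w - c\<^sup>2 * x\<^sup>2) / w - (- (c ^ 4 * x ^ 4 / 12))) \<longlongrightarrow> 0) (at_right 0)"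
  proof (rule Lim_null_comparison)
    have "((\<lambda>w. w * (c ^ 6 * x ^ 6 / 360)) \<longlongrightarrow> 0 * (c ^ 6 * x ^ 6 / 360)) (at_right 0)" by (intro tendsto_intros)
    then show "((\<lambda>w. w * (c ^ 6 * x ^ 6 / 360)) \<longlongrightarrow> 0) (at_right 0)" by simp
    show "\<forall>\<^sub>F w in at_right 0. norm ((sn c (sqrt w * x) / w - c\<^sup>2 * x\<^sup>2) / w - (- (c ^ 4 * x ^ 4 / 12))) \<le> w * (c ^ 6 * x ^ 6 / 360)"
      using eventually_at_right_less[of 0]
    proof eventually_elim
      case (elim w)
      have s: "(sqrt w)\<^sup>2 = w" "sqrt w ^ 4 = w\<^sup>2" "sqrt w ^ 6 = w ^ 3" using elim by (simp_all add: eval_nat_numeral)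
      define S where "S = sn c (sqrt w * x)"
      have "\<bar>S - c\<^sup>2 * x\<^sup>2 * w + c ^ 4 * x ^ 4 * w\<^sup>2 / 12\<bar> \<le> c ^ 6 * x ^ 6 * w ^ 3 / 360"
        using sn_sextic[of c "sqrt w * x"] unfolding power_mult_distrib s S_def by (simp add: mult_ac)
      then have "\<bar>S - c\<^sup>2 * x\<^sup>2 * w + c ^ 4 * x ^ 4 * w\<^sup>2 / 12\<bar> / w\<^sup>2 \<le> c ^ 6 * x ^ 6 * w ^ 3 / 360 / w\<^sup>2"
        by (rule divide_right_mono) simp
      also have "c ^ 6 * x ^ 6 * w ^ 3 / 360 / w\<^sup>2 = w * (c ^ 6 * x ^ 6 / 360)"
        using elim by (simp add: power2_eq_square power3_eq_cube)
      also have "\<bar>S - c\<^sup>2 * x\<^sup>2 * w + c ^ 4 * x ^ 4 * w\<^sup>2 / 12\<bar> / w\<^sup>2 = \<bar>(S - c\<^sup>2 * x\<^sup>2 * w + c ^ 4 * x ^ 4 * w\<^sup>2 / 12) / w\<^sup>2\<bar>" by simp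
      also have "(S - c\<^sup>2 * x\<^sup>2 * w + c ^ 4 * x ^ 4 * w\<^sup>2 / 12) / w\<^sup>2 = (S / w - c\<^sup>2 * x\<^sup>2) / w - (- (c ^ 4 * x ^ 4 / 12))"
        using elim by (simp add: add_divide_distrib diff_divide_distrib power2_eq_square)
      finally show ?case by (simp only: S_def real_norm_def)
    qed
  qed
qed

lemma sn_over_tendsto:
  assumes "c > 0" "x > 0"
  shows "((\<lambda>w. sn c (sqrt w * x) / w) \<longlongrightarrow> c\<^sup>2 * x\<^sup>2) (at_right 0)"
proof -
  have "((\<lambda>w. c\<^sup>2 * x\<^sup>2 + w * ((sn c (sqrt w * x) / w - c\<^sup>2 * x\<^sup>2) / w)) \<longlongrightarrow> c\<^sup>2 * x\<^sup>2 + 0 * - (c ^ 4 * x ^ 4 / 12)) (at_right 0)"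
    by (intro tendsto_intros sn_expansion assms)
  then have "((\<lambda>w. c\<^sup>2 * x\<^sup>2 + w * ((sn c (sqrt w * x) / w - c\<^sup>2 * x\<^sup>2) / w)) \<longlongrightarrow> c\<^sup>2 * x\<^sup>2) (at_right 0)" by simp
  then show ?thesis
    by (rule Lim_transform_eventually) (use eventually_at_right_less[of 0] in \<open>eventually_elim, simp\<close>)
qed

text \<open>The cut-off at \<epsilon> becomes an indicator under the integral. The domain then does
  not vary with \<open>w\<close>, as dominated convergence requires.\<close>

lemma LINT_scale:
  fixes g :: "real \<Rightarrow> real"
  assumes "0 < w"
  shows "(LINT \<theta>:{0<..<\<epsilon>}|lborel. g \<theta>) = sqrt w * (LINT x:{0<..}|lborel. indicator {..<\<epsilon>} (sqrt w * x) * g (sqrt w * x))"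
proof -
  have "(LINT \<theta>:{0<..<\<epsilon>}|lborel. g \<theta>) = \<bar>sqrt w\<bar> *\<^sub>R (\<integral>x. indicator {0<..<\<epsilon>} (0 + sqrt w * x) *\<^sub>R g (0 + sqrt w * x) \<partial>lborel)"
    unfolding set_lebesgue_integral_def by (rule lborel_integral_real_affine) (use assms in simp)
  also have "(\<lambda>x. indicator {0<..<\<epsilon>} (0 + sqrt w * x) *\<^sub>R g (0 + sqrt w * x)) =
     (\<lambda>x. indicator {0<..} x *\<^sub>R (indicator {..<\<epsilon>} (sqrt w * x) * g (sqrt w * x)))"
    using assms by (auto simp: fun_eq_iff indicator_def zero_less_mult_iff)
  finally show ?thesis using assms by (simp add: set_lebesgue_integral_def)
qed

text \<open>The reciprocal of the order w^(3/2 - n) of a peak: sqrt w from the substitution, w from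
  the numerator and w^(-n) from the denominator.\<close>

definition wscale :: "nat \<Rightarrow> real \<Rightarrow> real" where
  "wscale n w = w ^ n / (w * sqrt w)"

lemma prod_scale: "w > 0 \<Longrightarrow> (\<Prod>i<n. w + F i) = w ^ n * (\<Prod>i<n. 1 + F i / w)" for w :: real
proof -
  assume "w > 0"
  then have "(\<Prod>i<n. w + F i) = (\<Prod>i<n. w * (1 + F i / w))" by (intro prod.cong) (auto simp: field_simps)
  then show ?thesis by (simp add: prod.distrib)
qed

lemma peak_rescale:
  assumes "0 < w"
  shows "wscale n w * (LINT \<theta>:{0<..<\<epsilon>}|lborel. sn 2 \<theta> * \<psi> \<theta> / (\<Prod>i<n. w + sn (X i) \<theta>)) =
    (LINT x:{0<..}|lborel. indicator {..<\<epsilon>} (sqrt w * x) * (sn 2 (sqrt w * x) / w * \<psi> (sqrt w * x) / (\<Prod>i<n. 1 + sn (X i) (sqrt w * x) / w)))"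
proof -
  have c: "wscale n w * sqrt w * w = w ^ n" using assms by (simp add: wscale_def)
  have "wscale n w * (LINT \<theta>:{0<..<\<epsilon>}|lborel. sn 2 \<theta> * \<psi> \<theta> / (\<Prod>i<n. w + sn (X i) \<theta>)) =
    (LINT x:{0<..}|lborel. (wscale n w * sqrt w) * (indicator {..<\<epsilon>} (sqrt w * x) * (sn 2 (sqrt w * x) * \<psi> (sqrt w * x) / (\<Prod>i<n. w + sn (X i) (sqrt w * x)))))"
    unfolding LINT_scale[OF assms] set_integral_mult_right by simp
  also have "(\<lambda>x. (wscale n w * sqrt w) * (indicator {..<\<epsilon>} (sqrt w * x) * (sn 2 (sqrt w * x) * \<psi> (sqrt w * x) / (\<Prod>i<n. w + sn (X i) (sqrt w * x)))))
     = (\<lambda>x. indicator {..<\<epsilon>} (sqrt w * x) * (sn 2 (sqrt w * x) / w * \<psi> (sqrt w * x) / (\<Prod>i<n. 1 + sn (X i) (sqrt w * x) / w)))"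
  proof
    fix x
    define S where "S = sn 2 (sqrt w * x)"
    define Q where "Q = (\<Prod>i<n. 1 + sn (X i) (sqrt w * x) / w)"
    have "(wscale n w * sqrt w) * (S * \<psi> (sqrt w * x) / (w ^ n * Q)) = (wscale n w * sqrt w * w) * (S / w * \<psi> (sqrt w * x) / (w ^ n * Q))"
      using assms by simp
    also have "\<dots> = S / w * \<psi> (sqrt w * x) / Q" unfolding c using assms by simp
    finally have "(wscale n w * sqrt w) * (S * \<psi> (sqrt w * x) / (w ^ n * Q)) = S / w * \<psi> (sqrt w * x) / Q" .
    then show "(wscale n w * sqrt w) * (indicator {..<\<epsilon>} (sqrt w * x) * (sn 2 (sqrt w * x) * \<psi> (sqrt w * x) / (\<Prod>i<n. w + sn (X i) (sqrt w * x))))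
     = indicator {..<\<epsilon>} (sqrt w * x) * (sn 2 (sqrt w * x) / w * \<psi> (sqrt w * x) / (\<Prod>i<n. 1 + sn (X i) (sqrt w * x) / w))"
      unfolding prod_scale[OF assms] S_def Q_def by (auto split: split_indicator)
  qed
  finally show ?thesis .
qed

text \<open>The bound X_i \<epsilon> \<le> 1 keeps the argument in the range where the sine is at
  least half of it; squaring gives the factor 1/4.\<close>

lemma rescaled_prod_ge:
  assumes "0 < w" "x > 0" "sqrt w * x < \<epsilon>" "\<And>i. i < n \<Longrightarrow> X i \<ge> 1" "\<And>i. i < n \<Longrightarrow> X i * \<epsilon> \<le> 1"
  shows "((1 + x\<^sup>2) / 4) ^ n \<le> (\<Prod>i<n. 1 + sn (X i) (sqrt w * x) / w)"
proof -
  have "((1 + x\<^sup>2) / 4) ^ n = (\<Prod>i<n. (1 + x\<^sup>2) / 4)" by simp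
  also have "\<dots> \<le> (\<Prod>i<n. 1 + sn (X i) (sqrt w * x) / w)"
  proof (rule prod_mono, intro conjI)
    fix i assume i: "i \<in> {..<n}"
    have X: "1 \<le> X i" "X i * \<epsilon> \<le> 1" using i assms by auto
    have "X i * (sqrt w * x) \<le> X i * \<epsilon>" using X assms by (intro mult_left_mono) auto
    then have "X i * (sqrt w * x) \<le> 2" using X(2) by linarith
    then have "(X i * (sqrt w * x))\<^sup>2 / 4 \<le> sn (X i) (sqrt w * x)" using X(1) assms(1,2) by (intro sn_lower) auto
    then have "(X i * (sqrt w * x))\<^sup>2 / 4 / w \<le> sn (X i) (sqrt w * x) / w" using assms(1) by (intro divide_right_mono) auto
    then have "(X i)\<^sup>2 * x\<^sup>2 / 4 \<le> sn (X i) (sqrt w * x) / w" using assms(1) by (simp add: power_mult_distrib)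
    moreover have "x\<^sup>2 \<le> (X i)\<^sup>2 * x\<^sup>2" using X mult_right_mono[of 1 "(X i)\<^sup>2" "x\<^sup>2"] by (simp add: one_le_power)
    ultimately show "(1 + x\<^sup>2) / 4 \<le> 1 + sn (X i) (sqrt w * x) / w" by simp
  qed auto
  finally show ?thesis .
qed

lemma rescaled_bound:
  fixes A x :: real
  assumes "0 < w" "x > 0" "sqrt w * x < \<epsilon>" "\<And>i. i < n \<Longrightarrow> X i \<ge> 1" "\<And>i. i < n \<Longrightarrow> X i * \<epsilon> \<le> 1"
    and "Suc m \<le> n" "\<bar>A\<bar> \<le> K * x ^ (2 * m)"
  shows "\<bar>A / (\<Prod>i<n. 1 + sn (X i) (sqrt w * x) / w)\<bar> \<le> K * 4 ^ n / (1 + x\<^sup>2)"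
proof -
  have p: "1 + x\<^sup>2 > 0" by (intro add_pos_nonneg) auto
  then have p4: "((1 + x\<^sup>2) / 4) ^ n > 0" by simp
  have ge: "((1 + x\<^sup>2) / 4) ^ n \<le> (\<Prod>i<n. 1 + sn (X i) (sqrt w * x) / w)"
    by (rule rescaled_prod_ge[OF assms(1-3)]) (use assms(4,5) in auto)
  have K: "K * x ^ (2 * m) \<ge> 0" using assms(7) by linarith
  moreover have "x ^ (2 * m) > 0" using assms(2) by (rule zero_less_power)
  ultimately have K0: "K \<ge> 0" by (auto simp: zero_le_mult_iff)
  have "\<bar>A / (\<Prod>i<n. 1 + sn (X i) (sqrt w * x) / w)\<bar> = \<bar>A\<bar> / (\<Prod>i<n. 1 + sn (X i) (sqrt w * x) / w)"
    using ge p4 by (simp add: abs_divide)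
  also have "\<dots> \<le> K * x ^ (2 * m) / ((1 + x\<^sup>2) / 4) ^ n"
    using ge p4 assms(7) by (intro frac_le) auto
  also have "\<dots> = K * 4 ^ n * (x ^ (2 * m) / (1 + x\<^sup>2) ^ n)" by (simp add: power_divide)
  also have "\<dots> \<le> K * 4 ^ n * (x ^ (2 * m) / (1 + x\<^sup>2) ^ Suc m)"
    using K0 p assms(6) by (intro mult_left_mono divide_left_mono power_increasing) (auto intro!: mult_pos_pos)
  also have "\<dots> \<le> K * 4 ^ n * (1 / (1 + x\<^sup>2))"
    using K0 by (intro mult_left_mono pow_over_one_plus) auto
  finally show ?thesis by simp
qed

lemma eventually_sqrt_less:
  assumes "0 < \<epsilon>" "0 < x"
  shows "\<forall>\<^sub>F w in at_right 0. sqrt w * x < \<epsilon>"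
proof -
  have "((\<lambda>w. sqrt w * x) \<longlongrightarrow> sqrt 0 * x) (at_right 0)" by (intro tendsto_intros)
  then show ?thesis by (rule order_tendstoD(2)) (use assms in simp)
qed

text \<open>For the peak at 0 the factor \<psi> is 1. For the peak at \<pi> it holds a factor that
  stays away from 0 there.\<close>

lemma peak_limit:
  assumes n: "n \<ge> 2" and X: "\<And>i. i < n \<Longrightarrow> X i \<ge> 1" and eps: "0 < \<epsilon>" "\<And>i. i < n \<Longrightarrow> X i * \<epsilon> \<le> 1"
    and [measurable]: "\<And>w. \<psi> w \<in> borel_measurable borel"
    and psi: "\<And>w \<theta>. 0 < w \<Longrightarrow> w < 1 \<Longrightarrow> 0 < \<theta> \<Longrightarrow> \<theta> < \<epsilon> \<Longrightarrow> \<bar>\<psi> w \<theta>\<bar> \<le> M"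
    and psi0: "\<And>x. x > 0 \<Longrightarrow> ((\<lambda>w. \<psi> w (sqrt w * x)) \<longlongrightarrow> p0) (at_right 0)"
  shows "((\<lambda>w. wscale n w * (LINT \<theta>:{0<..<\<epsilon>}|lborel. sn 2 \<theta> * \<psi> w \<theta> / (\<Prod>i<n. w + sn (X i) \<theta>))) \<longlongrightarrow> p0 * K0 n X) (at_right 0)"
proof -
  define f where "f = (\<lambda>w x. indicator {..<\<epsilon>} (sqrt w * x) * (sn 2 (sqrt w * x) / w * \<psi> w (sqrt w * x) / (\<Prod>i<n. 1 + sn (X i) (sqrt w * x) / w)))"
  have A: "((\<lambda>w. LINT x:{0<..}|lborel. f w x) \<longlongrightarrow> (LINT x:{0<..}|lborel. 4 * x\<^sup>2 * p0 / PK n X x)) (at_right 0)"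
  proof (rule dominated_halfline[where \<delta> = 1 and B = "4 * M * 4 ^ n"])
    show "f w \<in> borel_measurable borel" for w unfolding f_def by measurable
    fix w x :: real assume w: "0 < w" "w < 1" and x: "0 < x"
    have M: "0 \<le> M" using psi[OF w, of "\<epsilon> / 2"] eps(1) by simp
    show "\<bar>f w x\<bar> \<le> 4 * M * 4 ^ n / (1 + x\<^sup>2)"
    proof (cases "sqrt w * x < \<epsilon>")
      case True
      have "\<bar>sn 2 (sqrt w * x) / w * \<psi> w (sqrt w * x)\<bar> \<le> 4 * M * x ^ (2 * 1)"
      proof -
        have "sn 2 (sqrt w * x) / w \<le> (2 * (sqrt w * x))\<^sup>2 / w" using w by (intro divide_right_mono sn_upper) auto
        also have "\<dots> = 4 * x\<^sup>2" using w by (simp add: power_mult_distrib)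
        finally have "\<bar>sn 2 (sqrt w * x) / w\<bar> \<le> 4 * x\<^sup>2" using w sn_nonneg[of 2 "sqrt w * x"] by simp
        moreover have "\<bar>\<psi> w (sqrt w * x)\<bar> \<le> M" using psi w x True by simp
        ultimately have "\<bar>sn 2 (sqrt w * x) / w\<bar> * \<bar>\<psi> w (sqrt w * x)\<bar> \<le> 4 * x\<^sup>2 * M" by (intro mult_mono) auto
        then show ?thesis by (simp add: abs_mult mult_ac)
      qed
      from rescaled_bound[OF w(1) x True X eps(2) _ this] n show ?thesis unfolding f_def using True by simp
    qed (use M in \<open>simp add: f_def\<close>)
  next
    fix x :: real assume x: "0 < x"
    have "((\<lambda>w. sn 2 (sqrt w * x) / w * \<psi> w (sqrt w * x) / (\<Prod>i<n. 1 + sn (X i) (sqrt w * x) / w)) \<longlongrightarrow> (2\<^sup>2 * x\<^sup>2) * p0 / (\<Prod>i<n. 1 + (X i)\<^sup>2 * x\<^sup>2)) (at_right 0)"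
    proof (intro tendsto_intros sn_over_tendsto psi0 x)
      show "X i > 0" if "i \<in> {..<n}" for i using X[of i] that by simp
      show "(\<Prod>i<n. 1 + (X i)\<^sup>2 * x\<^sup>2) \<noteq> 0" using PK_pos[of n X x] unfolding PK_def by linarith
    qed auto
    then have "((\<lambda>w. sn 2 (sqrt w * x) / w * \<psi> w (sqrt w * x) / (\<Prod>i<n. 1 + sn (X i) (sqrt w * x) / w)) \<longlongrightarrow> 4 * x\<^sup>2 * p0 / PK n X x) (at_right 0)"
      by (simp add: PK_def)
    then show "((\<lambda>w. f w x) \<longlongrightarrow> 4 * x\<^sup>2 * p0 / PK n X x) (at_right 0)"
      by (rule Lim_transform_eventually) (use eventually_sqrt_less[OF eps(1) x] in \<open>eventually_elim, simp add: f_def\<close>)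
  qed auto
  have B: "(LINT x:{0<..}|lborel. 4 * x\<^sup>2 * p0 / PK n X x) = p0 * K0 n X"
    unfolding K0_def set_integral_mult_right[symmetric] by (simp add: mult_ac)
  have C: "\<forall>\<^sub>F w in at_right 0. (LINT x:{0<..}|lborel. f w x) = wscale n w * (LINT \<theta>:{0<..<\<epsilon>}|lborel. sn 2 \<theta> * \<psi> w \<theta> / (\<Prod>i<n. w + sn (X i) \<theta>))"
    using eventually_at_right_less[of 0]
  proof eventually_elim
    case (elim w)
    show ?case unfolding peak_rescale[OF elim] f_def ..
  qed
  show ?thesis using Lim_transform_eventually[OF A C] unfolding B .
qed

lemma set_integrable_PK_term:
  assumes "\<And>i. i < n \<Longrightarrow> X i \<ge> 1" "n \<ge> 2"
  shows "set_integrable lborel {0<..} (\<lambda>x. 4 * x\<^sup>2 / PK n X x * (\<Sum>i<n. (X i)\<^sup>2 * x\<^sup>2 / (1 + (X i)\<^sup>2 * x\<^sup>2)))"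
proof (rule set_integrable_halfline[where B = "4 * real n"])
  show "(\<lambda>x. 4 * x\<^sup>2 / PK n X x * (\<Sum>i<n. (X i)\<^sup>2 * x\<^sup>2 / (1 + (X i)\<^sup>2 * x\<^sup>2))) \<in> borel_measurable borel"
    by measurable
  fix x :: real
  have t: "0 \<le> (X i)\<^sup>2 * x\<^sup>2 / (1 + (X i)\<^sup>2 * x\<^sup>2) \<and> (X i)\<^sup>2 * x\<^sup>2 / (1 + (X i)\<^sup>2 * x\<^sup>2) \<le> 1" for i
  proof -
    have q: "0 \<le> (X i)\<^sup>2 * x\<^sup>2" by simp
    then have d: "1 + (X i)\<^sup>2 * x\<^sup>2 > 0" by linarith
    show ?thesis using divide_nonneg_pos[OF q d] unfolding divide_le_eq_1_pos[OF d] by simp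
  qed
  have s: "0 \<le> (\<Sum>i<n. (X i)\<^sup>2 * x\<^sup>2 / (1 + (X i)\<^sup>2 * x\<^sup>2))" "(\<Sum>i<n. (X i)\<^sup>2 * x\<^sup>2 / (1 + (X i)\<^sup>2 * x\<^sup>2)) \<le> real n"
    using sum_nonneg[of "{..<n}" "\<lambda>i. (X i)\<^sup>2 * x\<^sup>2 / (1 + (X i)\<^sup>2 * x\<^sup>2)"] sum_mono[of "{..<n}" "\<lambda>i. (X i)\<^sup>2 * x\<^sup>2 / (1 + (X i)\<^sup>2 * x\<^sup>2)" "\<lambda>_. 1"] t by auto
  have "\<bar>4 * x\<^sup>2 / PK n X x\<bar> \<le> 4 / (1 + x\<^sup>2)" using K_integrand_bound[of n X 1 x, OF assms(1)] assms(2) by simp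
  then have "\<bar>4 * x\<^sup>2 / PK n X x\<bar> * \<bar>\<Sum>i<n. (X i)\<^sup>2 * x\<^sup>2 / (1 + (X i)\<^sup>2 * x\<^sup>2)\<bar> \<le> 4 / (1 + x\<^sup>2) * real n"
    using s by (intro mult_mono) auto
  then show "\<bar>4 * x\<^sup>2 / PK n X x * (\<Sum>i<n. (X i)\<^sup>2 * x\<^sup>2 / (1 + (X i)\<^sup>2 * x\<^sup>2))\<bar> \<le> 4 * real n / (1 + x\<^sup>2)"
    by (simp add: abs_mult)
qed

text \<open>The integrand is 3/2 times that of \<open>K0\<close> minus twice the derivative of x^3 /
  PK, and this function tends to 0 at both ends. The identity removes the sum over the factors from
  the second-order term of a peak.\<close>

lemma K_by_parts:
  assumes X: "\<And>i. i < n \<Longrightarrow> X i \<ge> 1" and n: "n \<ge> 2"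
  shows "(LINT x:{0<..}|lborel. 4 * x\<^sup>2 / PK n X x * (\<Sum>i<n. (X i)\<^sup>2 * x\<^sup>2 / (1 + (X i)\<^sup>2 * x\<^sup>2))) = 3 / 2 * K0 n X"
proof -
  define M where "M = (\<lambda>x. 4 * x\<^sup>2 / PK n X x * (\<Sum>i<n. (X i)\<^sup>2 * x\<^sup>2 / (1 + (X i)\<^sup>2 * x\<^sup>2)))"
  define F where "F = (\<lambda>x. x ^ 3 / PK n X x)"
  define F' where "F' = (\<lambda>x. 3 / 4 * (4 * x\<^sup>2 / PK n X x) - 1 / 2 * M x)"
  have p: "1 + (X i)\<^sup>2 * x\<^sup>2 > 0" for i x by (intro add_pos_nonneg) auto
  have P0: "PK n X x \<noteq> 0" for x using PK_pos[of n X x] by simp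
  have dPK: "(PK n X has_field_derivative PK n X x * (\<Sum>i<n. 2 * (X i)\<^sup>2 * x / (1 + (X i)\<^sup>2 * x\<^sup>2))) (at x)" for x
    unfolding PK_def[abs_def]
    by (rule has_field_derivative_prod') (use p in \<open>auto intro!: derivative_eq_intros simp: less_imp_neq[THEN not_sym]\<close>)
  have dF: "(F has_field_derivative F' x) (at x)" for x
  proof -
    have "(F has_field_derivative (3 * x\<^sup>2 * PK n X x - x ^ 3 * (PK n X x * (\<Sum>i<n. 2 * (X i)\<^sup>2 * x / (1 + (X i)\<^sup>2 * x\<^sup>2)))) / (PK n X x * PK n X x)) (at x)"
      unfolding F_def by (rule DERIV_divide) (auto intro!: derivative_eq_intros dPK P0)
    moreover have "(3 * x\<^sup>2 * PK n X x - x ^ 3 * (PK n X x * (\<Sum>i<n. 2 * (X i)\<^sup>2 * x / (1 + (X i)\<^sup>2 * x\<^sup>2)))) / (PK n X x * PK n X x) = F' x"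
    proof -
      have r: "(a * c - b * (c * d)) / (c * c) = (a - b * d) * c / (c * c)" for a b c d :: real
        by (rule arg_cong2[of _ _ _ _ "(/)"]) (simp_all add: algebra_simps)
      have e: "x ^ 3 * (\<Sum>i<n. 2 * (X i)\<^sup>2 * x / (1 + (X i)\<^sup>2 * x\<^sup>2)) = 2 * x\<^sup>2 * (\<Sum>i<n. (X i)\<^sup>2 * x\<^sup>2 / (1 + (X i)\<^sup>2 * x\<^sup>2))"
        unfolding sum_distrib_left by (intro sum.cong) (auto simp: power2_eq_square power3_eq_cube)
      have "(3 * x\<^sup>2 * PK n X x - x ^ 3 * (PK n X x * (\<Sum>i<n. 2 * (X i)\<^sup>2 * x / (1 + (X i)\<^sup>2 * x\<^sup>2)))) / (PK n X x * PK n X x)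
         = (3 * x\<^sup>2 - x ^ 3 * (\<Sum>i<n. 2 * (X i)\<^sup>2 * x / (1 + (X i)\<^sup>2 * x\<^sup>2))) * PK n X x / (PK n X x * PK n X x)"
        by (rule r)
      also have "\<dots> = (3 * x\<^sup>2 - x ^ 3 * (\<Sum>i<n. 2 * (X i)\<^sup>2 * x / (1 + (X i)\<^sup>2 * x\<^sup>2))) / PK n X x" using P0[of x] by simp
      also have "\<dots> = F' x" unfolding e F'_def M_def by (simp add: diff_divide_distrib)
      finally show ?thesis .
    qed
    ultimately show ?thesis by simp
  qed
  have contPK: "isCont (PK n X) x" for x using dPK by (rule DERIV_isCont)
  have contF': "isCont F' x" for x
    unfolding F'_def M_def using p P0 by (intro continuous_intros contPK) (auto simp: less_imp_neq[THEN not_sym])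
  have iM: "set_integrable lborel {0<..} M" unfolding M_def by (rule set_integrable_PK_term[OF X n])
  have i0: "set_integrable lborel {0<..} (\<lambda>x. 4 * x\<^sup>2 / PK n X x)" using K_integrable[of n X 1, OF X] n by simp
  have iF': "set_integrable lborel {0<..} F'" unfolding F'_def by (intro set_integral_diff set_integrable_mult_right iM i0)
  have A: "(F \<longlongrightarrow> 0) (at_right 0)"
  proof -
    have "isCont F 0" using dF by (rule DERIV_isCont)
    then have "(F \<longlongrightarrow> F 0) (at_right 0)" by (simp add: isCont_def filterlim_at_split)
    then show ?thesis by (simp add: F_def)
  qed
  have B: "(F \<longlongrightarrow> 0) at_top"
  proof (rule Lim_null_comparison)
    show "((\<lambda>x::real. x ^ 3 / (1 + x\<^sup>2) ^ 2) \<longlongrightarrow> 0) at_top" by real_asymp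
    show "\<forall>\<^sub>F x in at_top. norm (F x) \<le> x ^ 3 / (1 + x\<^sup>2) ^ 2"
      using eventually_ge_at_top[of 0]
    proof eventually_elim
      case (elim x)
      have "1 + x\<^sup>2 > 0" by (intro add_pos_nonneg) auto
      then have "(1 + x\<^sup>2) ^ 2 > 0" by simp
      then have "x ^ 3 / PK n X x \<le> x ^ 3 / (1 + x\<^sup>2) ^ 2"
        using PK_ge[of n X 2 x, OF X n] elim by (intro divide_left_mono mult_pos_pos PK_pos) auto
      then show ?case using elim PK_pos[of n X x] by (simp add: F_def)
    qed
  qed
  have "(LBINT x=0..\<infinity>. F' x) = 0 - 0"
  proof (rule interval_integral_FTC_integrable)
    show "(0::ereal) < \<infinity>" by simp
    show "(F has_vector_derivative F' x) (at x)" for x using dF by (simp add: has_real_derivative_iff_has_vector_derivative)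
    show "isCont F' x" for x by (rule contF')
    show "set_integrable lborel (einterval 0 \<infinity>) F'" using iF' by (simp add: zero_ereal_def)
    show "((F \<circ> real_of_ereal) \<longlongrightarrow> 0) (at_right 0)" using A ereal_tendsto_simps1(2)[of F 0 0] by (simp add: zero_ereal_def)
    show "((F \<circ> real_of_ereal) \<longlongrightarrow> 0) (at_left \<infinity>)" using B ereal_tendsto_simps1(3)[of F] by simp
  qed
  then have "(LINT x:{0<..}|lborel. F' x) = 0" unfolding zero_ereal_def interval_integral_to_infinity_eq by simp
  moreover have "(LINT x:{0<..}|lborel. F' x) = 3 / 4 * K0 n X - 1 / 2 * (LINT x:{0<..}|lborel. M x)"
    unfolding F'_def K0_def by (subst set_integral_diff(2)) (auto intro!: set_integrable_mult_right iM i0 simp only: set_integral_mult_right)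
  ultimately show ?thesis by (simp add: M_def)
qed

text \<open>First-order expansion of a product of factors 1 - \<tau>_i w + o(w). The limit of the
  product itself is carried along for the induction.\<close>

lemma one_minus_prod_tendsto:
  fixes t :: "nat \<Rightarrow> real \<Rightarrow> real"
  assumes "\<And>i. i < n \<Longrightarrow> ((\<lambda>w. t i w / w) \<longlongrightarrow> \<tau> i) (at_right 0)"
  shows "((\<lambda>w. \<Prod>i<n. 1 - t i w) \<longlongrightarrow> 1) (at_right 0) \<and> ((\<lambda>w. (1 - (\<Prod>i<n. 1 - t i w)) / w) \<longlongrightarrow> (\<Sum>i<n. \<tau> i)) (at_right 0)"
  using assms
proof (induction n)
  case (Suc n)
  then have IH: "((\<lambda>w. \<Prod>i<n. 1 - t i w) \<longlongrightarrow> 1) (at_right 0)" "((\<lambda>w. (1 - (\<Prod>i<n. 1 - t i w)) / w) \<longlongrightarrow> (\<Sum>i<n. \<tau> i)) (at_right 0)" by auto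
  have tn: "((\<lambda>w. t n w / w) \<longlongrightarrow> \<tau> n) (at_right 0)" using Suc.prems by simp
  have "((\<lambda>w. w * (t n w / w)) \<longlongrightarrow> 0 * \<tau> n) (at_right 0)" by (intro tendsto_intros tn)
  then have "((\<lambda>w. w * (t n w / w)) \<longlongrightarrow> 0) (at_right 0)" by simp
  then have t0: "((\<lambda>w. t n w) \<longlongrightarrow> 0) (at_right 0)"
    by (rule Lim_transform_eventually) (use eventually_at_right_less[of 0] in \<open>eventually_elim, simp\<close>)
  have "((\<lambda>w. (\<Prod>i<n. 1 - t i w) * (1 - t n w)) \<longlongrightarrow> 1 * (1 - 0)) (at_right 0)" by (intro tendsto_intros IH t0)
  moreover have "((\<lambda>w. (1 - (\<Prod>i<n. 1 - t i w)) / w + (\<Prod>i<n. 1 - t i w) * (t n w / w)) \<longlongrightarrow> (\<Sum>i<n. \<tau> i) + 1 * \<tau> n) (at_right 0)"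
    by (intro tendsto_intros IH tn)
  moreover have "(1 - (\<Prod>i<n. 1 - t i w)) / w + (\<Prod>i<n. 1 - t i w) * (t n w / w) = (1 - (\<Prod>i<n. 1 - t i w) * (1 - t n w)) / w" for w
    by (simp add: diff_divide_distrib right_diff_distrib)
  ultimately show ?case by simp
qed simp

lemma square_over_one_plus:
  fixes q :: real
  assumes "1 + q \<noteq> 0"
  shows "(q * q / 12) / (1 + q) = q / 12 - (1 / 12) * (q / (1 + q))"
proof -
  define d where "d = 1 + q"
  have d: "d \<noteq> 0" using assms by (simp add: d_def)
  have "(q / 12 - (1 / 12) * (q / d)) * d = q * d / 12 - q / 12" using d by (simp add: left_diff_distrib)
  also have "\<dots> = q * q / 12" by (simp add: d_def algebra_simps)
  finally show ?thesis using nonzero_eq_divide_eq[OF d, of "q / 12 - (1 / 12) * (q / d)" "q * q / 12"] by (simp add: d_def)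
qed

text \<open>In terms of the relative defects \<open>t i x w\<close> of the factors, the rescaled
  integrand differs from its limit by N / P, and N / w converges. The numerator contributes -4 x^4 /
  3, from the quartic term of 4 sin^2 \<theta>; a factor of weight a contributes 4 x^2 times (a^4
  x^4 / 12) / (1 + a^2 x^2). Splitting this quotient as a^2 x^2 / 12 minus a twelfth of a^2 x^2 / (1
  + a^2 x^2) gives a multiple of \<open>K2\<close> and, by \<open>K_by_parts\<close>, the term -1/12
  * 3/2 = -1/8 times \<open>K0\<close>.\<close>

lemma peak_expansion:
  assumes n: "n \<ge> 3" and X: "\<And>i. i < n \<Longrightarrow> X i \<ge> 1" and eps: "0 < \<epsilon>" "\<And>i. i < n \<Longrightarrow> X i * \<epsilon> \<le> 1"
  shows "((\<lambda>w. (wscale n w * (LINT \<theta>:{0<..<\<epsilon>}|lborel. sn 2 \<theta> / (\<Prod>i<n. w + sn (X i) \<theta>)) - K0 n X) / w) \<longlongrightarrow>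
     ((\<Sum>i<n. (X i)\<^sup>2) / 12 - 1 / 3) * K2 n X - K0 n X / 8) (at_right 0)"
proof -
  define P where "P = (\<lambda>w x. \<Prod>i<n. 1 + sn (X i) (sqrt w * x) / w)"
  define F where "F = (\<lambda>w x. indicator {..<\<epsilon>} (sqrt w * x) * (sn 2 (sqrt w * x) / w / P w x))"
  define h where "h = (\<lambda>w x. (F w x - 4 * x\<^sup>2 / PK n X x) / w)"
  define t where "t = (\<lambda>i x w. ((X i)\<^sup>2 * x\<^sup>2 - sn (X i) (sqrt w * x) / w) / (1 + (X i)\<^sup>2 * x\<^sup>2))"
  define N where "N = (\<lambda>w x. (sn 2 (sqrt w * x) / w - 4 * x\<^sup>2) + 4 * x\<^sup>2 * (1 - (\<Prod>i<n. 1 - t i x w)))"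
  define S where "S = (\<Sum>i<n. (X i)\<^sup>2)"
  define L where "L = (\<lambda>x. (- (4 / 3) * x ^ 4 + 4 * x\<^sup>2 * (\<Sum>i<n. ((X i) ^ 4 * x ^ 4 / 12) / (1 + (X i)\<^sup>2 * x\<^sup>2))) / PK n X x)"
  have p: "1 + (X i)\<^sup>2 * x\<^sup>2 > 0" for i x by (intro add_pos_nonneg) auto
  have Ppos: "P w x > 0" if "w > 0" for w x
    unfolding P_def using that by (intro prod_pos) (auto intro!: add_pos_nonneg divide_nonneg_pos sn_nonneg)
  have S0: "0 \<le> S" unfolding S_def by (intro sum_nonneg) auto
  have ratio: "(\<Prod>i<n. 1 - t i x w) = P w x / PK n X x" for w x
    unfolding P_def PK_def prod_dividef[symmetric]
  proof (rule prod.cong[OF refl])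
    fix i show "1 - t i x w = (1 + sn (X i) (sqrt w * x) / w) / (1 + (X i)\<^sup>2 * x\<^sup>2)"
      using p[of i x] by (simp add: t_def diff_divide_distrib[symmetric] eq_divide_eq left_diff_distrib)
  qed
  have sq: "sqrt w ^ 4 = w\<^sup>2" if "w > 0" for w using that by (simp add: eval_nat_numeral)
  have split: "sn 2 (sqrt w * x) / w / P w x - 4 * x\<^sup>2 / PK n X x = N w x / P w x" if "w > 0" for w x
    unfolding N_def ratio using Ppos[OF that, of x] PK_pos[of n X x]
    by (simp add: add_divide_distrib diff_divide_distrib right_diff_distrib)
  have qup: "sn c (sqrt w * x) / w \<le> c\<^sup>2 * x\<^sup>2" if "w > 0" for c w x
  proof -
    have "sn c (sqrt w * x) / w \<le> (c * (sqrt w * x))\<^sup>2 / w" using that by (intro divide_right_mono sn_upper) auto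
    then show ?thesis using that by (simp add: power_mult_distrib)
  qed
  have qlo: "\<bar>c\<^sup>2 * x\<^sup>2 - sn c (sqrt w * x) / w\<bar> \<le> c ^ 4 * x ^ 4 * w / 12" if "w > 0" for c w x
  proof -
    have "\<bar>sn c (sqrt w * x) - (c * (sqrt w * x))\<^sup>2\<bar> / w \<le> (c * (sqrt w * x)) ^ 4 / 12 / w"
      using that by (intro divide_right_mono sn_quartic) auto
    also have "\<bar>sn c (sqrt w * x) - (c * (sqrt w * x))\<^sup>2\<bar> / w = \<bar>(sn c (sqrt w * x) - (c * (sqrt w * x))\<^sup>2) / w\<bar>" using that by simp
    also have "(sn c (sqrt w * x) - (c * (sqrt w * x))\<^sup>2) / w = - (c\<^sup>2 * x\<^sup>2 - sn c (sqrt w * x) / w)"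
      using that by (simp add: diff_divide_distrib power_mult_distrib)
    also have "(c * (sqrt w * x)) ^ 4 / 12 / w = c ^ 4 * x ^ 4 * w / 12"
      using that by (simp add: power_mult_distrib sq power2_eq_square)
    finally show ?thesis unfolding abs_minus_cancel .
  qed
  have tb: "0 \<le> t i x w \<and> t i x w \<le> 1 \<and> t i x w \<le> (X i)\<^sup>2 * x\<^sup>2 * w / 12" if "w > 0" "i < n" "x > 0" for i x w
  proof (intro conjI)
    have Xi: "X i > 0" using X[OF that(2)] by simp
    show "0 \<le> t i x w" unfolding t_def using qup[OF that(1), of "X i" x] p[of i x] by (intro divide_nonneg_pos) auto
    have "0 \<le> sn (X i) (sqrt w * x) / w" using that(1) sn_nonneg by (intro divide_nonneg_pos) auto
    then show "t i x w \<le> 1" unfolding t_def using p[of i x] by (simp add: divide_le_eq_1)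
    have "t i x w \<le> (X i ^ 4 * x ^ 4 * w / 12) / ((X i)\<^sup>2 * x\<^sup>2)"
      unfolding t_def using qlo[OF that(1), of "X i" x] qup[OF that(1), of "X i" x] Xi that by (intro frac_le) auto
    also have "\<dots> = (X i)\<^sup>2 * x\<^sup>2 * w / 12" using Xi that(3) by (simp add: eval_nat_numeral)
    finally show "t i x w \<le> (X i)\<^sup>2 * x\<^sup>2 * w / 12" .
  qed
  have Nb: "\<bar>N w x / w\<bar> \<le> (4 / 3 + S / 3) * x ^ (2 * 2)" if "w > 0" "x > 0" for w x
  proof -
    have 1: "\<bar>sn 2 (sqrt w * x) / w - 4 * x\<^sup>2\<bar> \<le> 4 / 3 * x ^ 4 * w" using qlo[OF that(1), of 2 x] by (simp add: abs_minus_commute mult_ac)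
    \<comment> \<open>Together with the upper bound 1 this makes the defect of the whole product at
      most linear in \<open>w\<close>.\<close>
    have w1: "1 - (\<Sum>i<n. t i x w) \<le> (\<Prod>i<n. 1 - t i x w)"
      by (rule Weierstrass_prod_ineq) (use tb that in auto)
    have "(\<Prod>i<n. 1 - t i x w) \<le> 1" by (rule prod_le_1) (use tb that in auto)
    moreover have "(\<Sum>i<n. t i x w) \<le> (\<Sum>i<n. (X i)\<^sup>2 * x\<^sup>2 * w / 12)" by (rule sum_mono) (use tb that in auto)
    moreover have "(\<Sum>i<n. (X i)\<^sup>2 * x\<^sup>2 * w / 12) = S * x\<^sup>2 * w / 12" unfolding S_def by (simp add: sum_distrib_right sum_divide_distrib)
    ultimately have 2: "\<bar>1 - (\<Prod>i<n. 1 - t i x w)\<bar> \<le> S * x\<^sup>2 * w / 12" using w1 by linarith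
    have "\<bar>N w x\<bar> \<le> 4 / 3 * x ^ 4 * w + 4 * x\<^sup>2 * (S * x\<^sup>2 * w / 12)"
    proof -
      have "\<bar>4 * x\<^sup>2 * (1 - (\<Prod>i<n. 1 - t i x w))\<bar> \<le> 4 * x\<^sup>2 * (S * x\<^sup>2 * w / 12)"
        unfolding abs_mult using 2 by (intro mult_mono) auto
      then show ?thesis using 1 unfolding N_def by linarith
    qed
    also have "\<dots> = ((4 / 3 + S / 3) * x ^ (2 * 2)) * w" by (simp add: algebra_simps eval_nat_numeral)
    finally show ?thesis using that by (simp add: abs_divide divide_le_eq)
  qed
  have Fint: "set_integrable lborel {0<..} (F w)" if "w > 0" for w
  proof (rule set_integrable_halfline[where B = "4 * 4 ^ n"])
    show "F w \<in> borel_measurable borel" unfolding F_def P_def by measurable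
    fix x :: real assume x: "0 < x"
    show "\<bar>F w x\<bar> \<le> 4 * 4 ^ n / (1 + x\<^sup>2)"
    proof (cases "sqrt w * x < \<epsilon>")
      case True
      have "\<bar>sn 2 (sqrt w * x) / w\<bar> \<le> 4 * x ^ (2 * 1)" using qup[OF that, of 2 x] sn_nonneg[of 2 "sqrt w * x"] that by simp
      from rescaled_bound[OF that x True X eps(2) _ this] n show ?thesis unfolding F_def P_def using True by simp
    qed (simp add: F_def)
  qed
  have K0int: "set_integrable lborel {0<..} (\<lambda>x. 4 * x\<^sup>2 / PK n X x)" using K_integrable[of n X 1, OF X] n by simp
  have K2int: "set_integrable lborel {0<..} (\<lambda>x. 4 * x ^ 4 / PK n X x)" using K_integrable[of n X 2, OF X] n by simp
  have A: "((\<lambda>w. LINT x:{0<..}|lborel. h w x) \<longlongrightarrow> (LINT x:{0<..}|lborel. L x)) (at_right 0)"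
  proof (rule dominated_halfline[where \<delta> = 1 and B = "(4 / 3 + S / 3) * 4 ^ n + 4 / \<epsilon>\<^sup>2"])
    show "h w \<in> borel_measurable borel" for w unfolding h_def F_def P_def by measurable
    show "L \<in> borel_measurable borel" unfolding L_def by measurable
    fix w x :: real assume w: "0 < w" "w < 1" and x: "0 < x"
    have p1: "1 + x\<^sup>2 > 0" by (intro add_pos_nonneg) auto
    show "\<bar>h w x\<bar> \<le> ((4 / 3 + S / 3) * 4 ^ n + 4 / \<epsilon>\<^sup>2) / (1 + x\<^sup>2)"
    proof (cases "sqrt w * x < \<epsilon>")
      case True
      then have "h w x = (N w x / w) / P w x" unfolding h_def F_def using split[OF w(1), of x] by simp
      then have "\<bar>h w x\<bar> \<le> (4 / 3 + S / 3) * 4 ^ n / (1 + x\<^sup>2)"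
        using rescaled_bound[OF w(1) x True X eps(2) _ Nb[OF w(1) x]] n unfolding P_def by simp
      also have "\<dots> \<le> ((4 / 3 + S / 3) * 4 ^ n + 4 / \<epsilon>\<^sup>2) / (1 + x\<^sup>2)" using p1 by (intro divide_right_mono) auto
      finally show ?thesis .
    next
      case False
      \<comment> \<open>Beyond the cut-off the limit function alone remains, divided by
        \<open>w\<close>. There 1 / w \<le> x^2 / \<epsilon>^2, which turns it into a multiple of
        the integrand of \<open>K2\<close>; its integrability uses n \<ge> 3.\<close>
      then have "\<epsilon>\<^sup>2 \<le> (sqrt w * x)\<^sup>2" using eps(1) by (intro power_mono) auto
      then have le: "\<epsilon>\<^sup>2 \<le> w * x\<^sup>2" using w by (simp add: power_mult_distrib)
      have "\<bar>h w x\<bar> = (4 * x\<^sup>2 / PK n X x) / w" using False w PK_pos[of n X x] by (simp add: h_def F_def)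
      also have "\<dots> = (4 * x ^ 4 / PK n X x) * (1 / (w * x\<^sup>2))" using w x by (simp add: eval_nat_numeral)
      also have "\<dots> \<le> (4 * x ^ 4 / PK n X x) * (1 / \<epsilon>\<^sup>2)"
        using le eps(1) w x PK_pos[of n X x] by (intro mult_left_mono divide_left_mono) (auto intro!: mult_pos_pos)
      also have "\<dots> \<le> (4 / (1 + x\<^sup>2)) * (1 / \<epsilon>\<^sup>2)"
        using K_integrand_bound[of n X 2 x, OF X] n PK_pos[of n X x] by (intro mult_right_mono) (auto simp: abs_of_pos)
      also have "\<dots> \<le> ((4 / 3 + S / 3) * 4 ^ n + 4 / \<epsilon>\<^sup>2) / (1 + x\<^sup>2)"
      proof -
        have "(4 / (1 + x\<^sup>2)) * (1 / \<epsilon>\<^sup>2) = (4 / \<epsilon>\<^sup>2) / (1 + x\<^sup>2)" by simp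
        also have "\<dots> \<le> ((4 / 3 + S / 3) * 4 ^ n + 4 / \<epsilon>\<^sup>2) / (1 + x\<^sup>2)" using p1 S0 by (intro divide_right_mono) auto
        finally show ?thesis .
      qed
      finally show ?thesis .
    qed
  next
    fix x :: real assume x: "0 < x"
    have X0: "X i > 0" if "i < n" for i using X[OF that] by simp
    have tt: "((\<lambda>w. t i x w / w) \<longlongrightarrow> ((X i) ^ 4 * x ^ 4 / 12) / (1 + (X i)\<^sup>2 * x\<^sup>2)) (at_right 0)" if "i < n" for i
    proof -
      have "((\<lambda>w. - ((sn (X i) (sqrt w * x) / w - (X i)\<^sup>2 * x\<^sup>2) / w) / (1 + (X i)\<^sup>2 * x\<^sup>2)) \<longlongrightarrow> - (- ((X i) ^ 4 * x ^ 4 / 12)) / (1 + (X i)\<^sup>2 * x\<^sup>2)) (at_right 0)"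
        by (intro tendsto_intros sn_expansion X0 that x) (use p[of i x] in simp)
      moreover have "- ((sn (X i) (sqrt w * x) / w - (X i)\<^sup>2 * x\<^sup>2) / w) / (1 + (X i)\<^sup>2 * x\<^sup>2) = t i x w / w" for w
        unfolding t_def minus_divide_left minus_diff_eq by simp
      ultimately show ?thesis by simp
    qed
    note pr = one_minus_prod_tendsto[of n "\<lambda>i w. t i x w", OF tt]
    have Plim: "((\<lambda>w. P w x) \<longlongrightarrow> PK n X x) (at_right 0)"
      unfolding P_def PK_def by (intro tendsto_intros sn_over_tendsto x X0) auto
    have s4: "((\<lambda>w. (sn 2 (sqrt w * x) / w - 2\<^sup>2 * x\<^sup>2) / w) \<longlongrightarrow> - (2 ^ 4 * x ^ 4 / 12)) (at_right 0)" by (rule sn_expansion) (use x in auto)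
    have "((\<lambda>w. ((sn 2 (sqrt w * x) / w - 2\<^sup>2 * x\<^sup>2) / w + 4 * x\<^sup>2 * ((1 - (\<Prod>i<n. 1 - t i x w)) / w)) / P w x) \<longlongrightarrow>
       (- (2 ^ 4 * x ^ 4 / 12) + 4 * x\<^sup>2 * (\<Sum>i<n. ((X i) ^ 4 * x ^ 4 / 12) / (1 + (X i)\<^sup>2 * x\<^sup>2))) / PK n X x) (at_right 0)"
      by (intro tendsto_intros s4 conjunct2[OF pr] Plim) (use PK_pos[of n X x] in linarith)+
    also have "(- (2 ^ 4 * x ^ 4 / 12) + 4 * x\<^sup>2 * (\<Sum>i<n. ((X i) ^ 4 * x ^ 4 / 12) / (1 + (X i)\<^sup>2 * x\<^sup>2))) / PK n X x = L x" by (simp add: L_def)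
    finally show "((\<lambda>w. h w x) \<longlongrightarrow> L x) (at_right 0)"
    proof (rule Lim_transform_eventually)
      show "\<forall>\<^sub>F w in at_right 0. ((sn 2 (sqrt w * x) / w - 2\<^sup>2 * x\<^sup>2) / w + 4 * x\<^sup>2 * ((1 - (\<Prod>i<n. 1 - t i x w)) / w)) / P w x = h w x"
        using eventually_at_right_less[of 0] eventually_sqrt_less[OF eps(1) x]
      proof eventually_elim
        case (elim w)
        then have "h w x = (N w x / P w x) / w" unfolding h_def F_def using split[OF elim(1), of x] by simp
        also have "\<dots> = (N w x / w) / P w x" by simp
        also have "N w x / w = (sn 2 (sqrt w * x) / w - 2\<^sup>2 * x\<^sup>2) / w + 4 * x\<^sup>2 * ((1 - (\<Prod>i<n. 1 - t i x w)) / w)"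
          unfolding N_def by (simp add: add_divide_distrib)
        finally show ?case by simp
      qed
    qed
  qed simp
  have B: "(LINT x:{0<..}|lborel. L x) = (S / 12 - 1 / 3) * K2 n X - K0 n X / 8"
  proof -
    define M where "M = (\<lambda>x. 4 * x\<^sup>2 / PK n X x * (\<Sum>i<n. (X i)\<^sup>2 * x\<^sup>2 / (1 + (X i)\<^sup>2 * x\<^sup>2)))"
    have L: "L x = (S / 12 - 1 / 3) * (4 * x ^ 4 / PK n X x) - 1 / 12 * M x" for x
    proof -
      have "(\<Sum>i<n. ((X i) ^ 4 * x ^ 4 / 12) / (1 + (X i)\<^sup>2 * x\<^sup>2)) = (\<Sum>i<n. (X i)\<^sup>2 * x\<^sup>2 / 12 - (1 / 12) * ((X i)\<^sup>2 * x\<^sup>2 / (1 + (X i)\<^sup>2 * x\<^sup>2)))"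
      proof (rule sum.cong[OF refl])
        fix i
        define q where "q = (X i)\<^sup>2 * x\<^sup>2"
        have q: "1 + q \<noteq> 0" using p[of i x] by (simp add: q_def)
        have "(X i) ^ 4 * x ^ 4 = q * q" by (simp add: q_def eval_nat_numeral)
        then show "((X i) ^ 4 * x ^ 4 / 12) / (1 + (X i)\<^sup>2 * x\<^sup>2) = (X i)\<^sup>2 * x\<^sup>2 / 12 - (1 / 12) * ((X i)\<^sup>2 * x\<^sup>2 / (1 + (X i)\<^sup>2 * x\<^sup>2))"
          unfolding q_def[symmetric] using square_over_one_plus[OF q] by simp
      qed
      also have "\<dots> = S * x\<^sup>2 / 12 - (1 / 12) * (\<Sum>i<n. (X i)\<^sup>2 * x\<^sup>2 / (1 + (X i)\<^sup>2 * x\<^sup>2))"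
        by (simp add: sum_subtractf S_def sum_distrib_right sum_divide_distrib sum_distrib_left)
      finally have e: "(\<Sum>i<n. ((X i) ^ 4 * x ^ 4 / 12) / (1 + (X i)\<^sup>2 * x\<^sup>2)) = S * x\<^sup>2 / 12 - (1 / 12) * (\<Sum>i<n. (X i)\<^sup>2 * x\<^sup>2 / (1 + (X i)\<^sup>2 * x\<^sup>2))" .
      have num: "- (4 / 3) * x ^ 4 + 4 * x\<^sup>2 * (S * x\<^sup>2 / 12 - (1 / 12) * T) = (S / 12 - 1 / 3) * (4 * x ^ 4) - 1 / 12 * (4 * x\<^sup>2 * T)" for T
        by (simp add: algebra_simps power2_eq_square power4_eq_xxxx)
      show ?thesis unfolding L_def e M_def num diff_divide_distrib by simp
    qed
    have "(LINT x:{0<..}|lborel. L x) = (S / 12 - 1 / 3) * K2 n X - 1 / 12 * (LINT x:{0<..}|lborel. M x)"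
    proof -
      have iM: "set_integrable lborel {0<..} M" unfolding M_def by (rule set_integrable_PK_term[OF X]) (use n in auto)
      show ?thesis unfolding L K2_def
        by (simp only: set_integral_diff(2)[OF set_integrable_mult_right[OF K2int] set_integrable_mult_right[OF iM]] set_integral_mult_right)
    qed
    also have "(LINT x:{0<..}|lborel. M x) = 3 / 2 * K0 n X" unfolding M_def using K_by_parts[of n X, OF X] n by simp
    finally show ?thesis by simp
  qed
  have C: "\<forall>\<^sub>F w in at_right 0. (LINT x:{0<..}|lborel. h w x) = (wscale n w * (LINT \<theta>:{0<..<\<epsilon>}|lborel. sn 2 \<theta> / (\<Prod>i<n. w + sn (X i) \<theta>)) - K0 n X) / w"
    using eventually_at_right_less[of 0]
  proof eventually_elim
    case (elim w)
    have "(LINT x:{0<..}|lborel. h w x) = ((LINT x:{0<..}|lborel. F w x) - K0 n X) / w"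
      unfolding h_def K0_def set_integral_divide_zero by (subst set_integral_diff(2)[OF Fint[OF elim] K0int]) simp
    moreover have "(LINT x:{0<..}|lborel. F w x) = wscale n w * (LINT \<theta>:{0<..<\<epsilon>}|lborel. sn 2 \<theta> / (\<Prod>i<n. w + sn (X i) \<theta>))"
      using peak_rescale[OF elim, of n \<epsilon> "\<lambda>_. 1" X] by (simp add: F_def P_def)
    ultimately show ?case by simp
  qed
  show ?thesis using Lim_transform_eventually[OF A C] unfolding B S_def .
qed

section \<open>The part of the interval away from the peaks\<close>

lemma LINT_bounded:
  fixes g :: "real \<Rightarrow> real"
  assumes [measurable]: "g \<in> borel_measurable borel" "S \<in> sets borel" and S: "S \<subseteq> {0..pi}"
    and B: "\<And>x. x \<in> S \<Longrightarrow> \<bar>g x\<bar> \<le> B" and B0: "0 \<le> B"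
  shows "set_integrable lborel S g" "\<bar>LINT x:S|lborel. g x\<bar> \<le> pi * B"
proof -
  have c: "set_integrable lborel {0..pi} (\<lambda>_. B)" unfolding set_integrable_def by simp
  show i: "set_integrable lborel S g"
  proof (rule set_integrable_bound)
    show "set_integrable lborel S (\<lambda>_. B)" by (rule set_integrable_subset[OF c]) (use S in auto)
    show "set_borel_measurable lborel S g" unfolding set_borel_measurable_def by measurable
  qed (use B B0 in auto)
  have "\<bar>LINT x:S|lborel. g x\<bar> \<le> (\<integral>x. \<bar>indicator S x *\<^sub>R g x\<bar> \<partial>lborel)"
    unfolding set_lebesgue_integral_def by (rule integral_abs_bound)
  also have "\<dots> \<le> (\<integral>x. indicator {0..pi} x *\<^sub>R B \<partial>lborel)"
  proof (rule integral_mono)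
    show "integrable lborel (\<lambda>x. \<bar>indicator S x *\<^sub>R g x\<bar>)" using i unfolding set_integrable_def by (rule integrable_abs)
    show "integrable lborel (\<lambda>x. indicator {0..pi} x *\<^sub>R B)" using c by (simp add: set_integrable_def)
  qed (use B B0 S in \<open>auto split: split_indicator\<close>)
  also have "\<dots> = pi * B" by simp
  finally show "\<bar>LINT x:S|lborel. g x\<bar> \<le> pi * B" .
qed

text \<open>Scaling turns the bound K / w^(n - m) into a multiple of w^(m - 3/2). After division by
  w^(m - 2), the order of the coefficient to be extracted, a factor sqrt w is left.\<close>

lemma negligible_part:
  fixes g :: "real \<Rightarrow> real \<Rightarrow> real"
  assumes "\<And>w. g w \<in> borel_measurable borel" "S \<in> sets borel" "S \<subseteq> {0..pi}" "0 \<le> K" "2 \<le> m" "m \<le> n"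
    and "\<And>w x. 0 < w \<Longrightarrow> w < 1 \<Longrightarrow> x \<in> S \<Longrightarrow> \<bar>g w x\<bar> \<le> K / w ^ (n - m)"
  shows "((\<lambda>w. wscale n w / w ^ (m - 2) * (LINT x:S|lborel. g w x)) \<longlongrightarrow> 0) (at_right 0)"
proof (rule Lim_null_comparison)
  have "((\<lambda>w. pi * K * sqrt w) \<longlongrightarrow> pi * K * sqrt 0) (at_right 0)" by (intro tendsto_intros)
  then show "((\<lambda>w. pi * K * sqrt w) \<longlongrightarrow> 0) (at_right 0)" by simp
  have "\<forall>\<^sub>F w in at_right (0::real). w < 1" using eventually_at_right_real[of 0 1] by (auto elim: eventually_mono)
  then show "\<forall>\<^sub>F w in at_right 0. norm (wscale n w / w ^ (m - 2) * (LINT x:S|lborel. g w x)) \<le> pi * K * sqrt w"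
    using eventually_at_right_less[of 0]
  proof eventually_elim
    case (elim w)
    have b: "\<bar>LINT x:S|lborel. g w x\<bar> \<le> pi * (K / w ^ (n - m))"
      by (rule LINT_bounded(2)) (use assms elim in auto)
    have w: "w > 0" by (fact elim)
    have pos: "wscale n w / w ^ (m - 2) \<ge> 0" using w by (simp add: wscale_def)
    have "norm (wscale n w / w ^ (m - 2) * (LINT x:S|lborel. g w x)) = wscale n w / w ^ (m - 2) * \<bar>LINT x:S|lborel. g w x\<bar>"
      by (simp only: real_norm_def abs_mult[of "wscale n w / w ^ (m - 2)"] abs_of_nonneg[OF pos])
    also have "\<dots> \<le> wscale n w / w ^ (m - 2) * (pi * (K / w ^ (n - m)))" by (rule mult_left_mono[OF b pos])
    also have "\<dots> = pi * K * sqrt w"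
    proof -
      have "n = (m - 2) + (n - m) + 2" using assms(5,6) by simp
      then have "w ^ n = w ^ ((m - 2) + (n - m) + 2)" by (rule arg_cong)
      then have 1: "w ^ n = w ^ (m - 2) * w ^ (n - m) * w\<^sup>2" by (simp only: power_add)
      define c where "c = w * sqrt w"
      have c: "c \<noteq> 0" using w by (simp add: c_def)
      have 2: "w\<^sup>2 = c * sqrt w" using w by (simp add: c_def power2_eq_square mult.assoc)
      have "wscale n w = w ^ (m - 2) * w ^ (n - m) * (c * sqrt w) / c"
        unfolding wscale_def c_def[symmetric] 1 2 ..
      also have "\<dots> = w ^ (m - 2) * w ^ (n - m) * sqrt w" using c by simp
      finally have "wscale n w = w ^ (m - 2) * w ^ (n - m) * sqrt w" .
      then show ?thesis using w by simp
    qed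
    finally show ?case .
  qed
qed

lemma prod_add_ge:
  fixes s :: "nat \<Rightarrow> real"
  assumes "finite A" "I \<subseteq> A" "\<And>i. i \<in> A \<Longrightarrow> 0 \<le> s i" "0 \<le> w"
  shows "w ^ (card A - card I) * (\<Prod>i\<in>I. s i) \<le> (\<Prod>i\<in>A. w + s i)"
proof -
  have fI: "finite I" using assms finite_subset by blast
  have "(\<Prod>i\<in>A. w + s i) = (\<Prod>i\<in>A - I. w + s i) * (\<Prod>i\<in>I. w + s i)" by (rule prod.subset_diff) (use assms in auto)
  moreover have "(\<Prod>i\<in>A - I. w) \<le> (\<Prod>i\<in>A - I. w + s i)" by (rule prod_mono) (use assms in auto)
  moreover have "(\<Prod>i\<in>I. s i) \<le> (\<Prod>i\<in>I. w + s i)" by (rule prod_mono) (use assms in auto)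
  moreover have "(\<Prod>i\<in>A - I. w) = w ^ (card A - card I)" using fI assms(2) by (simp add: card_Diff_subset)
  ultimately show ?thesis using assms by (auto intro!: mult_mono prod_nonneg add_nonneg_nonneg)
qed

text \<open>Which \<open>m\<close> factors survive depends on \<theta>. The sum \<open>E\<close>
  over all m-subsets of their products is continuous and positive on the compact set, hence bounded
  below, and each summand times w^(n - m) is at most the full product.\<close>

lemma compact_prod_bound:
  assumes S: "compact S" and m: "\<And>\<theta>. \<theta> \<in> S \<Longrightarrow> m \<le> card {i\<in>{..<n}. sn (X i) \<theta> \<noteq> 0}"
  shows "\<exists>c>0. \<forall>\<theta>\<in>S. \<forall>w>0. c * w ^ (n - m) \<le> (\<Prod>i<n. w + sn (X i) \<theta>)"
proof (cases "S = {}")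
  case False
  define \<I> where "\<I> = {I. I \<subseteq> {..<n} \<and> card I = m}"
  define E where "E = (\<lambda>\<theta>. \<Sum>I\<in>\<I>. \<Prod>i\<in>I. sn (X i) \<theta>)"
  have fI: "finite \<I>" unfolding \<I>_def by simp
  have cont: "continuous_on S E" unfolding E_def by (intro continuous_intros)
  have pos: "E \<theta> > 0" if "\<theta> \<in> S" for \<theta>
  proof -
    from m[OF that] obtain I where I: "I \<subseteq> {i\<in>{..<n}. sn (X i) \<theta> \<noteq> 0}" "card I = m" "finite I"
      by (rule obtain_subset_with_card_n)
    have "0 < (\<Prod>i\<in>I. sn (X i) \<theta>)" using I sn_nonneg by (intro prod_pos) (auto simp: less_le)
    moreover have "I \<in> \<I>" using I by (auto simp: \<I>_def)
    ultimately show ?thesis unfolding E_def using fI sn_nonneg by (intro sum_pos2[of _ I]) (auto intro: prod_nonneg)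
  qed
  obtain \<theta>0 where t0: "\<theta>0 \<in> S" "\<And>\<theta>. \<theta> \<in> S \<Longrightarrow> E \<theta>0 \<le> E \<theta>"
    using continuous_attains_inf[OF S False cont] by blast
  have "\<I> \<noteq> {}" using pos[OF t0(1)] by (auto simp: E_def)
  then have cI: "card \<I> > 0" using fI by (simp add: card_gt_0_iff)
  have "E \<theta>0 / card \<I> * w ^ (n - m) \<le> (\<Prod>i<n. w + sn (X i) \<theta>)" if "\<theta> \<in> S" "w > 0" for \<theta> w
  proof -
    have "w ^ (n - m) * E \<theta> = (\<Sum>I\<in>\<I>. w ^ (n - m) * (\<Prod>i\<in>I. sn (X i) \<theta>))" by (simp add: E_def sum_distrib_left)
    also have "\<dots> \<le> (\<Sum>I\<in>\<I>. \<Prod>i<n. w + sn (X i) \<theta>)"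
    proof (rule sum_mono)
      fix I assume "I \<in> \<I>"
      then show "w ^ (n - m) * (\<Prod>i\<in>I. sn (X i) \<theta>) \<le> (\<Prod>i<n. w + sn (X i) \<theta>)"
        using prod_add_ge[of "{..<n}" I "\<lambda>i. sn (X i) \<theta>" w] that sn_nonneg by (auto simp: \<I>_def)
    qed
    also have "\<dots> = card \<I> * (\<Prod>i<n. w + sn (X i) \<theta>)" by simp
    finally have "w ^ (n - m) * E \<theta> \<le> card \<I> * (\<Prod>i<n. w + sn (X i) \<theta>)" .
    moreover have "w ^ (n - m) * E \<theta>0 \<le> w ^ (n - m) * E \<theta>" using t0(2) that by (intro mult_left_mono) auto
    ultimately show ?thesis using cI by (simp add: field_simps)
  qed
  moreover have "E \<theta>0 / card \<I> > 0" using pos[OF t0(1)] cI by simp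
  ultimately show ?thesis by blast
qed (auto intro: exI[of _ 1])

section \<open>The peaks at both ends of the interval\<close>

definition Gint :: "nat \<Rightarrow> (nat \<Rightarrow> nat) \<Rightarrow> real \<Rightarrow> real" where
  "Gint n b w = (LINT \<theta>:{0<..<pi}|lborel. sn 2 \<theta> / (\<Prod>i<n. w + sn (b i) \<theta>))"

lemma sn_reflect:
  "sn (real b) (pi - \<theta>) = (if even b then sn (real b) \<theta> else 4 - sn (real b) \<theta>)"
proof -
  have "cos (real b * (pi - \<theta>)) = cos (real b * pi) * cos (real b * \<theta>)"
    by (simp add: right_diff_distrib cos_diff sin_npi)
  then show ?thesis by (simp add: sn_cos cos_npi)
qed

lemma LINT_reflect:
  fixes g :: "real \<Rightarrow> real"
  shows "(LINT \<theta>:{pi - \<epsilon><..<pi}|lborel. g \<theta>) = (LINT \<theta>:{0<..<\<epsilon>}|lborel. g (pi - \<theta>))"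
proof -
  have "(LINT \<theta>:{pi - \<epsilon><..<pi}|lborel. g \<theta>) = \<bar>- 1\<bar> *\<^sub>R (\<integral>x. indicator {pi - \<epsilon><..<pi} (pi + (- 1) * x) *\<^sub>R g (pi + (- 1) * x) \<partial>lborel)"
    unfolding set_lebesgue_integral_def by (rule lborel_integral_real_affine) simp
  also have "(\<lambda>x. indicator {pi - \<epsilon><..<pi} (pi + (- 1) * x) *\<^sub>R g (pi + (- 1) * x)) = (\<lambda>x. indicator {0<..<\<epsilon>} x *\<^sub>R g (pi - x))"
    by (auto simp: fun_eq_iff indicator_def)
  finally show ?thesis by (simp add: set_lebesgue_integral_def)
qed

text \<open>The bound \<open>m\<close> on the number of nonvanishing factors is uniform in \<theta>.
  It is a parameter so that the leading term (\<open>m = 2\<close>) and the second term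
  (\<open>m = 3\<close>) share the estimates.\<close>

locale peaks =
  fixes n :: nat and b :: "nat \<Rightarrow> nat" and m :: nat
  assumes b: "\<And>i. i < n \<Longrightarrow> b i \<ge> 1" and m: "2 \<le> m" "m \<le> n"
    and count: "\<And>\<theta>. 0 < \<theta> \<Longrightarrow> \<theta> < pi \<Longrightarrow> m \<le> card {i\<in>{..<n}. sn (b i) \<theta> \<noteq> 0}"
begin

text \<open>The summand 1 in the denominator gives eps \<le> 1, so that the neighbourhoods of 0 and
  \<pi> are disjoint.\<close>

definition eps :: real where "eps = 1 / (1 + (\<Sum>i<n. real (b i)))"

lemma eps_pos: "eps > 0"
  unfolding eps_def by (intro divide_pos_pos add_pos_nonneg sum_nonneg) auto

lemma eps_le: "i < n \<Longrightarrow> real (b i) * eps \<le> 1"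
proof -
  assume "i < n"
  then have "real (b i) \<le> (\<Sum>i<n. real (b i))" by (intro member_le_sum) auto
  then have "real (b i) \<le> 1 + (\<Sum>i<n. real (b i))" by simp
  moreover have "0 < 1 + (\<Sum>i<n. real (b i))" by (intro add_pos_nonneg sum_nonneg) auto
  ultimately show ?thesis by (simp add: eps_def divide_le_eq)
qed

lemma X1: "i < n \<Longrightarrow> 1 \<le> real (b i)" using b by (simp add: Suc_leI)

lemma eps_lt: "eps \<le> 1"
  unfolding eps_def by (simp add: divide_le_eq sum_nonneg)

lemma pi_eps: "eps < pi - eps" using eps_lt pi_gt3 by linarith

definition integrand :: "real \<Rightarrow> real \<Rightarrow> real" where
  "integrand w \<theta> = sn 2 \<theta> / (\<Prod>i<n. w + sn (b i) \<theta>)"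

lemma integrand_measurable [measurable]: "integrand w \<in> borel_measurable borel"
  unfolding integrand_def by measurable

lemma integrand_bound: "0 < w \<Longrightarrow> \<bar>integrand w \<theta>\<bar> \<le> 4 / w ^ n"
proof -
  assume w: "0 < w"
  have "w ^ n = (\<Prod>i<n. w)" by simp
  also have "\<dots> \<le> (\<Prod>i<n. w + sn (b i) \<theta>)" by (rule prod_mono) (use w sn_nonneg in auto)
  finally have "w ^ n \<le> (\<Prod>i<n. w + sn (b i) \<theta>)" .
  moreover have "w ^ n > 0" using w by simp
  ultimately show ?thesis unfolding integrand_def using sn_nonneg[of 2 \<theta>] sn_le4[of 2 \<theta>]
    by (subst abs_of_nonneg) (auto intro!: frac_le)
qed

lemma integrand_integrable: "0 < w \<Longrightarrow> S \<in> sets borel \<Longrightarrow> S \<subseteq> {0..pi} \<Longrightarrow> set_integrable lborel S (integrand w)"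
  by (rule LINT_bounded(1)[of _ _ "4 / w ^ n"]) (use integrand_bound in auto)

lemma Gint_split:
  assumes "0 < w"
  shows "Gint n b w = (LINT \<theta>:{0<..<eps}|lborel. integrand w \<theta>) + (LINT \<theta>:{eps..pi - eps}|lborel. integrand w \<theta>)
     + (LINT \<theta>:{0<..<eps}|lborel. integrand w (pi - \<theta>))"
proof -
  note e = eps_pos pi_eps pi_gt_zero
  have "{0<..<pi} = ({0<..<eps} \<union> {eps..pi - eps}) \<union> {pi - eps<..<pi}" using e by auto
  then have "Gint n b w = (LINT \<theta>:({0<..<eps} \<union> {eps..pi - eps}) \<union> {pi - eps<..<pi}|lborel. integrand w \<theta>)"
    by (simp add: Gint_def integrand_def)
  also have "\<dots> = (LINT \<theta>:{0<..<eps} \<union> {eps..pi - eps}|lborel. integrand w \<theta>) + (LINT \<theta>:{pi - eps<..<pi}|lborel. integrand w \<theta>)"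
    by (rule set_integral_Un) (use e in \<open>auto intro!: integrand_integrable assms\<close>)
  also have "(LINT \<theta>:{0<..<eps} \<union> {eps..pi - eps}|lborel. integrand w \<theta>) = (LINT \<theta>:{0<..<eps}|lborel. integrand w \<theta>) + (LINT \<theta>:{eps..pi - eps}|lborel. integrand w \<theta>)"
    by (rule set_integral_Un) (use e in \<open>auto intro!: integrand_integrable assms\<close>)
  finally show ?thesis by (simp add: LINT_reflect)
qed

lemma middle_negligible:
  "((\<lambda>w. wscale n w / w ^ (m - 2) * (LINT \<theta>:{eps..pi - eps}|lborel. integrand w \<theta>)) \<longlongrightarrow> 0) (at_right 0)"
proof -
  obtain c where c: "c > 0" "\<And>\<theta> w. \<theta> \<in> {eps..pi - eps} \<Longrightarrow> w > 0 \<Longrightarrow> c * w ^ (n - m) \<le> (\<Prod>i<n. w + sn (b i) \<theta>)"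
    using compact_prod_bound[of "{eps..pi - eps}" m n "\<lambda>i. real (b i)"] count eps_pos pi_eps by force
  show ?thesis
  proof (rule negligible_part[where K = "4 / c"])
    fix w \<theta> :: real assume w: "0 < w" and t: "\<theta> \<in> {eps..pi - eps}"
    have "c * w ^ (n - m) > 0" using c w by simp
    then have "\<bar>integrand w \<theta>\<bar> \<le> 4 / (c * w ^ (n - m))"
      unfolding integrand_def using c(2)[OF t w] sn_nonneg[of 2 \<theta>] sn_le4[of 2 \<theta>]
      by (subst abs_of_nonneg) (auto intro!: frac_le)
    then show "\<bar>integrand w \<theta>\<bar> \<le> 4 / c / w ^ (n - m)" by simp
  qed (use c m eps_pos in auto)
qed

lemma reflected_even:
  assumes "\<And>i. i < n \<Longrightarrow> even (b i)"
  shows "integrand w (pi - \<theta>) = integrand w \<theta>"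
  unfolding integrand_def using assms sn_reflect[of 2 \<theta>] by (simp add: sn_reflect)

text \<open>Near \<pi> a factor of odd weight is close to 4 instead of 0. Already m - 1 odd weights
  suffice, because the numerator compensates one even factor: sn 2 \<le> 4 (w + sn b) for even b
  \<ge> 2.\<close>

lemma reflected_negligible:
  assumes odd: "m - 1 \<le> card {i\<in>{..<n}. odd (b i)}"
  shows "((\<lambda>w. wscale n w / w ^ (m - 2) * (LINT \<theta>:{0<..<eps}|lborel. integrand w (pi - \<theta>))) \<longlongrightarrow> 0) (at_right 0)"
proof (rule negligible_part[where K = 4])
  fix w \<theta> :: real assume w: "0 < w" "w < 1" and t: "\<theta> \<in> {0<..<eps}"
  define Od where "Od = {i\<in>{..<n}. odd (b i)}"
  define E where "E = {i\<in>{..<n}. even (b i)}"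
  have split: "{..<n} = E \<union> Od" "E \<inter> Od = {}" "finite E" "finite Od" by (auto simp: E_def Od_def)
  have "card {..<n} = card E + card Od" unfolding split(1) by (rule card_Un_disjoint[OF split(3,4,2)])
  then have "card E + card Od = n" by simp
  then have cE: "card E - 1 \<le> n - m" using odd m by (simp add: Od_def)
  have small: "sn (b i) \<theta> \<le> 1" if "i < n" for i
  proof -
    have "real (b i) * \<theta> \<le> real (b i) * eps" using t by (intro mult_left_mono) auto
    then have "real (b i) * \<theta> \<le> 1" using eps_le[OF that] by linarith
    then have "(real (b i) * \<theta>)\<^sup>2 \<le> 1\<^sup>2" using t by (intro power_mono) auto
    then show ?thesis using sn_upper[of "b i" \<theta>] by simp
  qed
  have "(\<Prod>i<n. w + sn (b i) (pi - \<theta>)) = (\<Prod>i\<in>E. w + sn (b i) (pi - \<theta>)) * (\<Prod>i\<in>Od. w + sn (b i) (pi - \<theta>))"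
    unfolding split(1) by (rule prod.union_disjoint[OF split(3,4,2)])
  also have "(\<Prod>i\<in>E. w + sn (b i) (pi - \<theta>)) = (\<Prod>i\<in>E. w + sn (b i) \<theta>)"
    by (rule prod.cong) (auto simp: E_def sn_reflect)
  finally have P: "(\<Prod>i<n. w + sn (b i) (pi - \<theta>)) = (\<Prod>i\<in>E. w + sn (b i) \<theta>) * (\<Prod>i\<in>Od. w + sn (b i) (pi - \<theta>))" .
  have PE0: "0 < (\<Prod>i\<in>E. w + sn (b i) \<theta>)" by (rule prod_pos) (use w sn_nonneg in \<open>auto intro: add_pos_nonneg\<close>)
  have "1 \<le> (\<Prod>i\<in>Od. w + sn (b i) (pi - \<theta>))"
  proof (rule prod_ge_1)
    fix i assume "i \<in> Od"
    then have "odd (b i)" "i < n" by (auto simp: Od_def)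
    then show "1 \<le> w + sn (b i) (pi - \<theta>)" using small[of i] w by (simp add: sn_reflect)
  qed
  then have PP: "(\<Prod>i\<in>E. w + sn (b i) \<theta>) \<le> (\<Prod>i<n. w + sn (b i) (pi - \<theta>))"
    unfolding P using PE0 mult_left_mono[of 1 _ "\<Prod>i\<in>E. w + sn (b i) \<theta>"] by simp
  have "\<bar>integrand w (pi - \<theta>)\<bar> = sn 2 \<theta> / (\<Prod>i<n. w + sn (b i) (pi - \<theta>))"
    unfolding integrand_def using sn_reflect[of 2 \<theta>] PE0 PP sn_nonneg[of 2 \<theta>] by simp
  also have "\<dots> \<le> sn 2 \<theta> / (\<Prod>i\<in>E. w + sn (b i) \<theta>)" using PE0 PP sn_nonneg by (intro divide_left_mono mult_pos_pos) auto
  also have "\<dots> \<le> 4 / w ^ (n - m)"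
  proof (cases "E = {}")
    case True
    have "sn 2 \<theta> / (\<Prod>i\<in>E. w + sn (b i) \<theta>) \<le> 4" using True sn_le4 by simp
    also have "4 \<le> 4 / w ^ (n - m)" using w by (simp add: le_divide_eq power_le_one)
    finally show ?thesis .
  next
    case False
    then obtain c where c: "c \<in> E" by blast
    then have "even (b c)" "b c \<ge> 1" "c < n" using b by (auto simp: E_def)
    then have b2: "real (b c) \<ge> 2" by (auto elim!: evenE)
    have ct: "real (b c) * \<theta> \<le> 2"
      using mult_left_mono[of \<theta> eps "real (b c)"] eps_le[OF \<open>c < n\<close>] t by simp
    have "sn 2 \<theta> \<le> (2 * \<theta>)\<^sup>2" by (rule sn_upper)
    also have "\<dots> \<le> (real (b c) * \<theta>)\<^sup>2" using b2 t by (intro power_mono mult_right_mono) auto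
    also have "\<dots> \<le> 4 * sn (b c) \<theta>" using sn_lower[of \<theta> "b c"] t ct by simp
    finally have s2: "sn 2 \<theta> \<le> 4 * (w + sn (b c) \<theta>)" using w by simp
    have "(w + sn (b c) \<theta>) * w ^ (card E - 1) \<le> (\<Prod>i\<in>E. w + sn (b i) \<theta>)"
    proof -
      have "(\<Prod>i\<in>E - {c}. w) \<le> (\<Prod>i\<in>E - {c}. w + sn (b i) \<theta>)" by (rule prod_mono) (use w sn_nonneg in auto)
      then have "w ^ (card E - 1) \<le> (\<Prod>i\<in>E - {c}. w + sn (b i) \<theta>)" using c split(3) by simp
      then show ?thesis unfolding prod.remove[OF split(3) c] using w sn_nonneg[of "b c" \<theta>] by (intro mult_left_mono) auto
    qed
    moreover have "w ^ (n - m) \<le> w ^ (card E - 1)" using w cE by (intro power_decreasing) auto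
    then have "(w + sn (b c) \<theta>) * w ^ (n - m) \<le> (w + sn (b c) \<theta>) * w ^ (card E - 1)" using w sn_nonneg[of "b c" \<theta>] by (intro mult_left_mono) auto
    ultimately have le: "(w + sn (b c) \<theta>) * w ^ (n - m) \<le> (\<Prod>i\<in>E. w + sn (b i) \<theta>)" by linarith
    have pw: "0 < w + sn (b c) \<theta>" using w sn_nonneg[of "b c" \<theta>] by linarith
    have "sn 2 \<theta> / (\<Prod>i\<in>E. w + sn (b i) \<theta>) \<le> 4 * (w + sn (b c) \<theta>) / ((w + sn (b c) \<theta>) * w ^ (n - m))"
      using s2 le pw w sn_nonneg[of 2 \<theta>] by (intro frac_le) auto
    also have "\<dots> = 4 / w ^ (n - m)"
    proof -
      have "4 * d / (d * v) = 4 / v" if "0 < d" for d v :: real using that by simp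
      then show ?thesis using pw by blast
    qed
    finally show ?thesis .
  qed
  finally show "\<bar>integrand w (pi - \<theta>)\<bar> \<le> 4 / w ^ (n - m)" .
qed (use m eps_lt pi_gt3 in auto)

lemma limit_two:
  assumes m2: "m = 2"
  shows "(\<And>i. i < n \<Longrightarrow> even (b i)) \<Longrightarrow> ((\<lambda>w. wscale n w * Gint n b w) \<longlongrightarrow> 2 * K0 n (\<lambda>i. real (b i))) (at_right 0)"
    and "i < n \<Longrightarrow> odd (b i) \<Longrightarrow> ((\<lambda>w. wscale n w * Gint n b w) \<longlongrightarrow> K0 n (\<lambda>i. real (b i))) (at_right 0)"
proof -
  have p: "((\<lambda>w. wscale n w * (LINT \<theta>:{0<..<eps}|lborel. integrand w \<theta>)) \<longlongrightarrow> K0 n (\<lambda>i. real (b i))) (at_right 0)"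
    using peak_limit[of n "\<lambda>i. real (b i)" eps "\<lambda>_ _. 1" 1 1] m X1 eps_pos eps_le unfolding integrand_def by simp
  have mid: "((\<lambda>w. wscale n w * (LINT \<theta>:{eps..pi - eps}|lborel. integrand w \<theta>)) \<longlongrightarrow> 0) (at_right 0)"
    using middle_negligible m2 by simp
  have ev: "\<forall>\<^sub>F w in at_right 0. wscale n w * (LINT \<theta>:{0<..<eps}|lborel. integrand w \<theta>) + wscale n w * (LINT \<theta>:{eps..pi - eps}|lborel. integrand w \<theta>)
     + wscale n w * (LINT \<theta>:{0<..<eps}|lborel. integrand w (pi - \<theta>)) = wscale n w * Gint n b w"
    using eventually_at_right_less[of 0] by eventually_elim (simp add: Gint_split distrib_left)
  { assume "\<And>i. i < n \<Longrightarrow> even (b i)"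
    then have "((\<lambda>w. wscale n w * (LINT \<theta>:{0<..<eps}|lborel. integrand w (pi - \<theta>))) \<longlongrightarrow> K0 n (\<lambda>i. real (b i))) (at_right 0)"
      using p by (simp add: reflected_even)
    from Lim_transform_eventually[OF tendsto_add[OF tendsto_add[OF p mid] this] ev]
    show "((\<lambda>w. wscale n w * Gint n b w) \<longlongrightarrow> 2 * K0 n (\<lambda>i. real (b i))) (at_right 0)" by simp }
  { assume i: "i < n" "odd (b i)"
    then have "card {i\<in>{..<n}. odd (b i)} > 0" by (auto simp: card_gt_0_iff)
    then have "((\<lambda>w. wscale n w * (LINT \<theta>:{0<..<eps}|lborel. integrand w (pi - \<theta>))) \<longlongrightarrow> 0) (at_right 0)"
      using reflected_negligible m2 by simp
    from Lim_transform_eventually[OF tendsto_add[OF tendsto_add[OF p mid] this] ev]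
    show "((\<lambda>w. wscale n w * Gint n b w) \<longlongrightarrow> K0 n (\<lambda>i. real (b i))) (at_right 0)" by simp }
qed

definition L1 :: real where
  "L1 = ((\<Sum>i<n. (real (b i))\<^sup>2) / 12 - 1 / 3) * K2 n (\<lambda>i. real (b i)) - K0 n (\<lambda>i. real (b i)) / 8"

lemma limit_three:
  assumes m3: "m = 3"
  shows "(\<And>i. i < n \<Longrightarrow> even (b i)) \<Longrightarrow> ((\<lambda>w. (wscale n w * Gint n b w - 2 * K0 n (\<lambda>i. real (b i))) / w) \<longlongrightarrow> 2 * L1) (at_right 0)"
    and "2 \<le> card {i\<in>{..<n}. odd (b i)} \<Longrightarrow> ((\<lambda>w. (wscale n w * Gint n b w - K0 n (\<lambda>i. real (b i))) / w) \<longlongrightarrow> L1) (at_right 0)"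
    and "b 0 = 1 \<Longrightarrow> (\<And>i. 0 < i \<Longrightarrow> i < n \<Longrightarrow> even (b i)) \<Longrightarrow>
      ((\<lambda>w. (wscale n w * Gint n b w - K0 n (\<lambda>i. real (b i))) / w) \<longlongrightarrow> L1 + K0 (n - 1) (\<lambda>i. real (b (Suc i))) / 4) (at_right 0)"
proof -
  have p: "((\<lambda>w. (wscale n w * (LINT \<theta>:{0<..<eps}|lborel. integrand w \<theta>) - K0 n (\<lambda>i. real (b i))) / w) \<longlongrightarrow> L1) (at_right 0)"
    using peak_expansion[of n "\<lambda>i. real (b i)" eps] m m3 X1 eps_pos eps_le unfolding integrand_def L1_def by simp
  have mid: "((\<lambda>w. wscale n w / w * (LINT \<theta>:{eps..pi - eps}|lborel. integrand w \<theta>)) \<longlongrightarrow> 0) (at_right 0)"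
    using middle_negligible m3 by simp
  have ev: "\<forall>\<^sub>F w in at_right 0. (wscale n w * (LINT \<theta>:{0<..<eps}|lborel. integrand w \<theta>) - K0 n (\<lambda>i. real (b i))) / w + wscale n w / w * (LINT \<theta>:{eps..pi - eps}|lborel. integrand w \<theta>)
     + wscale n w / w * (LINT \<theta>:{0<..<eps}|lborel. integrand w (pi - \<theta>)) = (wscale n w * Gint n b w - K0 n (\<lambda>i. real (b i))) / w"
    using eventually_at_right_less[of 0] by eventually_elim (simp add: Gint_split distrib_left add_divide_distrib diff_divide_distrib)
  { assume "\<And>i. i < n \<Longrightarrow> even (b i)"
    then have re: "integrand w (pi - \<theta>) = integrand w \<theta>" for w \<theta> by (rule reflected_even)
    have ev: "\<forall>\<^sub>F w in at_right 0. (wscale n w * (LINT \<theta>:{0<..<eps}|lborel. integrand w \<theta>) - K0 n (\<lambda>i. real (b i))) / w + wscale n w / w * (LINT \<theta>:{eps..pi - eps}|lborel. integrand w \<theta>)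
     + (wscale n w * (LINT \<theta>:{0<..<eps}|lborel. integrand w \<theta>) - K0 n (\<lambda>i. real (b i))) / w = (wscale n w * Gint n b w - 2 * K0 n (\<lambda>i. real (b i))) / w"
      using eventually_at_right_less[of 0] by eventually_elim (simp add: Gint_split re distrib_left add_divide_distrib diff_divide_distrib)
    from Lim_transform_eventually[OF tendsto_add[OF tendsto_add[OF p mid] p] this]
    show "((\<lambda>w. (wscale n w * Gint n b w - 2 * K0 n (\<lambda>i. real (b i))) / w) \<longlongrightarrow> 2 * L1) (at_right 0)" by simp }
  { assume "2 \<le> card {i\<in>{..<n}. odd (b i)}"
    then have "((\<lambda>w. wscale n w / w * (LINT \<theta>:{0<..<eps}|lborel. integrand w (pi - \<theta>))) \<longlongrightarrow> 0) (at_right 0)"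
      using reflected_negligible m3 by simp
    from Lim_transform_eventually[OF tendsto_add[OF tendsto_add[OF p mid] this] ev]
    show "((\<lambda>w. (wscale n w * Gint n b w - K0 n (\<lambda>i. real (b i))) / w) \<longlongrightarrow> L1) (at_right 0)" by simp }
  { assume b0: "b 0 = 1" and be: "\<And>i. 0 < i \<Longrightarrow> i < n \<Longrightarrow> even (b i)"
    obtain n' where n': "n = Suc n'" using m by (cases n) auto
    \<comment> \<open>The only odd weight is 1, and at \<pi> its factor tends to 4. This peak has
      one vanishing factor fewer, hence is smaller by one order in \<open>w\<close>, and a quarter
      of its leading term enters the second coefficient.\<close>
    define \<psi> where "\<psi> = (\<lambda>w \<theta>. 1 / (w + (4 - sn 1 \<theta>)))"
    have "((\<lambda>w. wscale n' w * (LINT \<theta>:{0<..<eps}|lborel. sn 2 \<theta> * \<psi> w \<theta> / (\<Prod>i<n'. w + sn (real (b (Suc i))) \<theta>))) \<longlongrightarrow> 1 / 4 * K0 n' (\<lambda>i. real (b (Suc i)))) (at_right 0)"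
    proof (rule peak_limit)
      show "2 \<le> n'" using m m3 n' by simp
      show "1 \<le> real (b (Suc i))" "real (b (Suc i)) * eps \<le> 1" if "i < n'" for i using X1[of "Suc i"] eps_le[of "Suc i"] that n' by auto
      show "\<psi> w \<in> borel_measurable borel" for w unfolding \<psi>_def by measurable
      show "0 < eps" by (rule eps_pos)
      fix w \<theta> :: real assume w: "0 < w" and t: "0 < \<theta>" "\<theta> < eps"
      have "\<theta>\<^sup>2 \<le> 1" using t eps_lt by (simp add: power_le_one)
      then have "sn 1 \<theta> \<le> 1" using sn_upper[of 1 \<theta>] by simp
      then show "\<bar>\<psi> w \<theta>\<bar> \<le> 1" using w unfolding \<psi>_def by (simp add: divide_le_eq)
    next
      fix x :: real assume x: "0 < x"
      have "((\<lambda>w. sn 1 (sqrt w * x)) \<longlongrightarrow> sn 1 (sqrt 0 * x)) (at_right 0)" unfolding sn_def by (intro tendsto_intros) auto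
      then have s: "((\<lambda>w. sn 1 (sqrt w * x)) \<longlongrightarrow> 0) (at_right 0)" by (simp add: sn_def)
      have "((\<lambda>w. \<psi> w (sqrt w * x)) \<longlongrightarrow> 1 / (0 + (4 - 0))) (at_right 0)" unfolding \<psi>_def by (intro tendsto_intros s) auto
      then show "((\<lambda>w. \<psi> w (sqrt w * x)) \<longlongrightarrow> 1 / 4) (at_right 0)" by simp
    qed
    then have "((\<lambda>w. wscale n w / w * (LINT \<theta>:{0<..<eps}|lborel. integrand w (pi - \<theta>))) \<longlongrightarrow> 1 / 4 * K0 n' (\<lambda>i. real (b (Suc i)))) (at_right 0)"
    proof (rule Lim_transform_eventually)
      show "\<forall>\<^sub>F w in at_right 0. wscale n' w * (LINT \<theta>:{0<..<eps}|lborel. sn 2 \<theta> * \<psi> w \<theta> / (\<Prod>i<n'. w + sn (real (b (Suc i))) \<theta>))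
         = wscale n w / w * (LINT \<theta>:{0<..<eps}|lborel. integrand w (pi - \<theta>))"
        using eventually_at_right_less[of 0]
      proof eventually_elim
        case (elim w)
        have "integrand w (pi - \<theta>) = sn 2 \<theta> * \<psi> w \<theta> / (\<Prod>i<n'. w + sn (real (b (Suc i))) \<theta>)" for \<theta>
        proof -
          have "(\<Prod>i<n. w + sn (b i) (pi - \<theta>)) = (w + (4 - sn 1 \<theta>)) * (\<Prod>i<n'. w + sn (b (Suc i)) \<theta>)"
            unfolding n' prod.lessThan_Suc_shift using b0 be n' sn_reflect[of 1 \<theta>] by (simp add: sn_reflect)
          then show ?thesis using sn_reflect[of 2 \<theta>] by (simp add: integrand_def \<psi>_def)
        qed
        moreover have "wscale n w / w = wscale n' w" using elim by (simp add: wscale_def n')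
        ultimately show ?case by simp
      qed
    qed
    from Lim_transform_eventually[OF tendsto_add[OF tendsto_add[OF p mid] this] ev]
    show "((\<lambda>w. (wscale n w * Gint n b w - K0 n (\<lambda>i. real (b i))) / w) \<longlongrightarrow> L1 + K0 (n - 1) (\<lambda>i. real (b (Suc i))) / 4) (at_right 0)"
      by (simp add: n') }
qed

end

section \<open>Rationality of the circle mean\<close>

text \<open>Convention for two variables: in a \<open>complex poly poly\<close> the outer variable
  is z, and the coefficients are polynomials in t.\<close>

lemma poly_poly_const: "poly (map_poly (\<lambda>c. poly c t) p) z = poly (poly p [:z:]) t" for p :: "complex poly poly"
  by (induction p) (simp_all add: map_poly_pCons)

text \<open>At \<open>t = 0\<close> the Sylvester matrix of \<open>A\<close> and \<open>B\<close> is the identity matrix, since there \<open>A\<close> becomes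
  \<open>z\<^sup>s\<close> and \<open>B\<close> becomes \<open>1\<close>. So its determinant \<open>d\<close> does not vanish at \<open>t = 0\<close>, and the adjugate gives
  a Bezout relation over \<open>\<complex>[t]\<close> without any division.\<close>

lemma bezout_parameter:
  fixes A B N :: "complex poly poly"
  assumes dA: "degree A \<le> s" and dB: "degree B \<le> s" and dN: "degree N < 2 * s"
    and A0: "\<And>i. poly (coeff A i) 0 = (if i = s then 1 else 0)"
    and B0: "\<And>i. poly (coeff B i) 0 = (if i = 0 then 1 else 0)"
  shows "\<exists>d P Q. poly d 0 = 1 \<and> (\<forall>i\<ge>s. coeff P i = 0) \<and> (\<forall>i\<ge>s. coeff Q i = 0) \<and> Q * B + P * A = Polynomial.smult d N"
proof -
  define n where "n = 2 * s"
  define col where "col = (\<lambda>j. if j < s then monom 1 j * B else monom 1 (j - s) * A)"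
  define M where "M = Matrix.mat n n (\<lambda>(i, j). coeff (col j) i)"
  define v where "v = Matrix.vec n (\<lambda>i. coeff N i)"
  \<comment> \<open>The first \<open>s\<close> entries of \<open>x\<close> become the coefficients
    of \<open>Q\<close>, the others those of \<open>P\<close>.\<close>
  define x where "x = adj_mat M *\<^sub>v v"
  have M: "M \<in> carrier_mat n n" and v: "v \<in> carrier_vec n" by (auto simp: M_def v_def)
  note adj = adj_mat[OF M]
  have x: "x \<in> carrier_vec n" unfolding x_def using adj(1) v by (rule mult_mat_vec_carrier)
  have "M *\<^sub>v x = (M * adj_mat M) *\<^sub>v v" unfolding x_def using M adj(1) v by (rule assoc_mult_mat_vec[symmetric])
  also have "\<dots> = det M \<cdot>\<^sub>v v" unfolding adj(2) using v
    by (intro eq_vecI) (auto simp: scalar_prod_def if_distrib[of "\<lambda>c. c * _"] if_distrib[of "\<lambda>c. _ * c"] cong: if_cong)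
  finally have Mx: "M *\<^sub>v x = det M \<cdot>\<^sub>v v" .
  have dcol: "degree (col j) < n" if "j < n" for j
  proof (cases "j < s")
    case True
    then have "degree (col j) \<le> j + s" unfolding col_def using dB
      by (auto intro: order_trans[OF degree_mult_le] add_mono[OF degree_monom_le])
    then show ?thesis using True by (simp add: n_def)
  next
    case False
    then have "col j = monom 1 (j - s) * A" by (simp add: col_def)
    then have "degree (col j) \<le> degree (monom 1 (j - s) :: complex poly poly) + degree A" using degree_mult_le by metis
    also have "\<dots> \<le> (j - s) + s" by (intro add_mono degree_monom_le dA)
    finally have "degree (col j) \<le> (j - s) + s" .
    then show ?thesis using False that by (simp add: n_def)
  qed
  define Q where "Q = (\<Sum>j<s. monom (vec_index x j) j)"
  define P where "P = (\<Sum>j<s. monom (vec_index x (s + j)) j)"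
  have mon: "monom c j * p = Polynomial.smult c (monom 1 j * p)" for c :: "complex poly" and j p
    by (metis mult.right_neutral mult_smult_left smult_monom)
  have QB: "Q * B = (\<Sum>j<s. Polynomial.smult (vec_index x j) (col j))"
    unfolding Q_def sum_distrib_right by (rule sum.cong) (auto simp: col_def mon[symmetric])
  have PA: "P * A = (\<Sum>j<s. Polynomial.smult (vec_index x (s + j)) (col (s + j)))"
    unfolding P_def sum_distrib_right by (rule sum.cong) (auto simp: col_def mon[symmetric])
  have tot: "Q * B + P * A = (\<Sum>j<n. Polynomial.smult (vec_index x j) (col j))"
  proof -
    have "(\<Sum>j<n. Polynomial.smult (vec_index x j) (col j)) = (\<Sum>j<s. Polynomial.smult (vec_index x j) (col j)) + (\<Sum>j=s..<s+s. Polynomial.smult (vec_index x j) (col j))"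
      unfolding n_def mult_2 lessThan_atLeast0 by (rule sum.atLeastLessThan_concat[symmetric]) auto
    also have "(\<Sum>j=s..<s+s. Polynomial.smult (vec_index x j) (col j)) = (\<Sum>j<s. Polynomial.smult (vec_index x (s + j)) (col (s + j)))"
      by (rule sum.reindex_bij_witness[of _ "\<lambda>j. s + j" "\<lambda>j. j - s"]) auto
    finally show ?thesis unfolding QB PA by simp
  qed
  have eq: "Q * B + P * A = Polynomial.smult (det M) N"
  proof (rule poly_eqI)
    fix i
    show "coeff (Q * B + P * A) i = coeff (Polynomial.smult (det M) N) i"
    proof (cases "i < n")
      case True
      have "coeff (Q * B + P * A) i = (\<Sum>j<n. vec_index x j * coeff (col j) i)" by (simp add: tot coeff_sum)
      also have "\<dots> = vec_index (M *\<^sub>v x) i" using True x M by (simp add: scalar_prod_def M_def lessThan_atLeast0 mult.commute)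
      also have "\<dots> = det M * coeff N i" unfolding Mx using True by (simp add: v_def)
      finally show ?thesis by simp
    next
      case False
      have "coeff (col j) i = 0" if "j < n" for j using dcol[OF that] False by (intro coeff_eq_0) auto
      then have "coeff (Q * B + P * A) i = 0" by (simp add: tot coeff_sum)
      moreover have "coeff N i = 0" using dN False by (intro coeff_eq_0) (auto simp: n_def)
      ultimately show ?thesis by simp
    qed
  qed
  interpret h: comm_ring_hom "\<lambda>p :: complex poly. poly p 0" by unfold_locales auto
  have "map_mat (\<lambda>p. poly p 0) M = 1\<^sub>m n"
  proof (rule eq_matI)
    fix i j assume "i < dim_row (1\<^sub>m n :: complex Matrix.mat)" "j < dim_col (1\<^sub>m n :: complex Matrix.mat)"
    then have ij: "i < n" "j < n" by auto
    then show "map_mat (\<lambda>p. poly p 0) M $$ (i, j) = 1\<^sub>m n $$ (i, j)"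
      by (auto simp: M_def col_def coeff_monom_mult A0 B0)
  qed (auto simp: M_def)
  then have "poly (det M) 0 = 1" using h.hom_det[of M] by simp
  moreover have "coeff Q i = 0" "coeff P i = 0" if "i \<ge> s" for i
    using that by (auto simp: Q_def P_def coeff_sum intro!: sum.neutral)
  ultimately show ?thesis using eq by blast
qed

lemma coeff_mult_top:
  fixes p q :: "'a :: comm_ring_1 poly"
  assumes "\<And>i. i > k \<Longrightarrow> coeff p i = 0" "\<And>i. i > l \<Longrightarrow> coeff q i = 0"
  shows "coeff (p * q) (k + l) = coeff p k * coeff q l"
proof -
  have "coeff (p * q) (k + l) = (\<Sum>i\<le>k + l. coeff p i * coeff q (k + l - i))" by (rule coeff_mult)
  also have "\<dots> = (\<Sum>i\<in>{k}. coeff p i * coeff q (k + l - i))"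
  proof (rule sum.mono_neutral_right)
    show "\<forall>i\<in>{..k + l} - {k}. coeff p i * coeff q (k + l - i) = 0"
    proof
      fix i assume "i \<in> {..k + l} - {k}"
      then have "i > k \<or> k + l - i > l" by auto
      then show "coeff p i * coeff q (k + l - i) = 0" using assms by auto
    qed
  qed auto
  finally show ?thesis by simp
qed

section \<open>Mean values of holomorphic functions over the unit circle\<close>

lemma circle_mean:
  fixes f :: "complex \<Rightarrow> complex"
  assumes "f holomorphic_on cball 0 1"
  shows "((\<lambda>\<theta>. f (cis \<theta>)) has_integral complex_of_real (2 * pi) * f 0) {0..2 * pi}"
proof -
  have "((\<lambda>u. f u / (u - 0)) has_contour_integral 2 * complex_of_real pi * \<i> * f 0) (circlepath 0 1)"
    by (rule Cauchy_integral_circlepath_simple) (use assms in auto)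
  then have "((\<lambda>\<theta>. f (cis \<theta>) * \<i>) has_integral 2 * pi * \<i> * f 0) {0..2 * pi}"
    unfolding circlepath_def by (subst (asm) has_contour_integral_part_circlepath_iff) (auto simp: field_simps)
  from has_integral_mult_right[OF this, of "- \<i>"] show ?thesis by (simp add: algebra_simps)
qed

lemma has_integral_circle_reflect:
  fixes f :: "real \<Rightarrow> complex"
  assumes "(f has_integral I) {0..2 * pi}"
  shows "((\<lambda>\<theta>. f (2 * pi - \<theta>)) has_integral I) {0..2 * pi}"
proof -
  have im: "(\<lambda>x. (1 / - 1) *\<^sub>R x + - ((1 / - 1) *\<^sub>R (2 * pi))) ` cbox 0 (2 * pi) = {0..2 * pi}"
  proof -
    have "(\<lambda>x. (1 / - 1) *\<^sub>R x + - ((1 / - 1) *\<^sub>R (2 * pi))) = (\<lambda>x. 2 * pi - x)" by auto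
    then show ?thesis by simp
  qed
  from has_integral_affinity[of f I 0 "2 * pi" "-1" "2 * pi"] assms
  have "((\<lambda>x. f (- 1 *\<^sub>R x + 2 * pi)) has_integral (1 / \<bar>- 1\<bar> ^ DIM(real)) *\<^sub>R I) ((\<lambda>x. (1 / - 1) *\<^sub>R x + - ((1 / - 1) *\<^sub>R (2 * pi))) ` cbox 0 (2 * pi))"
    by simp
  then show ?thesis unfolding im by simp
qed

lemma cis_2pi_minus: "cis (2 * pi - \<theta>) = inverse (cis \<theta>)"
  unfolding cis_divide[symmetric] cis_2pi by (rule inverse_eq_divide[symmetric])

lemma circle_mean_inverse:
  fixes f :: "complex \<Rightarrow> complex"
  assumes "f holomorphic_on cball 0 1"
  shows "((\<lambda>\<theta>. f (inverse (cis \<theta>))) has_integral complex_of_real (2 * pi) * f 0) {0..2 * pi}"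
  using has_integral_circle_reflect[OF circle_mean[OF assms]] unfolding cis_2pi_minus .

text \<open>\<open>b\<close> lists the positive weights. With z = cis \<theta> the integrand is z N
  / (A B), where \<open>B\<close> holds the factors of the positive weights and \<open>A\<close>, up
  to the power z^s, those of the negative ones. The bound 3 on the sum of the weights makes
  \<open>N\<close> a polynomial.\<close>

locale torus_weights =
  fixes n :: nat and b :: "nat \<Rightarrow> nat"
  assumes b: "\<And>i. i < n \<Longrightarrow> b i \<ge> 1" and s3: "(\<Sum>i<n. b i) \<ge> 3"
begin

lemma bpos: "i < n \<Longrightarrow> b i \<noteq> 0"
  using b by fastforce

definition s :: nat where "s = (\<Sum>i<n. b i)"

definition A :: "complex poly poly" where "A = (\<Prod>i<n. monom 1 (b i) - [:[:0, 1:]:])"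
definition B :: "complex poly poly" where "B = (\<Prod>i<n. 1 - monom [:0, 1:] (b i))"
definition N :: "complex poly poly" where "N = monom 1 (s - 1) - monom 1 (s - 3)"

lemma eval_A: "poly (poly A [:z:]) t = (\<Prod>i<n. z ^ b i - t)"
  by (simp add: A_def poly_prod poly_monom poly_power)

lemma eval_B: "poly (poly B [:z:]) t = (\<Prod>i<n. 1 - t * z ^ b i)"
  by (simp add: B_def poly_prod poly_monom poly_power)

lemma eval_N: "poly (poly N [:z:]) t = z ^ (s - 1) - z ^ (s - 3)"
  by (simp add: N_def poly_monom poly_power)

lemma map_A: "map_poly (\<lambda>c. poly c t) A = (\<Prod>i<n. monom 1 (b i) - [:t:])"
  by (rule poly_eq_poly_eq_iff[THEN iffD1]) (auto simp: fun_eq_iff poly_poly_const eval_A poly_prod poly_monom)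

lemma map_B: "map_poly (\<lambda>c. poly c t) B = (\<Prod>i<n. 1 - monom t (b i))"
  by (rule poly_eq_poly_eq_iff[THEN iffD1]) (auto simp: fun_eq_iff poly_poly_const eval_B poly_prod poly_monom)

lemma degree_A: "degree A \<le> s"
  unfolding A_def s_def
  by (rule order_trans[OF degree_prod_sum_le], simp, rule sum_mono) (auto intro!: degree_diff_le degree_monom_le)

lemma degree_B: "degree B \<le> s"
  unfolding B_def s_def
  by (rule order_trans[OF degree_prod_sum_le], simp, rule sum_mono) (auto intro!: degree_diff_le degree_monom_le)

lemma coeff_A_s: "poly (coeff A s) t = 1"
proof -
  have d: "degree (monom 1 (b i) - [:t:]) = b i" if "i < n" for i
    using b[OF that] by (subst diff_conv_add_uminus, subst degree_add_eq_left) (auto simp: degree_monom_eq)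
  have "lead_coeff (\<Prod>i<n. monom 1 (b i) - [:t:]) = (\<Prod>i<n. lead_coeff (monom 1 (b i) - [:t:]))"
    by (rule Polynomial.lead_coeff_prod)
  also have "\<dots> = 1"
  proof (rule prod.neutral, rule ballI)
    fix i assume "i \<in> {..<n}"
    then show "lead_coeff (monom 1 (b i) - [:t:]) = 1" using d[of i] bpos[of i] by (simp add: coeff_pCons split: nat.splits)
  qed
  finally have l: "lead_coeff (\<Prod>i<n. monom 1 (b i) - [:t:]) = 1" .
  have "degree (\<Prod>i<n. monom 1 (b i) - [:t:]) = (\<Sum>i<n. degree (monom 1 (b i) - [:t:]))"
    by (rule degree_prod_eq_sum_degree) (use d b in force)
  also have "\<dots> = s" unfolding s_def by (rule sum.cong) (use d in auto)
  finally have "coeff (map_poly (\<lambda>c. poly c t) A) s = 1" unfolding map_A using l by simp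
  then show ?thesis by (simp add: coeff_map_poly)
qed

text \<open>The point t = 0 is treated separately, because there the degree in z drops.\<close>

lemma coeff_B_s: "poly (coeff B s) t = (- t) ^ n"
proof (cases "t = 0")
  case True
  have n: "n \<noteq> 0" using s3 by (intro notI) simp
  moreover have "s \<noteq> 0" using s3 unfolding s_def by linarith
  moreover have "poly (coeff B s) 0 = coeff (map_poly (\<lambda>c. poly c 0) B) s" by (simp add: coeff_map_poly)
  ultimately show ?thesis using True n unfolding map_B by simp
next
  case False
  have d: "degree (1 - monom t (b i)) = b i" if "i < n" for i
    using b[OF that] False by (subst diff_conv_add_uminus, subst degree_add_eq_right) (auto simp: degree_monom_eq)
  have "lead_coeff (\<Prod>i<n. 1 - monom t (b i)) = (\<Prod>i<n. lead_coeff (1 - monom t (b i)))"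
    by (rule Polynomial.lead_coeff_prod)
  also have "\<dots> = (\<Prod>i<n. - t)"
  proof (rule prod.cong[OF refl])
    fix i assume "i \<in> {..<n}"
    then show "lead_coeff (1 - monom t (b i)) = - t" using d[of i] bpos[of i] by simp
  qed
  finally have l: "lead_coeff (\<Prod>i<n. 1 - monom t (b i)) = (- t) ^ n" by simp
  have "degree (\<Prod>i<n. 1 - monom t (b i)) = (\<Sum>i<n. degree (1 - monom t (b i)))"
    by (rule degree_prod_eq_sum_degree) (use d b in force)
  also have "\<dots> = s" unfolding s_def by (rule sum.cong) (use d in auto)
  finally have "coeff (map_poly (\<lambda>c. poly c t) B) s = (- t) ^ n" unfolding map_B using l by simp
  then show ?thesis by (simp add: coeff_map_poly)
qed

definition circle_integrand :: "complex \<Rightarrow> real \<Rightarrow> complex" where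
  "circle_integrand t \<theta> = (1 - inverse (cis \<theta>) ^ 2) / (\<Prod>i<n. (1 - t * cis \<theta> ^ b i) * (1 - t * inverse (cis \<theta>) ^ b i))"

lemma circle_integrand_eq:
  assumes "cis \<theta> = z"
  shows "circle_integrand t \<theta> = z * (z ^ (s - 1) - z ^ (s - 3)) / ((\<Prod>i<n. z ^ b i - t) * (\<Prod>i<n. 1 - t * z ^ b i))"
proof -
  have z: "z \<noteq> 0" using assms by auto
  have s: "s \<ge> 3" using s3 by (simp add: s_def)
  have "z * (z ^ (s - 1) - z ^ (s - 3)) = z ^ s * (1 - inverse z ^ 2)"
  proof -
    have "z ^ s = z * z ^ (s - 1)" "z ^ s * inverse z ^ 2 = z * z ^ (s - 3)"
    proof -
      have "s = Suc (s - 1)" using s by simp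
      then show "z ^ s = z * z ^ (s - 1)" by (metis power_Suc)
      have "s = (s - 3) + 1 + 2" using s by simp
      then have "z ^ s = z ^ ((s - 3) + 1 + 2)" by (rule arg_cong)
      then have "z ^ s = z ^ (s - 3) * z * z ^ 2" by (simp only: power_add power_one_right)
      then show "z ^ s * inverse z ^ 2 = z * z ^ (s - 3)" using z by (simp add: field_simps)
    qed
    then show ?thesis by (simp only: right_diff_distrib mult_1_right)
  qed
  moreover have "(\<Prod>i<n. z ^ b i - t) = z ^ s * (\<Prod>i<n. 1 - t * inverse z ^ b i)"
  proof -
    have "(\<Prod>i<n. z ^ b i - t) = (\<Prod>i<n. z ^ b i * (1 - t * inverse z ^ b i))"
      by (rule prod.cong) (use z in \<open>auto simp: right_diff_distrib power_inverse\<close>)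
    then show ?thesis by (simp add: prod.distrib s_def power_sum)
  qed
  ultimately show ?thesis
    using z by (simp add: circle_integrand_def assms prod.distrib mult_ac)
qed


text \<open>For real t the two factors of a weight k multiply to t (w + 4 sin^2(k \<theta> / 2)).
  Adding the values at \<theta> and 2 \<pi> - \<theta> turns the numerator 1 - z^(-2) into 4 sin^2
  \<theta>. The sum is real and symmetric about \<pi>, so half its integral over the circle is its
  integral over (0, \<pi>).\<close>

lemma Gint_circle:
  assumes t: "0 < t" "t \<noteq> 1" and w: "w = (1 - t)\<^sup>2 / t"
  shows "(circle_integrand (of_real t) has_integral complex_of_real (Gint n b w / t ^ n)) {0..2 * pi}"
proof -
  have w0: "w > 0" using t w by simp
  define g where "g = (\<lambda>\<theta>. sn 2 \<theta> / (\<Prod>i<n. w + sn (b i) \<theta>))"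
  have P0: "(\<Prod>i<n. w + sn (b i) \<theta>) > 0" for \<theta> using w0 sn_nonneg by (intro prod_pos) (auto intro: add_pos_nonneg)
  have fac: "(1 - of_real t * cis \<theta> ^ k) * (1 - of_real t * inverse (cis \<theta>) ^ k) = complex_of_real (t * (w + sn (real k) \<theta>))" for k \<theta>
  proof -
    have "cis \<theta> ^ k = cis (real k * \<theta>)" "inverse (cis \<theta>) ^ k = cis (- (real k * \<theta>))"
      by (simp_all add: Complex.DeMoivre)
    then have "(1 - of_real t * cis \<theta> ^ k) * (1 - of_real t * inverse (cis \<theta>) ^ k) = complex_of_real (1 + t\<^sup>2 - 2 * t * cos (real k * \<theta>))"
      by (simp add: complex_eq_iff algebra_simps power2_eq_square sin_squared_eq[unfolded power2_eq_square])
    also have "1 + t\<^sup>2 - 2 * t * cos (real k * \<theta>) = t * (w + sn (real k) \<theta>)"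
      using t by (simp add: w sn_cos distrib_left power2_diff) (simp add: algebra_simps)
    finally show ?thesis .
  qed
  have ci: "circle_integrand (of_real t) \<theta> = (1 - inverse (cis \<theta>) ^ 2) / complex_of_real (t ^ n * (\<Prod>i<n. w + sn (b i) \<theta>))" for \<theta>
    unfolding circle_integrand_def fac by (simp add: prod.distrib)
  have cont: "continuous_on {0..2 * pi} (circle_integrand (of_real t))"
    unfolding ci[abs_def]
  proof (rule continuous_on_divide)
    have "t ^ n * (\<Prod>i<n. w + sn (b i) \<theta>) \<noteq> 0" for \<theta> using mult_pos_pos[OF zero_less_power[OF t(1)] P0] by (rule less_imp_neq[THEN not_sym])
    then show "\<forall>\<theta>\<in>{0..2 * pi}. complex_of_real (t ^ n * (\<Prod>i<n. w + sn (b i) \<theta>)) \<noteq> 0" unfolding of_real_eq_0_iff by blast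
  qed (auto intro!: continuous_intros)
  then have "circle_integrand (of_real t) integrable_on {0..2 * pi}" by (rule integrable_continuous_interval)
  then obtain J where J: "(circle_integrand (of_real t) has_integral J) {0..2 * pi}" by blast
  have rfl: "sn (b i) (2 * pi - \<theta>) = sn (b i) \<theta>" "sn 2 (2 * pi - \<theta>) = sn 2 \<theta>" for i \<theta>
  proof -
    have "sn (real k) (2 * pi - \<theta>) = sn (real k) \<theta>" for k
    proof -
      have "real k * (2 * pi - \<theta>) = real k * (2 * pi) - real k * \<theta>" by (simp add: right_diff_distrib)
      moreover have "cos (real k * (2 * pi)) = 1" "sin (real k * (2 * pi)) = 0"
        using cos_npi[of "2 * k"] sin_npi[of "2 * k"] by (simp_all add: mult_ac)
      ultimately show ?thesis by (simp add: sn_cos cos_diff)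
    qed
    from this[of "b i"] this[of 2] show "sn (b i) (2 * pi - \<theta>) = sn (b i) \<theta>" "sn 2 (2 * pi - \<theta>) = sn 2 \<theta>" by simp_all
  qed
  have sum: "circle_integrand (of_real t) \<theta> + circle_integrand (of_real t) (2 * pi - \<theta>) = complex_of_real (g \<theta> / t ^ n)" for \<theta>
  proof -
    have "(1 - inverse (cis \<theta>) ^ 2) + (1 - inverse (cis (2 * pi - \<theta>)) ^ 2) = complex_of_real (sn 2 \<theta>)"
      unfolding cis_2pi_minus by (simp add: Complex.DeMoivre sn_cos complex_eq_iff)
    then show ?thesis unfolding ci rfl add_divide_distrib[symmetric] by (simp add: g_def mult.commute)
  qed
  have "((\<lambda>\<theta>. complex_of_real (g \<theta> / t ^ n)) has_integral (J + J)) {0..2 * pi}"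
    unfolding sum[symmetric] by (intro has_integral_add J has_integral_circle_reflect)
  then have JJ: "((\<lambda>\<theta>. complex_of_real (g \<theta> / t ^ n)) has_integral (J + J)) {0..2 * pi}" .
  have imJ: "((\<lambda>\<theta>. 0) has_integral Im (J + J)) {0..2 * pi}"
    using has_integral_linear[OF JJ bounded_linear_Im] by (simp only: o_def Im_complex_of_real)
  have "((\<lambda>\<theta>. g \<theta> / t ^ n) has_integral Re (J + J)) {0..2 * pi}"
    using has_integral_linear[OF JJ bounded_linear_Re] by (simp only: o_def Re_complex_of_real)
  then have g2: "((\<lambda>\<theta>. g \<theta> / t ^ n) has_integral 2 * Re J) {0..2 * pi}" by simp
  have imJ: "Im J = 0" using has_integral_unique[OF imJ has_integral_0] by simp
  have contg: "continuous_on S g" for S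
    unfolding g_def using P0 by (intro continuous_intros) (auto simp: less_imp_neq[THEN not_sym] prod_zero_iff)
  have ig: "(g has_integral Gint n b w) {0..pi}"
  proof -
    have "set_integrable lborel {0..pi} g"
      by (rule borel_integrable_compact[unfolded set_integrable_def[symmetric]]) (use contg in auto)
    then have "set_integrable lborel {0<..<pi} g" by (rule set_integrable_subset) auto
    from set_borel_integral_eq_integral[OF this] have "g integrable_on {0<..<pi}" "(LINT x:{0<..<pi}|lborel. g x) = integral {0<..<pi} g" by auto
    then have "(g has_integral Gint n b w) {0<..<pi}" by (simp add: Gint_def g_def has_integral_integrable_integral)
    then show ?thesis by (simp add: has_integral_Icc_iff_Ioo)
  qed
  have "((\<lambda>\<theta>. g (- 1 * \<theta> + 2 * pi)) has_integral Gint n b w) {pi..2 * pi}"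
  proof -
    have im: "(\<lambda>x. (1 / - 1) *\<^sub>R x + - ((1 / - 1) *\<^sub>R (2 * pi))) ` cbox 0 pi = {pi..2 * pi}"
    proof -
      have "(\<lambda>x. (1 / - 1) *\<^sub>R x + - ((1 / - 1) *\<^sub>R (2 * pi))) = (\<lambda>x. 2 * pi - x)" by auto
      then show ?thesis by simp
    qed
    from has_integral_affinity[of g "Gint n b w" 0 pi "-1" "2 * pi"] ig
    have "((\<lambda>x. g (- 1 *\<^sub>R x + 2 * pi)) has_integral (1 / \<bar>- 1\<bar> ^ DIM(real)) *\<^sub>R Gint n b w) ((\<lambda>x. (1 / - 1) *\<^sub>R x + - ((1 / - 1) *\<^sub>R (2 * pi))) ` cbox 0 pi)"
      by simp
    then show ?thesis unfolding im by simp
  qed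
  moreover have "g (- 1 * \<theta> + 2 * pi) = g \<theta>" for \<theta>
  proof -
    have "- 1 * \<theta> + 2 * pi = 2 * pi - \<theta>" by simp
    then show ?thesis by (simp only: g_def rfl)
  qed
  ultimately have "(g has_integral Gint n b w) {pi..2 * pi}" by simp
  from has_integral_combine[OF _ _ ig this] have "(g has_integral (Gint n b w + Gint n b w)) {0..2 * pi}" by simp
  then have "((\<lambda>\<theta>. g \<theta> / t ^ n) has_integral (Gint n b w + Gint n b w) / t ^ n) {0..2 * pi}" by (rule has_integral_divide)
  from has_integral_unique[OF g2 this] have "Re J = Gint n b w / t ^ n" by simp
  then have "J = complex_of_real (Gint n b w / t ^ n)" using imJ by (simp add: complex_eq_iff)
  then show ?thesis using J by simp
qed

text \<open>The Bezout relation d N = Q B + P A splits d times the integrand into z Q / A + z P / B.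
  For |t| < 1 the zeros of A lie inside the circle and those of B outside. So z Q / A is holomorphic
  in 1/z, with value q, the top coefficient of Q, at infinity, while z P / B is holomorphic in z and
  0 at the origin. For |t| > 1 the roles are exchanged, and the value at infinity comes from the top
  coefficient of P; the relation between the two top coefficients makes it -q.\<close>

lemma rational_continuation:
  "\<exists>d q. poly d 0 = 1 \<and>
    (\<forall>t. norm t < 1 \<longrightarrow> ((\<lambda>\<theta>. poly d t * circle_integrand t \<theta>) has_integral complex_of_real (2 * pi) * poly q t) {0..2 * pi}) \<and>
    (\<forall>t. norm t > 1 \<longrightarrow> ((\<lambda>\<theta>. poly d t * circle_integrand t \<theta>) has_integral - (complex_of_real (2 * pi) * poly q t)) {0..2 * pi})"
proof -
  have s: "s \<ge> 3" using s3 by (simp add: s_def)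
  have dN: "degree N < 2 * s"
    unfolding N_def by (rule le_less_trans[OF degree_diff_le[of _ "s - 1"]]) (use s in \<open>auto intro: order_trans[OF degree_monom_le]\<close>)
  have A0: "poly (coeff A i) 0 = (if i = s then 1 else 0)" for i
  proof -
    have "map_poly (\<lambda>c. poly c 0) A = monom 1 s"
      by (rule poly_eq_poly_eq_iff[THEN iffD1]) (auto simp: fun_eq_iff poly_poly_const eval_A poly_monom s_def power_sum)
    then have "coeff (map_poly (\<lambda>c. poly c 0) A) i = coeff (monom 1 s) i" by simp
    then show ?thesis by (simp add: coeff_map_poly)
  qed
  have B0: "poly (coeff B i) 0 = (if i = 0 then 1 else 0)" for i
  proof -
    have "map_poly (\<lambda>c. poly c 0) B = 1" by (simp add: map_B)
    then have "coeff (map_poly (\<lambda>c. poly c 0) B) i = coeff 1 i" by simp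
    then show ?thesis by (simp add: coeff_map_poly)
  qed
  obtain d P Q where d0: "poly d 0 = 1" and P: "\<And>i. i \<ge> s \<Longrightarrow> coeff P i = 0" and Q: "\<And>i. i \<ge> s \<Longrightarrow> coeff Q i = 0"
    and eq: "Q * B + P * A = Polynomial.smult d N"
    using bezout_parameter[OF degree_A degree_B dN A0 B0] by blast
  define q where "q = coeff Q (s - 1)"
  \<comment> \<open>In degree 2s - 1 the relation involves the top coefficients of Q B and P A only,
    since this degree exceeds that of N.\<close>
  have top: "poly (coeff P (s - 1)) t = - ((- t) ^ n * poly q t)" for t
  proof -
    have "coeff (Q * B + P * A) ((s - 1) + s) = coeff Q (s - 1) * coeff B s + coeff P (s - 1) * coeff A s"
      unfolding coeff_add
      by (intro arg_cong2[of _ _ _ _ "(+)"] coeff_mult_top P Q coeff_eq_0 le_less_trans[OF degree_A] le_less_trans[OF degree_B]) (use s in auto)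
    moreover have "coeff (Polynomial.smult d N) ((s - 1) + s) = 0" using s by (simp add: N_def)
    ultimately have "coeff Q (s - 1) * coeff B s + coeff P (s - 1) * coeff A s = 0" unfolding eq by simp
    then have "poly (coeff Q (s - 1) * coeff B s + coeff P (s - 1) * coeff A s) t = 0" by simp
    then show ?thesis by (simp add: coeff_A_s coeff_B_s q_def add_eq_0_iff mult.commute)
  qed
  have evQ: "poly (poly U [:z:]) t = (\<Sum>j<s. poly (coeff U j) t * z ^ j)" if "\<And>i. i \<ge> s \<Longrightarrow> coeff U i = 0" for U :: "complex poly poly" and z t
  proof -
    have "poly (poly U [:z:]) t = poly (map_poly (\<lambda>c. poly c t) U) z" by (simp add: poly_poly_const)
    also have "\<dots> = (\<Sum>j\<le>degree (map_poly (\<lambda>c. poly c t) U). poly (coeff U j) t * z ^ j)" by (simp add: poly_altdef coeff_map_poly)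
    also have "\<dots> = (\<Sum>j<s. poly (coeff U j) t * z ^ j)"
    proof (rule sum.mono_neutral_cong)
      show "poly (coeff U i) t * z ^ i = 0" if "i \<in> {..<s} - {..degree (map_poly (\<lambda>c. poly c t) U)}" for i
        using that coeff_eq_0[of "map_poly (\<lambda>c. poly c t) U" i] by (simp add: coeff_map_poly)
      show "poly (coeff U i) t * z ^ i = 0" if "i \<in> {..degree (map_poly (\<lambda>c. poly c t) U)} - {..<s}" for i
        using that \<open>\<And>i. i \<ge> s \<Longrightarrow> coeff U i = 0\<close>[of i] by simp
    qed auto
    finally show ?thesis .
  qed
  have id: "poly d t * (z ^ (s - 1) - z ^ (s - 3)) = (\<Sum>j<s. poly (coeff Q j) t * z ^ j) * (\<Prod>i<n. 1 - t * z ^ b i)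
      + (\<Sum>j<s. poly (coeff P j) t * z ^ j) * (\<Prod>i<n. z ^ b i - t)" for t z
  proof -
    have "poly (poly (Q * B + P * A) [:z:]) t = poly (poly (Polynomial.smult d N) [:z:]) t" by (simp only: eq)
    then show ?thesis by (simp add: eval_A eval_B eval_N evQ[OF Q] evQ[OF P])
  qed
  \<comment> \<open>z times a polynomial of degree below s is z^s times a polynomial in 1/z, and z^s
    cancels against the same power in \<open>AA\<close> or \<open>BB\<close>.\<close>
  have flip: "z * (\<Sum>j<s. poly (coeff U j) t * z ^ j) = z ^ s * (\<Sum>j<s. poly (coeff U j) t * inverse z ^ (s - 1 - j))" if "z \<noteq> 0" for U :: "complex poly poly" and z t
    unfolding sum_distrib_left
  proof (rule sum.cong[OF refl])
    fix j assume "j \<in> {..<s}"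
    then have "s = Suc j + (s - 1 - j)" by simp
    then have "z ^ s = z ^ (Suc j + (s - 1 - j))" by (rule arg_cong)
    then have "z ^ s = z ^ Suc j * z ^ (s - 1 - j)" by (simp only: power_add)
    then show "z * (poly (coeff U j) t * z ^ j) = z ^ s * (poly (coeff U j) t * inverse z ^ (s - 1 - j))"
      using that by (simp add: power_inverse)
  qed
  have pz: "z \<noteq> 0 \<Longrightarrow> (\<Prod>i<n. z ^ b i) = z ^ s" for z :: complex by (simp add: s_def power_sum)
  have hp: "(\<Sum>j<s. poly (coeff U j) t * z ^ (s - 1 - j)) = poly (coeff U (s - 1)) t" if "z = 0" for U :: "complex poly poly" and t z :: complex
  proof -
    have "(\<Sum>j<s. poly (coeff U j) t * z ^ (s - 1 - j)) = (\<Sum>j<s. if j = s - 1 then poly (coeff U j) t else 0)"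
      by (rule sum.cong) (use that in auto)
    then show ?thesis using s by simp
  qed
  have z1: "(\<Prod>i<n. 1 - t * 0 ^ b i) = 1" for t :: complex
    by (rule prod.neutral) (use bpos in force)
  have z2: "(\<Prod>i<n. 0 ^ b i - t) = (- t) ^ n" for t :: complex
  proof -
    have "(\<Prod>i<n. 0 ^ b i - t) = (\<Prod>i<n. - t)" by (rule prod.cong) (use bpos in force)+
    then show ?thesis by simp
  qed
  have nz1: "norm u < 1 \<Longrightarrow> z \<in> cball 0 1 \<Longrightarrow> 1 - u * z ^ k \<noteq> 0" for u z :: complex and k
  proof
    assume u: "norm u < 1" "z \<in> cball 0 1" and "1 - u * z ^ k = 0"
    then have "u * z ^ k = 1" by simp
    then have "norm u * norm z ^ k = 1" by (metis norm_mult norm_one norm_power)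
    moreover have "norm z ^ k \<le> 1" using u by (intro power_le_one) auto
    then have "norm u * norm z ^ k \<le> norm u * 1" by (intro mult_left_mono) auto
    ultimately show False using u by simp
  qed
  have nz2: "norm u > 1 \<Longrightarrow> z \<in> cball 0 1 \<Longrightarrow> z ^ k - u \<noteq> 0" for u z :: complex and k
  proof
    assume u: "norm u > 1" "z \<in> cball 0 1" and "z ^ k - u = 0"
    then have "u = z ^ k" by simp
    then have "norm u = norm z ^ k" by (simp only: norm_power)
    moreover have "norm z ^ k \<le> 1" using u by (intro power_le_one) auto
    ultimately show False using u by simp
  qed
  have c1: "((\<lambda>\<theta>. poly d t * circle_integrand t \<theta>) has_integral complex_of_real (2 * pi) * poly q t) {0..2 * pi}" if t: "norm t < 1" for t
  proof -
    define f1 where "f1 = (\<lambda>v. (\<Sum>j<s. poly (coeff Q j) t * v ^ (s - 1 - j)) / (\<Prod>i<n. 1 - t * v ^ b i))"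
    define f2 where "f2 = (\<lambda>z. z * (\<Sum>j<s. poly (coeff P j) t * z ^ j) / (\<Prod>i<n. 1 - t * z ^ b i))"
    have h1: "f1 holomorphic_on cball 0 1" unfolding f1_def using nz1[OF t] by (intro holomorphic_intros) (auto simp: prod_zero_iff)
    have h2: "f2 holomorphic_on cball 0 1" unfolding f2_def using nz1[OF t] by (intro holomorphic_intros) (auto simp: prod_zero_iff)
    have f10: "f1 0 = poly q t" unfolding f1_def hp[OF refl] q_def z1 by simp
    have f20: "f2 0 = 0" by (simp add: f2_def)
    have "poly d t * circle_integrand t \<theta> = f1 (inverse (cis \<theta>)) + f2 (cis \<theta>)" for \<theta>
    proof -
      define z where "z = cis \<theta>"
      have z: "z \<noteq> 0" "z \<in> cball 0 1" "inverse z \<in> cball 0 1" by (auto simp: z_def norm_inverse)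
      have Bz: "(\<Prod>i<n. 1 - t * z ^ b i) \<noteq> 0" using nz1[OF t z(2)] by (simp add: prod_zero_iff)
      have Az: "(\<Prod>i<n. 1 - t * inverse z ^ b i) \<noteq> 0" using nz1[OF t z(3)] by (simp add: prod_zero_iff)
      have AA: "(\<Prod>i<n. z ^ b i - t) = z ^ s * (\<Prod>i<n. 1 - t * inverse z ^ b i)"
      proof -
        have "(\<Prod>i<n. z ^ b i - t) = (\<Prod>i<n. z ^ b i * (1 - t * inverse z ^ b i))"
          by (rule prod.cong) (use z in \<open>auto simp: right_diff_distrib power_inverse\<close>)
        then show ?thesis by (simp add: prod.distrib pz[OF z(1)])
      qed
      have "poly d t * circle_integrand t \<theta> = z * (poly d t * (z ^ (s - 1) - z ^ (s - 3))) / ((\<Prod>i<n. z ^ b i - t) * (\<Prod>i<n. 1 - t * z ^ b i))"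
        unfolding circle_integrand_eq[OF z_def[symmetric]] by (simp add: mult_ac)
      also have "\<dots> = z * (\<Sum>j<s. poly (coeff Q j) t * z ^ j) / (\<Prod>i<n. z ^ b i - t) + f2 z"
        unfolding id f2_def using Bz Az z(1) unfolding AA by (simp add: distrib_left add_divide_distrib)
      also have "z * (\<Sum>j<s. poly (coeff Q j) t * z ^ j) / (\<Prod>i<n. z ^ b i - t) = f1 (inverse z)"
        unfolding flip[OF z(1)] AA f1_def using z(1) by simp
      finally show ?thesis by (simp add: z_def)
    qed
    moreover have "((\<lambda>\<theta>. f1 (inverse (cis \<theta>)) + f2 (cis \<theta>)) has_integral complex_of_real (2 * pi) * poly q t + complex_of_real (2 * pi) * 0) {0..2 * pi}"
      using has_integral_add[OF circle_mean_inverse[OF h1] circle_mean[OF h2]] unfolding f10 f20 .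
    ultimately show ?thesis by simp
  qed
  have c2: "((\<lambda>\<theta>. poly d t * circle_integrand t \<theta>) has_integral - (complex_of_real (2 * pi) * poly q t)) {0..2 * pi}" if t: "norm t > 1" for t
  proof -
    define f1 where "f1 = (\<lambda>v. (\<Sum>j<s. poly (coeff P j) t * v ^ (s - 1 - j)) / (\<Prod>i<n. v ^ b i - t))"
    define f2 where "f2 = (\<lambda>z. z * (\<Sum>j<s. poly (coeff Q j) t * z ^ j) / (\<Prod>i<n. z ^ b i - t))"
    have h1: "f1 holomorphic_on cball 0 1" unfolding f1_def using nz2[OF t] by (intro holomorphic_intros) (auto simp: prod_zero_iff)
    have h2: "f2 holomorphic_on cball 0 1" unfolding f2_def using nz2[OF t] by (intro holomorphic_intros) (auto simp: prod_zero_iff)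
    have t0: "t \<noteq> 0" using t by auto
    have f10: "f1 0 = - poly q t" unfolding f1_def hp[OF refl] top z2 using t0 by simp
    have f20: "f2 0 = 0" by (simp add: f2_def)
    have "poly d t * circle_integrand t \<theta> = f1 (inverse (cis \<theta>)) + f2 (cis \<theta>)" for \<theta>
    proof -
      define z where "z = cis \<theta>"
      have z: "z \<noteq> 0" "z \<in> cball 0 1" "inverse z \<in> cball 0 1" by (auto simp: z_def norm_inverse)
      have Az: "(\<Prod>i<n. z ^ b i - t) \<noteq> 0" using nz2[OF t z(2)] by (simp add: prod_zero_iff)
      have Bz: "(\<Prod>i<n. inverse z ^ b i - t) \<noteq> 0" using nz2[OF t z(3)] by (simp add: prod_zero_iff)
      have BB: "(\<Prod>i<n. 1 - t * z ^ b i) = z ^ s * (\<Prod>i<n. inverse z ^ b i - t)"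
      proof -
        have "(\<Prod>i<n. 1 - t * z ^ b i) = (\<Prod>i<n. z ^ b i * (inverse z ^ b i - t))"
          by (rule prod.cong) (use z in \<open>auto simp: right_diff_distrib power_inverse\<close>)
        then show ?thesis by (simp add: prod.distrib pz[OF z(1)])
      qed
      have "poly d t * circle_integrand t \<theta> = z * (poly d t * (z ^ (s - 1) - z ^ (s - 3))) / ((\<Prod>i<n. z ^ b i - t) * (\<Prod>i<n. 1 - t * z ^ b i))"
        unfolding circle_integrand_eq[OF z_def[symmetric]] by (simp add: mult_ac)
      also have "\<dots> = f2 z + z * (\<Sum>j<s. poly (coeff P j) t * z ^ j) / (\<Prod>i<n. 1 - t * z ^ b i)"
        unfolding id f2_def using Bz Az z(1) unfolding BB by (simp add: distrib_left add_divide_distrib)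
      also have "z * (\<Sum>j<s. poly (coeff P j) t * z ^ j) / (\<Prod>i<n. 1 - t * z ^ b i) = f1 (inverse z)"
        unfolding flip[OF z(1)] BB f1_def using z(1) by simp
      finally show ?thesis by (simp add: z_def)
    qed
    moreover have "((\<lambda>\<theta>. f1 (inverse (cis \<theta>)) + f2 (cis \<theta>)) has_integral complex_of_real (2 * pi) * - poly q t + complex_of_real (2 * pi) * 0) {0..2 * pi}"
      using has_integral_add[OF circle_mean_inverse[OF h1] circle_mean[OF h2]] unfolding f10 f20 .
    ultimately show ?thesis by simp
  qed
  show ?thesis using d0 c1 c2 by blast
qed

end

section \<open>The Hilbert series as a circle mean\<close>

definition expo :: "'a set \<Rightarrow> nat \<Rightarrow> ('a \<Rightarrow> nat) set" where
  "expo A n = {m. (\<forall>p. p \<notin> A \<longrightarrow> m p = 0) \<and> sum m A = n}"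

lemma finite_expo: "finite A \<Longrightarrow> finite (expo A n)"
proof (rule finite_subset)
  assume A: "finite A"
  show "expo A n \<subseteq> {m. \<forall>p. (p \<in> A \<longrightarrow> m p \<in> {..n}) \<and> (p \<notin> A \<longrightarrow> m p = 0)}"
  proof
    fix m assume m: "m \<in> expo A n"
    have "m p \<le> n" if "p \<in> A" for p using m member_le_sum[OF that _ A, of m] by (auto simp: expo_def)
    then show "m \<in> {m. \<forall>p. (p \<in> A \<longrightarrow> m p \<in> {..n}) \<and> (p \<notin> A \<longrightarrow> m p = 0)}" using m by (auto simp: expo_def)
  qed
  show "finite {m. \<forall>p. (p \<in> A \<longrightarrow> m p \<in> {..n}) \<and> (p \<notin> A \<longrightarrow> m p = (0::nat))}"
    by (rule finite_set_of_finite_funs) (use A in auto)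
qed

lemma geometric_prod_nth:
  fixes y :: "'a \<Rightarrow> complex"
  assumes "finite A"
  shows "fps_nth (\<Prod>p\<in>A. Abs_fps (\<lambda>k. y p ^ k)) n = (\<Sum>m\<in>expo A n. \<Prod>p\<in>A. y p ^ m p)"
  using assms
proof (induction A arbitrary: n rule: finite_induct)
  case empty
  have "expo ({} :: 'a set) n = (if n = 0 then {\<lambda>_. 0} else {})" by (auto simp: expo_def)
  then show ?case by (cases "n = 0") simp_all
next
  case (insert q A)
  let ?S = "SIGMA i:{0..n}. expo A (n - i)"
  have "fps_nth (\<Prod>p\<in>insert q A. Abs_fps (\<lambda>k. y p ^ k)) n = (\<Sum>i=0..n. y q ^ i * (\<Sum>m\<in>expo A (n - i). \<Prod>p\<in>A. y p ^ m p))"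
    using insert by (simp add: fps_mult_nth)
  also have "\<dots> = (\<Sum>(i, m)\<in>?S. y q ^ i * (\<Prod>p\<in>A. y p ^ m p))"
    unfolding sum_distrib_left by (rule sum.Sigma) (auto simp: finite_expo insert)
  also have "\<dots> = (\<Sum>m\<in>expo (insert q A) n. \<Prod>p\<in>insert q A. y p ^ m p)"
  proof (rule sum.reindex_bij_witness[of _ "\<lambda>m. (m q, m(q := 0))" "\<lambda>(i, m). m(q := i)"])
    fix x assume "x \<in> ?S"
    then obtain i m where x: "x = (i, m)" "i \<le> n" "m \<in> expo A (n - i)" by auto
    then have mq: "m q = 0" using insert by (auto simp: expo_def)
    then show "((case x of (i, m) \<Rightarrow> m(q := i)) q, (case x of (i, m) \<Rightarrow> m(q := i))(q := 0)) = x"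
      using x by (auto simp: fun_eq_iff)
    have s: "sum (m(q := i)) A = sum m A" by (rule sum.cong) (use insert in auto)
    then show "(case x of (i, m) \<Rightarrow> m(q := i)) \<in> expo (insert q A) n"
      using x insert by (auto simp: expo_def simp del: fun_upd_apply) auto
    have "(\<Prod>p\<in>A. y p ^ (m(q := i)) p) = (\<Prod>p\<in>A. y p ^ m p)" by (rule prod.cong) (use insert in auto)
    then show "(\<Prod>p\<in>insert q A. y p ^ (case x of (i, m) \<Rightarrow> m(q := i)) p) = (case x of (i, m) \<Rightarrow> y q ^ i * (\<Prod>p\<in>A. y p ^ m p))"
      using x insert by (simp add: prod.insert)
  next
    fix m assume m: "m \<in> expo (insert q A) n"
    have s: "sum (m(q := 0)) A = sum m A" by (rule sum.cong) (use insert in auto)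
    have "m q + sum m A = n" using m insert by (simp add: expo_def)
    then show "(m q, m(q := 0)) \<in> ?S" using m s by (auto simp: expo_def)
  qed auto
  finally show ?case .
qed

lemma geometric_fps:
  assumes "norm (c :: complex) \<le> 1"
  shows "fps_conv_radius (Abs_fps (\<lambda>k. c ^ k)) \<ge> 1"
    and "norm t < 1 \<Longrightarrow> eval_fps (Abs_fps (\<lambda>k. c ^ k)) t = 1 / (1 - t * c)"
proof -
  have sums: "(\<lambda>k. c ^ k * t ^ k) sums (1 / (1 - t * c))" if "norm t < 1" for t
  proof -
    have "norm (c * t) \<le> 1 * norm t" unfolding norm_mult using assms by (intro mult_right_mono) auto
    then have "norm (c * t) < 1" using that by simp
    from geometric_sums[OF this] show ?thesis by (simp add: power_mult_distrib mult.commute)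
  qed
  show "fps_conv_radius (Abs_fps (\<lambda>k. c ^ k)) \<ge> 1"
    unfolding fps_conv_radius_def
  proof (rule conv_radius_geI_ex)
    fix r :: real assume "0 < r" "ereal r < 1"
    then have "norm (complex_of_real r) < 1" by simp
    from sums_summable[OF sums[OF this]] show "\<exists>z. norm z = r \<and> summable (\<lambda>n. fps_nth (Abs_fps (\<lambda>k. c ^ k)) n * z ^ n)"
      using \<open>0 < r\<close> by (intro exI[of _ "complex_of_real r"]) simp
  qed
  show "eval_fps (Abs_fps (\<lambda>k. c ^ k)) t = 1 / (1 - t * c)" if "norm t < 1"
    using sums_unique[OF sums[OF that]] by (simp add: eval_fps_def)
qed

lemma geometric_prod_fps:
  fixes y :: "'a \<Rightarrow> complex"
  assumes "finite A" "\<And>p. p \<in> A \<Longrightarrow> norm (y p) \<le> 1" "norm t < 1"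
  shows "fps_conv_radius (\<Prod>p\<in>A. Abs_fps (\<lambda>k. y p ^ k)) \<ge> 1 \<and>
    eval_fps (\<Prod>p\<in>A. Abs_fps (\<lambda>k. y p ^ k)) t = (\<Prod>p\<in>A. 1 / (1 - t * y p))"
  using assms(1,2)
proof (induction A rule: finite_induct)
  case (insert q A)
  define F where "F = Abs_fps (\<lambda>k. y q ^ k)"
  define G where "G = (\<Prod>p\<in>A. Abs_fps (\<lambda>k. y p ^ k))"
  have yq: "norm (y q) \<le> 1" using insert.prems by simp
  have F: "fps_conv_radius F \<ge> 1" "eval_fps F t = 1 / (1 - t * y q)" using geometric_fps[OF yq] assms(3) by (auto simp: F_def)
  have G: "fps_conv_radius G \<ge> 1" "eval_fps G t = (\<Prod>p\<in>A. 1 / (1 - t * y p))" using insert by (auto simp: G_def)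
  have "ereal (norm t) < 1" using assms(3) by simp
  then have "eval_fps (F * G) t = eval_fps F t * eval_fps G t"
    using less_le_trans[OF _ F(1)] less_le_trans[OF _ G(1)] by (intro eval_fps_mult) blast+
  moreover have "fps_conv_radius (F * G) \<ge> 1" using fps_conv_radius_mult[of F G] F(1) G(1) by (meson min.boundedI order_trans)
  moreover have "(\<Prod>p\<in>insert q A. Abs_fps (\<lambda>k. y p ^ k)) = F * G" using insert by (simp add: F_def G_def)
  ultimately show ?case using F G insert by simp
qed (simp add: fps_conv_radius_1)

lemma circle_fourier:
  "((\<lambda>\<theta>. cis (of_int k * \<theta>)) has_integral (if k = 0 then complex_of_real (2 * pi) else 0)) {0..2 * pi}"
proof (cases "k \<ge> 0")
  case True
  have "((\<lambda>\<theta>. cis \<theta> ^ nat k) has_integral complex_of_real (2 * pi) * 0 ^ nat k) {0..2 * pi}"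
    by (rule circle_mean) (auto intro!: holomorphic_intros)
  moreover have "cis \<theta> ^ nat k = cis (of_int k * \<theta>)" for \<theta> using True by (simp add: Complex.DeMoivre)
  moreover have "complex_of_real (2 * pi) * 0 ^ nat k = (if k = 0 then complex_of_real (2 * pi) else 0)"
    using True by (cases "k = 0") simp_all
  ultimately show ?thesis by simp
next
  case False
  have "((\<lambda>\<theta>. inverse (cis \<theta>) ^ nat (- k)) has_integral complex_of_real (2 * pi) * 0 ^ nat (- k)) {0..2 * pi}"
    by (rule circle_mean_inverse[of "\<lambda>v. v ^ nat (- k)"]) (auto intro!: holomorphic_intros)
  moreover have "inverse (cis \<theta>) ^ nat (- k) = cis (of_int k * \<theta>)" for \<theta> using False by (simp add: Complex.DeMoivre)
  moreover have "complex_of_real (2 * pi) * 0 ^ nat (- k) = 0" using False by simp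
  ultimately show ?thesis using False by (simp only: if_False) simp
qed

definition wt :: "nat list \<Rightarrow> (nat \<times> nat \<Rightarrow> nat) \<Rightarrow> int" where
  "wt ds m = (\<Sum>p\<in>Theta ds. int (m p) * weight ds p)"

lemma Mon_eq: "Mon ds n l = {m \<in> expo (Theta ds) n. wt ds m = l}"
  by (auto simp: Mon_def expo_def wt_def)

text \<open>Orthogonality of the characters lets 1 - z^(-2) select the monomials of weight 0 minus
  those of weight 2, to which \<open>dim_invariants\<close> applies. Sum and integral are
  interchanged by uniform convergence, with twice the number of monomials times |t|^n as
  majorant.\<close>

lemma dim_sums_circle:
  assumes t: "norm t < 1"
    and J: "((\<lambda>\<theta>. (1 - inverse (cis \<theta>) ^ 2) * (\<Prod>p\<in>Theta ds. 1 / (1 - t * cis (of_int (weight ds p) * \<theta>)))) has_integral J) {0..2 * pi}"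
  shows "(\<lambda>n. of_nat (fun_vs.dim (invariants ds n)) * t ^ n) sums (J / (2 * pi))"
proof -
  define \<Theta> where "\<Theta> = Theta ds"
  have t1: "ereal (norm t) < 1" using t by simp
  have fin: "finite \<Theta>" unfolding \<Theta>_def by (rule finite_Theta)
  define g where "g = (\<lambda>n \<theta>. (1 - inverse (cis \<theta>) ^ 2) * (\<Sum>m\<in>expo \<Theta> n. cis (of_int (wt ds m) * \<theta>)))"
  define c where "c = (\<lambda>n. complex_of_real (2 * pi) * of_nat (fun_vs.dim (invariants ds n)))"
  have ig: "(g n has_integral c n) {0..2 * pi}" for n
  proof -
    have "((\<lambda>\<theta>. \<Sum>m\<in>expo \<Theta> n. cis (of_int (wt ds m) * \<theta>) - cis (of_int (wt ds m - 2) * \<theta>)) has_integral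
       (\<Sum>m\<in>expo \<Theta> n. (if wt ds m = 0 then complex_of_real (2 * pi) else 0) - (if wt ds m - 2 = 0 then complex_of_real (2 * pi) else 0))) {0..2 * pi}"
      by (intro has_integral_sum has_integral_diff circle_fourier finite_expo fin)
    moreover have "(\<Sum>m\<in>expo \<Theta> n. cis (of_int (wt ds m) * \<theta>) - cis (of_int (wt ds m - 2) * \<theta>)) = g n \<theta>" for \<theta>
      unfolding g_def sum_distrib_left by (rule sum.cong) (auto simp: Complex.DeMoivre cis_mult algebra_simps)
    moreover have "(\<Sum>m\<in>expo \<Theta> n. (if wt ds m = 0 then complex_of_real (2 * pi) else 0) - (if wt ds m - 2 = 0 then complex_of_real (2 * pi) else 0)) = c n"
    proof -
      have "(\<Sum>m\<in>expo \<Theta> n. if wt ds m = l then complex_of_real (2 * pi) else 0) = complex_of_real (2 * pi) * of_nat (card (Mon ds n l))" for l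
        unfolding Mon_eq \<Theta>_def[symmetric]
        by (subst sum.inter_filter[symmetric]) (auto simp: finite_expo fin)
      moreover have "of_nat (fun_vs.dim (invariants ds n)) + of_nat (card (Mon ds n 2)) = (of_nat (card (Mon ds n 0)) :: complex)"
        using dim_invariants[of ds n] by (metis of_nat_add)
      ultimately show ?thesis by (simp add: sum_subtractf c_def algebra_simps) (metis distrib_left)
    qed
    ultimately show ?thesis by simp
  qed
  define f where "f = (\<lambda>\<theta>. (1 - inverse (cis \<theta>) ^ 2) * (\<Prod>p\<in>\<Theta>. 1 / (1 - t * cis (of_int (weight ds p) * \<theta>))))"
  have sums_f: "(\<lambda>n. t ^ n * g n \<theta>) sums f \<theta>" for \<theta>
  proof -
    define y where "y = (\<lambda>p. cis (of_int (weight ds p) * \<theta>))"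
    define F where "F = (\<Prod>p\<in>\<Theta>. Abs_fps (\<lambda>k. y p ^ k))"
    have F: "fps_conv_radius F \<ge> 1" "eval_fps F t = (\<Prod>p\<in>\<Theta>. 1 / (1 - t * y p))"
      using geometric_prod_fps[OF fin _ t, of y] by (auto simp: F_def y_def)
    have nth: "fps_nth F n = (\<Sum>m\<in>expo \<Theta> n. cis (of_int (wt ds m) * \<theta>))" for n
    proof -
      have "(\<Prod>p\<in>\<Theta>. y p ^ m p) = cis (of_int (wt ds m) * \<theta>)" for m
      proof -
        have "(\<Prod>p\<in>\<Theta>. y p ^ m p) = (\<Prod>p\<in>\<Theta>. cis (real (m p) * (of_int (weight ds p) * \<theta>)))" by (simp add: y_def Complex.DeMoivre)
        also have "\<dots> = cis (\<Sum>p\<in>\<Theta>. real (m p) * (of_int (weight ds p) * \<theta>))"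
          using fin by (induction \<Theta> rule: finite_induct) (auto simp: cis_mult)
        also have "(\<Sum>p\<in>\<Theta>. real (m p) * (of_int (weight ds p) * \<theta>)) = of_int (wt ds m) * \<theta>"
          by (simp add: wt_def \<Theta>_def[symmetric] sum_distrib_right mult.assoc)
        finally show ?thesis .
      qed
      then show ?thesis unfolding F_def geometric_prod_nth[OF fin] by simp
    qed
    have "ereal (norm t) < fps_conv_radius F" using less_le_trans[OF t1 F(1)] .
    then have "summable (\<lambda>n. fps_nth F n * t ^ n)" by (rule summable_fps)
    then have "(\<lambda>n. fps_nth F n * t ^ n) sums eval_fps F t" unfolding eval_fps_def by (rule summable_sums)
    from sums_mult[OF this, of "1 - inverse (cis \<theta>) ^ 2"]
    have "(\<lambda>n. (1 - inverse (cis \<theta>) ^ 2) * (fps_nth F n * t ^ n)) sums f \<theta>"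
      unfolding F(2) f_def y_def .
    moreover have "(1 - inverse (cis \<theta>) ^ 2) * (fps_nth F n * t ^ n) = t ^ n * g n \<theta>" for n
      unfolding nth g_def by (simp only: mult_ac)
    ultimately show ?thesis by (simp only:)
  qed
  define Mb where "Mb = (\<lambda>n. 2 * real (card (expo \<Theta> n)) * norm t ^ n)"
  have sM: "summable Mb"
  proof -
    \<comment> \<open>With all variables equal to 1 the product of geometric series counts the
      monomials, so its radius of convergence makes the majorant summable.\<close>
    define F where "F = (\<Prod>p\<in>\<Theta>. Abs_fps (\<lambda>k. (1::complex) ^ k))"
    have F: "fps_conv_radius F \<ge> 1" using geometric_prod_fps[OF fin _ t, of "\<lambda>_. 1"] by (simp add: F_def)
    have "ereal (norm t) < fps_conv_radius F" using less_le_trans[OF t1 F] .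
    then have "summable (\<lambda>n. norm (fps_nth F n * t ^ n))" by (rule norm_summable_fps)
    moreover have "fps_nth F n = of_nat (card (expo \<Theta> n))" for n unfolding F_def geometric_prod_nth[OF fin] by simp
    ultimately have "summable (\<lambda>n. real (card (expo \<Theta> n)) * norm t ^ n)" by (simp add: norm_mult norm_power)
    from summable_mult[OF this, of 2] show ?thesis by (simp add: Mb_def mult.assoc)
  qed
  have bound: "norm (t ^ n * g n \<theta>) \<le> Mb n" for n \<theta>
  proof -
    have "norm (g n \<theta>) \<le> 2 * real (card (expo \<Theta> n))"
      unfolding g_def norm_mult
    proof (rule mult_mono)
      show "norm (1 - inverse (cis \<theta>) ^ 2) \<le> 2" using norm_triangle_ineq4[of 1 "inverse (cis \<theta>) ^ 2"] by (simp add: norm_power norm_inverse)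
      have "norm (\<Sum>m\<in>expo \<Theta> n. cis (of_int (wt ds m) * \<theta>)) \<le> (\<Sum>m\<in>expo \<Theta> n. 1)" by (rule sum_norm_le) simp
      then show "norm (\<Sum>m\<in>expo \<Theta> n. cis (of_int (wt ds m) * \<theta>)) \<le> real (card (expo \<Theta> n))" by simp
    qed auto
    then have "norm t ^ n * norm (g n \<theta>) \<le> norm t ^ n * (2 * real (card (expo \<Theta> n)))" by (intro mult_left_mono) auto
    then show ?thesis by (simp add: norm_mult norm_power Mb_def mult_ac)
  qed
  have ul: "uniform_limit {0..2 * pi} (\<lambda>N \<theta>. \<Sum>n\<in>{..<N}. t ^ n * g n \<theta>) (\<lambda>\<theta>. suminf (\<lambda>n. t ^ n * g n \<theta>)) sequentially"
    by (rule Weierstrass_m_test[OF bound sM])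
  have fsum: "(\<lambda>\<theta>. suminf (\<lambda>n. t ^ n * g n \<theta>)) = f" using sums_f by (auto simp: sums_iff)
  have cont: "continuous_on {0..2 * pi} (\<lambda>\<theta>. \<Sum>n\<in>{..<N}. t ^ n * g n \<theta>)" for N
    unfolding g_def by (intro continuous_intros) auto
  obtain I L where I: "\<And>N. ((\<lambda>\<theta>. \<Sum>n\<in>{..<N}. t ^ n * g n \<theta>) has_integral I N) {0..2 * pi}"
    and L: "(f has_integral L) {0..2 * pi}" and lim: "I \<longlonglongrightarrow> L"
    by (rule uniform_limit_integral[OF ul[unfolded fsum] cont]) (simp, rule that)
  have "I N = (\<Sum>n\<in>{..<N}. t ^ n * c n)" for N
  proof (rule has_integral_unique[OF I])
    show "((\<lambda>\<theta>. \<Sum>n\<in>{..<N}. t ^ n * g n \<theta>) has_integral (\<Sum>n\<in>{..<N}. t ^ n * c n)) {0..2 * pi}"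
      by (intro has_integral_sum has_integral_mult_right ig) auto
  qed
  then have "I = (\<lambda>N. \<Sum>n\<in>{..<N}. t ^ n * c n)" by (rule ext)
  then have "(\<lambda>n. t ^ n * c n) sums L" using lim unfolding sums_def by (simp only:)
  moreover have "L = J"
    by (rule has_integral_unique[OF L]) (use J in \<open>simp only: f_def \<Theta>_def\<close>)
  ultimately have "(\<lambda>n. t ^ n * c n / complex_of_real (2 * pi)) sums (J / complex_of_real (2 * pi))" by (simp add: sums_divide)
  then show ?thesis by (simp add: c_def mult_ac)
qed

section \<open>Weights\<close>

text \<open>The positive weights of one summand. Passing from d to d + 2 appends the weight d + 2,
  so facts about them are proved by induction in steps of two.\<close>

definition form_weights :: "nat \<Rightarrow> int list" where
  "form_weights d = map (\<lambda>i. 2 * int i - int d) [d div 2 + 1..<d + 1]"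

lemma Lambda_concat: "Lambda ds = concat (map (\<lambda>k. map (Pair k) [ds ! k div 2 + 1..<ds ! k + 1]) [0..<length ds])"
  by (simp add: Lambda_def)

lemma pos_weights_concat: "pos_weights ds = concat (map form_weights ds)"
proof -
  have "pos_weights ds = concat (map (\<lambda>k. form_weights (ds ! k)) [0..<length ds])"
    unfolding pos_weights_def Lambda_concat map_concat map_map comp_def by (simp add: form_weights_def weight_def comp_def)
  also have "map (\<lambda>k. form_weights (ds ! k)) [0..<length ds] = map form_weights ds"
    by (rule nth_equalityI) simp_all
  finally show ?thesis .
qed

lemma pos_weights1_Cons: "pos_weights1 (1 # ds) = pos_weights ds"
proof -
  have "Lambda (1 # ds) = (0, 1) # concat (map (\<lambda>k. map (Pair (Suc k)) [ds ! k div 2 + 1..<ds ! k + 1]) [0..<length ds])"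
    unfolding Lambda_concat length_Cons upt_conv_Cons[OF zero_less_Suc] map_Suc_upt[symmetric]
    by (simp add: comp_def nth_Cons_Suc cong: if_cong)
  moreover have "(0, 1) \<notin> set (concat (map (\<lambda>k. map (Pair (Suc k)) [ds ! k div 2 + 1..<ds ! k + 1]) [0..<length ds]))"
    by auto
  ultimately have "pos_weights1 (1 # ds) = map (weight (1 # ds)) (concat (map (\<lambda>k. map (Pair (Suc k)) [ds ! k div 2 + 1..<ds ! k + 1]) [0..<length ds]))"
    unfolding pos_weights1_def by (simp only: removeAll.simps if_True simp_thms removeAll_id)
  also have "\<dots> = concat (map (\<lambda>k. form_weights (ds ! k)) [0..<length ds])"
    unfolding map_concat map_map comp_def by (simp add: form_weights_def weight_def comp_def)
  also have "map (\<lambda>k. form_weights (ds ! k)) [0..<length ds] = map form_weights ds"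
    by (rule nth_equalityI) simp_all
  finally show ?thesis unfolding pos_weights_concat .
qed

lemma form_weights_simps [simp]:
  "form_weights 0 = []" "form_weights (Suc 0) = [1]"
  "form_weights (Suc (Suc d)) = form_weights d @ [int d + 2]"
proof -
  have "[Suc (Suc d) div 2 + 1..<Suc (Suc d) + 1] = map Suc [d div 2 + 1..<d + 1] @ [Suc (Suc d)]"
    unfolding map_Suc_upt by (simp add: upt_Suc)
  then show "form_weights (Suc (Suc d)) = form_weights d @ [int d + 2]"
    by (simp add: form_weights_def comp_def del: upt_Suc)
qed (simp_all add: form_weights_def)

lemma form_weights_pos: "x \<in> set (form_weights d) \<Longrightarrow> x \<ge> 1"
  by (induction d rule: induct_nat_012) auto

lemma pos_weights_pos: "x \<in> set (pos_weights ds) \<Longrightarrow> x \<ge> 1"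
  by (auto simp: pos_weights_concat intro: form_weights_pos)

text \<open>Passing from d to d + 2 adds the two extreme weights, which are opposite. An arbitrary
  commutative monoid as target covers the integrand and, through exponentials, sums over the
  weights.\<close>

lemma prod_form_weights:
  fixes F :: "int \<Rightarrow> 'a::comm_monoid_mult"
  shows "(\<Prod>i\<le>d. F (2 * int i - int d)) =
    (if even d then F 0 else 1) * prod_list (map (\<lambda>x. F x * F (- x)) (form_weights d))"
proof (induction d rule: induct_nat_012)
  case (ge2 d)
  have "(\<Prod>i\<le>Suc (Suc d). F (2 * int i - int (Suc (Suc d)))) =
      F (- (int d + 2)) * (\<Prod>i\<le>d. F (2 * int i - int d)) * F (int d + 2)"
  proof -
    have e: "- 2 - int d = - int d - 2" by simp
    show ?thesis by (subst prod.atMost_Suc_shift) (simp add: mult.assoc e)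
  qed
  then show ?case unfolding ge2.IH(1) by (simp add: mult_ac)
qed (simp_all add: mult_ac)

lemma prod_weights:
  fixes F :: "int \<Rightarrow> 'a::comm_monoid_mult"
  shows "(\<Prod>p\<in>Theta ds. F (weight ds p)) =
    F 0 ^ length (filter even ds) * (\<Prod>i<length (pos_weights ds). F (pos_weights ds ! i) * F (- (pos_weights ds ! i)))"
proof -
  have "Theta ds = (SIGMA k:{..<length ds}. {..ds ! k})" by (auto simp: Theta_def)
  then have "(\<Prod>p\<in>Theta ds. F (weight ds p)) = (\<Prod>k<length ds. \<Prod>i\<le>ds ! k. F (2 * int i - int (ds ! k)))"
    by (simp add: prod.Sigma weight_def case_prod_unfold)
  also have "\<dots> = prod_list (map (\<lambda>d. \<Prod>i\<le>d. F (2 * int i - int d)) ds)"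
    by (simp add: prod.list_conv_set_nth atLeast0LessThan)
  also have "\<dots> = F 0 ^ length (filter even ds) * prod_list (map (\<lambda>x. F x * F (- x)) (pos_weights ds))"
    unfolding prod_form_weights pos_weights_concat by (induction ds) (simp_all add: mult_ac)
  also have "prod_list (map (\<lambda>x. F x * F (- x)) (pos_weights ds))
      = (\<Prod>i<length (pos_weights ds). F (pos_weights ds ! i) * F (- (pos_weights ds ! i)))"
    by (simp add: prod.list_conv_set_nth atLeast0LessThan)
  finally show ?thesis .
qed

text \<open>The product formula is applied to the exponentials of the squares, and the exponents are
  compared.\<close>

lemma P2_pos_weights: "P2 ds = 2 * (\<Sum>i<length (pos_weights ds). (pos_weights ds ! i)\<^sup>2)"
proof -
  have fin: "finite (Theta ds)" by (rule finite_Theta)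
  have "exp (real_of_int (P2 ds)) = (\<Prod>p\<in>Theta ds. exp (real_of_int ((weight ds p)\<^sup>2)))"
    unfolding P2_def of_int_sum using fin by (rule exp_sum)
  also have "\<dots> = (\<Prod>i<length (pos_weights ds). exp (real_of_int (2 * (pos_weights ds ! i)\<^sup>2)))"
    by (subst prod_weights[of "\<lambda>x. exp (real_of_int (x\<^sup>2))"]) (simp add: exp_add[symmetric])
  also have "\<dots> = exp (\<Sum>i<length (pos_weights ds). real_of_int (2 * (pos_weights ds ! i)\<^sup>2))"
    by (rule exp_sum[symmetric]) simp
  finally have "real_of_int (P2 ds) = real_of_int (\<Sum>i<length (pos_weights ds). 2 * (pos_weights ds ! i)\<^sup>2)"
    by simp
  then show ?thesis unfolding sum_distrib_left of_int_eq_iff .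
qed

lemma length_form_weights: "(if even d then 1 else 0) + 2 * length (form_weights d) = Suc d"
  by (induction d rule: induct_nat_012) auto

lemma dimV_pos_weights: "dimV ds = length (filter even ds) + 2 * length (pos_weights ds)"
proof (induction ds)
  case (Cons d ds)
  then show ?case using length_form_weights[of d] by (auto simp: dimV_def pos_weights_concat split: if_splits)
qed (simp add: dimV_def pos_weights_concat)

text \<open>A summand of degree 0 is the trivial representation; this converts the hypothesis on
  fixed vectors into positive degrees.\<close>

lemma fixed_vectors_zero_component:
  assumes "k < length ds" "ds ! k = 0"
  shows "(\<lambda>p. if p = (k, 0) then 1 else 0) \<in> fixed_vectors ds"
proof -
  define v :: "nat \<times> nat \<Rightarrow> complex" where "v = (\<lambda>p. if p = (k, 0) then 1 else 0)"
  have "act ds g v p = v p" for g p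
  proof -
    obtain j i where p: "p = (j, i)" by force
    have "subst_form (ds ! j) g (\<lambda>l. v (j, l)) i = v (j, i)" if "(j, i) \<in> Theta ds"
    proof (cases "j = k")
      case True
      then have "i = 0" using that assms by (simp add: Theta_def)
      then show ?thesis using True assms by (simp add: subst_form_def v_def)
    next
      case False
      then show ?thesis by (simp add: subst_form_def v_def)
    qed
    moreover have "v (j, i) = 0" if "(j, i) \<notin> Theta ds" using that assms by (auto simp: Theta_def v_def)
    ultimately show ?thesis by (simp add: act_def p)
  qed
  moreover have "v \<in> rep_space ds" using assms by (auto simp: rep_space_def v_def Theta_def)
  ultimately show ?thesis unfolding fixed_vectors_def v_def[symmetric] by blast
qed

lemma degrees_positive:
  assumes "fixed_vectors ds = {0}" "d \<in> set ds"
  shows "d \<ge> 1"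
proof (rule ccontr)
  assume "\<not> d \<ge> 1"
  then obtain k where k: "k < length ds" "ds ! k = 0" using assms(2) by (auto simp: in_set_conv_nth)
  then have "(\<lambda>p. if p = (k, 0) then 1 else 0) = (0 :: nat \<times> nat \<Rightarrow> complex)"
    using fixed_vectors_zero_component[OF k] assms(1) by blast
  from fun_cong[OF this, of "(k, 0)"] show False by (simp add: zero_fun_def)
qed

text \<open>Turns each assumption of non-isomorphism into an inequality of lists of degrees.\<close>

lemma rep_iso_refl: "rep_iso ds ds"
  unfolding rep_iso_def by (rule exI[of _ id]) auto

text \<open>Zeros of the function \<open>x \<mapsto> sin (x\<theta>/2)\<close> on the integers form a subgroup,
  which for \<open>0 < \<theta> < \<pi>\<close> contains neither 1 nor 2.\<close>

definition nonzero_sines :: "real \<Rightarrow> int list \<Rightarrow> nat" where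
  "nonzero_sines \<theta> xs = length (filter (\<lambda>x. sin (of_int x * \<theta> / 2) \<noteq> 0) xs)"

lemma nonzero_sines_simps [simp]:
  "nonzero_sines \<theta> [] = 0"
  "nonzero_sines \<theta> (x # xs) = (if sin (of_int x * \<theta> / 2) \<noteq> 0 then 1 else 0) + nonzero_sines \<theta> xs"
  "nonzero_sines \<theta> (xs @ ys) = nonzero_sines \<theta> xs + nonzero_sines \<theta> ys"
  by (simp_all add: nonzero_sines_def)

lemma nonzero_sines_concat:
  "nonzero_sines \<theta> (concat xss) = sum_list (map (nonzero_sines \<theta>) xss)"
  by (induction xss) simp_all

context
  fixes \<theta> :: real
  assumes th: "0 < \<theta>" "\<theta> < pi"
begin

lemma sin_diff_zero:
  assumes "sin (of_int x * \<theta> / 2) = 0" "sin (of_int y * \<theta> / 2) = 0"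
  shows "sin (of_int (x - y) * \<theta> / 2) = 0"
proof -
  have "of_int (x - y) * \<theta> / 2 = of_int x * \<theta> / 2 - of_int y * \<theta> / 2" by (simp add: left_diff_distrib diff_divide_distrib)
  then show ?thesis using assms by (simp only: sin_diff mult_zero_left mult_zero_right diff_zero)
qed

lemma sin_one_two: "sin (of_int 1 * \<theta> / 2) \<noteq> 0" "sin (of_int 2 * \<theta> / 2) \<noteq> 0"
  using th sin_gt_zero[of "\<theta> / 2"] sin_gt_zero[of \<theta>] by auto

lemma form_nonzero_sines_mono: "nonzero_sines \<theta> (form_weights d) \<le> nonzero_sines \<theta> (form_weights (d + 2 * k))"
  by (induction k) auto

lemma form_nonzero_sines_ge:
  assumes "d = m + 2 * k" "l \<le> nonzero_sines \<theta> (form_weights m)"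
  shows "l \<le> nonzero_sines \<theta> (form_weights d)"
  unfolding assms(1) using assms(2) form_nonzero_sines_mono by (rule order_trans)

lemma form_weights_numerals:
  "form_weights 1 = [1]" "form_weights 2 = [2]" "form_weights 3 = [1, 3]" "form_weights 4 = [2, 4]"
  "form_weights 5 = [1, 3, 5]" "form_weights 6 = [2, 4, 6]" "form_weights 7 = [1, 3, 5, 7]"
  "form_weights 10 = [2, 4, 6, 8, 10]"
  by (simp_all add: numeral_eq_Suc del: One_nat_def) (simp_all)

text \<open>Two weights that differ by 1 or 2 cannot both give 0. Hence at most one of 3, 5, 7 does
  (for the outer pair, 7 - 3 = 4 and then 4 - 3 = 1), and at most one in each of the pairs 4, 6 and
  8, 10. Degree 8 is absent from the count 3, since both 4 and 8 give 0 at \<theta> = \<pi> /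
  2.\<close>

lemma nonzero_sines_numerals:
  "1 \<le> nonzero_sines \<theta> (form_weights 1)" "1 \<le> nonzero_sines \<theta> (form_weights 2)"
  "2 \<le> nonzero_sines \<theta> (form_weights 5)" "2 \<le> nonzero_sines \<theta> (form_weights 6)"
  "3 \<le> nonzero_sines \<theta> (form_weights 7)" "3 \<le> nonzero_sines \<theta> (form_weights 10)"
  "3 \<le> nonzero_sines \<theta> (form_weights 3) + nonzero_sines \<theta> (form_weights 4)"
  using sin_one_two sin_diff_zero[of 5 3] sin_diff_zero[of 6 4] sin_diff_zero[of 7 5]
    sin_diff_zero[of 7 3] sin_diff_zero[of 4 3] sin_diff_zero[of 10 8]
  unfolding form_weights_numerals by auto

text \<open>Raising the degree by 2 only adds a weight, so one odd and one even starting degree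
  settle each count; for the count 3 these are 7 and 10.\<close>

lemma form_nonzero_sines:
  "1 \<le> d \<Longrightarrow> 1 \<le> nonzero_sines \<theta> (form_weights d)"
  "5 \<le> d \<Longrightarrow> 2 \<le> nonzero_sines \<theta> (form_weights d)"
  "d = 7 \<or> 9 \<le> d \<Longrightarrow> 3 \<le> nonzero_sines \<theta> (form_weights d)"
proof -
  have parity: "\<exists>k. d = m + 2 * k \<or> d = Suc m + 2 * k" if "m \<le> d" for m
    using that by presburger
  show "1 \<le> nonzero_sines \<theta> (form_weights d)" if "1 \<le> d"
    using parity[OF that] form_nonzero_sines_ge nonzero_sines_numerals(1,2) by (metis Suc_1)
  show "2 \<le> nonzero_sines \<theta> (form_weights d)" if "5 \<le> d"
    using parity[OF that] form_nonzero_sines_ge[of d 5 _ 2] form_nonzero_sines_ge[of d 6 _ 2] nonzero_sines_numerals(3,4) by auto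
  show "3 \<le> nonzero_sines \<theta> (form_weights d)" if "d = 7 \<or> 9 \<le> d"
  proof -
    have "\<exists>k. d = 7 + 2 * k \<or> d = 10 + 2 * k" using that by presburger
    then show ?thesis
      using form_nonzero_sines_ge[of d 7 _ 3] form_nonzero_sines_ge[of d 10 _ 3] nonzero_sines_numerals(5,6) by auto
  qed
qed

lemma sum_list_nonzero_sines_ge_length:
  assumes "\<And>d. d \<in> set ds \<Longrightarrow> 1 \<le> d"
  shows "length ds \<le> nonzero_sines \<theta> (pos_weights ds)"
proof -
  have "sum_list (map (\<lambda>_. 1) ds) \<le> sum_list (map (\<lambda>d. nonzero_sines \<theta> (form_weights d)) ds)"
    by (rule sum_list_mono) (use assms form_nonzero_sines(1) in auto)
  then show ?thesis by (simp add: pos_weights_concat nonzero_sines_concat comp_def sum_list_triv)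
qed

lemma nonzero_sines_ge_2:
  assumes "\<And>d. d \<in> set ds \<Longrightarrow> 1 \<le> d" "ds \<noteq> []" "\<forall>d\<le>4. ds \<noteq> [d]"
  shows "2 \<le> nonzero_sines \<theta> (pos_weights ds)"
proof (cases "length ds \<ge> 2")
  case True
  then show ?thesis using sum_list_nonzero_sines_ge_length[of ds] assms(1) by fastforce
next
  case False
  then obtain d where d: "ds = [d]" using assms(2) by (cases ds; cases "tl ds") auto
  then have "5 \<le> d" using assms(3) by (metis not_less_eq_eq eval_nat_numeral(3) semiring_norm(26,27,28))
  then show ?thesis using form_nonzero_sines(2) by (simp add: d pos_weights_concat)
qed

text \<open>Three summands contribute at least one each. Of two summands, a degree at least 5
  contributes two and the other summand one. Among pairs of degrees at most 4 the exceptions leave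
  (3, 4), where the weights 1 and 2 survive together with 3 or 4.\<close>

lemma nonzero_sines_ge_3:
  assumes pos: "\<And>d. d \<in> set ds \<Longrightarrow> 1 \<le> d" and ds: "ds \<noteq> []" "sorted ds"
    and one: "\<forall>d\<in>{1, 2, 3, 4, 5, 6, 8}. ds \<noteq> [d]"
    and two: "\<forall>es\<in>{[1, 1], [1, 2], [1, 3], [1, 4], [2, 2], [2, 3], [2, 4], [3, 3], [4, 4]}. ds \<noteq> es"
  shows "3 \<le> nonzero_sines \<theta> (pos_weights ds)"
proof -
  consider "length ds \<ge> 3" | d where "ds = [d]" | c d where "ds = [c, d]"
    using ds(1) by (cases ds; cases "tl ds"; cases "tl (tl ds)") auto
  then show ?thesis
  proof cases
    case 1
    then show ?thesis using sum_list_nonzero_sines_ge_length[of ds] pos by fastforce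
  next
    case 2
    then have "d \<ge> 1" using pos by simp
    moreover have "d \<notin> {1, 2, 3, 4, 5, 6, 8}" using one 2 by blast
    ultimately have "d = 7 \<or> 9 \<le> d" unfolding insert_iff empty_iff by presburger
    then show ?thesis using form_nonzero_sines(3) by (simp add: 2 pos_weights_concat)
  next
    case 3
    have cd: "1 \<le> c" "c \<le> d" using pos ds(2) 3 by auto
    show ?thesis
    proof (cases "d \<ge> 5")
      case True
      then show ?thesis using form_nonzero_sines(1)[of c] form_nonzero_sines(2)[of d] cd by (simp add: 3 pos_weights_concat)
    next
      case False
      then have "d \<in> {1,2,3,4}" "c \<in> {1,2,3,4}" using cd by auto
      moreover have "\<not> (c = 1 \<and> d = 1)" "\<not> (c = 1 \<and> d = 2)" "\<not> (c = 1 \<and> d = 3)" "\<not> (c = 1 \<and> d = 4)"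
        "\<not> (c = 2 \<and> d = 2)" "\<not> (c = 2 \<and> d = 3)" "\<not> (c = 2 \<and> d = 4)" "\<not> (c = 3 \<and> d = 3)" "\<not> (c = 4 \<and> d = 4)"
        using two 3 by blast+
      ultimately have "c = 3 \<and> d = 4" using cd(2) unfolding insert_iff empty_iff by presburger
      then show ?thesis using nonzero_sines_numerals(7) by (simp add: 3 pos_weights_concat)
    qed
  qed
qed

end

lemma le_sum_form_weights: "int d \<le> sum_list (form_weights d)"
proof (induction d rule: induct_nat_012)
  case (ge2 n)
  have "0 \<le> int n" by simp
  then show ?case using ge2.IH(1) by simp
qed simp_all

text \<open>The bound asked for by \<open>torus_weights\<close>. The list \<open>[1, 1]\<close> has
  to be excluded separately: it passes the count of nonzero sines, but its weights add up to
  2.\<close>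

lemma sum_pos_weights_ge_3:
  assumes "\<And>d. d \<in> set ds \<Longrightarrow> 1 \<le> d" "ds \<noteq> []" "\<forall>d\<le>4. ds \<noteq> [d]" "ds \<noteq> [1, 1]"
  shows "3 \<le> sum_list (pos_weights ds)"
proof -
  have *: "sum_list (map int ds) \<le> sum_list (pos_weights ds)"
  proof (induction ds)
    case (Cons d ds)
    then show ?case using le_sum_form_weights[of d] by (simp add: pos_weights_concat)
  qed (simp add: pos_weights_concat)
  consider d where "ds = [d]" | c d where "ds = [c, d]" | c d e es where "ds = c # d # e # es"
    using assms(2) by (cases ds; cases "tl ds"; cases "tl (tl ds)") auto
  then have "3 \<le> sum_list (map int ds)"
  proof cases
    case 1
    then have "\<not> d \<le> 4" using assms(3) by blast
    then show ?thesis using 1 by simp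
  next
    case 2
    then have "1 \<le> c" "1 \<le> d" "\<not> (c = 1 \<and> d = 1)" using assms(1,4) by auto
    then show ?thesis using 2 by simp linarith
  next
    case 3
    then have "1 \<le> c" "1 \<le> d" "1 \<le> e" using assms(1) by auto
    moreover have "0 \<le> sum_list (map int es)" by (rule sum_list_nonneg) auto
    ultimately show ?thesis using 3 by simp
  qed
  then show ?thesis using * by linarith
qed

section \<open>Parity of the weights\<close>

lemma even_form_weights: "even d \<Longrightarrow> x \<in> set (form_weights d) \<Longrightarrow> even x"
  by (induction d rule: induct_nat_012) auto

text \<open>An odd degree d has (d + 1)/2 positive weights, all of them odd.\<close>

lemma odd_form_weights:
  "odd d \<Longrightarrow> 1 \<le> length (filter odd (form_weights d))"
  "odd d \<Longrightarrow> 1 < d \<Longrightarrow> 2 \<le> length (filter odd (form_weights d))"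
proof -
  have *: "2 * length (filter odd (form_weights d)) = (if odd d then Suc d else 0)" for d
    by (induction d rule: induct_nat_012) auto
  show "odd d \<Longrightarrow> 1 \<le> length (filter odd (form_weights d))"
    "odd d \<Longrightarrow> 1 < d \<Longrightarrow> 2 \<le> length (filter odd (form_weights d))"
    using *[of d] by (auto elim!: oddE)
qed

lemma odd_pos_weights: "length (filter odd (pos_weights ds)) = (\<Sum>d\<leftarrow>ds. length (filter odd (form_weights d)))"
  by (simp add: pos_weights_concat filter_concat length_concat comp_def)

lemma two_odd_pos_weights:
  assumes "card {k. k < length ds \<and> odd (ds ! k)} \<ge> 2 \<or> (\<exists>d\<in>set ds. odd d \<and> d > 1)"
  shows "2 \<le> length (filter odd (pos_weights ds))"
  using assms
proof
  assume "card {k. k < length ds \<and> odd (ds ! k)} \<ge> 2"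
  then have "2 \<le> length (filter odd ds)" by (simp add: length_filter_conv_card)
  also have "length (filter odd ds) = (\<Sum>d\<leftarrow>ds. if odd d then 1 else 0)" by (induction ds) auto
  also have "\<dots> \<le> (\<Sum>d\<leftarrow>ds. length (filter odd (form_weights d)))"
    by (rule sum_list_mono) (use odd_form_weights(1) in auto)
  finally show ?thesis unfolding odd_pos_weights .
next
  assume "\<exists>d\<in>set ds. odd d \<and> d > 1"
  then obtain d where d: "d \<in> set ds" "odd d" "1 < d" by blast
  have "2 \<le> length (filter odd (form_weights d))" using odd_form_weights(2) d by blast
  also have "\<dots> \<le> (\<Sum>d\<leftarrow>ds. length (filter odd (form_weights d)))"
    by (rule member_le_sum_list) (use d in auto)
  finally show ?thesis unfolding odd_pos_weights .
qed

lemma even_pos_weights: "(\<And>d. d \<in> set ds \<Longrightarrow> even d) \<Longrightarrow> x \<in> set (pos_weights ds) \<Longrightarrow> even x"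
  by (auto simp: pos_weights_concat intro: even_form_weights)

lemma odd_pos_weight:
  assumes "d \<in> set ds" "odd d"
  obtains x where "x \<in> set (pos_weights ds)" "odd x"
proof -
  have "filter odd (form_weights d) \<noteq> []" using odd_form_weights(1)[OF assms(2)] by auto
  then obtain x where "x \<in> set (form_weights d)" "odd x" by (auto simp: filter_empty_conv)
  then show ?thesis using assms that by (auto simp: pos_weights_concat)
qed

section \<open>Laurent expansions of rational functions\<close>

text \<open>Uniqueness: the cross-multiplied numerators agree as power series, hence as
  polynomials.\<close>

lemma rational_of_fps_eq:
  assumes "q \<noteq> 0" "H * fps_of_poly q = fps_of_poly p"
  shows "rational_of_fps H = Fract p q"
  unfolding rational_of_fps_def
proof (rule the_equality)
  show "\<exists>p' q'. q' \<noteq> 0 \<and> Fract p q = Fract p' q' \<and> H * fps_of_poly q' = fps_of_poly p'"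
    using assms by blast
  fix h assume "\<exists>p q. q \<noteq> 0 \<and> h = Fract p q \<and> H * fps_of_poly q = fps_of_poly p"
  then obtain p' q' where h: "q' \<noteq> 0" "h = Fract p' q'" "H * fps_of_poly q' = fps_of_poly p'" by blast
  have "fps_of_poly (p' * q) = fps_of_poly (p * q')"
    unfolding fps_of_poly_mult h(3)[symmetric] assms(2)[symmetric] by (simp only: mult_ac)
  then have "p' * q = p * q'" by simp
  then show "h = Fract p q" using h assms(1) by (simp add: eq_fract)
qed

lemma quot_of_fract_cross:
  assumes "(q :: complex poly) \<noteq> 0"
  shows "fst (quot_of_fract (Fract p q)) * q = p * snd (quot_of_fract (Fract p q))"
proof -
  have "Fract (fst (quot_of_fract (Fract p q))) (snd (quot_of_fract (Fract p q))) = Fract p q"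
    by (rule Fract_quot_of_fract)
  then show ?thesis by (subst (asm) eq_fract(1)) (use assms in simp_all)
qed

text \<open>The difference of degrees does not change under cancellation, so common factors of
  \<open>p\<close> and \<open>q\<close> do no harm.\<close>

lemma rational_degree_Fract:
  assumes "p \<noteq> 0" "q \<noteq> 0"
  shows "rational_degree (Fract p q) = int (degree p) - int (degree q)"
proof -
  define x y where "x = fst (quot_of_fract (Fract p q))" and "y = snd (quot_of_fract (Fract p q))"
  have xy: "x * q = p * y" using quot_of_fract_cross[OF assms(2)] by (simp add: x_def y_def)
  have y: "y \<noteq> 0" by (simp add: y_def)
  then have x: "x \<noteq> 0" using xy assms by auto
  have "degree x + degree q = degree p + degree y"
    using arg_cong[OF xy, of degree] x y assms by (simp add: degree_mult_eq)
  then show ?thesis unfolding rational_degree_def x_def[symmetric] y_def[symmetric] by linarith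
qed

lemma reflection_pcompose_eq_0_iff: "pcompose p [:1, -1:] = 0 \<longleftrightarrow> (p :: complex poly) = 0"
  by (rule pcompose_eq_0_iff) simp

lemma laurent_at_1_Fract:
  assumes "q \<noteq> 0"
  shows "laurent_at_1 (Fract p q) =
    fps_to_fls (fps_of_poly (pcompose p [:1, -1:])) / fps_to_fls (fps_of_poly (pcompose q [:1, -1:]))"
proof -
  define x y where "x = fst (quot_of_fract (Fract p q))" and "y = snd (quot_of_fract (Fract p q))"
  have "x * q = p * y" using quot_of_fract_cross[OF assms] by (simp add: x_def y_def)
  then have xy: "pcompose x [:1, -1:] * pcompose q [:1, -1:] = pcompose p [:1, -1:] * pcompose y [:1, -1:]"
    unfolding pcompose_mult[symmetric] by simp
  have y: "y \<noteq> 0" by (simp add: y_def)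
  have "fps_to_fls (fps_of_poly (pcompose x [:1, -1:])) * fps_to_fls (fps_of_poly (pcompose q [:1, -1:]))
      = fps_to_fls (fps_of_poly (pcompose p [:1, -1:])) * fps_to_fls (fps_of_poly (pcompose y [:1, -1:]))"
    unfolding fls_times_fps_to_fls[symmetric] fps_of_poly_mult[symmetric] xy ..
  then show ?thesis
    unfolding laurent_at_1_def x_def[symmetric] y_def[symmetric]
    by (subst frac_eq_eq) (use y assms in \<open>simp_all add: reflection_pcompose_eq_0_iff\<close>)
qed

section \<open>Rational functions near t = 1 in the variable u = 1 - t\<close>

lemma poly_tendsto_at_right_0:
  "((\<lambda>u. poly p (complex_of_real u)) \<longlongrightarrow> poly p 0) (at_right 0)"
proof -
  have "((\<lambda>u. poly p (complex_of_real u)) \<longlongrightarrow> poly p (complex_of_real 0)) (at_right 0)"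
    by (intro tendsto_intros)
  then show ?thesis by simp
qed

lemma filterlim_complex_of_real_at_0:
  assumes "(f \<longlongrightarrow> 0) (at_right (0::real))" "eventually (\<lambda>u. f u \<noteq> 0) (at_right 0)"
  shows "filterlim (\<lambda>u. complex_of_real (f u)) (at 0) (at_right 0)"
proof (rule filterlim_atI)
  show "((\<lambda>u. complex_of_real (f u)) \<longlongrightarrow> 0) (at_right 0)" using tendsto_of_real[OF assms(1)] by simp
  show "eventually (\<lambda>u. complex_of_real (f u) \<noteq> 0) (at_right 0)" using assms(2) by eventually_elim simp
qed

lemma eventually_poly_nonzero_at_0:
  assumes "(p :: complex poly) \<noteq> 0"
  shows "eventually (\<lambda>u. poly p u \<noteq> 0) (at 0)"
proof -
  have "finite {x. poly p x = 0}" by (rule poly_roots_finite[OF assms])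
  then have "open (- ({x. poly p x = 0} - {0}))" by (intro open_Compl finite_imp_closed finite_Diff)
  then have "eventually (\<lambda>u. u \<in> - ({x. poly p x = 0} - {0})) (nhds 0)" by (rule eventually_nhds_in_open) simp
  then show ?thesis unfolding eventually_at_filter by (rule eventually_mono) auto
qed

lemma eventually_poly_nonzero:
  assumes "(p :: complex poly) \<noteq> 0"
  shows "eventually (\<lambda>u::real. poly p (of_real u) \<noteq> 0) (at_right 0)"
proof (rule eventually_compose_filterlim[OF eventually_poly_nonzero_at_0[OF assms]])
  show "filterlim complex_of_real (at 0) (at_right 0)"
    by (rule filterlim_complex_of_real_at_0[of "\<lambda>u. u"]) (auto intro: eventually_mono[OF eventually_at_right_less[of 0]])
qed

text \<open>A finite one-sided limit rules out a pole: if \<open>q\<close> had the higher order at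
  0, multiplying by the missing powers of u would force P1 to vanish at 0. The common power of u can
  then be cancelled.\<close>

lemma poly_quotient_finite_limit:
  fixes p q :: "complex poly"
  assumes "p \<noteq> 0" "q \<noteq> 0"
    and lim: "((\<lambda>u. poly p (of_real u) / poly q (of_real u)) \<longlongrightarrow> L) (at_right (0::real))"
  obtains A B where "poly B 0 \<noteq> 0" "p * B = A * q"
proof -
  obtain P1 where P1: "p = [:0, 1:] ^ order 0 p * P1" "\<not> [:0, 1:] dvd P1"
    using order_decomp[OF assms(1), of 0] by auto
  obtain Q1 where Q1: "q = [:0, 1:] ^ order 0 q * Q1" "\<not> [:0, 1:] dvd Q1"
    using order_decomp[OF assms(2), of 0] by auto
  have P10: "poly P1 0 \<noteq> 0" using P1(2) poly_eq_0_iff_dvd[of P1 0] by simp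
  have Q10: "poly Q1 0 \<noteq> 0" using Q1(2) poly_eq_0_iff_dvd[of Q1 0] by simp
  have le: "order 0 q \<le> order 0 p"
  proof (rule ccontr)
    assume "\<not> ?thesis"
    then obtain k where k: "order 0 q = order 0 p + Suc k"
      using less_iff_Suc_add by (metis linorder_not_le add_Suc_right)
    have "((\<lambda>u. poly p (of_real u) / poly q (of_real u) * (of_real u ^ Suc k * poly Q1 (of_real u))) \<longlongrightarrow> L * (complex_of_real 0 ^ Suc k * poly Q1 0)) (at_right (0::real))"
      by (intro tendsto_mult lim poly_tendsto_at_right_0) (intro tendsto_intros)
    moreover have "eventually (\<lambda>u::real. poly p (of_real u) / poly q (of_real u) * (of_real u ^ Suc k * poly Q1 (of_real u)) = poly P1 (of_real u)) (at_right 0)"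
      using eventually_poly_nonzero[OF assms(2)] eventually_at_right_less[of 0]
    proof eventually_elim
      case (elim u)
      have *: "poly ([:0, 1:] ^ j * s) x = x ^ j * poly s x" for j s and x :: complex by (simp add: poly_power)
      have pp: "poly p (of_real u) = of_real u ^ order 0 p * poly P1 (of_real u)"
        using arg_cong[OF P1(1), of "\<lambda>s. poly s (of_real u)"] unfolding * .
      have "poly q (of_real u) = of_real u ^ order 0 q * poly Q1 (of_real u)"
        using arg_cong[OF Q1(1), of "\<lambda>s. poly s (of_real u)"] unfolding * .
      then have qq: "poly q (of_real u) = of_real u ^ order 0 p * (of_real u ^ Suc k * poly Q1 (of_real u))"
        unfolding k power_add by (simp only: mult.assoc)
      have cancel: "x * y / (x * z) * z = y" if "x \<noteq> 0" "z \<noteq> 0" for x y z :: complex using that by simp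
      show ?case unfolding pp qq by (rule cancel) (use elim qq in auto)
    qed
    ultimately have "((\<lambda>u. poly P1 (of_real u)) \<longlongrightarrow> 0) (at_right (0::real))"
      by (simp add: tendsto_cong)
    then have "poly P1 0 = 0" by (rule tendsto_unique[OF _ poly_tendsto_at_right_0, rotated]) simp
    then show False using P10 by simp
  qed
  show ?thesis
  proof (rule that[OF Q10])
    have "[:0, 1 :: complex:] ^ order 0 p = [:0, 1:] ^ (order 0 p - order 0 q) * [:0, 1:] ^ order 0 q"
      unfolding power_add[symmetric] using le by simp
    then show "p * Q1 = ([:0, 1:] ^ (order 0 p - order 0 q) * P1) * q"
      by (subst P1(1), subst (2) Q1(1)) (simp only: mult_ac)
  qed
qed

lemma poly_monom_times_of_low_coeffs:
  assumes "\<And>i. i < n \<Longrightarrow> coeff E i = 0"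
  obtains W where "E = monom (1::'a::comm_ring_1) n * W"
proof
  show "E = monom 1 n * Polynomial.poly_shift n E"
    by (rule poly_eqI) (use assms in \<open>auto simp: coeff_monom_mult coeff_poly_shift\<close>)
qed

text \<open>The function is rewritten as A / B with B(0) \<noteq> 0. Its power series
  \<open>S\<close> is, as a formal Laurent series, X^N times the expansion at 1, so the Laurent
  coefficients are Taylor coefficients of A / B. Four of them are split off by dividing A - T B by
  u^4, which leaves a remainder continuous at 0.\<close>

lemma laurent_expansion_at_1:
  fixes p q :: "complex poly"
  assumes p: "p \<noteq> 0" and q: "q \<noteq> 0"
    and lim: "((\<lambda>u. of_real u ^ N * poly p (1 - of_real u) / poly q (1 - of_real u)) \<longlongrightarrow> L) (at_right (0::real))"
  defines "c \<equiv> \<lambda>m. fls_nth (laurent_at_1 (Fract p q)) (int m - int N)"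
  obtains r :: "complex \<Rightarrow> complex" where "isCont r 0"
    and "eventually (\<lambda>u. u ^ N * poly p (1 - u) / poly q (1 - u)
           = c 0 + c 1 * u + c 2 * u^2 + c 3 * u^3 + u^4 * r u) (at 0)"
proof -
  define P Q where "P = pcompose p [:1, -1:]" and "Q = pcompose q [:1, -1:]"
  have P0: "monom 1 N * P \<noteq> 0" and Q0: "Q \<noteq> 0" using p q by (auto simp: P_def Q_def reflection_pcompose_eq_0_iff)
  have PQ: "u ^ N * poly p (1 - u) / poly q (1 - u) = poly (monom 1 N * P) u / poly Q u" for u
    by (simp add: P_def Q_def poly_pcompose poly_monom)
  obtain A B where B: "poly B 0 \<noteq> 0" and AB: "monom 1 N * P * B = A * Q"
    using poly_quotient_finite_limit[OF P0 Q0 lim[unfolded PQ]] by blast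
  have B': "fps_nth (fps_of_poly B) 0 \<noteq> 0" using B by (simp add: poly_0_coeff_0)
  define S where "S = fps_of_poly A * inverse (fps_of_poly B)"
  have SB: "S * fps_of_poly B = fps_of_poly A" unfolding S_def using inverse_mult_eq_1[OF B'] by (simp add: mult.assoc)
  have Bn0: "B \<noteq> 0" using B by auto
  have c: "c m = fps_nth S m" for m
  proof -
    define L1 where "L1 = laurent_at_1 (Fract p q)"
    have L1: "L1 * fps_to_fls (fps_of_poly Q) = fps_to_fls (fps_of_poly P)"
      unfolding L1_def laurent_at_1_Fract[OF q] P_def[symmetric] Q_def[symmetric] using Q0 by simp
    have X: "fps_to_fls (fps_of_poly (monom 1 N)) = (fls_X :: complex fls) ^ N"
      by (simp only: fps_of_poly_monom' fps_to_fls_power) simp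
    have "fps_to_fls (fps_of_poly (monom 1 N * P * B)) = fps_to_fls (fps_of_poly (A * Q))" unfolding AB ..
    then have "fls_X ^ N * fps_to_fls (fps_of_poly P) * fps_to_fls (fps_of_poly B) = fps_to_fls (fps_of_poly A) * fps_to_fls (fps_of_poly Q)"
      unfolding fps_of_poly_mult fls_times_fps_to_fls X .
    then have "(fls_X ^ N * L1) * (fps_to_fls (fps_of_poly B) * fps_to_fls (fps_of_poly Q)) = fps_to_fls S * (fps_to_fls (fps_of_poly B) * fps_to_fls (fps_of_poly Q))"
      unfolding L1[symmetric] SB[symmetric] fls_times_fps_to_fls by (simp only: mult_ac)
    then have "fls_X ^ N * L1 = fps_to_fls S" using Bn0 Q0 by simp
    then have "fls_nth (fls_X ^ N * L1) (int m) = fps_nth S m" by simp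
    then show ?thesis unfolding c_def L1_def[symmetric] fls_X_power_times_conv_shift by simp
  qed
  define T where "T = [:c 0, c 1, c 2, c 3:]"
  have "coeff (A - T * B) i = 0" if "i < 4" for i
  proof -
    have "fps_nth (S * fps_of_poly B) i = (\<Sum>j=0..i. c j * coeff B (i - j))" by (simp add: fps_mult_nth c)
    then have "coeff A i = (\<Sum>j=0..i. c j * coeff B (i - j))" unfolding SB by simp
    also have "\<dots> = (\<Sum>j\<le>i. coeff T j * coeff B (i - j))"
      unfolding atMost_atLeast0
    proof (rule sum.cong[OF refl])
      fix j assume "j \<in> {0..i}"
      then have "j < 4" using that by simp
      then have "j \<in> {0,1,2,3}" by auto
      then show "c j * coeff B (i - j) = coeff T j * coeff B (i - j)" by (auto simp: T_def numeral_2_eq_2 numeral_3_eq_3)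
    qed
    also have "\<dots> = coeff (T * B) i" by (simp add: coeff_mult)
    finally show ?thesis by simp
  qed
  then obtain W where W: "A - T * B = monom 1 4 * W" using poly_monom_times_of_low_coeffs by blast
  show ?thesis
  proof (rule that[of "\<lambda>u. poly W u / poly B u"])
    show "isCont (\<lambda>u. poly W u / poly B u) 0" using B by (intro continuous_intros) auto
    show "eventually (\<lambda>u. u ^ N * poly p (1 - u) / poly q (1 - u)
           = c 0 + c 1 * u + c 2 * u^2 + c 3 * u^3 + u^4 * (poly W u / poly B u)) (at 0)"
      using eventually_poly_nonzero_at_0[OF Q0] eventually_poly_nonzero_at_0[OF Bn0]
    proof eventually_elim
      case (elim u)
      have "poly (monom 1 N * P * B) u = poly (A * Q) u" unfolding AB ..
      then have "poly (monom 1 N * P) u / poly Q u = poly A u / poly B u"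
        by (subst frac_eq_eq[OF elim]) simp
      moreover have "A = T * B + monom 1 4 * W" using W by (simp add: algebra_simps)
      then have "poly A u / poly B u = poly T u + u ^ 4 * (poly W u / poly B u)"
        using elim(2) by (simp add: poly_monom add_divide_distrib)
      moreover have "poly T u = c 0 + c 1 * u + c 2 * u^2 + c 3 * u^3"
        by (simp add: T_def algebra_simps power2_eq_square power3_eq_cube)
      ultimately show ?case unfolding PQ by simp
    qed
  qed
qed

section \<open>Comparison of coefficients by limits\<close>

lemma vanishing_constant:
  fixes a :: complex
  assumes "(k \<longlongrightarrow> l) (at_right (0::real))" "eventually (\<lambda>u. a + of_real u * k u = 0) (at_right 0)"
  shows "a = 0"
proof -
  have "((\<lambda>u. a + of_real u * k u) \<longlongrightarrow> a + of_real 0 * l) (at_right 0)" by (intro tendsto_intros assms(1))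
  moreover have "((\<lambda>u. a + of_real u * k u) \<longlongrightarrow> 0) (at_right (0::real))"
    using tendsto_cong[OF assms(2)] by simp
  ultimately show ?thesis using tendsto_unique[of "at_right (0::real)"] by fastforce
qed

text \<open>The nested form allows peeling: once a coefficient is 0, division by u exposes the next
  one as a limit.\<close>

lemma vanishing_coefficients:
  fixes a b c d :: complex
  assumes k: "(k \<longlongrightarrow> l) (at_right (0::real))"
    and "eventually (\<lambda>u. a + of_real u * (b + of_real u * (c + of_real u * (d + of_real u * k u))) = 0) (at_right 0)"
  shows "a = 0" "b = 0" "c = 0" "d = 0"
proof -
  have pos: "eventually (\<lambda>u::real. u > 0) (at_right 0)" by (rule eventually_at_right_less)
  have step: "eventually (\<lambda>u. f u = 0) (at_right 0)" if "eventually (\<lambda>u. 0 + of_real u * f u = 0) (at_right 0)"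
    for f :: "real \<Rightarrow> complex" using that pos by eventually_elim auto
  have 1: "((\<lambda>u. d + of_real u * k u) \<longlongrightarrow> d + of_real 0 * l) (at_right 0)"
    and 2: "((\<lambda>u. c + of_real u * (d + of_real u * k u)) \<longlongrightarrow> c + of_real 0 * (d + of_real 0 * l)) (at_right 0)"
    and 3: "((\<lambda>u. b + of_real u * (c + of_real u * (d + of_real u * k u))) \<longlongrightarrow> b + of_real 0 * (c + of_real 0 * (d + of_real 0 * l))) (at_right 0)"
    by (intro tendsto_intros k)+
  show a: "a = 0" by (rule vanishing_constant[OF 3 assms(2)])
  note e1 = step[OF assms(2)[unfolded a]]
  show b: "b = 0" by (rule vanishing_constant[OF 2 e1])
  note e2 = step[OF e1[unfolded b]]
  show c: "c = 0" by (rule vanishing_constant[OF 1 e2])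
  note e3 = step[OF e2[unfolded c]]
  show "d = 0" by (rule vanishing_constant[OF k e3])
qed

section \<open>The reciprocity of the Hilbert series\<close>

definition int_weight :: "nat list \<Rightarrow> nat \<Rightarrow> nat" where
  "int_weight ds i = nat (pos_weights ds ! i)"

definition zero_weights :: "nat list \<Rightarrow> nat" where
  "zero_weights ds = length (filter even ds)"

lemma int_weight_pos: "i < length (pos_weights ds) \<Longrightarrow> int_weight ds i \<ge> 1"
  and int_int_weight: "i < length (pos_weights ds) \<Longrightarrow> int (int_weight ds i) = pos_weights ds ! i"
  using pos_weights_pos[of "pos_weights ds ! i" ds] by (auto simp: int_weight_def)

lemma torus_weights_pos_weights:
  assumes "3 \<le> sum_list (pos_weights ds)"
  shows "torus_weights (length (pos_weights ds)) (int_weight ds)"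
proof
  have "int (\<Sum>i<length (pos_weights ds). int_weight ds i) = (\<Sum>i<length (pos_weights ds). pos_weights ds ! i)"
    by (simp add: int_int_weight)
  also have "\<dots> = sum_list (pos_weights ds)" by (simp add: sum_list_sum_nth atLeast0LessThan)
  finally show "3 \<le> (\<Sum>i<length (pos_weights ds). int_weight ds i)" using assms by linarith
qed (rule int_weight_pos)

text \<open>Each even degree has one weight 0, whose factor 1 - t does not depend on \<theta> and
  leaves the integral.\<close>

lemma (in torus_weights) molien_integrand:
  assumes "n = length (pos_weights ds)" "b = int_weight ds"
  shows "(1 - inverse (cis \<theta>) ^ 2) * (\<Prod>p\<in>Theta ds. 1 / (1 - t * cis (of_int (weight ds p) * \<theta>)))
    = circle_integrand t \<theta> / (1 - t) ^ zero_weights ds"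
proof -
  have "cis (of_int (pos_weights ds ! i) * \<theta>) = cis \<theta> ^ b i" "cis (of_int (- (pos_weights ds ! i)) * \<theta>) = inverse (cis \<theta>) ^ b i"
    if "i < n" for i
  proof -
    have *: "real_of_int (pos_weights ds ! i) = real (b i)"
      using int_int_weight[of i ds] that assms by (metis of_int_of_nat_eq)
    show "cis (of_int (pos_weights ds ! i) * \<theta>) = cis \<theta> ^ b i" unfolding * Complex.DeMoivre ..
    show "cis (of_int (- (pos_weights ds ! i)) * \<theta>) = inverse (cis \<theta>) ^ b i"
      unfolding of_int_minus * cis_inverse Complex.DeMoivre by simp
  qed
  then have "(\<Prod>i<n. 1 / (1 - t * cis (of_int (pos_weights ds ! i) * \<theta>)) * (1 / (1 - t * cis (of_int (- (pos_weights ds ! i)) * \<theta>))))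
      = (\<Prod>i<n. 1 / ((1 - t * cis \<theta> ^ b i) * (1 - t * inverse (cis \<theta>) ^ b i)))"
    by (intro prod.cong) auto
  then have "(\<Prod>p\<in>Theta ds. 1 / (1 - t * cis (of_int (weight ds p) * \<theta>)))
      = (1 / (1 - t)) ^ zero_weights ds * (1 / (\<Prod>i<n. (1 - t * cis \<theta> ^ b i) * (1 - t * inverse (cis \<theta>) ^ b i)))"
    using prod_weights[of "\<lambda>x. 1 / (1 - t * cis (of_int x * \<theta>))" ds] assms(1)
    by (simp add: zero_weights_def prod_dividef)
  then show ?thesis by (simp add: circle_integrand_def power_one_over)
qed

text \<open>The identity of formal power series follows from equality of values on a disc around 0
  on which \<open>d\<close> has no zero. The series is evaluated only there; the values at t > 1 are
  those of the fraction and come from the outer half of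
  \<open>rational_continuation\<close>.\<close>

lemma hilbert_rational:
  assumes s3: "3 \<le> sum_list (pos_weights ds)"
  obtains d q :: "complex poly" where "poly d 0 = 1" "poly q 0 = 1"
    "hilb_series ds * fps_of_poly ([:1, -1:] ^ zero_weights ds * d) = fps_of_poly q"
    "\<And>t::real. 0 < t \<Longrightarrow> t < 1 \<Longrightarrow> poly q (of_real t) = poly d (of_real t) *
      of_real (Gint (length (pos_weights ds)) (int_weight ds) ((1 - t)\<^sup>2 / t) / (2 * pi * t ^ length (pos_weights ds)))"
    "\<And>t::real. 1 < t \<Longrightarrow> poly q (of_real t) = - (poly d (of_real t) *
      of_real (Gint (length (pos_weights ds)) (int_weight ds) ((1 - t)\<^sup>2 / t) / (2 * pi * t ^ length (pos_weights ds))))"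
proof -
  define n where "n = length (pos_weights ds)"
  define b where "b = int_weight ds"
  define e where "e = zero_weights ds"
  interpret torus_weights n b unfolding n_def b_def by (rule torus_weights_pos_weights[OF s3])
  obtain d q where d0: "poly d 0 = 1"
    and small: "\<And>t. norm t < 1 \<Longrightarrow> ((\<lambda>\<theta>. poly d t * circle_integrand t \<theta>) has_integral complex_of_real (2 * pi) * poly q t) {0..2 * pi}"
    and large: "\<And>t. norm t > 1 \<Longrightarrow> ((\<lambda>\<theta>. poly d t * circle_integrand t \<theta>) has_integral - (complex_of_real (2 * pi) * poly q t)) {0..2 * pi}"
    using rational_continuation by blast
  have q0: "poly q 0 = 1"
  proof -
    have "((\<lambda>\<theta>. cis (of_int 0 * \<theta>) - cis (of_int (- 2) * \<theta>)) has_integral complex_of_real (2 * pi) - 0) {0..2 * pi}"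
      using has_integral_diff[OF circle_fourier[of 0] circle_fourier[of "- 2"]] by simp
    moreover have "poly d 0 * circle_integrand 0 \<theta> = cis (of_int 0 * \<theta>) - cis (of_int (- 2) * \<theta>)" for \<theta>
      by (simp add: d0 circle_integrand_def Complex.DeMoivre)
    ultimately have "((\<lambda>\<theta>. poly d 0 * circle_integrand 0 \<theta>) has_integral complex_of_real (2 * pi)) {0..2 * pi}" by simp
    from has_integral_unique[OF small[of 0] this] show ?thesis by simp
  qed
  have sums: "(\<lambda>k. fps_nth (hilb_series ds) k * t ^ k) sums (poly q t / (poly d t * (1 - t) ^ e))"
    if t: "norm t < 1" "poly d t \<noteq> 0" for t
  proof -
    have "((\<lambda>\<theta>. inverse (poly d t * (1 - t) ^ e) * (poly d t * circle_integrand t \<theta>)) has_integral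
        inverse (poly d t * (1 - t) ^ e) * (complex_of_real (2 * pi) * poly q t)) {0..2 * pi}"
      by (rule has_integral_mult_right[OF small[OF t(1)]])
    moreover have "inverse (poly d t * (1 - t) ^ e) * (poly d t * circle_integrand t \<theta>) = circle_integrand t \<theta> / (1 - t) ^ e" for \<theta>
      using t(2) by (simp add: divide_inverse)
    ultimately have "((\<lambda>\<theta>. (1 - inverse (cis \<theta>) ^ 2) * (\<Prod>p\<in>Theta ds. 1 / (1 - t * cis (of_int (weight ds p) * \<theta>)))) has_integral
        inverse (poly d t * (1 - t) ^ e) * (complex_of_real (2 * pi) * poly q t)) {0..2 * pi}"
      unfolding molien_integrand[OF n_def b_def] e_def[symmetric] by (simp only:)
    from dim_sums_circle[OF t(1) this]
    have "(\<lambda>k. fps_nth (hilb_series ds) k * t ^ k) sums (inverse (poly d t * (1 - t) ^ e) * (complex_of_real (2 * pi) * poly q t) / (2 * pi))"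
      by (simp add: hilb_series_def)
    moreover have "inverse y * (c * x) / c = x / y" if "c \<noteq> 0" for x y c :: complex
    proof -
      have "inverse y * (c * x) / c = (x / y) * (c / c)" unfolding divide_inverse by (simp only: mult_ac)
      then show ?thesis using that by simp
    qed
    from this[of "complex_of_real (2 * pi)"]
    have "inverse y * (complex_of_real (2 * pi) * x) / complex_of_real (2 * pi) = x / y" for x y by simp
    ultimately show ?thesis by (simp only:)
  qed
  define V where "V = {t. norm t < 1 \<and> poly d t \<noteq> 0}"
  have "V = ball 0 1 \<inter> {t. poly d t \<noteq> 0}" by (auto simp: V_def)
  moreover have "open {t. poly d t \<noteq> 0}" by (intro open_Collect_neq continuous_intros)
  ultimately have "open V" by (simp add: open_Int)
  moreover have V0: "0 \<in> V" by (simp add: V_def d0)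
  ultimately obtain \<delta> where \<delta>: "\<delta> > 0" "ball 0 \<delta> \<subseteq> V" by (meson open_contains_ball)
  have radius: "fps_conv_radius (hilb_series ds) \<ge> ereal (\<delta> / 2)"
  proof -
    have "complex_of_real (\<delta> / 2) \<in> ball 0 \<delta>" using \<delta>(1) by (simp add: norm_of_real[of "\<delta> / 2", where 'a = complex, simplified])
    then have "summable (\<lambda>k. fps_nth (hilb_series ds) k * complex_of_real (\<delta> / 2) ^ k)"
      using \<delta>(2) sums_summable[OF sums] by (auto simp only: V_def)
    from conv_radius_geI[OF this] show ?thesis using \<delta>(1) unfolding fps_conv_radius_def norm_of_real by simp
  qed
  have rational: "hilb_series ds * fps_of_poly ([:1, -1:] ^ e * d) = fps_of_poly q"
  proof (rule eval_fps_eqD)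
    have Hpos: "fps_conv_radius (hilb_series ds) > 0" using radius \<delta>(1) by (meson ereal_less(2) half_gt_zero less_le_trans)
    then show "fps_conv_radius (hilb_series ds * fps_of_poly ([:1, -1:] ^ e * d)) > 0"
      by (intro less_le_trans[OF _ fps_conv_radius_mult]) simp
    show "fps_conv_radius (fps_of_poly q) > 0" by simp
    have "eventually (\<lambda>t. t \<in> ball 0 (\<delta> / 2)) (nhds (0 :: complex))"
      by (rule eventually_nhds_in_open) (use \<delta> in auto)
    then show "eventually (\<lambda>t. eval_fps (hilb_series ds * fps_of_poly ([:1, -1:] ^ e * d)) t = eval_fps (fps_of_poly q) t) (nhds 0)"
    proof eventually_elim
      case (elim t)
      then have nt: "norm t < \<delta> / 2" by simp
      then have tV: "norm t < 1" "poly d t \<noteq> 0" using \<delta> by (auto simp: V_def subset_iff)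
      have "ereal (norm t) < ereal (\<delta> / 2)" using nt by simp
      note rt = less_le_trans[OF this radius]
      have "1 - t \<noteq> 0" using tV by auto
      have "eval_fps (hilb_series ds * fps_of_poly ([:1, -1:] ^ e * d)) t
          = eval_fps (hilb_series ds) t * eval_fps (fps_of_poly ([:1, -1:] ^ e * d)) t"
        by (rule eval_fps_mult[OF rt]) simp
      also have "eval_fps (hilb_series ds) t = poly q t / (poly d t * (1 - t) ^ e)"
        unfolding eval_fps_def using sums_unique[OF sums[OF tV]] by (simp only:)
      also have "eval_fps (fps_of_poly ([:1, -1:] ^ e * d)) t = poly d t * (1 - t) ^ e"
        by (simp add: eval_fps_of_poly)
      finally show ?case using tV(2) \<open>1 - t \<noteq> 0\<close> by (simp add: eval_fps_of_poly)
    qed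
  qed
  have circle: "((\<lambda>\<theta>. poly d (of_real t) * circle_integrand (of_real t) \<theta>) has_integral
      poly d (of_real t) * complex_of_real (Gint n b ((1 - t)\<^sup>2 / t) / t ^ n)) {0..2 * pi}" if "0 < t" "t \<noteq> 1" for t
    by (rule has_integral_mult_right[OF Gint_circle[OF that refl]])
  have div: "x = y * complex_of_real (g / (2 * pi * z))" if "complex_of_real (2 * pi) * x = y * complex_of_real (g / z)" for x y g z
  proof -
    have "x = y * complex_of_real (g / z) / complex_of_real (2 * pi)" using that[symmetric] by simp
    then show ?thesis by simp
  qed
  show ?thesis
  proof (rule that[OF d0 q0 rational[unfolded e_def]], goal_cases)
    case (1 t)
    have "complex_of_real (2 * pi) * poly q (of_real t) = poly d (of_real t) * complex_of_real (Gint n b ((1 - t)\<^sup>2 / t) / t ^ n)"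
      by (rule has_integral_unique[OF small circle]) (use 1 in auto)
    from div[OF this] show ?case unfolding n_def b_def .
  next
    case (2 t)
    have "- (complex_of_real (2 * pi) * poly q (of_real t)) = poly d (of_real t) * complex_of_real (Gint n b ((1 - t)\<^sup>2 / t) / t ^ n)"
      by (rule has_integral_unique[OF large circle]) (use 2 in auto)
    then have "complex_of_real (2 * pi) * (- poly q (of_real t)) = poly d (of_real t) * complex_of_real (Gint n b ((1 - t)\<^sup>2 / t) / t ^ n)" by simp
    from div[OF this] show ?case unfolding n_def b_def by (simp only: minus_equation_iff[of "poly q (of_real t)"])
  qed
qed

lemma poly_reflect_of_real:
  assumes "t \<noteq> 0"
  shows "poly (reflect_poly p) (of_real t) = of_real t ^ degree p * poly p (of_real (1 / t) :: complex)"
  using poly_reflect_poly_nz[of "complex_of_real t" p] assms by (simp add: of_real_inverse divide_inverse)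

text \<open>Under t \<mapsto> 1/t the argument of \<open>g\<close> is unchanged, t^n is inverted and
  the sign flips. Eliminating \<open>g\<close> gives an identity between \<open>d\<close>,
  \<open>q\<close> and their reflections for all real t > 1, hence the polynomial identity E = 0, in
  which degrees are compared. Nonzero constant terms ensure that reflection preserves the
  degrees.\<close>

lemma reciprocal_degree:
  fixes d q :: "complex poly"
  assumes d0: "poly d 0 \<noteq> 0" and q0: "poly q 0 \<noteq> 0"
    and small: "\<And>t::real. 0 < t \<Longrightarrow> t < 1 \<Longrightarrow> poly q (of_real t) = poly d (of_real t) * of_real (g ((1 - t)\<^sup>2 / t) / (c * t ^ n))"
    and large: "\<And>t::real. 1 < t \<Longrightarrow> poly q (of_real t) = - (poly d (of_real t) * of_real (g ((1 - t)\<^sup>2 / t) / (c * t ^ n)))"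
  shows "degree q + 2 * n = degree d"
proof -
  define Rd Rq where "Rd = reflect_poly d" and "Rq = reflect_poly q"
  define E where "E = q * Rd * monom 1 (2 * n + degree q) + d * Rq * monom 1 (degree d)"
  have "poly E (of_real t) = 0" if t: "1 < t" for t :: real
  proof -
    have w: "(1 - 1 / t)\<^sup>2 / (1 / t) = (1 - t)\<^sup>2 / t" using t by (simp add: field_simps power2_eq_square)
    define y where "y = complex_of_real (g ((1 - t)\<^sup>2 / t) / c)"
    define z where "z = complex_of_real t"
    have z: "z \<noteq> 0" using t by (simp add: z_def)
    have 1: "poly q z = - (poly d z * (y / z ^ n))" using large[OF t] by (simp add: y_def z_def)
    have 2: "poly q (of_real (1 / t)) = poly d (of_real (1 / t)) * (y * z ^ n)"
      using small[of "1 / t"] t unfolding w by (simp add: y_def z_def power_one_over)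
    have Rd: "poly Rd z = z ^ degree d * poly d (of_real (1 / t))" and Rq: "poly Rq z = z ^ degree q * poly q (of_real (1 / t))"
      unfolding Rd_def Rq_def z_def using t by (intro poly_reflect_of_real, simp)+
    have "y / z ^ n * z ^ (2 * n) = y * z ^ n" using z by (simp add: mult_2 power_add)
    moreover have "- (x * a) * v * (w * u) + x * (u * (v' * c)) * k = 0" if "v = k * v'" "a * w = c" for x u v v' k a w c :: complex
      unfolding that(1) that(2)[symmetric] by (simp add: mult_ac)
    ultimately have "- (poly d z * (y / z ^ n)) * poly Rd z * (z ^ (2 * n) * z ^ degree q)
        + poly d z * (z ^ degree q * (poly d (of_real (1 / t)) * (y * z ^ n))) * z ^ degree d = 0"
      using Rd by blast
    then show ?thesis
      unfolding E_def poly_add poly_mult poly_monom z_def[symmetric] Rq 2 power_add 1 by simp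
  qed
  then have sub: "complex_of_real ` {1<..} \<subseteq> {x. poly E x = 0}" by auto
  have "infinite (complex_of_real ` {1<..})" by (simp add: finite_image_iff inj_on_def infinite_Ioi)
  then have "E = 0" using sub poly_roots_finite[of E] finite_subset by blast
  then have eq: "q * Rd * monom 1 (2 * n + degree q) = - (d * Rq * monom 1 (degree d))"
    unfolding E_def by (simp add: add_eq_0_iff2)
  have nz: "q \<noteq> 0" "d \<noteq> 0" "Rq \<noteq> 0" "Rd \<noteq> 0" using d0 q0 by (auto simp: Rd_def Rq_def)
  have "degree Rd = degree d" "degree Rq = degree q"
    unfolding Rd_def Rq_def using d0 q0 by (auto intro!: degree_reflect_poly_eq simp: poly_0_coeff_0)
  moreover have "degree (q * Rd * monom 1 (2 * n + degree q)) = degree q + degree Rd + (2 * n + degree q)"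
    using nz by (simp add: degree_mult_eq degree_monom_eq)
  moreover have "degree (d * Rq * monom 1 (degree d)) = degree d + degree Rq + degree d"
    using nz by (simp add: degree_mult_eq degree_monom_eq)
  ultimately show ?thesis using arg_cong[OF eq, of degree] by simp
qed


section \<open>The functional equation and the first four coefficients\<close>

lemma eventually_at_right_less_one: "eventually (\<lambda>u::real. u < 1) (at_right 0)"
proof -
  have "eventually (\<lambda>u. u \<in> {0<..<1::real}) (at_right 0)" by (rule eventually_at_right_real) simp
  then show ?thesis by (rule eventually_mono) simp
qed

text \<open>The hypothesis expresses the functional equation \<open>F (u / (u - 1)) = (1 - u)^3 F u\<close>, which
  reflects the symmetry \<open>t \<mapsto> 1 / t\<close> of the Hilbert series.\<close>

lemma reciprocity_coefficients:
  fixes c0 c1 c2 c3 :: complex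
  assumes r: "(r \<longlongrightarrow> L) (at_right (0::real))" and r': "(r' \<longlongrightarrow> L') (at_right (0::real))"
    and eq: "eventually (\<lambda>u. (1 - of_real u) ^ 3 * (c0 + c1 * of_real u + c2 * of_real u ^ 2 + c3 * of_real u ^ 3 + of_real u ^ 4 * r u)
      = c0 + c1 * x u + c2 * x u ^ 2 + c3 * x u ^ 3 + x u ^ 4 * r' u) (at_right 0)"
    and x: "\<And>u. x u = - (of_real u / (1 - of_real u))"
  shows "c1 = 3 / 2 * c0" "c3 = 5 * (c2 - c0) / 2"
proof -
  \<comment> \<open>After multiplication by (1 - u)^3, \<open>k\<close> collects the terms of order
    at least 4, divided by u^4. The numerals are coefficients of (1 - u)^6; the polynomial part of
    the other side has degree 3 and contributes nothing.\<close>
  define k where "k = (\<lambda>u::real. 15 * c0 - 20 * c1 + 15 * c2 - 6 * c3 + of_real u * (- 6 * c0 + 15 * c1 - 20 * c2 + 15 * c3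
     + of_real u * (c0 - 6 * c1 + 15 * c2 - 20 * c3 + of_real u * (c1 - 6 * c2 + 15 * c3 + of_real u * (c2 - 6 * c3 + of_real u * c3))))
     + (1 - of_real u) ^ 6 * r u - r' u / (1 - of_real u))"
  have "(k \<longlongrightarrow> 15 * c0 - 20 * c1 + 15 * c2 - 6 * c3 + of_real 0 * (- 6 * c0 + 15 * c1 - 20 * c2 + 15 * c3
     + of_real 0 * (c0 - 6 * c1 + 15 * c2 - 20 * c3 + of_real 0 * (c1 - 6 * c2 + 15 * c3 + of_real 0 * (c2 - 6 * c3 + of_real 0 * c3))))
     + (1 - of_real 0) ^ 6 * L - L' / (1 - of_real 0)) (at_right 0)"
    unfolding k_def by (intro tendsto_intros r r') simp
  moreover have "eventually (\<lambda>u. (0::complex) + of_real u * ((2 * c1 - 3 * c0) + of_real u * ((12 * c0 - 8 * c1)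
      + of_real u * ((2 * c3 - 5 * c2 + 16 * c1 - 19 * c0) + of_real u * k u))) = 0) (at_right 0)"
    using eq eventually_at_right_less[of 0] eventually_at_right_less_one
  proof eventually_elim
    case (elim u)
    define v where "v = complex_of_real u"
    define m where "m = 1 - v"
    have "u < 1" using elim by simp
    then have m: "m \<noteq> 0" by (auto simp: m_def v_def)
    define y where "y = r' u / m"
    have xm: "x u * m = - v" using m by (simp add: x m_def v_def)
    have r'u: "r' u = y * m" using m by (simp add: y_def)
    have "m ^ 3 * (m ^ 3 * (c0 + c1 * v + c2 * v ^ 2 + c3 * v ^ 3 + v ^ 4 * r u))
        = m ^ 3 * (c0 + c1 * x u + c2 * x u ^ 2 + c3 * x u ^ 3 + x u ^ 4 * (y * m))"
      using elim(1) by (simp add: m_def v_def r'u)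
    also have "\<dots> = c0 * m ^ 3 + c1 * m ^ 2 * (x u * m) + c2 * m * (x u * m) ^ 2 + c3 * (x u * m) ^ 3 + (x u * m) ^ 4 * y"
      by (simp only: power_mult_distrib distrib_left power2_eq_square power3_eq_cube power4_eq_xxxx mult_ac)
    finally have "m ^ 3 * (m ^ 3 * (c0 + c1 * v + c2 * v ^ 2 + c3 * v ^ 3 + v ^ 4 * r u))
        = c0 * m ^ 3 + c1 * m ^ 2 * (- v) + c2 * m * (- v) ^ 2 + c3 * (- v) ^ 3 + (- v) ^ 4 * y" unfolding xm .
    moreover have "k u = 15 * c0 - 20 * c1 + 15 * c2 - 6 * c3 + v * (- 6 * c0 + 15 * c1 - 20 * c2 + 15 * c3
     + v * (c0 - 6 * c1 + 15 * c2 - 20 * c3 + v * (c1 - 6 * c2 + 15 * c3 + v * (c2 - 6 * c3 + v * c3))))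
     + m ^ 6 * r u - y" by (simp add: k_def v_def m_def y_def)
    moreover have "0 + v * ((2 * c1 - 3 * c0) + v * ((12 * c0 - 8 * c1)
      + v * ((2 * c3 - 5 * c2 + 16 * c1 - 19 * c0) + v * k'))) =
      (1 - v) ^ 3 * ((1 - v) ^ 3 * (c0 + c1 * v + c2 * v ^ 2 + c3 * v ^ 3 + v ^ 4 * r'))
      - (c0 * (1 - v) ^ 3 + c1 * (1 - v) ^ 2 * (- v) + c2 * (1 - v) * (- v) ^ 2 + c3 * (- v) ^ 3 + (- v) ^ 4 * y)"
      if "k' = 15 * c0 - 20 * c1 + 15 * c2 - 6 * c3 + v * (- 6 * c0 + 15 * c1 - 20 * c2 + 15 * c3
     + v * (c0 - 6 * c1 + 15 * c2 - 20 * c3 + v * (c1 - 6 * c2 + 15 * c3 + v * (c2 - 6 * c3 + v * c3))))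
     + (1 - v) ^ 6 * r' - y" for k' r'
      unfolding that by (simp add: algebra_simps eval_nat_numeral)
    ultimately show ?case unfolding v_def[symmetric] m_def by (metis (no_types, lifting) right_minus_eq)
  qed
  \<comment> \<open>The coefficient of u^2 is -4 times that of u, so two independent relations
    remain.\<close>
  ultimately have "2 * c1 - 3 * c0 = 0" "2 * c3 - 5 * c2 + 16 * c1 - 19 * c0 = 0"
    using vanishing_coefficients(2)[of k _ 0] vanishing_coefficients(4)[of k _ 0] by blast+
  then show c1: "c1 = 3 / 2 * c0" by (simp add: field_simps)
  have "2 * c3 = 5 * (c2 - c0)"
    using \<open>2 * c3 - 5 * c2 + 16 * c1 - 19 * c0 = 0\<close> unfolding c1 by (simp add: algebra_simps)
  then show "c3 = 5 * (c2 - c0) / 2" by (simp add: field_simps)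
qed

text \<open>At t = 1 - u one has w = (1 - t)^2 / t = u^2 / (1 - u). The scalings by u^(2n - 3) and
  by \<open>wscale\<close> then differ by the factor (1 - u)^(3/2).\<close>

lemma wscale_substitution:
  assumes u: "0 < u" "u < 1"
  shows "u ^ (2 * n) / u ^ 3 * (g / (c * (1 - u) ^ n)) = wscale n (u\<^sup>2 / (1 - u)) * g / c / ((1 - u) * sqrt (1 - u))"
proof -
  define m where "m = 1 - u"
  have m: "m > 0" using u by (simp add: m_def)
  have s: "sqrt (u\<^sup>2 / m) = u / sqrt m" using u by (simp add: real_sqrt_divide)
  have "wscale n (u\<^sup>2 / m) = u ^ (2 * n) / m ^ n / (u\<^sup>2 / m * (u / sqrt m))"
    unfolding wscale_def s by (simp add: power_divide power_mult)
  also have "\<dots> = u ^ (2 * n) / m ^ n / u ^ 3 * (m * sqrt m)"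
    using u m by (simp add: power2_eq_square power3_eq_cube)
  finally have "wscale n (u\<^sup>2 / m) * g / c / (m * sqrt m) = u ^ (2 * n) / m ^ n / u ^ 3 * g / c"
    using m by simp
  then show ?thesis unfolding m_def[symmetric] by (simp add: mult_ac)
qed

text \<open>\<open>F u\<close>, the Hilbert function at 1 - u times u^(D - 3), equals G(w) (1 -
  u)^(-3/2) for small u > 0. Since (1 - u)^(-3/2) = 1 + 3u/2 + 15u^2/8 + ... and w = u^2 + O(u^3),
  the coefficient of u^2 is 15/8 g0 + g1. The values on the other side of t = 1 supply the
  functional equation and with it the remaining relations.\<close>

lemma hilbert_coefficients:
  fixes ds g0
  defines "n \<equiv> length (pos_weights ds)"
  defines "G \<equiv> \<lambda>w. wscale n w * Gint n (int_weight ds) w / (2 * pi)"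
  assumes s3: "3 \<le> sum_list (pos_weights ds)" and n2: "2 \<le> n"
    and g0: "(G \<longlongrightarrow> g0) (at_right 0)"
  shows "gam ds 0 = of_real g0" "gam ds 1 = 3 / 2 * gam ds 0" "gam ds 3 = 5 * (gam ds 2 - gam ds 0) / 2"
    "a_invariant ds = - int (dimV ds)"
    "((\<lambda>w. (G w - g0) / w) \<longlongrightarrow> g1) (at_right 0) \<Longrightarrow> gam ds 2 = of_real (15 / 8 * g0 + g1)"
proof -
  define e where "e = zero_weights ds"
  obtain d q where d0: "poly d 0 = 1" and q0: "poly q 0 = 1"
    and rational: "hilb_series ds * fps_of_poly ([:1, -1:] ^ e * d) = fps_of_poly q"
    and small: "\<And>t::real. 0 < t \<Longrightarrow> t < 1 \<Longrightarrow> poly q (of_real t) = poly d (of_real t) * of_real (Gint n (int_weight ds) ((1 - t)\<^sup>2 / t) / (2 * pi * t ^ n))"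
    and large: "\<And>t::real. 1 < t \<Longrightarrow> poly q (of_real t) = - (poly d (of_real t) * of_real (Gint n (int_weight ds) ((1 - t)\<^sup>2 / t) / (2 * pi * t ^ n)))"
    using hilbert_rational[OF s3] unfolding n_def e_def by blast
  have nz: "d \<noteq> 0" "q \<noteq> 0" using d0 q0 by auto
  define Q where "Q = [:1, -1:] ^ e * d"
  have Qnz: "Q \<noteq> 0" using nz by (simp add: Q_def)
  have hs: "rational_of_fps (hilb_series ds) = Fract q Q" using rational Qnz by (intro rational_of_fps_eq) (simp_all add: Q_def)
  have D: "dimV ds = e + 2 * n" unfolding e_def n_def zero_weights_def by (rule dimV_pos_weights)
  have "degree q + 2 * n = degree d" using d0 q0 by (intro reciprocal_degree[OF _ _ small large]) simp_all
  moreover have "degree Q = e + degree d" unfolding Q_def using nz by (simp add: degree_mult_eq degree_power_eq)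
  ultimately show "a_invariant ds = - int (dimV ds)"
    unfolding a_invariant_def hs rational_degree_Fract[OF nz(2) Qnz] D by simp
  define N where "N = e + 2 * n - 3"
  have N: "N + 3 = e + 2 * n" using n2 by (simp add: N_def)
  define F where "F = (\<lambda>u. u ^ N * poly q (1 - u) / poly Q (1 - u))"
  have quot: "u ^ N / u ^ e = u ^ (2 * n) / u ^ 3" if "u \<noteq> 0" for u :: "'a :: field"
  proof -
    have "u ^ N * u ^ 3 = u ^ e * u ^ (2 * n)" unfolding power_add[symmetric] N ..
    then show ?thesis using that by (simp add: frac_eq_eq)
  qed
  have FQ: "F u = u ^ (2 * n) / u ^ 3 * (poly q (1 - u) / poly d (1 - u))" if "u \<noteq> 0" for u
    unfolding quot[OF that, symmetric] by (simp add: F_def Q_def)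
  have dnz: "eventually (\<lambda>u::real. poly d (1 - of_real u) \<noteq> 0) (at_right 0)"
    using eventually_poly_nonzero[of "pcompose d [:1, -1:]"] nz(1) by (simp add: reflection_pcompose_eq_0_iff poly_pcompose)
  note lt1 = eventually_at_right_less_one
  define h where "h = (\<lambda>u. G (u\<^sup>2 / (1 - u)) / ((1 - u) * sqrt (1 - u)))"
  have F_pos: "eventually (\<lambda>u. F (of_real u) = of_real (h u)) (at_right 0)"
    using dnz lt1 eventually_at_right_less[of 0]
  proof eventually_elim
    case (elim u)
    have "poly q (1 - of_real u) / poly d (1 - of_real u) = complex_of_real (Gint n (int_weight ds) (u\<^sup>2 / (1 - u)) / (2 * pi * (1 - u) ^ n))"
      using small[of "1 - u"] elim by simp
    then have "F (of_real u) = complex_of_real (u ^ (2 * n) / u ^ 3 * (Gint n (int_weight ds) (u\<^sup>2 / (1 - u)) / (2 * pi * (1 - u) ^ n)))"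
      using elim by (subst FQ) simp_all
    then show ?case unfolding wscale_substitution[OF elim(3,2)] h_def G_def .
  qed
  have wlim: "filterlim (\<lambda>u::real. u\<^sup>2 / (1 - u)) (at_right 0) (at_right 0)" by real_asymp
  have "(h \<longlongrightarrow> g0 / ((1 - 0) * sqrt (1 - 0))) (at_right 0)"
    unfolding h_def by (intro tendsto_intros filterlim_compose[OF g0 wlim]) simp
  then have hlim: "(h \<longlongrightarrow> g0) (at_right 0)" by simp
  then have Flim: "((\<lambda>u. F (of_real u)) \<longlongrightarrow> of_real g0) (at_right 0)"
    using tendsto_cong[OF F_pos] tendsto_of_real[OF hlim] by blast
  have gam: "gam ds m = fls_nth (laurent_at_1 (Fract q Q)) (int m - int N)" for m
  proof -
    have "int m + 3 - int (dimV ds) = int m - int N" unfolding D using N by linarith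
    then show ?thesis unfolding gam_def hs by (rule arg_cong)
  qed
  obtain r where r: "isCont r 0" and exp: "eventually (\<lambda>u. F u = gam ds 0 + gam ds 1 * u + gam ds 2 * u^2 + gam ds 3 * u^3 + u^4 * r u) (at 0)"
    using laurent_expansion_at_1[OF nz(2) Qnz Flim[unfolded F_def]] unfolding F_def gam by blast
  \<comment> \<open>For t = 1 - u this is 1 - 1/t, the value of u that belongs to 1/t. It tends to 0
    from the left.\<close>
  define x where "x = (\<lambda>u::real. - (u / (1 - u)))"
  have cx: "complex_of_real (x u) = - (of_real u / (1 - of_real u))" for u by (simp add: x_def)
  have f1: "filterlim complex_of_real (at 0) (at_right 0)"
    by (rule filterlim_complex_of_real_at_0[of "\<lambda>u. u"]) (auto intro: eventually_mono[OF eventually_at_right_less[of 0]])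
  have xlim: "(x \<longlongrightarrow> 0) (at_right 0)" unfolding x_def by real_asymp
  have "eventually (\<lambda>u. x u \<noteq> 0) (at_right 0)"
    using lt1 eventually_at_right_less[of 0] by eventually_elim (simp add: x_def)
  note f2 = filterlim_complex_of_real_at_0[OF xlim this]
  have r0: "(r \<longlongrightarrow> r 0) (at 0)" using r by (simp add: isCont_def)
  note R1 = filterlim_compose[OF r0 f1] and R2 = filterlim_compose[OF r0 f2]
  have "eventually (\<lambda>u. poly (pcompose d [:1, -1:]) u \<noteq> 0) (at 0)"
    by (rule eventually_poly_nonzero_at_0) (simp add: nz reflection_pcompose_eq_0_iff)
  then have "eventually (\<lambda>u. poly d (1 - u) \<noteq> 0) (at 0)" by (simp add: poly_pcompose)
  note dnz' = eventually_compose_filterlim[OF this f2]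
  note E1 = eventually_compose_filterlim[OF exp f1] and E2 = eventually_compose_filterlim[OF exp f2]
  have reciprocity: "eventually (\<lambda>u. (1 - of_real u) ^ 3 * F (of_real u) = F (of_real (x u))) (at_right 0)"
    using dnz' lt1 eventually_at_right_less[of 0] F_pos
  proof eventually_elim
    case (elim u)
    define m where "m = 1 - u"
    define k where "k = Gint n (int_weight ds) (u\<^sup>2 / m)"
    have m: "0 < m" "u = 1 - m" "m < 1" using elim by (auto simp: m_def)
    have xm: "x u = - u / m" "1 - x u = 1 / m" using m by (simp_all add: x_def field_simps)
    have w: "(1 - 1 / m)\<^sup>2 / (1 / m) = u\<^sup>2 / m" unfolding m(2) using m by (simp add: field_simps power2_eq_square)
    have t: "1 - complex_of_real (x u) = of_real (1 / m)" unfolding xm(2)[symmetric] by simp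
    have u0: "complex_of_real (x u) \<noteq> 0" unfolding xm(1) using m(1) elim(3) by simp
    have "poly q (of_real (1 / m)) / poly d (of_real (1 / m)) = - complex_of_real (k / (2 * pi * (1 / m) ^ n))"
      using large[of "1 / m"] elim(1) m unfolding w k_def t by simp
    then have "F (of_real (x u)) = of_real (x u) ^ (2 * n) / of_real (x u) ^ 3 * - complex_of_real (k / (2 * pi * (1 / m) ^ n))"
      using FQ[OF u0] unfolding t by (simp only:)
    also have "\<dots> = of_real ((x u) ^ (2 * n) / (x u) ^ 3 * - (k / (2 * pi * (1 / m) ^ n)))" by simp
    also have "(x u) ^ (2 * n) / (x u) ^ 3 * - (k / (2 * pi * (1 / m) ^ n)) = m ^ 3 * (u ^ (2 * n) / u ^ 3 * (k / (2 * pi * m ^ n)))"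
    proof -
      have "(x u) ^ (2 * n) = u ^ (2 * n) / (m ^ n * m ^ n)" 
      proof -
        have "(x u)\<^sup>2 = u\<^sup>2 / (m * m)" unfolding xm(1) by (simp add: power2_eq_square)
        then show ?thesis unfolding power_mult by (simp add: power_divide power_mult_distrib)
      qed
      moreover have "(x u) ^ 3 = - (u ^ 3 / m ^ 3)" unfolding xm(1) by (simp add: power_divide)
      ultimately show ?thesis using m(1) elim(3) by (simp add: power_one_over mult_ac)
    qed
    also have "u ^ (2 * n) / u ^ 3 * (k / (2 * pi * m ^ n)) = h u"
      unfolding k_def m_def wscale_substitution[OF elim(3,2)] h_def G_def ..
    finally show ?case using elim(4) by (simp add: m_def)
  qed
  have eq: "eventually (\<lambda>u. (1 - of_real u) ^ 3 * (gam ds 0 + gam ds 1 * of_real u + gam ds 2 * of_real u ^ 2 + gam ds 3 * of_real u ^ 3 + of_real u ^ 4 * r (of_real u))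
      = gam ds 0 + gam ds 1 * of_real (x u) + gam ds 2 * of_real (x u) ^ 2 + gam ds 3 * of_real (x u) ^ 3 + of_real (x u) ^ 4 * r (of_real (x u))) (at_right 0)"
    using reciprocity E1 E2 by eventually_elim (simp only:)
  show c1: "gam ds 1 = 3 / 2 * gam ds 0" and "gam ds 3 = 5 * (gam ds 2 - gam ds 0) / 2"
    using reciprocity_coefficients[OF R1 R2 eq cx] by blast+
  have "((\<lambda>u. gam ds 0 + gam ds 1 * of_real u + gam ds 2 * of_real u^2 + gam ds 3 * of_real u^3 + of_real u^4 * r (of_real u))
      \<longlongrightarrow> gam ds 0 + gam ds 1 * of_real 0 + gam ds 2 * of_real 0^2 + gam ds 3 * of_real 0^3 + of_real 0^4 * r 0) (at_right (0::real))"
    by (intro tendsto_intros R1)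
  then have "((\<lambda>u. F (of_real u)) \<longlongrightarrow> gam ds 0) (at_right (0::real))"
    using tendsto_cong[OF E1] by simp
  then show c0: "gam ds 0 = of_real g0" by (rule tendsto_unique[OF _ _ Flim, rotated]) simp
  assume g1: "((\<lambda>w. (G w - g0) / w) \<longlongrightarrow> g1) (at_right 0)"
  have "((\<lambda>u. gam ds 2 + gam ds 3 * of_real u + of_real u^2 * r (of_real u))
      \<longlongrightarrow> gam ds 2 + gam ds 3 * of_real 0 + of_real 0^2 * r 0) (at_right (0::real))"
    by (intro tendsto_intros R1)
  then have l2: "((\<lambda>u. gam ds 2 + gam ds 3 * of_real u + of_real u^2 * r (of_real u)) \<longlongrightarrow> gam ds 2) (at_right (0::real))" by simp
  have ev: "eventually (\<lambda>u. gam ds 2 + gam ds 3 * of_real u + of_real u^2 * r (of_real u) = of_real ((h u - g0 - 3 / 2 * g0 * u) / u\<^sup>2)) (at_right 0)"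
    using E1 F_pos eventually_at_right_less[of 0]
  proof eventually_elim
    case (elim u)
    define v where "v = complex_of_real u"
    have v: "v \<noteq> 0" using elim by (simp add: v_def)
    have "of_real (h u) - gam ds 0 - gam ds 1 * v = v^2 * (gam ds 2 + gam ds 3 * v + v^2 * r v)"
      unfolding elim(2)[symmetric] elim(1) v_def by (simp add: algebra_simps eval_nat_numeral)
    then have "gam ds 2 + gam ds 3 * v + v^2 * r v = (of_real (h u) - gam ds 0 - gam ds 1 * v) / v^2" using v by simp
    then show ?case unfolding c1 c0 v_def by simp
  qed
  have "((\<lambda>u. (G (u\<^sup>2 / (1 - u)) - g0) / (u\<^sup>2 / (1 - u)) * (1 / ((1 - u) * (1 - u) * sqrt (1 - u)))
      + g0 * ((1 / ((1 - u) * sqrt (1 - u)) - 1 - 3 / 2 * u) / u\<^sup>2)) \<longlongrightarrow> g1 * (1 / ((1 - 0) * (1 - 0) * sqrt (1 - 0))) + g0 * (15 / 8)) (at_right (0::real))"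
  proof (intro tendsto_add tendsto_mult tendsto_const filterlim_compose[OF g1 wlim])
    show "((\<lambda>u::real. 1 / ((1 - u) * (1 - u) * sqrt (1 - u))) \<longlongrightarrow> 1 / ((1 - 0) * (1 - 0) * sqrt (1 - 0))) (at_right 0)"
      by (intro tendsto_intros) simp
    show "((\<lambda>u::real. (1 / ((1 - u) * sqrt (1 - u)) - 1 - 3 / 2 * u) / u\<^sup>2) \<longlongrightarrow> 15 / 8) (at_right 0)" by real_asymp
  qed
  moreover have "eventually (\<lambda>u. (G (u\<^sup>2 / (1 - u)) - g0) / (u\<^sup>2 / (1 - u)) * (1 / ((1 - u) * (1 - u) * sqrt (1 - u)))
      + g0 * ((1 / ((1 - u) * sqrt (1 - u)) - 1 - 3 / 2 * u) / u\<^sup>2) = (h u - g0 - 3 / 2 * g0 * u) / u\<^sup>2) (at_right 0)"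
    using lt1 eventually_at_right_less[of 0]
  proof eventually_elim
    case (elim u)
    define m where "m = (1 - u)"
    define s where "s = sqrt m"
    have m: "m \<noteq> 0" "s \<noteq> 0" "u \<noteq> 0" using elim by (auto simp: m_def s_def)
    have "(y - g0) / (u\<^sup>2 / m) * (1 / (m * m * s)) = (y - g0) / (m * s) / u\<^sup>2" for y using m by simp
    moreover have "(y - g0) / (m * s) / u\<^sup>2 + g0 * ((1 / (m * s) - 1 - 3 / 2 * u) / u\<^sup>2) = (y / (m * s) - g0 - 3 / 2 * g0 * u) / u\<^sup>2" for y
      by (simp add: diff_divide_distrib right_diff_distrib add_divide_distrib)
    ultimately show ?case unfolding h_def m_def[symmetric] s_def[symmetric] by simp
  qed
  ultimately have "((\<lambda>u. (h u - g0 - 3 / 2 * g0 * u) / u\<^sup>2) \<longlongrightarrow> g1 * (1 / ((1 - 0) * (1 - 0) * sqrt (1 - 0))) + g0 * (15 / 8)) (at_right 0)"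
    by (rule Lim_transform_eventually)
  moreover have "g1 * (1 / ((1 - 0) * (1 - 0) * sqrt (1 - 0))) + g0 * (15 / 8) = 15 / 8 * g0 + g1" by simp
  ultimately have "((\<lambda>u. (h u - g0 - 3 / 2 * g0 * u) / u\<^sup>2) \<longlongrightarrow> 15 / 8 * g0 + g1) (at_right 0)" by (simp only:)
  from tendsto_of_real[OF this, where ?'a = complex]
  show "gam ds 2 = of_real (15 / 8 * g0 + g1)"
    by (intro tendsto_unique[OF _ Lim_transform_eventually[OF l2 ev]]) simp
qed

section \<open>The Laurent coefficients\<close>

lemma schur_at_leval:
  assumes "length xs = n" "\<And>i. i < n \<Longrightarrow> real_of_int (xs ! i) = X i"
  shows "schur_at rho xs = leval n (\<lambda>i. complex_of_real (X i)) (schur rho)"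
proof -
  have "(\<Prod>i<n. of_int (xs ! i) powi Poly_Mapping.lookup m i) = (\<Prod>i<n. complex_of_real (X i) powi Poly_Mapping.lookup m i)" for m
    by (rule prod.cong) (simp_all flip: assms(2))
  then show ?thesis unfolding schur_at_def laurent_eval_eq assms(1) leval_def by (simp only:)
qed

text \<open>The integrand is positive on a set of positive measure. This makes
  \<open>gam ds 0\<close> nonzero, which the quotient in the formula for the a-invariant relies
  on.\<close>

lemma K0_pos:
  assumes "\<And>i. i < n \<Longrightarrow> X i \<ge> 1" "2 \<le> n"
  shows "K0 n X > 0"
proof -
  define f where "f = (\<lambda>x. indicat_real {0<..} x *\<^sub>R (4 * x ^ 2 / PK n X x))"
  have int: "integrable lborel f"
    using K_integrable[of n X 1] assms unfolding f_def set_integrable_def by simp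
  have nonneg: "0 \<le> f x" for x unfolding f_def using PK_pos[of n X x] by (auto intro: mult_nonneg_nonneg)
  have "integral\<^sup>L lborel f \<noteq> 0"
  proof
    assume "integral\<^sup>L lborel f = 0"
    then have "AE x in lborel. f x = 0" using integral_nonneg_eq_0_iff_AE[OF int] nonneg by simp
    moreover have "f x = 0 \<longleftrightarrow> x \<notin> {0<..}" for x
      using PK_pos[of n X x] by (auto simp: f_def indicator_def)
    ultimately have "AE x in lborel. x \<notin> {0<..<(1::real)}" by (auto elim: eventually_mono)
    then have "{0<..<(1::real)} \<in> null_sets lborel" by (subst AE_iff_null_sets) simp_all
    then have "emeasure lborel {0<..<(1::real)} = 0" by (rule null_setsD1)
    then show False by simp
  qed
  moreover have "integral\<^sup>L lborel f \<ge> 0" using nonneg by simp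
  ultimately show ?thesis unfolding K0_def set_lebesgue_integral_def f_def by simp
qed

lemma card_nonzero_sn:
  "card {i\<in>{..<length (pos_weights ds)}. sn (int_weight ds i) \<theta> \<noteq> 0} = nonzero_sines \<theta> (pos_weights ds)"
  unfolding nonzero_sines_def length_filter_conv_card
proof (rule arg_cong[where f = card], rule Collect_cong, rule conj_cong)
  fix i assume "i < length (pos_weights ds)"
  then have "real (int_weight ds i) = of_int (pos_weights ds ! i)" using int_int_weight by (metis of_int_of_nat_eq)
  then show "(sn (int_weight ds i) \<theta> \<noteq> 0) = (sin (of_int (pos_weights ds ! i) * \<theta> / 2) \<noteq> 0)" by (simp add: sn_def)
qed simp

lemma card_odd_int_weight:
  "card {i\<in>{..<length (pos_weights ds)}. odd (int_weight ds i)} = length (filter odd (pos_weights ds))"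
  unfolding length_filter_conv_card
proof (rule arg_cong[where f = card], rule Collect_cong, rule conj_cong)
  fix i assume "i < length (pos_weights ds)"
  from int_int_weight[OF this] show "odd (int_weight ds i) = odd (pos_weights ds ! i)" by (metis even_of_nat)
qed simp

lemma nonzero_sines_le_length: "nonzero_sines \<theta> xs \<le> length xs"
  by (simp add: nonzero_sines_def)

lemma peaks_pos_weights:
  assumes "2 \<le> m" "\<And>\<theta>. 0 < \<theta> \<Longrightarrow> \<theta> < pi \<Longrightarrow> m \<le> nonzero_sines \<theta> (pos_weights ds)"
  shows "peaks (length (pos_weights ds)) (int_weight ds) m"
proof
  show "m \<le> length (pos_weights ds)"
    using assms(2)[of 1] nonzero_sines_le_length[of 1 "pos_weights ds"] pi_gt3 by simp
qed (use assms int_weight_pos card_nonzero_sn in auto)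

lemma even_int_weight:
  assumes "\<forall>d\<in>set ds. even d" "i < length (pos_weights ds)"
  shows "even (int_weight ds i)"
proof -
  have "even (pos_weights ds ! i)" using even_pos_weights[of ds "pos_weights ds ! i"] assms by simp
  then show ?thesis using int_int_weight[OF assms(2)] by (metis even_of_nat)
qed

text \<open>If all weights are even, the peaks at 0 and \<pi> are equal; a single odd weight makes
  the one at \<pi> negligible. This is the origin of \<open>sigma\<close>.\<close>

lemma leading_limit:
  assumes pos: "\<And>d. d \<in> set ds \<Longrightarrow> 1 \<le> d" and ds: "ds \<noteq> []" "\<forall>d\<le>4. ds \<noteq> [d]"
  defines "n \<equiv> length (pos_weights ds)"
  shows "((\<lambda>w. wscale n w * Gint n (int_weight ds) w / (2 * pi)) \<longlongrightarrow>
    sigma ds * K0 n (\<lambda>i. real (int_weight ds i)) / (2 * pi)) (at_right 0)"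
proof -
  interpret peaks n "int_weight ds" 2
    unfolding n_def by (rule peaks_pos_weights) (use nonzero_sines_ge_2[OF _ _ pos ds] in auto)
  have "((\<lambda>w. wscale n w * Gint n (int_weight ds) w) \<longlongrightarrow> sigma ds * K0 n (\<lambda>i. real (int_weight ds i))) (at_right 0)"
  proof (cases "\<forall>d\<in>set ds. even d")
    case True
    then show ?thesis using limit_two(1)[OF refl] even_int_weight by (simp add: sigma_def n_def)
  next
    case False
    then obtain d x where "x \<in> set (pos_weights ds)" "odd x" using odd_pos_weight by metis
    then obtain i where "i < n" "odd (pos_weights ds ! i)" by (auto simp: in_set_conv_nth n_def)
    moreover from this have "odd (int_weight ds i)" using int_int_weight[of i ds] unfolding n_def by (metis even_of_nat)
    moreover have "sigma ds = 1" using False by (auto simp: sigma_def)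
    ultimately show ?thesis using limit_two(2)[OF refl] by simp
  qed
  then show ?thesis by (intro tendsto_divide tendsto_const) simp_all
qed

text \<open>The coefficient of \<open>w\<close> in the peak at 0, that is \<open>L1\<close> of the
  locale \<open>peaks\<close> with the weights as an argument.\<close>

definition second_coefficient :: "nat \<Rightarrow> (nat \<Rightarrow> real) \<Rightarrow> real" where
  "second_coefficient n X = ((\<Sum>i<n. (X i)\<^sup>2) / 12 - 1 / 3) * K2 n X - K0 n X / 8"

lemma second_limit:
  assumes pos: "\<And>d. d \<in> set ds \<Longrightarrow> 1 \<le> d" and ds: "ds \<noteq> []" "sorted ds"
    and one: "\<forall>d\<in>{1, 2, 3, 4, 5, 6, 8}. ds \<noteq> [d]"
    and two: "\<forall>es\<in>{[1, 1], [1, 2], [1, 3], [1, 4], [2, 2], [2, 3], [2, 4], [3, 3], [4, 4]}. ds \<noteq> es"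
  defines "n \<equiv> length (pos_weights ds)" and "X \<equiv> \<lambda>i. real (int_weight ds i)"
  shows "3 \<le> n"
    and "(\<forall>d\<in>set ds. even d) \<or> card {k. k < length ds \<and> odd (ds ! k)} \<ge> 2 \<or> (\<exists>d\<in>set ds. odd d \<and> d > 1) \<Longrightarrow>
      ((\<lambda>w. (wscale n w * Gint n (int_weight ds) w / (2 * pi) - sigma ds * K0 n X / (2 * pi)) / w) \<longlongrightarrow>
        sigma ds * second_coefficient n X / (2 * pi)) (at_right 0)"
    and "ds ! 0 = 1 \<Longrightarrow> \<forall>k. 0 < k \<and> k < length ds \<longrightarrow> even (ds ! k) \<Longrightarrow>
      ((\<lambda>w. (wscale n w * Gint n (int_weight ds) w / (2 * pi) - K0 n X / (2 * pi)) / w) \<longlongrightarrow>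
        (second_coefficient n X + K0 (n - 1) (\<lambda>i. real (int_weight (tl ds) i)) / 4) / (2 * pi)) (at_right 0)"
proof -
  interpret peaks n "int_weight ds" 3
    unfolding n_def by (rule peaks_pos_weights) (use nonzero_sines_ge_3[OF _ _ pos ds one two] in auto)
  show "3 \<le> n" by (rule m(2))
  have L1: "L1 = second_coefficient n X" by (simp add: L1_def second_coefficient_def X_def)
  have scale: "((\<lambda>w. (wscale n w * Gint n (int_weight ds) w / (2 * pi) - c / (2 * pi)) / w) \<longlongrightarrow> l / (2 * pi)) (at_right 0)"
    if "((\<lambda>w. (wscale n w * Gint n (int_weight ds) w - c) / w) \<longlongrightarrow> l) (at_right 0)" for c l
  proof -
    have "(x / (2 * pi) - c / (2 * pi)) / w = (x - c) / w / (2 * pi)" for x w :: real by (simp add: diff_divide_distrib mult_ac)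
    then show ?thesis using tendsto_divide[OF that tendsto_const, of "2 * pi"] by simp
  qed
  show "((\<lambda>w. (wscale n w * Gint n (int_weight ds) w / (2 * pi) - sigma ds * K0 n X / (2 * pi)) / w) \<longlongrightarrow>
        sigma ds * second_coefficient n X / (2 * pi)) (at_right 0)"
    if "(\<forall>d\<in>set ds. even d) \<or> card {k. k < length ds \<and> odd (ds ! k)} \<ge> 2 \<or> (\<exists>d\<in>set ds. odd d \<and> d > 1)"
  proof (cases "\<forall>d\<in>set ds. even d")
    case True
    have "((\<lambda>w. (wscale n w * Gint n (int_weight ds) w - 2 * K0 n X) / w) \<longlongrightarrow> 2 * L1) (at_right 0)"
      using limit_three(1)[OF refl] even_int_weight[OF True] unfolding n_def X_def by blast
    moreover have "real (sigma ds) = 2" using True by (simp add: sigma_def)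
    ultimately show ?thesis using scale[of "2 * K0 n X" "2 * L1"] by (simp only: L1)
  next
    case False
    then have "card {k. k < length ds \<and> odd (ds ! k)} \<ge> 2 \<or> (\<exists>d\<in>set ds. odd d \<and> d > 1)" using that by blast
    then have "2 \<le> card {i\<in>{..<n}. odd (int_weight ds i)}"
      using two_odd_pos_weights unfolding n_def card_odd_int_weight by blast
    then have "((\<lambda>w. (wscale n w * Gint n (int_weight ds) w - K0 n X) / w) \<longlongrightarrow> L1) (at_right 0)"
      using limit_three(2)[OF refl] unfolding X_def by blast
    moreover have "sigma ds = 1" using False by (auto simp: sigma_def)
    ultimately show ?thesis using scale by (simp add: L1)
  qed
  show "((\<lambda>w. (wscale n w * Gint n (int_weight ds) w / (2 * pi) - K0 n X / (2 * pi)) / w) \<longlongrightarrow>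
        (second_coefficient n X + K0 (n - 1) (\<lambda>i. real (int_weight (tl ds) i)) / 4) / (2 * pi)) (at_right 0)"
    if first: "ds ! 0 = 1" and rest: "\<forall>k. 0 < k \<and> k < length ds \<longrightarrow> even (ds ! k)"
  proof -
    obtain es where es: "ds = 1 # es" using ds(1) first by (cases ds) auto
    have ev: "\<forall>d\<in>set es. even d"
    proof
      fix d assume "d \<in> set es"
      then obtain k where "k < length es" "d = es ! k" by (auto simp: in_set_conv_nth)
      then show "even d" using rest[rule_format, of "Suc k"] by (simp add: es)
    qed
    have pw: "pos_weights ds = 1 # pos_weights es" by (simp add: es pos_weights_concat)
    \<comment> \<open>The summand V_1 contributes the single positive weight 1 at the front, so the
      weights of \<open>es\<close> are those of \<open>ds\<close> moved by one place.\<close>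
    have shift: "int_weight ds (Suc i) = int_weight es i" for i by (simp add: int_weight_def pw)
    have "int_weight ds 0 = 1" by (simp add: int_weight_def pw)
    moreover have "even (int_weight ds i)" if "0 < i" "i < n" for i
      using that even_int_weight[OF ev, of "i - 1"] shift[of "i - 1"] by (simp add: n_def pw)
    ultimately have "((\<lambda>w. (wscale n w * Gint n (int_weight ds) w - K0 n X) / w) \<longlongrightarrow> L1 + K0 (n - 1) (\<lambda>i. real (int_weight ds (Suc i))) / 4) (at_right 0)"
      using limit_three(3)[OF refl] unfolding X_def by blast
    moreover have "tl ds = es" by (simp add: es)
    ultimately show ?thesis using scale by (simp only: L1 shift)
  qed
qed

theorem theorem1p1:
  fixes ds :: "nat list" and C :: int and a a1 :: "int list"
  assumes "ds \<noteq> []" and "sorted ds" and "fixed_vectors ds = {0}"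
    and C: "C = int (length (Lambda ds))"
    and a: "a = pos_weights ds"
    and a1: "a1 = pos_weights1 ds"
  shows
    "(\<not> rep_iso ds [1, 1] \<and> (\<forall>d\<le>4. \<not> rep_iso ds [d]) \<longrightarrow>
        gam ds 0 = of_nat (sigma ds) * (schur_at (rho_tuple C) a / schur_at (delta_tuple C) a)
        \<and> gam ds 1 = 3 / 2 * gam ds 0
        \<and> of_int (a_invariant ds) = - (of_nat (dimV ds) - 3) - 2 * gam ds 1 / gam ds 0
        \<and> a_invariant ds = - int (dimV ds))
     \<and>
     ((\<forall>d\<in>{1, 2, 3, 4, 5, 6, 8}. \<not> rep_iso ds [d])
        \<and> (\<forall>es\<in>{[1, 1], [1, 2], [1, 3], [1, 4], [2, 2], [2, 3], [2, 4], [3, 3], [4, 4]}. \<not> rep_iso ds es) \<longrightarrow>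
        ((\<forall>d\<in>set ds. even d) \<or> card {k. k < length ds \<and> odd (ds ! k)} \<ge> 2 \<or> (\<exists>d\<in>set ds. odd d \<and> d > 1) \<longrightarrow>
           gam ds 2 = of_nat (sigma ds) *
             ((42 * schur_at (rho_tuple C) a + schur_at (rho'_tuple C) a * of_int (P2 ds - 8))
              / (24 * schur_at (delta_tuple C) a)))
        \<and> (ds ! 0 = 1 \<and> (\<forall>k. 0 < k \<and> k < length ds \<longrightarrow> even (ds ! k)) \<longrightarrow>
           gam ds 2 =
             (42 * schur_at (rho_tuple C) a + schur_at (rho'_tuple C) a * of_int (P2 ds - 8))
              / (24 * schur_at (delta_tuple C) a)
             + schur_at (map (\<lambda>j. if j \<le> 2 then C - 4 else C - 1 - j) [1..C - 1]) a1
              / (4 * schur_at (delta_tuple (C - 1)) a1)))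
     \<and>
     (\<not> rep_iso ds [1, 1] \<and> (\<forall>d\<le>4. \<not> rep_iso ds [d]) \<longrightarrow>
        gam ds 3 = 5 * (gam ds 2 - gam ds 0) / 2)"
proof -
  have pos: "1 \<le> d" if "d \<in> set ds" for d using degrees_positive[OF assms(3) that] .
  have iso: "ds \<noteq> es" if "\<not> rep_iso ds es" for es using rep_iso_refl that by blast
  define n where "n = length (pos_weights ds)"
  define X where "X = (\<lambda>i. real (int_weight ds i))"
  define \<sigma> where "\<sigma> = real (sigma ds)"
  have Cn: "C = int n" by (simp add: C n_def pos_weights_def)
  have X: "X i \<ge> 1" if "i < n" for i using int_weight_pos[of i ds] that by (simp add: X_def n_def)
  have aX: "real_of_int (a ! i) = X i" if "i < n" for i
    using int_int_weight[of i ds] that unfolding X_def a n_def by (metis of_int_of_nat_eq)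
  define S0 where "S0 = schur_at (delta_tuple C) a"
  have schur: "schur_at rho a = leval n (\<lambda>i. complex_of_real (X i)) (schur rho)" for rho
    by (rule schur_at_leval) (use aX in \<open>simp_all add: a n_def\<close>)
  have S0: "S0 \<noteq> 0" and S1: "schur_at (rho_tuple C) a = of_real (K0 n X / (2 * pi)) * S0" if "2 \<le> n"
    unfolding S0_def schur Cn using leval_schur_integral[OF that, of X] X by blast+
  have S2: "schur_at (rho'_tuple C) a = of_real (K2 n X / (2 * pi)) * S0" if "3 \<le> n"
    unfolding S0_def schur Cn using leval_schur_integral(2)[of n X] X that by simp
  have P2: "of_int (P2 ds) = complex_of_real (2 * (\<Sum>i<n. (X i)\<^sup>2))"
  proof -
    have "real_of_int (P2 ds) = 2 * (\<Sum>i<n. (real_of_int (a ! i))\<^sup>2)"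
      unfolding P2_pos_weights n_def[symmetric] a by simp
    also have "(\<Sum>i<n. (real_of_int (a ! i))\<^sup>2) = (\<Sum>i<n. (X i)\<^sup>2)"
      by (rule sum.cong) (simp_all only: aX lessThan_iff)
    finally show ?thesis by (metis of_real_of_int_eq)
  qed
  define G where "G = (\<lambda>w. wscale n w * Gint n (int_weight ds) w / (2 * pi))"
  define g0 where "g0 = \<sigma> * K0 n X / (2 * pi)"
  have main: "2 \<le> n" "gam ds 0 = of_real g0" "gam ds 1 = 3 / 2 * gam ds 0"
      "gam ds 3 = 5 * (gam ds 2 - gam ds 0) / 2" "a_invariant ds = - int (dimV ds)"
      "\<And>g1. ((\<lambda>w. (G w - g0) / w) \<longlongrightarrow> g1) (at_right 0) \<Longrightarrow> gam ds 2 = of_real (15 / 8 * g0 + g1)"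
    if generic: "ds \<noteq> [1, 1]" "\<forall>d\<le>4. ds \<noteq> [d]"
  proof -
    have s3: "3 \<le> sum_list (pos_weights ds)" by (rule sum_pos_weights_ge_3[OF pos assms(1) generic(2,1)])
    have "2 \<le> nonzero_sines 1 (pos_weights ds)"
      by (rule nonzero_sines_ge_2[OF _ _ pos assms(1) generic(2)]) (use pi_gt3 in auto)
    then show n2: "2 \<le> n" using nonzero_sines_le_length[of 1 "pos_weights ds"] by (simp add: n_def)
    have lim: "(G \<longlongrightarrow> g0) (at_right 0)"
      using leading_limit[OF pos assms(1) generic(2)] unfolding G_def g0_def n_def X_def \<sigma>_def by simp
    note coeffs = hilbert_coefficients[OF s3 n2[unfolded n_def] lim[unfolded G_def n_def]]
    show "gam ds 0 = of_real g0" "gam ds 1 = 3 / 2 * gam ds 0"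
      "gam ds 3 = 5 * (gam ds 2 - gam ds 0) / 2" "a_invariant ds = - int (dimV ds)"
      by (fact coeffs)+
    show "gam ds 2 = of_real (15 / 8 * g0 + g1)" if "((\<lambda>w. (G w - g0) / w) \<longlongrightarrow> g1) (at_right 0)" for g1
      using coeffs(5) that unfolding G_def n_def by blast
  qed
  have ratio: "of_real x * S0 / S0 = complex_of_real x" if "2 \<le> n" for x using S0[OF that] by simp
  have leading: "gam ds 0 = of_nat (sigma ds) * (schur_at (rho_tuple C) a / schur_at (delta_tuple C) a)"
    "of_int (a_invariant ds) = - (of_nat (dimV ds) - 3) - 2 * gam ds 1 / gam ds 0"
    if generic: "ds \<noteq> [1, 1]" "\<forall>d\<le>4. ds \<noteq> [d]"
  proof -
    note m = main[OF generic]
    show "gam ds 0 = of_nat (sigma ds) * (schur_at (rho_tuple C) a / schur_at (delta_tuple C) a)"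
      unfolding m(2) S0_def[symmetric] S1[OF m(1)] ratio[OF m(1)] by (simp add: g0_def \<sigma>_def)
    have "K0 n X > 0" by (rule K0_pos[OF X m(1)])
    then have "gam ds 0 \<noteq> 0" unfolding m(2) g0_def \<sigma>_def by (simp add: sigma_def)
    then show "of_int (a_invariant ds) = - (of_nat (dimV ds) - 3) - 2 * gam ds 1 / gam ds 0"
      unfolding m(3,5) by simp
  qed
  \<comment> \<open>For \<open>K0\<close> the constants are 15/8 - 1/8 = 42/24. \<open>P2\<close>
    counts the negative weights as well, so it is twice the sum of the squares of the positive ones,
    and a twelfth of that sum minus 1/3 is (P2 - 8)/24.\<close>
  have second_value: "of_real (15 / 8 * (K0 n X / (2 * pi)) + second_coefficient n X / (2 * pi)) =
      (42 * schur_at (rho_tuple C) a + schur_at (rho'_tuple C) a * of_int (P2 ds - 8)) / (24 * schur_at (delta_tuple C) a)"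
    if n3: "3 \<le> n"
  proof -
    have n2: "2 \<le> n" using n3 by simp
    define k0 k2 p where "k0 = K0 n X / (2 * pi)" and "k2 = K2 n X / (2 * pi)" and "p = (\<Sum>i<n. (X i)\<^sup>2)"
    have P: "(of_int (P2 ds - 8) :: complex) = of_real (2 * p - 8)" using P2 by (simp add: p_def)
    have "(42 * (of_real k0 * S0) + of_real k2 * S0 * of_real (2 * p - 8)) / (24 * S0) = complex_of_real ((42 * k0 + k2 * (2 * p - 8)) / 24)"
      using S0[OF n2] by (simp add: field_simps)
    moreover have "15 / 8 * k0 + second_coefficient n X / (2 * pi) = (42 * k0 + k2 * (2 * p - 8)) / 24"
    proof -
      have sc: "second_coefficient n X / (2 * pi) = (p / 12 - 1 / 3) * k2 - k0 / 8"
        by (simp add: second_coefficient_def k0_def k2_def p_def diff_divide_distrib)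
      show ?thesis unfolding sc by (simp add: field_simps)
    qed
    ultimately show ?thesis
      unfolding S0_def[symmetric] S1[OF n2] S2[OF n3] P k0_def[symmetric] k2_def[symmetric] by (simp only:)
  qed
  have generic: "ds \<noteq> [1, 1]" "\<forall>d\<le>4. ds \<noteq> [d]"
    if one: "\<forall>d\<in>{1, 2, 3, 4, 5, 6, 8}. ds \<noteq> [d]"
      and two: "\<forall>es\<in>{[1, 1], [1, 2], [1, 3], [1, 4], [2, 2], [2, 3], [2, 4], [3, 3], [4, 4]}. ds \<noteq> es"
  proof -
    show "ds \<noteq> [1, 1]" using two by blast
    show "\<forall>d\<le>4. ds \<noteq> [d]"
    proof (intro allI impI notI)
      fix d assume d: "d \<le> 4" "ds = [d]"
      \<comment> \<open>The list \<open>[0]\<close> is not among the exceptions of the second part;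
        it is ruled out by positive degrees.\<close>
      then have "1 \<le> d" using pos by simp
      then have "d \<in> {1, 2, 3, 4, 5, 6, 8}" using d(1) unfolding insert_iff empty_iff by presburger
      then show False using one d(2) by blast
    qed
  qed
  have second: "gam ds 2 = of_nat (sigma ds) *
        ((42 * schur_at (rho_tuple C) a + schur_at (rho'_tuple C) a * of_int (P2 ds - 8)) / (24 * schur_at (delta_tuple C) a))"
    if one: "\<forall>d\<in>{1, 2, 3, 4, 5, 6, 8}. ds \<noteq> [d]"
      and two: "\<forall>es\<in>{[1, 1], [1, 2], [1, 3], [1, 4], [2, 2], [2, 3], [2, 4], [3, 3], [4, 4]}. ds \<noteq> es"
      and cond: "(\<forall>d\<in>set ds. even d) \<or> card {k. k < length ds \<and> odd (ds ! k)} \<ge> 2 \<or> (\<exists>d\<in>set ds. odd d \<and> d > 1)"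
  proof -
    note lim = second_limit[OF pos assms(1,2) one two, folded n_def]
    have "gam ds 2 = of_real (15 / 8 * g0 + \<sigma> * second_coefficient n X / (2 * pi))"
      by (rule main(6)[OF generic[OF one two]]) (use lim(2)[OF _ cond] in \<open>simp add: G_def g0_def \<sigma>_def X_def\<close>)
    also have "15 / 8 * g0 + \<sigma> * second_coefficient n X / (2 * pi) = \<sigma> * (15 / 8 * (K0 n X / (2 * pi)) + second_coefficient n X / (2 * pi))"
      by (simp add: g0_def distrib_left)
    finally have "gam ds 2 = of_real \<sigma> * of_real (15 / 8 * (K0 n X / (2 * pi)) + second_coefficient n X / (2 * pi))"
      unfolding of_real_mult .
    then show ?thesis using second_value[OF lim(1)] by (simp only: \<sigma>_def of_real_of_nat_eq)
  qed
  have third: "gam ds 2 = (42 * schur_at (rho_tuple C) a + schur_at (rho'_tuple C) a * of_int (P2 ds - 8))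
          / (24 * schur_at (delta_tuple C) a)
         + schur_at (map (\<lambda>j. if j \<le> 2 then C - 4 else C - 1 - j) [1..C - 1]) a1 / (4 * schur_at (delta_tuple (C - 1)) a1)"
    if one: "\<forall>d\<in>{1, 2, 3, 4, 5, 6, 8}. ds \<noteq> [d]"
      and two: "\<forall>es\<in>{[1, 1], [1, 2], [1, 3], [1, 4], [2, 2], [2, 3], [2, 4], [3, 3], [4, 4]}. ds \<noteq> es"
      and first: "ds ! 0 = 1" "\<forall>k. 0 < k \<and> k < length ds \<longrightarrow> even (ds ! k)"
  proof -
    note lim = second_limit[OF pos assms(1,2) one two, folded n_def]
    have n3: "3 \<le> n" by (rule lim(1))
    obtain es where es: "ds = 1 # es" using assms(1) first(1) by (cases ds) auto
    have a1': "a1 = pos_weights es" unfolding a1 es by (rule pos_weights1_Cons)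
    have len: "length a1 = n - 1" by (simp add: a1' n_def es pos_weights_concat)
    define Y where "Y = (\<lambda>i. real (int_weight es i))"
    have Y: "Y i \<ge> 1" "real_of_int (a1 ! i) = Y i" if "i < n - 1" for i
    proof -
      have i: "i < length (pos_weights es)" using that len by (simp add: a1')
      show "Y i \<ge> 1" using int_weight_pos[OF i] by (simp add: Y_def)
      show "real_of_int (a1 ! i) = Y i" unfolding a1' Y_def int_int_weight[OF i, symmetric] by simp
    qed
    have schur': "schur_at rho a1 = leval (n - 1) (\<lambda>i. complex_of_real (Y i)) (schur rho)" for rho
      by (rule schur_at_leval[OF len Y(2)])
    have n1: "2 \<le> n - 1" using n3 by simp
    have C1: "C - 1 = int (n - 1)" using n3 by (simp add: Cn)
    \<comment> \<open>The tuple of length C - 1 is rho for one variable fewer, as C - 4 = (C - 1) -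
      3.\<close>
    have tuple: "map (\<lambda>j. if j \<le> 2 then C - 4 else C - 1 - j) [1..C - 1] = rho_tuple (C - 1)"
      by (simp add: rho_tuple_def)
    define S1 where "S1 = schur_at (delta_tuple (C - 1)) a1"
    have S1: "S1 \<noteq> 0" "schur_at (rho_tuple (C - 1)) a1 = of_real (K0 (n - 1) Y / (2 * pi)) * S1"
      unfolding S1_def schur' C1 using leval_schur_integral[OF n1, of Y] Y(1) by blast+
    have sigma: "\<sigma> = 1" by (simp add: \<sigma>_def sigma_def es)
    have tl: "(\<lambda>i. real (int_weight (tl ds) i)) = Y" by (simp add: Y_def es)
    have "gam ds 2 = of_real (15 / 8 * g0 + (second_coefficient n X + K0 (n - 1) Y / 4) / (2 * pi))"
      by (rule main(6)[OF generic[OF one two]]) (use lim(3)[OF _ first] in \<open>simp add: G_def g0_def sigma X_def tl\<close>)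
    also have "15 / 8 * g0 + (second_coefficient n X + K0 (n - 1) Y / 4) / (2 * pi)
        = (15 / 8 * (K0 n X / (2 * pi)) + second_coefficient n X / (2 * pi)) + K0 (n - 1) Y / (2 * pi) / 4"
      by (simp add: g0_def sigma add_divide_distrib)
    also have "complex_of_real \<dots> = of_real (15 / 8 * (K0 n X / (2 * pi)) + second_coefficient n X / (2 * pi)) + of_real (K0 (n - 1) Y / (2 * pi)) / 4"
      by (simp only: of_real_add of_real_divide of_real_numeral)
    also have "complex_of_real (K0 (n - 1) Y / (2 * pi)) / 4 = schur_at (rho_tuple (C - 1)) a1 / (4 * S1)"
      unfolding S1(2) using S1(1) by simp
    finally show ?thesis unfolding second_value[OF n3] tuple S1_def .
  qed
  show ?thesis
  proof (intro conjI impI)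
    assume "\<not> rep_iso ds [1, 1] \<and> (\<forall>d\<le>4. \<not> rep_iso ds [d])"
    then have g: "ds \<noteq> [1, 1]" "\<forall>d\<le>4. ds \<noteq> [d]" using iso by blast+
    show "gam ds 0 = of_nat (sigma ds) * (schur_at (rho_tuple C) a / schur_at (delta_tuple C) a)"
      "of_int (a_invariant ds) = - (of_nat (dimV ds) - 3) - 2 * gam ds 1 / gam ds 0"
      by (fact leading[OF g])+
    show "gam ds 1 = 3 / 2 * gam ds 0" "gam ds 3 = 5 * (gam ds 2 - gam ds 0) / 2" "a_invariant ds = - int (dimV ds)"
      by (fact main[OF g])+
  next
    assume hyp: "(\<forall>d\<in>{1, 2, 3, 4, 5, 6, 8}. \<not> rep_iso ds [d])
        \<and> (\<forall>es\<in>{[1, 1], [1, 2], [1, 3], [1, 4], [2, 2], [2, 3], [2, 4], [3, 3], [4, 4]}. \<not> rep_iso ds es)"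
    have one: "\<forall>d\<in>{1, 2, 3, 4, 5, 6, 8}. ds \<noteq> [d]" using hyp iso by blast
    have two: "\<forall>es\<in>{[1, 1], [1, 2], [1, 3], [1, 4], [2, 2], [2, 3], [2, 4], [3, 3], [4, 4]}. ds \<noteq> es"
      using hyp iso by (blast intro!: ballI)
    show "gam ds 2 = of_nat (sigma ds) *
        ((42 * schur_at (rho_tuple C) a + schur_at (rho'_tuple C) a * of_int (P2 ds - 8)) / (24 * schur_at (delta_tuple C) a))"
      if "(\<forall>d\<in>set ds. even d) \<or> card {k. k < length ds \<and> odd (ds ! k)} \<ge> 2 \<or> (\<exists>d\<in>set ds. odd d \<and> d > 1)"
      by (rule second[OF one two that])
    show "gam ds 2 = (42 * schur_at (rho_tuple C) a + schur_at (rho'_tuple C) a * of_int (P2 ds - 8))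
          / (24 * schur_at (delta_tuple C) a)
         + schur_at (map (\<lambda>j. if j \<le> 2 then C - 4 else C - 1 - j) [1..C - 1]) a1 / (4 * schur_at (delta_tuple (C - 1)) a1)"
      if "ds ! 0 = 1 \<and> (\<forall>k. 0 < k \<and> k < length ds \<longrightarrow> even (ds ! k))"
      using third[OF one two] that by blast
  qed
qed

end
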